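(* Let $p$ be an integer with $1\le p<\infty$. Every abstract-definable $\mathcal{C}^p$ manifold $M$ admits an abstract-definable $\mathcal{C}^p$ embedding $g\colon M\to R^n$ for some positive integer $n$.
   Context: Fix an o-minimal expansion $\mathcal{R}$ of a real closed field $R$; "definable" means definable in $\mathcal{R}$ with parameters from $R$, and $R^k$ carries the order (product) topology. An abstract-definable $\mathcal{C}^p$ atlas of dimension $m$ on a set $M$ is a finite family of bijections $\phi_i\colon U_i\to\phi_i(U_i)\subseteq R^m$ ($U_i\subseteq M$) with $M=\bigcup_i U_i$, each $\phi_i(U_i)$ definable open, each $\phi_i(U_i\cap U_j)$ definable open, and each transition map $\phi_j\circ\phi_i^{-1}\colon\phi_i(U_i\cap U_j)\to\phi_j(U_i\cap U_j)$ a definable $\mathcal{C}^p$ diffeomorphism. Two atlases are compatible if their union is an atlas. An abstract-definable $\mathcal{C}^p$ manifold of dimension $m$ is a set $M$ with a compatibility class of such atlases whose induced topology (the unique one making each $U_i$ open and each $\phi_i$ a homeomorphism) is Hausdorff. A map $f\colon M\to N$ between such manifolds is abstract-definable $\mathcal{C}^p$ (resp. an abstract-definable $\mathcal{C}^p$ diffeomorphism) if all its chart representations $\psi\circ f\circ\phi^{-1}$ are definable $\mathcal{C}^p$ maps (resp. definable $\mathcal{C}^p$ diffeomorphisms); $R^n$ is regarded as a manifold with the identity chart. Tangent spaces $T_xM$ and differentials $d_xf$ are defined as usual via chart derivatives of definable $\mathcal{C}^p$ curves. An abstract-definable $\mathcal{C}^p$ immersion is an abstract-definable $\mathcal{C}^p$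 map with $d_xf$ injective for all $x$; an abstract-definable $\mathcal{C}^p$ embedding is an immersion that is a homeomorphism onto its image (with the subspace topology). *)

theory Defs
  imports Main "HOL-Computational_Algebra.Polynomial"
begin

definition Rn :: "nat \<Rightarrow> 'r list set" where
  "Rn k = {xs. length xs = k}"

definition real_closed_field :: "'r::linordered_field itself \<Rightarrow> bool" where
  "real_closed_field _ \<longleftrightarrow>
     (\<forall>x::'r. 0 \<le> x \<longrightarrow> (\<exists>y. y * y = x)) \<and>
     (\<forall>q::'r poly. odd (degree q) \<longrightarrow> (\<exists>x. poly q x = 0))"

definition in_ival :: "'r::linorder option \<Rightarrow> 'r option \<Rightarrow> 'r \<Rightarrow> bool" where
  "in_ival a b x \<longleftrightarrow>
     (case a of None \<Rightarrow> True | Some a' \<Rightarrow> a' < x) \<and>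
     (case b of None \<Rightarrow> True | Some b' \<Rightarrow> x < b')"

text \<open>S n = the definable (with parameters) subsets of R^n of an o-minimal expansion
  of the ordered field 'r (structure axioms as in van den Dries).\<close>
definition o_minimal_structure :: "(nat \<Rightarrow> 'r::linordered_field list set set) \<Rightarrow> bool" where
  "o_minimal_structure S \<longleftrightarrow>
     (\<forall>n. \<forall>A\<in>S n. A \<subseteq> Rn n) \<and>
     (\<forall>n. {} \<in> S n) \<and>
     (\<forall>n. \<forall>A\<in>S n. Rn n - A \<in> S n) \<and>
     (\<forall>n. \<forall>A\<in>S n. \<forall>B\<in>S n. A \<union> B \<in> S n) \<and>
     (\<forall>n. \<forall>A\<in>S n. {x @ [t] | x t. x \<in> A} \<in> S (Suc n) \<and> {t # x | x t. x \<in> A} \<in> S (Suc n)) \<and>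
     (\<forall>n i j. i < n \<longrightarrow> j < n \<longrightarrow> {x \<in> Rn n. x ! i = x ! j} \<in> S n) \<and>
     (\<forall>n. \<forall>A\<in>S (Suc n). butlast ` A \<in> S n) \<and>
     (\<forall>c. {[c]} \<in> S 1) \<and>
     {[x, y] | x y. x < y} \<in> S 2 \<and>
     {[x, y, x + y] | x y. True} \<in> S 3 \<and>
     {[x, y, x * y] | x y. True} \<in> S 3 \<and>
     (\<forall>A\<in>S 1. \<exists>P J. finite P \<and> finite J \<and>
         A = {[x] | x. x \<in> P \<or> (\<exists>(a, b)\<in>J. in_ival a b x)})"

definition vsub :: "'r::ab_group_add list \<Rightarrow> 'r list \<Rightarrow> 'r list" where
  "vsub xs ys = map (\<lambda>(a, b). a - b) (zip xs ys)"

definition sup_norm :: "'r::linordered_field list \<Rightarrow> 'r" where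
  "sup_norm xs = foldr (\<lambda>a b. max \<bar>a\<bar> b) xs 0"

definition open_in_Rn :: "nat \<Rightarrow> 'r::linordered_field list set \<Rightarrow> bool" where
  "open_in_Rn k U \<longleftrightarrow> U \<subseteq> Rn k \<and>
     (\<forall>x\<in>U. \<exists>e>0. \<forall>y\<in>Rn k. (\<forall>i<k. \<bar>y ! i - x ! i\<bar> < e) \<longrightarrow> y \<in> U)"

text \<open>An m x n matrix stored row-major as a list of length m*n, applied to v in R^n.\<close>
definition mat_apply :: "nat \<Rightarrow> nat \<Rightarrow> 'r::comm_ring_1 list \<Rightarrow> 'r list \<Rightarrow> 'r list" where
  "mat_apply m n D v = map (\<lambda>i. \<Sum>j<n. D ! (i * n + j) * v ! j) [0..<m]"

definition has_deriv :: "nat \<Rightarrow> nat \<Rightarrow> ('r::linordered_field list \<Rightarrow> 'r list) \<Rightarrow> 'r list \<Rightarrow> 'r list \<Rightarrow> bool" where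
  "has_deriv n m f D x \<longleftrightarrow> D \<in> Rn (m * n) \<and>
     (\<forall>e>0. \<exists>d>0. \<forall>y\<in>Rn n. sup_norm (vsub y x) < d \<longrightarrow>
        sup_norm (vsub (vsub (f y) (f x)) (mat_apply m n D (vsub y x))) \<le> e * sup_norm (vsub y x))"

definition continuous_on_Rn :: "nat \<Rightarrow> ('r::linordered_field list \<Rightarrow> 'r list) \<Rightarrow> 'r list set \<Rightarrow> bool" where
  "continuous_on_Rn n f U \<longleftrightarrow>
     (\<forall>x\<in>U. \<forall>e>0. \<exists>d>0. \<forall>y\<in>U. sup_norm (vsub y x) < d \<longrightarrow> sup_norm (vsub (f y) (f x)) < e)"

fun Ck :: "nat \<Rightarrow> nat \<Rightarrow> nat \<Rightarrow> ('r::linordered_field list \<Rightarrow> 'r list) \<Rightarrow> 'r list set \<Rightarrow> bool" where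
  "Ck 0 n m f U \<longleftrightarrow> (\<forall>x\<in>U. f x \<in> Rn m) \<and> continuous_on_Rn n f U"
| "Ck (Suc k) n m f U \<longleftrightarrow> (\<forall>x\<in>U. f x \<in> Rn m) \<and>
     (\<exists>D. (\<forall>x\<in>U. has_deriv n m f (D x) x) \<and> Ck k n (m * n) D U)"

definition definable_map :: "(nat \<Rightarrow> 'r list set set) \<Rightarrow> nat \<Rightarrow> nat \<Rightarrow> ('r list \<Rightarrow> 'r list) \<Rightarrow> 'r list set \<Rightarrow> bool" where
  "definable_map S n m f A \<longleftrightarrow> A \<subseteq> Rn n \<and> (\<forall>x\<in>A. f x \<in> Rn m) \<and> {x @ f x | x. x \<in> A} \<in> S (n + m)"

definition dCp :: "(nat \<Rightarrow> 'r::linordered_field list set set) \<Rightarrow> nat \<Rightarrow> nat \<Rightarrow> nat \<Rightarrow> ('r list \<Rightarrow> 'r list) \<Rightarrow> 'r list set \<Rightarrow> bool" where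
  "dCp S p n m f U \<longleftrightarrow> open_in_Rn n U \<and> U \<in> S n \<and> definable_map S n m f U \<and> Ck p n m f U"

definition dCp_diffeo :: "(nat \<Rightarrow> 'r::linordered_field list set set) \<Rightarrow> nat \<Rightarrow> nat \<Rightarrow> ('r list \<Rightarrow> 'r list) \<Rightarrow> 'r list set \<Rightarrow> 'r list set \<Rightarrow> bool" where
  "dCp_diffeo S p n f U V \<longleftrightarrow> dCp S p n n f U \<and> inj_on f U \<and> f ` U = V \<and>
     (\<exists>g. dCp S p n n g V \<and> (\<forall>x\<in>U. g (f x) = x))"

definition is_atlas :: "(nat \<Rightarrow> 'r::linordered_field list set set) \<Rightarrow> nat \<Rightarrow> nat \<Rightarrow> 'm set \<Rightarrow> ('m set \<times> ('m \<Rightarrow> 'r list)) list \<Rightarrow> bool" where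
  "is_atlas S p m M A \<longleftrightarrow>
     M = (\<Union>(U, \<phi>)\<in>set A. U) \<and>
     (\<forall>(U, \<phi>)\<in>set A. inj_on \<phi> U \<and> \<phi> ` U \<in> S m \<and> open_in_Rn m (\<phi> ` U)) \<and>
     (\<forall>(U, \<phi>)\<in>set A. \<forall>(V, \<psi>)\<in>set A.
        \<phi> ` (U \<inter> V) \<in> S m \<and> open_in_Rn m (\<phi> ` (U \<inter> V)) \<and>
        dCp_diffeo S p m (\<psi> \<circ> the_inv_into U \<phi>) (\<phi> ` (U \<inter> V)) (\<psi> ` (U \<inter> V)))"

definition compat_chart :: "(nat \<Rightarrow> 'r::linordered_field list set set) \<Rightarrow> nat \<Rightarrow> nat \<Rightarrow> 'm set \<Rightarrow> ('m set \<times> ('m \<Rightarrow> 'r list)) list \<Rightarrow> 'm set \<times> ('m \<Rightarrow> 'r list) \<Rightarrow> bool" where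
  "compat_chart S p m M A c \<longleftrightarrow> is_atlas S p m M (A @ [c])"

definition atlas_open :: "nat \<Rightarrow> 'm set \<Rightarrow> ('m set \<times> ('m \<Rightarrow> 'r::linordered_field list)) list \<Rightarrow> 'm set \<Rightarrow> bool" where
  "atlas_open m M A W \<longleftrightarrow> W \<subseteq> M \<and> (\<forall>(U, \<phi>)\<in>set A. open_in_Rn m (\<phi> ` (W \<inter> U)))"

definition ad_manifold :: "(nat \<Rightarrow> 'r::linordered_field list set set) \<Rightarrow> nat \<Rightarrow> nat \<Rightarrow> 'm set \<Rightarrow> ('m set \<times> ('m \<Rightarrow> 'r list)) list \<Rightarrow> bool" where
  "ad_manifold S p m M A \<longleftrightarrow> is_atlas S p m M A \<and>
     (\<forall>x\<in>M. \<forall>y\<in>M. x \<noteq> y \<longrightarrow> (\<exists>W1 W2. atlas_open m M A W1 \<and> atlas_open m M A W2 \<and>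
        x \<in> W1 \<and> y \<in> W2 \<and> W1 \<inter> W2 = {}))"

definition ad_Cp_map :: "(nat \<Rightarrow> 'r::linordered_field list set set) \<Rightarrow> nat \<Rightarrow>
    nat \<Rightarrow> 'm set \<Rightarrow> ('m set \<times> ('m \<Rightarrow> 'r list)) list \<Rightarrow>
    nat \<Rightarrow> 'n set \<Rightarrow> ('n set \<times> ('n \<Rightarrow> 'r list)) list \<Rightarrow> ('m \<Rightarrow> 'n) \<Rightarrow> bool" where
  "ad_Cp_map S p m M A k N B f \<longleftrightarrow> f ` M \<subseteq> N \<and>
     (\<forall>U \<phi> V \<psi>. compat_chart S p m M A (U, \<phi>) \<and> compat_chart S p k N B (V, \<psi>) \<longrightarrow>
        dCp S p m k (\<psi> \<circ> f \<circ> the_inv_into U \<phi>) (\<phi> ` (U \<inter> f -` V)))"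

definition ad_Cp_immersion :: "(nat \<Rightarrow> 'r::linordered_field list set set) \<Rightarrow> nat \<Rightarrow>
    nat \<Rightarrow> 'm set \<Rightarrow> ('m set \<times> ('m \<Rightarrow> 'r list)) list \<Rightarrow>
    nat \<Rightarrow> 'n set \<Rightarrow> ('n set \<times> ('n \<Rightarrow> 'r list)) list \<Rightarrow> ('m \<Rightarrow> 'n) \<Rightarrow> bool" where
  "ad_Cp_immersion S p m M A k N B f \<longleftrightarrow> ad_Cp_map S p m M A k N B f \<and>
     (\<forall>U \<phi> V \<psi>. compat_chart S p m M A (U, \<phi>) \<and> compat_chart S p k N B (V, \<psi>) \<longrightarrow>
        (\<forall>x\<in>U \<inter> f -` V. \<exists>D. has_deriv m k (\<psi> \<circ> f \<circ> the_inv_into U \<phi>) D (\<phi> x) \<and>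
            (\<forall>v\<in>Rn m. mat_apply k m D v = replicate k 0 \<longrightarrow> v = replicate m 0)))"

definition Rn_atlas :: "nat \<Rightarrow> ('r list set \<times> ('r list \<Rightarrow> 'r list)) list" where
  "Rn_atlas n = [(Rn n, id)]"

definition ad_Cp_embedding_Rn :: "(nat \<Rightarrow> 'r::linordered_field list set set) \<Rightarrow> nat \<Rightarrow>
    nat \<Rightarrow> 'm set \<Rightarrow> ('m set \<times> ('m \<Rightarrow> 'r list)) list \<Rightarrow> nat \<Rightarrow> ('m \<Rightarrow> 'r list) \<Rightarrow> bool" where
  "ad_Cp_embedding_Rn S p m M A n g \<longleftrightarrow>
     ad_Cp_immersion S p m M A n (Rn n) (Rn_atlas n) g \<and> inj_on g M \<and>
     (\<forall>W. atlas_open m M A W \<longrightarrow> (\<exists>Q. open_in_Rn n Q \<and> g ` W = g ` M \<inter> Q))"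

end

theory Submission
  imports Defs
begin

text \<open>
  Every definable open subset \<open>W\<close> of \<open>R^m\<close> is a finite union of sets \<open>{h > 0}\<close>, where \<open>h\<close> is definable,
  continuous on \<open>R^m\<close> with bounded superlevel sets \<open>{h \<ge> e}\<close>, \<open>e > 0\<close>, and of class \<open>C^p\<close> where it is positive.
  Apply this to the chart images of \<open>M\<close>. As \<open>M\<close> is Hausdorff and bounded definable families have cluster
  points, each \<open>h \<circ> \<phi>\<close> extended by zero is continuous on \<open>M\<close>. Composing with a definable
  \<open>\<theta>\<close> that is flat enough at \<open>0\<close> makes \<open>\<theta>(h \<circ> \<phi>)\<close> and \<open>\<theta>(h \<circ> \<phi>) * \<phi>\<close>, extended by zero, of class \<open>C^p\<close> on \<open>M\<close>;
  such a \<open>\<theta>\<close> exists because, by o-minimality, the growth of the finitely many derivatives involved is bounded by a definable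
  antitone function of \<open>h\<close>. The map \<open>g\<close> collects all these functions. Where \<open>\<theta>(h \<circ> \<phi>) > 0\<close>, the chart \<open>\<phi>\<close> is recovered as a
  quotient of coordinates of \<open>g\<close>, which gives injectivity, the immersion property and openness onto the image.
\<close>

text \<open>The field may be non-archimedean and incomplete, so suprema, cluster points and mean
  value estimates are available only for definable data; hence every auxiliary object is shown to be
  definable. Regularity comes only generically: a distance-like function attached to
  \<open>W\<close> is of class \<open>C^p\<close> only over most base points. Multiplying by bump
  functions of a good open part of the base removes the other points, and what lies over the small
  remainder is surrounded by tubes; this is why \<open>W\<close> needs finitely many
  \<open>h\<close> instead of one. Bounded superlevel sets replace compact supports: they supply the
  cluster points needed when \<open>h\<close> is carried into another chart. Nothing controls the
  derivatives of \<open>h\<close> where \<open>h\<close> tends to zero, nor the size of the chart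
  there. Flatness of \<theta> defeats both, and it can be achieved because only finitely many
  derivatives enter, each being estimated through values at doubled and halved arguments.\<close>

locale omin =
  fixes S :: "nat \<Rightarrow> 'r::linordered_field list set set"
  assumes om: "o_minimal_structure S"
begin

section \<open>Closure properties of the structure\<close>

lemma S_sub: "A \<in> S n ==> A \<subseteq> Rn n"
  and S_empty: "{} \<in> S n"
  and S_compl: "A \<in> S n ==> Rn n - A \<in> S n"
  and S_Un: "A \<in> S n ==> B \<in> S n ==> A \<union> B \<in> S n"
  and S_cons: "A \<in> S n ==> {t # x | x t. x \<in> A} \<in> S (Suc n)"
  and S_diag: "i < n ==> j < n ==> {x \<in> Rn n. x ! i = x ! j} \<in> S n"
  and S_proj: "A \<in> S (Suc n) ==> butlast ` A \<in> S n"
  and S_point: "{[c]} \<in> S 1"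
  and S_less: "{[x, y] | x y. x < y} \<in> S 2"
  and S_add: "{[x, y, x + y] | x y. True} \<in> S 3"
  and S_mult: "{[x, y, x * y] | x y. True} \<in> S 3"
  and S_ominimal: "A \<in> S 1 ==> \<exists>P J. finite P \<and> finite J \<and>
         A = {[x] | x. x \<in> P \<or> (\<exists>(a, b)\<in>J. in_ival a b x)}"
  using om unfolding o_minimal_structure_def by auto

lemma Rn_iff [simp]: "x \<in> Rn n \<longleftrightarrow> length x = n"
  by (simp add: Rn_def)

lemma S_len: "A \<in> S n ==> x \<in> A ==> length x = n"
  using S_sub by fastforce

lemma S_Rn: "Rn n \<in> S n"
  using S_compl[OF S_empty] by simp

lemma S_Int: assumes "A \<in> S n" "B \<in> S n" shows "A \<inter> B \<in> S n"
proof -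
  have "A \<inter> B = Rn n - ((Rn n - A) \<union> (Rn n - B))"
    using S_sub[OF assms(1)] S_sub[OF assms(2)] by blast
  thus ?thesis using S_compl[OF S_Un[OF S_compl[OF assms(1)] S_compl[OF assms(2)]]] by simp
qed

lemma S_take: "A \<in> S (n + k) ==> take n ` A \<in> S n"
proof (induction k arbitrary: A)
  case 0
  have "take n ` A = (\<lambda>x. x) ` A" using S_len[OF 0] by (intro image_cong) auto
  thus ?case using 0 by simp
next
  case (Suc k)
  have "take n ` (butlast ` A) \<in> S n" using Suc.IH S_proj Suc.prems by simp
  moreover have "take n ` (butlast ` A) = take n ` A" unfolding image_image
    using S_len[OF Suc.prems] by (intro image_cong) (auto simp: take_butlast)
  ultimately show ?case by simp
qed

lemma S_prefix: "A \<in> S k ==> {y @ x | y x. y \<in> Rn n \<and> x \<in> A} \<in> S (n + k)"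
proof (induction n)
  case 0 thus ?case by (simp add: Rn_def)
next
  case (Suc n)
  have "{t # z | z t. z \<in> {y @ x | y x. y \<in> Rn n \<and> x \<in> A}} = {y @ x | y x. y \<in> Rn (Suc n) \<and> x \<in> A}"
    (is "?L = ?R")
  proof
    show "?L \<subseteq> ?R"
    proof clarsimp
      fix t x and y :: "'r list" assume "x \<in> A" "n = length y"
      thus "\<exists>ya xa. t # y @ x = ya @ xa \<and> length ya = Suc (length y) \<and> xa \<in> A"
        by (intro exI[of _ "t # y"] exI[of _ x]) simp
    qed
    show "?R \<subseteq> ?L" by (clarsimp simp: length_Suc_conv) blast
  qed
  thus ?case using S_cons[OF Suc.IH[OF Suc.prems]] by simp
qed

lemma S_Inter: "(\<And>i. i < k ==> A i \<in> S n) ==> {x \<in> Rn n. \<forall>i<(k::nat). x \<in> A i} \<in> S n"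
proof (induction k)
  case 0 thus ?case using S_Rn by (simp add: Rn_def)
next
  case (Suc k)
  have "{x \<in> Rn n. \<forall>i<Suc k. x \<in> A i} = {x \<in> Rn n. \<forall>i<k. x \<in> A i} \<inter> A k"
    using S_len[OF Suc.prems[of k]] by (auto simp: less_Suc_eq)
  thus ?case using S_Int Suc by simp
qed

text \<open>Put \<open>n\<close> free coordinates in front of \<open>A\<close>, intersect with the
  diagonals that identify coordinate \<open>\<sigma> i\<close> with coordinate \<open>n + i\<close>,
  and project to the first \<open>n\<close>. Permutations, repetitions and dummy variables in
  formulas all reduce to this.\<close>

lemma S_subst:
  assumes "A \<in> S k" "\<And>i. i < k ==> \<sigma> i < n"
  shows "{x \<in> Rn n. map (\<lambda>i. x ! \<sigma> i) [0..<k] \<in> A} \<in> S n"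
proof -
  let ?B = "{y @ x | y x. y \<in> Rn n \<and> x \<in> A}"
  let ?C = "{z \<in> Rn (n+k). \<forall>i<k. z \<in> {z \<in> Rn (n+k). z ! \<sigma> i = z ! (n + i)}}"
  have C: "?C \<in> S (n+k)"
    by (rule S_Inter, rule S_diag) (use assms(2) in \<open>auto intro: trans_less_add1\<close>)
  have "take n ` (?B \<inter> ?C) = {x \<in> Rn n. map (\<lambda>i. x ! \<sigma> i) [0..<k] \<in> A}" (is "_ = ?D")
  proof
    show "take n ` (?B \<inter> ?C) \<subseteq> ?D"
    proof (rule image_subsetI)
      fix z assume "z \<in> ?B \<inter> ?C"
      then obtain y x where z: "z = y @ x" and *: "x \<in> A" "n = length y"
        "\<forall>i<k. (y @ x) ! \<sigma> i = x ! i" by auto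
      have "map (\<lambda>i. y ! \<sigma> i) [0..<k] = x"
        using * assms S_len[OF assms(1) *(1)] by (intro nth_equalityI) (auto simp: nth_append)
      thus "take n z \<in> ?D" using * z by simp
    qed
    show "?D \<subseteq> take n ` (?B \<inter> ?C)"
    proof
      fix x assume x: "x \<in> ?D"
      let ?y = "map (\<lambda>i. x ! \<sigma> i) [0..<k]"
      have "x @ ?y \<in> ?B \<inter> ?C" using x assms(2) by (auto simp: nth_append)
      moreover have "x = take n (x @ ?y)" using x by simp
      ultimately show "x \<in> take n ` (?B \<inter> ?C)" by (metis (no_types, lifting) image_eqI)
    qed
  qed
  thus ?thesis using S_take[OF S_Int[OF S_prefix[OF assms(1)] C]] by simp
qed

subsection \<open>Definable predicates and functions\<close>

text \<open>Formulas are predicates of an environment \<open>e\<close>. Variables are de Bruijn indices: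
  a quantifier binds \<open>e 0\<close> and shifts the other variables.\<close>

definition Dp :: "((nat \<Rightarrow> 'r) \<Rightarrow> bool) \<Rightarrow> bool" where
  "Dp P \<longleftrightarrow> (\<exists>n. \<exists>X\<in>S n. \<forall>e. P e \<longleftrightarrow> map e [0..<n] \<in> X)"

lemma Dp_mem_var: assumes "X \<in> S k" shows "Dp (\<lambda>e. map (\<lambda>i. e (\<sigma> i)) [0..<k] \<in> X)"
proof -
  define n where "n = Suc (Max (\<sigma> ` {..<k} \<union> {0}))"
  have n: "i < k ==> \<sigma> i < n" for i unfolding n_def by (simp add: less_Suc_eq_le)
  have "map (\<lambda>i. map e [0..<n] ! \<sigma> i) [0..<k] = map (\<lambda>i. e (\<sigma> i)) [0..<k]" for e :: "nat \<Rightarrow> 'r"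
    using n by (intro map_cong) auto
  hence "map (\<lambda>i. e (\<sigma> i)) [0..<k] \<in> X \<longleftrightarrow> map e [0..<n] \<in> {x \<in> Rn n. map (\<lambda>i. x ! \<sigma> i) [0..<k] \<in> X}" for e
    unfolding mem_Collect_eq by (simp only: Rn_iff length_map length_upt) simp
  moreover have "{x \<in> Rn n. map (\<lambda>i. x ! \<sigma> i) [0..<k] \<in> X} \<in> S n" by (rule S_subst[OF assms n])
  ultimately show ?thesis unfolding Dp_def by blast
qed

text \<open>A formula may be read as one in any larger number of variables; this brings two formulas
  to a common arity before they are combined.\<close>

lemma Dp_lift: assumes "Dp P" obtains n where
  "\<And>N. N \<ge> n ==> \<exists>X\<in>S N. \<forall>e. P e \<longleftrightarrow> map e [0..<N] \<in> X"
proof -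
  obtain n X where X: "X \<in> S n" "\<And>e. P e \<longleftrightarrow> map e [0..<n] \<in> X" using assms unfolding Dp_def by blast
  show thesis
  proof (rule that[of n])
    fix N assume N: "n \<le> N"
    let ?Y = "{x \<in> Rn N. map (\<lambda>i. x ! i) [0..<n] \<in> X}"
    have "?Y \<in> S N" by (rule S_subst[OF X(1)]) (use N in simp)
    moreover have "P e \<longleftrightarrow> map e [0..<N] \<in> ?Y" for e
    proof -
      have "map (\<lambda>i. map e [0..<N] ! i) [0..<n] = map e [0..<n]" by (intro map_cong) (use N in auto)
      thus ?thesis unfolding X(2) mem_Collect_eq by (simp only: Rn_iff length_map length_upt) simp
    qed
    ultimately show "\<exists>X\<in>S N. \<forall>e. P e \<longleftrightarrow> map e [0..<N] \<in> X" by blast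
  qed
qed

lemma Dp_not: assumes "Dp P" shows "Dp (\<lambda>e. \<not> P e)"
proof -
  obtain n X where X: "X \<in> S n" "\<And>e. P e \<longleftrightarrow> map e [0..<n] \<in> X" using assms unfolding Dp_def by blast
  thus ?thesis unfolding Dp_def using S_compl[OF X(1)]
    by (intro exI[of _ n] bexI[of _ "Rn n - X"]) auto
qed

lemma Dp_conj: assumes "Dp P" "Dp Q" shows "Dp (\<lambda>e. P e \<and> Q e)"
proof -
  obtain n where n: "\<And>N. N \<ge> n ==> \<exists>X\<in>S N. \<forall>e. P e \<longleftrightarrow> map e [0..<N] \<in> X" using Dp_lift[OF assms(1)] by metis
  obtain m where m: "\<And>N. N \<ge> m ==> \<exists>X\<in>S N. \<forall>e. Q e \<longleftrightarrow> map e [0..<N] \<in> X" using Dp_lift[OF assms(2)] by metis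
  obtain X where X: "X \<in> S (max n m)" "\<forall>e. P e \<longleftrightarrow> map e [0..<max n m] \<in> X" using n[of "max n m"] by auto
  obtain Y where Y: "Y \<in> S (max n m)" "\<forall>e. Q e \<longleftrightarrow> map e [0..<max n m] \<in> Y" using m[of "max n m"] by auto
  show ?thesis unfolding Dp_def
    using X Y S_Int[OF X(1) Y(1)] by (intro exI[of _ "max n m"] bexI[of _ "X \<inter> Y"]) auto
qed

lemma Dp_True: "Dp (\<lambda>e. True)"
  unfolding Dp_def by (intro exI[of _ 0] bexI[of _ "Rn 0"]) (auto simp: S_Rn)

lemma Dp_disj: assumes "Dp P" "Dp Q" shows "Dp (\<lambda>e. P e \<or> Q e)"
  using Dp_not[OF Dp_conj[OF Dp_not[OF assms(1)] Dp_not[OF assms(2)]]] by (simp only: de_Morgan_conj not_not)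

lemma Dp_imp: assumes "Dp P" "Dp Q" shows "Dp (\<lambda>e. P e --> Q e)"
  unfolding imp_conv_disj by (intro Dp_disj Dp_not assms)

lemma Dp_iff: assumes "Dp P" "Dp Q" shows "Dp (\<lambda>e. P e \<longleftrightarrow> Q e)"
  by (subst iff_conv_conj_imp) (intro Dp_conj Dp_imp assms)

lemma Dp_ren: assumes "Dp P" shows "Dp (\<lambda>e. P (\<lambda>i. e (\<sigma> i)))"
proof -
  obtain n X where X: "X \<in> S n" "\<And>e. P e \<longleftrightarrow> map e [0..<n] \<in> X" using assms unfolding Dp_def by blast
  show ?thesis unfolding X(2) by (rule Dp_mem_var[OF X(1)])
qed

lemma Dp_ex0: assumes "Dp P" shows "Dp (\<lambda>e. \<exists>x. P (case_nat x e))"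
proof -
  obtain n where n: "\<And>N. N \<ge> n ==> \<exists>X\<in>S N. \<forall>e. P e \<longleftrightarrow> map e [0..<N] \<in> X" using Dp_lift[OF assms] by metis
  obtain X where X: "X \<in> S (Suc n)" "\<And>e. P e \<longleftrightarrow> map e [0..<Suc n] \<in> X" using n[of "Suc n"] by auto
  \<comment> \<open>The bound variable has index 0, but \<open>S_proj\<close> forgets the last
    coordinate; \<open>\<sigma>\<close> moves variable 0 to the last place.\<close>
  define \<sigma> where "\<sigma> i = (if i = 0 then n else i - 1)" for i
  define Y where "Y = {z \<in> Rn (Suc n). map (\<lambda>i. z ! \<sigma> i) [0..<Suc n] \<in> X}"
  have Y: "Y \<in> S (Suc n)" unfolding Y_def by (rule S_subst[OF X(1)]) (auto simp: \<sigma>_def)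
  have eq: "map (\<lambda>i. (y @ [x]) ! \<sigma> i) [0..<Suc n] = x # y" if "length y = n" for x :: 'r and y
    using that unfolding map_upt_Suc by (auto simp: \<sigma>_def nth_append intro!: nth_equalityI)
  have cn: "map (case_nat x e) [0..<Suc n] = x # map e [0..<n]" for x :: 'r and e
    unfolding map_upt_Suc by simp
  have Pc: "P (case_nat x e) \<longleftrightarrow> x # map e [0..<n] \<in> X" for x e unfolding X(2) cn ..
  have "(\<exists>x. P (case_nat x e)) \<longleftrightarrow> map e [0..<n] \<in> butlast ` Y" for e unfolding Pc
  proof
    assume "\<exists>x. x # map e [0..<n] \<in> X"
    then obtain x where "x # map e [0..<n] \<in> X" by blast
    hence "map e [0..<n] @ [x] \<in> Y" unfolding Y_def mem_Collect_eq using eq[of "map e [0..<n]" x]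
      by (simp only: Rn_iff length_map length_upt length_append) simp
    thus "map e [0..<n] \<in> butlast ` Y" by (intro image_eqI[of _ _ "map e [0..<n] @ [x]"]) simp_all
  next
    assume "map e [0..<n] \<in> butlast ` Y"
    then obtain z where z: "z \<in> Y" "butlast z = map e [0..<n]" by auto
    hence l: "length z = Suc n" unfolding Y_def by simp
    obtain t where t: "z = map e [0..<n] @ [t]" using l z(2)
      by (cases z rule: rev_cases) auto
    have "map (\<lambda>i. z ! \<sigma> i) [0..<Suc n] \<in> X" using z(1) unfolding Y_def by blast
    hence "t # map e [0..<n] \<in> X" unfolding t using eq[of "map e [0..<n]" t] by (simp only: length_map length_upt)
    thus "\<exists>x. x # map e [0..<n] \<in> X" by blast
  qed
  thus ?thesis unfolding Dp_def by (intro exI[of _ n] bexI[of _ "butlast ` Y"] allI S_proj[OF Y])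
qed

lemma Dp_ex: assumes "Dp (\<lambda>e. P (e 0) (\<lambda>i. e (Suc i)))" shows "Dp (\<lambda>e. \<exists>x. P x e)"
  using Dp_ex0[OF assms] by simp

lemma Dp_all: assumes "Dp (\<lambda>e. P (e 0) (\<lambda>i. e (Suc i)))" shows "Dp (\<lambda>e. \<forall>x. P x e)"
  using Dp_not[OF Dp_ex[OF Dp_not[OF assms]]] by simp

lemma Dp_all_less: "(\<And>i. i < n ==> Dp (P i)) ==> Dp (\<lambda>e. \<forall>i<(n::nat). P i e)"
proof (induction n)
  case (Suc n)
  have "Dp (\<lambda>e. (\<forall>i<n. P i e) \<and> P n e)" using Suc by (intro Dp_conj) auto
  moreover have "(\<lambda>e. (\<forall>i<n. P i e) \<and> P n e) = (\<lambda>e. \<forall>i<Suc n. P i e)" by (auto simp: less_Suc_eq)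
  ultimately show ?case by simp
qed (simp add: Dp_True)

lemma Dp_ex_less: "(\<And>i. i < n ==> Dp (P i)) ==> Dp (\<lambda>e. \<exists>i<(n::nat). P i e)"
  using Dp_not[OF Dp_all_less[of n "\<lambda>i e. \<not> P i e"]] Dp_not by simp

lemma Dp_exv: "Dp (\<lambda>e. P (map e [0..<n]) (\<lambda>i. e (i + n))) ==> Dp (\<lambda>e. \<exists>x\<in>Rn n. P x e)"
proof (induction n arbitrary: P)
  case 0 thus ?case by (simp add: Rn_def)
next
  case (Suc n)
  have "Dp (\<lambda>e. \<exists>x\<in>Rn n. \<exists>t. P (x @ [t]) e)"
  proof (rule Suc.IH, rule Dp_ex)
    \<comment> \<open>The last component of the block is the innermost bound variable, so index
      \<open>n\<close> becomes 0 and the indices below \<open>n\<close> move up by one; the indices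
      beyond the block stay.\<close>
    have "Dp (\<lambda>e. P (map (\<lambda>i. e (if i = n then 0 else if i < n then Suc i else i)) [0..<Suc n])
        (\<lambda>i. e (if i + Suc n = n then 0 else if i + Suc n < n then Suc (i + Suc n) else i + Suc n)))"
      using Dp_ren[OF Suc.prems, of "\<lambda>i. if i = n then 0 else if i < n then Suc i else i"] .
    moreover have "map (\<lambda>i. e (if i = n then 0 else if i < n then Suc i else i)) [0..<Suc n] =
        map (\<lambda>i. e (Suc i)) [0..<n] @ [e 0]" for e :: "nat \<Rightarrow> 'r" by simp
    ultimately show "Dp (\<lambda>e. P (map (\<lambda>i. e (Suc i)) [0..<n] @ [e 0]) (\<lambda>i. e (Suc (i + n))))"
      by (simp del: map_eq_conv upt_Suc)
  qed
  moreover have "(\<exists>x\<in>Rn n. \<exists>t. P (x @ [t]) e) \<longleftrightarrow> (\<exists>x\<in>Rn (Suc n). P x e)" for e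
    by (auto simp: length_Suc_conv_rev) force
  ultimately show ?case by simp
qed

lemma Dp_allv: "Dp (\<lambda>e. P (map e [0..<n]) (\<lambda>i. e (i + n))) ==> Dp (\<lambda>e. \<forall>x\<in>Rn n. P x e)"
  using Dp_not[OF Dp_exv[OF Dp_not]] by simp

text \<open>The set that witnesses definability may live in a larger arity \<open>n + k\<close>; as
  the formula ignores the extra coordinates, projecting them away loses nothing.\<close>

lemma S_Collect: assumes "Dp (\<lambda>e. Q (map e [0..<n]))" shows "{x \<in> Rn n. Q x} \<in> S n"
proof -
  obtain k where k: "\<And>N. N \<ge> k ==> \<exists>X\<in>S N. \<forall>e. Q (map e [0..<n]) \<longleftrightarrow> map e [0..<N] \<in> X"
    using Dp_lift[OF assms] by metis
  obtain X where X: "X \<in> S (n + k)" "\<And>e. Q (map e [0..<n]) \<longleftrightarrow> map e [0..<n+k] \<in> X" using k[of "n+k"] by auto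
  have "{x \<in> Rn n. Q x} = take n ` X"
  proof safe
    fix x :: "'r list" assume x: "x \<in> Rn n" "Q x"
    define e where "e i = (if i < n then x ! i else 0)" for i
    have "map e [0..<n] = x" using x(1) by (intro nth_equalityI) (auto simp: e_def)
    hence "map e [0..<n+k] \<in> X" "take n (map e [0..<n+k]) = x" using X(2)[of e] x(2) by (auto simp: take_map)
    thus "x \<in> take n ` X" by force
  next
    fix x assume x: "x \<in> X"
    show "take n x \<in> Rn n" using S_len[OF X(1) x] by simp
    have *: "map ((!) x) [0..<n+k] = x" using S_len[OF X(1) x] by (metis map_nth)
    hence "Q (map ((!) x) [0..<n])" using X(2)[of "(!) x"] x by simp
    moreover have "map ((!) x) [0..<n] = take n x" using S_len[OF X(1) x] by (intro nth_equalityI) auto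
    ultimately show "Q (take n x)" by simp
  qed
  thus ?thesis using S_take[OF X(1)] by simp
qed

section \<open>Definable functions and substitution\<close>

definition DF :: "((nat \<Rightarrow> 'r) \<Rightarrow> 'r) \<Rightarrow> bool" where
  "DF f \<longleftrightarrow> Dp (\<lambda>e. e 0 = f (\<lambda>i. e (Suc i)))"

definition DV :: "nat \<Rightarrow> ((nat \<Rightarrow> 'r) \<Rightarrow> 'r list) \<Rightarrow> bool" where
  "DV n v \<longleftrightarrow> (\<forall>e. length (v e) = n) \<and> (\<forall>i<n. DF (\<lambda>e. v e ! i))"

definition dfun :: "nat \<Rightarrow> ('r list \<Rightarrow> 'r) \<Rightarrow> bool" where
  "dfun n f \<longleftrightarrow> DF (\<lambda>e. f (map e [0..<n]))"

lemma DF_ren: "DF f ==> DF (\<lambda>e. f (\<lambda>i. e (\<sigma> i)))"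
  unfolding DF_def using Dp_ren[of "\<lambda>e. e 0 = f (\<lambda>i. e (Suc i))" "case_nat 0 (\<lambda>i. Suc (\<sigma> i))"] by simp

lemma Dp_app: assumes "DF f" "Dp (\<lambda>e. P (e 0) (\<lambda>i. e (Suc i)))" shows "Dp (\<lambda>e. P (f e) e)"
proof -
  have "Dp (\<lambda>e. \<exists>x. x = f e \<and> P x e)" using assms unfolding DF_def by (intro Dp_ex Dp_conj)
  thus ?thesis by simp
qed

lemma DF_graph: assumes "\<And>e y. y = f e \<longleftrightarrow> Q y e" "Dp (\<lambda>e. Q (e 0) (\<lambda>i. e (Suc i)))" shows "DF f"
  using assms unfolding DF_def by simp

lemma Dp_var_eq: "Dp (\<lambda>e. e i = e j)"
proof -
  have "Dp (\<lambda>e. map (\<lambda>k. e (if k = 0 then i else j)) [0..<2] \<in> {x \<in> Rn 2. x ! 0 = x ! 1})"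
    by (intro Dp_mem_var S_diag) auto
  thus ?thesis by simp
qed

lemma DF_var: "DF (\<lambda>e. e i)"
  unfolding DF_def by (rule Dp_var_eq)

lemma DF_const: "DF (\<lambda>e. c)"
proof -
  have "Dp (\<lambda>e. map (\<lambda>k. e 0) [0..<1] \<in> {[c]})" by (intro Dp_mem_var S_point)
  thus ?thesis unfolding DF_def by simp
qed

lemma Dp_eq: assumes "DF f" "DF g" shows "Dp (\<lambda>e. f e = g e)"
proof (rule Dp_app[OF assms(1)])
  show "Dp (\<lambda>e. e 0 = g (\<lambda>i. e (Suc i)))" using assms(2) unfolding DF_def .
qed

lemma Dp_less: assumes "DF f" "DF g" shows "Dp (\<lambda>e. f e < g e)"
proof -
  have "Dp (\<lambda>e. map (\<lambda>k. e k) [0..<2] \<in> {[x, y] | x y. x < y})" by (intro Dp_mem_var S_less)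
  hence "Dp (\<lambda>e. e 0 < e 1)" by (simp add: numeral_2_eq_2)
  hence "Dp (\<lambda>e. \<exists>x y. y = f e \<and> x = g e \<and> y < x)"
    using DF_ren[OF assms(1), of "\<lambda>i. Suc (Suc i)"] DF_ren[OF assms(2), of "\<lambda>i. Suc (Suc i)"]
    by (intro Dp_ex Dp_conj Dp_eq DF_var) (simp_all)
  thus ?thesis by simp
qed

lemma Dp_le: assumes "DF f" "DF g" shows "Dp (\<lambda>e. f e \<le> g e)"
  using Dp_not[OF Dp_less[OF assms(2,1)]] by (simp add: not_less)

lemma DF_op:
  assumes "{[x, y, h x y] | x y. True} \<in> S 3" "DF f" "DF g" shows "DF (\<lambda>e. h (f e) (g e))"
proof -
  have "Dp (\<lambda>e. map (\<lambda>k. e k) [0..<3] \<in> {[x, y, h x y] | x y. True})" by (intro Dp_mem_var assms(1))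
  hence "Dp (\<lambda>e. e 2 = h (e 0) (e 1))" by (simp add: numeral_3_eq_3 numeral_2_eq_2)
  from Dp_ren[OF this, of "case_nat 1 (case_nat 0 (\<lambda>_. 2))"]
  have "Dp (\<lambda>e. e 2 = h (e 1) (e 0))" by (simp add: numeral_2_eq_2)
  hence h: "Dp (\<lambda>e. e (Suc (Suc 0)) = h (e (Suc 0)) (e 0))" by (simp add: numeral_2_eq_2)
  have "Dp (\<lambda>e. \<exists>x y. x = f (\<lambda>i. e (Suc i)) \<and> y = g (\<lambda>i. e (Suc i)) \<and> e 0 = h x y)"
    by (intro Dp_ex Dp_conj h Dp_eq[OF DF_var] DF_ren[OF assms(2)] DF_ren[OF assms(3)])
  thus ?thesis unfolding DF_def by simp
qed

lemma DF_add: "DF f ==> DF g ==> DF (\<lambda>e. f e + g e)"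
  using DF_op[OF S_add] .

lemma DF_mult: "DF f ==> DF g ==> DF (\<lambda>e. f e * g e)"
  using DF_op[OF S_mult] .

lemma DF_uminus: "DF f ==> DF (\<lambda>e. - f e)"
  using DF_mult[OF DF_const[of "-1"], of f] by simp

lemma DF_diff: "DF f ==> DF g ==> DF (\<lambda>e. f e - g e)"
  using DF_add[OF _ DF_uminus, of f g] by (simp only: add_uminus_conv_diff)

lemma DF_if: assumes "Dp P" "DF f" "DF g" shows "DF (\<lambda>e. if P e then f e else g e)"
proof (rule DF_graph)
  show "y = (if P e then f e else g e) \<longleftrightarrow> (P e --> y = f e) \<and> (\<not> P e --> y = g e)" for e y by simp
  show "Dp (\<lambda>e. (P (\<lambda>i. e (Suc i)) --> e 0 = f (\<lambda>i. e (Suc i))) \<and> (\<not> P (\<lambda>i. e (Suc i)) --> e 0 = g (\<lambda>i. e (Suc i))))"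
    by (intro Dp_conj Dp_imp Dp_not Dp_eq DF_ren[OF assms(2)] DF_ren[OF assms(3)] Dp_ren[OF assms(1)] DF_var)
qed

lemma DF_inverse: assumes "DF f" shows "DF (\<lambda>e. inverse (f e))"
proof (rule DF_graph)
  show "y = inverse (f e) \<longleftrightarrow> (f e = 0 \<and> y = 0) \<or> y * f e = 1" for e y
    by (cases "f e = 0") (auto simp: field_simps)
  show "Dp (\<lambda>e. (f (\<lambda>i. e (Suc i)) = 0 \<and> e 0 = 0) \<or> e 0 * f (\<lambda>i. e (Suc i)) = 1)"
    by (intro Dp_conj Dp_disj Dp_eq DF_mult DF_ren[OF assms] DF_var DF_const)
qed

lemma DF_divide: "DF f ==> DF g ==> DF (\<lambda>e. f e / g e)"
  using DF_mult[OF _ DF_inverse, of f g] by (simp only: divide_inverse)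

lemma DF_abs: assumes "DF f" shows "DF (\<lambda>e. \<bar>f e\<bar>)"
  unfolding abs_if using assms by (intro DF_if DF_uminus Dp_less DF_const)

lemma DF_power: "DF f ==> DF (\<lambda>e. f e ^ k)"
  by (induction k) (simp_all add: DF_const DF_mult)

lemma DF_sum: "(\<And>i. i < n ==> DF (f i)) ==> DF (\<lambda>e. \<Sum>i<(n::nat). f i e)"
  by (induction n) (simp_all add: DF_const DF_add)

lemma DV_map: "(\<And>i. i < n ==> DF (f i)) ==> DV n (\<lambda>e. map (\<lambda>i. f i e) [0..<n])"
  unfolding DV_def by simp

lemma DV_vars: "DV n (\<lambda>e. map e [0..<n])"
  by (rule DV_map) (rule DF_var)

lemma DV_const: "length x = n ==> DV n (\<lambda>e. x)"
  unfolding DV_def using DF_const by simp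

lemma DF_nth: "DV n v ==> i < n ==> DF (\<lambda>e. v e ! i)"
  unfolding DV_def by simp

lemma DV_update: assumes "DV n v" "DF f" shows "DV n (\<lambda>e. (v e)[i := f e])"
proof -
  have "DF (\<lambda>e. (v e)[i := f e] ! j)" if "j < n" for j
    using assms that unfolding DV_def by (cases "i = j") auto
  thus ?thesis using assms(1) unfolding DV_def by simp
qed

lemma DV_append: assumes "DV n v" "DV m w" shows "DV (n + m) (\<lambda>e. v e @ w e)"
proof -
  have "DF (\<lambda>e. (v e @ w e) ! j)" if "j < n + m" for j
    using assms that unfolding DV_def by (cases "j < n") (auto simp: nth_append)
  thus ?thesis using assms(1,2) unfolding DV_def by simp
qed

lemma DV_snoc: "DV n v ==> DF f ==> DV (Suc n) (\<lambda>e. v e @ [f e])"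
  using DV_append[of n v 1 "\<lambda>e. [f e]"] unfolding DV_def[of 1] by simp

lemma DV_ren: "DV n v ==> DV n (\<lambda>e. v (\<lambda>i. e (\<sigma> i)))"
  unfolding DV_def using DF_ren[of "\<lambda>e. v e ! _" \<sigma>] by blast

lemma Dp_appv: assumes "DV n v" "Dp (\<lambda>e. P (map e [0..<n]) (\<lambda>i. e (i + n)))" shows "Dp (\<lambda>e. P (v e) e)"
proof -
  have "Dp (\<lambda>e. \<exists>x\<in>Rn n. (\<forall>i<n. x ! i = v e ! i) \<and> P x e)"
    using assms DF_ren[of "\<lambda>e. v e ! _" "\<lambda>i. i + n"] unfolding DV_def
    by (intro Dp_exv Dp_conj Dp_all_less Dp_eq DF_nth[OF DV_vars]) auto
  moreover have "(\<exists>x\<in>Rn n. (\<forall>i<n. x ! i = v e ! i) \<and> P x e) \<longleftrightarrow> P (v e) e" for e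
    using assms(1) unfolding DV_def by (auto intro!: bexI[of _ "v e"]) (metis nth_equalityI)
  ultimately show ?thesis by simp
qed

lemma Dp_mem: assumes "X \<in> S n" "DV n v" shows "Dp (\<lambda>e. v e \<in> X)"
  by (rule Dp_appv[OF assms(2)]) (rule Dp_mem_var[OF assms(1)])

lemma DF_app: assumes "dfun n f" "DV n v" shows "DF (\<lambda>e. f (v e))"
proof -
  have "Dp (\<lambda>e. e 0 = f (v (\<lambda>i. e (Suc i))))"
  proof (rule Dp_appv[OF DV_ren[OF assms(2), of Suc]])
    show "Dp (\<lambda>e. e (0 + n) = f (map e [0..<n]))"
      using assms(1) unfolding dfun_def by (intro Dp_eq DF_var)
  qed
  thus ?thesis unfolding DF_def .
qed

lemmas dfi = Dp_not Dp_conj Dp_disj Dp_imp Dp_iff Dp_ex Dp_all Dp_all_less Dp_ex_less Dp_exv Dp_allv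
  Dp_eq Dp_less Dp_le DF_if DF_add DF_mult DF_diff DF_uminus DF_inverse DF_divide DF_abs DF_power DF_sum
  DF_nth DF_var DF_const DV_update DV_snoc DV_map

text \<open>All variables are replaced at once by definable terms. Only finitely many of them occur
  in \<open>P\<close>, so the infinite family \<open>g\<close> is no obstacle.\<close>

lemma Dp_subst: assumes "Dp P" "\<And>i. DF (g i)" shows "Dp (\<lambda>e. P (\<lambda>i. g i e))"
proof -
  obtain n X where X: "X \<in> S n" "\<And>e. P e \<longleftrightarrow> map e [0..<n] \<in> X" using assms(1) unfolding Dp_def by blast
  show ?thesis unfolding X(2) by (rule Dp_mem[OF X(1)], rule DV_map, rule assms)
qed

lemma DF_subst: assumes "DF f" "\<And>i. DF (g i)" shows "DF (\<lambda>e. f (\<lambda>i. g i e))"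
proof -
  let ?c = "\<lambda>k e. case_nat (e 0) (\<lambda>i. g i (\<lambda>j. e (Suc j))) k"
  have "Dp (\<lambda>e. ?c 0 e = f (\<lambda>i. ?c (Suc i) e))"
  proof (rule Dp_subst[OF assms(1)[unfolded DF_def], of ?c])
    show "DF (?c k)" for k by (cases k) (simp_all only: nat.case DF_var DF_ren[OF assms(2)])
  qed
  thus ?thesis unfolding DF_def by (simp only: nat.case)
qed

lemma Dp_app1: assumes "Dp (\<lambda>e. P (e 0))" "DF g" shows "Dp (\<lambda>e. P (g e))"
  by (rule Dp_app[OF assms(2,1)])

lemma DF_app1: assumes "DF (\<lambda>e. f (e 0))" "DF g" shows "DF (\<lambda>e. f (g e))"
  by (rule DF_subst[OF assms(1), of "\<lambda>i. g"]) (rule assms(2))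

lemma Dp_app2: assumes "Dp (\<lambda>e. A (e 0) (\<lambda>i. e (Suc i)))" "DF t"
  shows "Dp (\<lambda>e. A (t e) (\<lambda>i. e (\<sigma> i)))"
proof -
  let ?c = "\<lambda>k e. case_nat (t e) (\<lambda>j. e (\<sigma> j)) k"
  have "Dp (\<lambda>e. A (?c 0 e) (\<lambda>i. ?c (Suc i) e))"
  proof (rule Dp_subst[OF assms(1), of ?c])
    show "DF (?c k)" for k by (cases k) (simp_all only: nat.case DF_var assms(2))
  qed
  thus ?thesis by (simp only: nat.case)
qed

subsection \<open>Definable functions of one variable\<close>

text \<open>A definable subset of the line is a finite union of points and intervals, so an
  induction over two finite sets suffices. Through this rule o-minimality enters: germs, suprema and
  the finiteness dichotomy are drawn from it.\<close>

lemma ominimal_induct: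
  assumes "Dp (\<lambda>e. P (e 0))" "Q (\<lambda>x. False)" "\<And>a. Q (\<lambda>x. x = a)" "\<And>a b. Q (in_ival a b)"
    "\<And>P P'. Q P ==> Q P' ==> Q (\<lambda>x::'r. P x \<or> P' x)"
  shows "Q P"
proof -
  have "Dp (\<lambda>e. P (map e [0..<1] ! 0))" using assms(1) by simp
  hence "{x \<in> Rn 1. P (x ! 0)} \<in> S 1" by (rule S_Collect)
  from S_ominimal[OF this] obtain F J where F: "finite F" "finite J" and
    eq: "{x \<in> Rn 1. P (x ! 0)} = {[x] | x. x \<in> F \<or> (\<exists>(a, b)\<in>J. in_ival a b x)}"
    by (elim exE conjE)
  have P: "P x \<longleftrightarrow> x \<in> F \<or> (\<exists>(a, b)\<in>J. in_ival a b x)" for x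
  proof -
    have "P x \<longleftrightarrow> [x] \<in> {x \<in> Rn 1. P (x ! 0)}" by simp
    thus ?thesis unfolding eq by simp
  qed
  have 1: "Q (\<lambda>x. x \<in> F)" using F(1)
  proof (induction F rule: finite_induct)
    case (insert a F)
    have "Q (\<lambda>x. x = a \<or> x \<in> F)" by (rule assms(5)[OF assms(3) insert.IH])
    thus ?case by simp
  qed (simp add: assms(2))
  have 2: "Q (\<lambda>x. \<exists>(a, b)\<in>J. in_ival a b x)" using F(2)
  proof (induction J rule: finite_induct)
    case (insert j J)
    obtain a b where j: "j = (a, b)" by fastforce
    have "Q (\<lambda>x. in_ival a b x \<or> (\<exists>(a, b)\<in>J. in_ival a b x))" by (rule assms(5)[OF assms(4) insert.IH])
    thus ?case by (simp add: j)
  qed (simp add: assms(2))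
  have "Q (\<lambda>x. x \<in> F \<or> (\<exists>(a, b)\<in>J. in_ival a b x))" by (rule assms(5)[OF 1 2])
  moreover have "(\<lambda>x. x \<in> F \<or> (\<exists>(a, b)\<in>J. in_ival a b x)) = P" using P by (intro ext) (simp only:)
  ultimately show ?thesis by (simp only:)
qed

lemma in_ival_germ: "\<exists>b>a. (\<forall>x. a < x \<and> x < b --> in_ival l u x) \<or> (\<forall>x. a < x \<and> x < b --> \<not> in_ival l u (x::'r))"
proof -
  obtain a1 where a1: "a < a1" using gt_ex by blast
  have "\<exists>b>a. b \<le> a1 \<and> ((\<forall>x. a < x \<and> x < b --> (case l of None \<Rightarrow> True | Some a' \<Rightarrow> a' < x)) \<or>
     (\<forall>x. a < x \<and> x < b --> \<not> (case l of None \<Rightarrow> True | Some a' \<Rightarrow> a' < x)))"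
  proof (cases l)
    case (Some a')
    show ?thesis
    proof (cases "a' \<le> a")
      case False thus ?thesis using a1 Some by (intro exI[of _ "min a' a1"]) auto
    qed (use a1 Some in \<open>auto intro!: exI[of _ a1]\<close>)
  qed (use a1 in auto)
  then obtain b1 where b1: "b1 > a" "b1 \<le> a1" and b1': "(\<forall>x. a < x \<and> x < b1 --> (case l of None \<Rightarrow> True | Some a' \<Rightarrow> a' < x)) \<or>
     (\<forall>x. a < x \<and> x < b1 --> \<not> (case l of None \<Rightarrow> True | Some a' \<Rightarrow> a' < x))" by blast
  have "\<exists>b>a. b \<le> b1 \<and> ((\<forall>x. a < x \<and> x < b --> (case u of None \<Rightarrow> True | Some a' \<Rightarrow> x < a')) \<or>
     (\<forall>x. a < x \<and> x < b --> \<not> (case u of None \<Rightarrow> True | Some a' \<Rightarrow> x < a')))"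
  proof (cases u)
    case (Some a')
    show ?thesis
    proof (cases "a' \<le> a")
      case False thus ?thesis using b1 Some by (intro exI[of _ "min a' b1"]) auto
    qed (use b1 Some in \<open>auto intro!: exI[of _ b1]\<close>)
  qed (use b1 in auto)
  then obtain b where "b > a" "b \<le> b1" "(\<forall>x. a < x \<and> x < b --> (case u of None \<Rightarrow> True | Some a' \<Rightarrow> x < a')) \<or>
     (\<forall>x. a < x \<and> x < b --> \<not> (case u of None \<Rightarrow> True | Some a' \<Rightarrow> x < a'))" by blast
  thus ?thesis using b1' unfolding in_ival_def by (intro exI[of _ b]) force
qed

lemma germ_right: assumes "Dp (\<lambda>e. P (e 0))"
  shows "\<exists>b>a. (\<forall>x. a < x \<and> x < b --> P x) \<or> (\<forall>x. a < x \<and> x < b --> \<not> P (x::'r))"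
  using assms
proof (rule ominimal_induct)
  obtain a1 where a1: "a < a1" using gt_ex by blast
  show "\<exists>b>a. (\<forall>x. a < x \<and> x < b --> False) \<or> (\<forall>x. a < x \<and> x < b --> \<not> False)" using a1 by blast
  show "\<exists>b>a. (\<forall>x. a < x \<and> x < b --> in_ival l u x) \<or> (\<forall>x. a < x \<and> x < b --> \<not> in_ival l u x)" for l u
    by (rule in_ival_germ)
  show "\<exists>b>a. (\<forall>x. a < x \<and> x < b --> x = c) \<or> (\<forall>x. a < x \<and> x < b --> \<not> x = c)" for c
    using a1 by (cases "a < c") (blast, force)
  fix P P' assume "\<exists>b>a. (\<forall>x. a < x \<and> x < b --> P x) \<or> (\<forall>x. a < x \<and> x < b --> \<not> P x)"
    "\<exists>b>a. (\<forall>x. a < x \<and> x < b --> P' x) \<or> (\<forall>x. a < x \<and> x < b --> \<not> P' x)"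
  then obtain b1 b2 where "b1 > a" "(\<forall>x. a < x \<and> x < b1 --> P x) \<or> (\<forall>x. a < x \<and> x < b1 --> \<not> P x)"
    "b2 > a" "(\<forall>x. a < x \<and> x < b2 --> P' x) \<or> (\<forall>x. a < x \<and> x < b2 --> \<not> P' x)" by blast
  thus "\<exists>b>a. (\<forall>x. a < x \<and> x < b --> P x \<or> P' x) \<or> (\<forall>x. a < x \<and> x < b --> \<not> (P x \<or> P' x))"
    by (intro exI[of _ "min b1 b2"]) auto
qed

lemma dichotomy1: assumes "Dp (\<lambda>e. P (e 0))" "a < (b::'r)"
  obtains c d where "a \<le> c" "c < d" "d \<le> b" "(\<forall>x. c < x \<and> x < d --> P x) \<or> (\<forall>x. c < x \<and> x < d --> \<not> P x)"
proof -
  obtain d where "d > a" "(\<forall>x. a < x \<and> x < d --> P x) \<or> (\<forall>x. a < x \<and> x < d --> \<not> P x)"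
    using germ_right[OF assms(1)] by blast
  thus thesis using assms(2) by (intro that[of a "min b d"]) auto
qed

text \<open>Stands in for completeness of the field: a nonempty bounded interval has its right end
  point as supremum, and the maximum handles unions. The limit points of later arguments are
  obtained from it.\<close>

lemma definable_sup: assumes "Dp (\<lambda>e. P (e 0))" "P x0" "\<And>x. P x ==> x \<le> (B::'r)"
  obtains s where "\<And>x. P x ==> x \<le> s" "\<And>u. (\<And>x. P x ==> x \<le> u) ==> s \<le> u"
proof -
  let ?lub = "\<lambda>P s::'r. (\<forall>x. P x --> x \<le> s) \<and> (\<forall>u. (\<forall>x. P x --> x \<le> u) --> s \<le> u)"
  let ?Q = "\<lambda>P. (\<exists>x. P x) --> (\<exists>B. \<forall>x. P x --> x \<le> B) --> (\<exists>s. ?lub P s)"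
  have "?Q P" using assms(1)
  proof (rule ominimal_induct)
    fix l u :: "'r option"
    show "?Q (in_ival l u)"
    proof (intro impI)
      assume "\<exists>x. in_ival l u x" "\<exists>B. \<forall>x. in_ival l u x --> x \<le> B"
      then obtain x B where x: "in_ival l u x" and B: "\<And>x. in_ival l u x ==> x \<le> B" by blast
      obtain y where y: "max x B < y" using gt_ex by blast
      have "\<not> in_ival l u y" using B[of y] y by auto
      then obtain b where b: "u = Some b" using x y unfolding in_ival_def by (cases l; cases u) auto
      have "b \<le> v" if v: "\<And>x. in_ival l u x ==> x \<le> v" for v
      proof (rule ccontr)
        assume "\<not> b \<le> v"
        hence "max x v < b" using x b unfolding in_ival_def by auto
        then obtain z where "max x v < z" "z < b" using dense by blast
        hence "in_ival l u z" "v < z" using x b unfolding in_ival_def by (auto split: option.splits)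
        thus False using v by force
      qed
      thus "\<exists>s. ?lub (in_ival l u) s" by (intro exI[of _ b]) (auto simp: in_ival_def b)
    qed
  next
    fix P P' assume *: "?Q P" "?Q P'"
    show "?Q (\<lambda>x. P x \<or> P' x)"
    proof (intro impI)
      assume ne: "\<exists>x. P x \<or> P' x" and bd: "\<exists>B. \<forall>x. P x \<or> P' x --> x \<le> B"
      show "\<exists>s. ?lub (\<lambda>x. P x \<or> P' x) s"
      proof (cases "(\<exists>x. P x) \<and> (\<exists>x. P' x)")
        case True
        then obtain s s' where "?lub P s" "?lub P' s'" using * bd by blast
        thus ?thesis by (intro exI[of _ "max s s'"]) (auto simp: le_max_iff_disj)
      next
        case False thus ?thesis using * bd ne by metis
      qed
    qed
  qed (auto intro: exI)
  thus thesis using assms(2,3) that by blast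
qed

lemma finite_or_interval: assumes "Dp (\<lambda>e. P (e 0))"
  shows "finite {x. P x} \<or> (\<exists>a b. a < b \<and> (\<forall>x::'r. a < x \<and> x < b --> P x))"
  using assms
proof (rule ominimal_induct)
  fix l u :: "'r option"
  show "finite {x. in_ival l u x} \<or> (\<exists>a b. a < b \<and> (\<forall>x. a < x \<and> x < b --> in_ival l u x))"
  proof (cases "\<exists>x. in_ival l u x")
    case True
    then obtain x where x: "in_ival l u x" by blast
    obtain b1 where "x < b1" using gt_ex by blast
    then obtain b where "x < b" "case u of None \<Rightarrow> True | Some b' \<Rightarrow> b \<le> b'" using x
      by (cases u) (auto simp: in_ival_def)
    hence "\<forall>y. x < y \<and> y < b --> in_ival l u y" using x by (auto simp: in_ival_def split: option.splits)
    thus ?thesis using \<open>x < b\<close> by blast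
  qed auto
qed auto

section \<open>Definable choice\<close>

text \<open>A canonical point of a nonempty fibre. Folding the fibre by absolute values makes it
  bounded below, so an infimum \<open>a\<close> exists. Either \<open>a\<close> is attained, or the
  folded fibre contains an interval starting at \<open>a\<close>, and the midpoint of the longest
  such interval of length at most 1 is taken. Finally the sign is restored.\<close>

lemma definable_choice1: assumes A: "Dp (\<lambda>e. A (e 0) (\<lambda>i. e (Suc i)))"
  obtains f where "DF f" "\<And>e x. A x e ==> A (f e) e"
proof -
  define Y where "Y r e \<longleftrightarrow> 0 \<le> r \<and> (A r e \<or> A (- r) e)" for r e
  define I where "I a e \<longleftrightarrow> (\<forall>r. Y r e --> a \<le> r) \<and> (\<forall>u. (\<forall>r. Y r e --> u \<le> r) --> u \<le> a)" for a e
  \<comment> \<open>The cap \<open>a + 1\<close> keeps the candidate end points bounded, so that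
    they have a supremum even if the interval is unbounded.\<close>
  define B where "B a b e \<longleftrightarrow> a < b \<and> b \<le> a + 1 \<and> (\<forall>t. a < t \<and> t < b --> Y t e)" for a b e
  define L where "L a b e \<longleftrightarrow> (\<forall>c. B a c e --> c \<le> b) \<and> (\<forall>u. (\<forall>c. B a c e --> c \<le> u) --> b \<le> u)" for a b e
  define R where "R r e \<longleftrightarrow> (\<exists>a. I a e \<and> (if Y a e then r = a else (\<exists>b. L a b e \<and> r = (a + b) / 2)))" for r e
  define C where "C y e \<longleftrightarrow> (\<exists>r. R r e \<and> y = (if A r e then r else - r))" for y e
  define f where "f e = (if \<exists>x. A x e then THE y. C y e else 0)" for e
  have uI: "I a e ==> I a' e ==> a = a'" for a a' e unfolding I_def by (meson order_antisym)
  have uL: "L a b e ==> L a b' e ==> b = b'" for a b b' e unfolding L_def by (meson order_antisym)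
  have uR: "R r e ==> R r' e ==> r = r'" for r r' e unfolding R_def using uI uL by (metis (no_types, lifting))
  have uC: "C y e ==> C y' e ==> y = y'" for y y' e unfolding C_def using uR by blast
  note DA = Dp_app2[OF A]
  have dY0: "Dp (\<lambda>e. Y (e 0) (\<lambda>i. e (Suc i)))" unfolding Y_def by (intro dfi DA)
  note dY = Dp_app2[OF dY0]
  have dI0: "Dp (\<lambda>e. I (e 0) (\<lambda>i. e (Suc i)))" unfolding I_def by (intro dfi dY)
  note dI = Dp_app2[OF dI0]
  have e1: "\<exists>y. C y e \<and> A y e" if x: "A x e" for x e
  proof -
    have A1: "Dp (\<lambda>e'. A (e' 0) e)"
    proof -
      let ?c = "\<lambda>k e'. case_nat (e' 0) e k"
      have "Dp (\<lambda>e'. A (?c 0 e') (\<lambda>i. ?c (Suc i) e'))"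
      proof (rule Dp_subst[OF A, of ?c])
        show "DF (?c k)" for k by (cases k) (simp_all only: nat.case DF_var DF_const)
      qed
      thus ?thesis by (simp only: nat.case)
    qed
    have Y1: "Dp (\<lambda>e'. Y (e' 0) e)" unfolding Y_def by (intro dfi Dp_app1[OF A1])
    have Yx: "Y \<bar>x\<bar> e" using x unfolding Y_def by (auto simp: abs_if)
    obtain s where s: "\<And>x. Y (- x) e ==> x \<le> s" "\<And>u. (\<And>x. Y (- x) e ==> x \<le> u) ==> s \<le> u"
    proof (rule definable_sup[of "\<lambda>x. Y (- x) e" "- \<bar>x\<bar>" 0])
      show "Dp (\<lambda>ea. Y (- ea 0) e)" by (intro Dp_app1[OF Y1] dfi)
    qed (use Yx in \<open>auto simp: Y_def\<close>)
    define a where "a = - s"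
    have I: "I a e" unfolding I_def a_def
    proof (intro conjI allI impI)
      show "- s \<le> r" if "Y r e" for r using s(1)[of "- r"] that by simp
      fix u assume u: "\<forall>r. Y r e --> u \<le> r"
      have "s \<le> - u" by (rule s(2)) (use u in force)
      thus "u \<le> - s" by simp
    qed
    have "\<exists>r. R r e \<and> Y r e"
    proof (cases "Y a e")
      case True thus ?thesis unfolding R_def using I by (intro exI[of _ a]) auto
    next
      case False
      have "\<exists>b. B a b e"
      proof -
        obtain b where b: "b > a" "(\<forall>x. a < x \<and> x < b --> Y x e) \<or> (\<forall>x. a < x \<and> x < b --> \<not> Y x e)"
          using germ_right[OF Y1] by blast
        have "\<exists>r. a < r \<and> r < b \<and> Y r e"
        proof (rule ccontr)
          assume *: "\<not> ?thesis"
          have "b \<le> r" if "Y r e" for r using * that False I unfolding I_def by (metis order.not_eq_order_implies_strict not_le)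
          hence "b \<le> a" using I unfolding I_def by blast
          thus False using b(1) by simp
        qed
        hence "\<forall>x. a < x \<and> x < b --> Y x e" using b(2) by blast
        hence "B a (min b (a+1)) e" unfolding B_def using b(1) by simp
        thus ?thesis by blast
      qed
      then obtain b0 where b0: "B a b0 e" by blast
      obtain b where b: "\<And>c. B a c e ==> c \<le> b" "\<And>u. (\<And>c. B a c e ==> c \<le> u) ==> b \<le> u"
      proof (rule definable_sup[of "\<lambda>c. B a c e", OF _ b0, of "a + 1"])
        show "Dp (\<lambda>ea. B a (ea 0) e)" unfolding B_def by (intro dfi Dp_app1[OF Y1])
      qed (auto simp: B_def)
      have "a < b" using b(1)[OF b0] b0 unfolding B_def by simp
      hence *: "a < (a + b) / 2" "(a + b) / 2 < b" by (auto simp: field_simps)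
      have "\<exists>c. B a c e \<and> (a + b) / 2 < c" using b(2)[of "(a+b)/2"] *(2) by force
      hence "Y ((a + b) / 2) e" using * unfolding B_def by blast
      moreover have "L a b e" unfolding L_def using b by blast
      ultimately show ?thesis unfolding R_def using I False by (intro exI[of _ "(a+b)/2"]) auto
    qed
    then obtain r where "R r e" "Y r e" by blast
    thus ?thesis unfolding C_def by (intro exI[of _ "if A r e then r else - r"]) (auto simp: Y_def)
  qed
  show thesis
  proof (rule that[of f])
    fix e x assume x: "A x e"
    then obtain y where "C y e" "A y e" using e1 by blast
    moreover have "f e = y" unfolding f_def using x \<open>C y e\<close> uC by (auto intro!: the_equality)
    ultimately show "A (f e) e" by simp
  next
    show "DF f"
    proof (rule DF_graph)
      show "y = f e \<longleftrightarrow> ((\<exists>x. A x e) --> C y e) \<and> ((\<not> (\<exists>x. A x e)) --> y = 0)" for e y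
      proof (cases "\<exists>x. A x e")
        case True
        then obtain z where z: "C z e" using e1 by blast
        have "f e = z" unfolding f_def using True z uC by (auto intro!: the_equality)
        thus ?thesis using True z uC by blast
      qed (simp add: f_def)
      show "Dp (\<lambda>e. ((\<exists>x. A x (\<lambda>i. e (Suc i))) --> C (e 0) (\<lambda>i. e (Suc i))) \<and> ((\<not> (\<exists>x. A x (\<lambda>i. e (Suc i)))) --> e 0 = 0))"
        unfolding C_def R_def L_def B_def if_bool_eq_conj by (intro dfi DA dY dI)
    qed
  qed
qed

text \<open>By induction the first \<open>k\<close> coordinates are chosen among those that admit
  some last coordinate; then the last one is chosen in the remaining fibre. The facts
  \<open>gen\<close> and \<open>gen'\<close> only renumber variables.\<close>

lemma definable_choice: "Dp (\<lambda>e. A (map e [0..<k]) (\<lambda>i. e (i + k))) ==>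
  \<exists>v. DV k v \<and> (\<forall>e. \<forall>x\<in>Rn k. A x e --> A (v e) e)"
proof (induction k arbitrary: A)
  case 0
  show ?case by (intro exI[of _ "\<lambda>e. []"]) (auto intro: DV_const)
next
  case (Suc k)
  have gen: "Dp (\<lambda>e. A (map (\<lambda>i. g i e) [0..<Suc k]) (\<lambda>i. h i e))" if "\<And>i. DF (g i)" "\<And>i. DF (h i)" for g h
  proof -
    have "Dp (\<lambda>e. A (map (\<lambda>i. if i < Suc k then g i e else h (i - Suc k) e) [0..<Suc k])
        (\<lambda>i. if i + Suc k < Suc k then g (i + Suc k) e else h (i + Suc k - Suc k) e))"
      by (rule Dp_subst[OF Suc.prems, of "\<lambda>i e. if i < Suc k then g i e else h (i - Suc k) e"], rename_tac i, case_tac "i < Suc k")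
        (simp_all add: that)
    moreover have "map (\<lambda>i. if i < Suc k then g i e else h (i - Suc k) e) [0..<Suc k] = map (\<lambda>i. g i e) [0..<Suc k]" for e
      by (rule map_cong) auto
    ultimately show ?thesis by (simp del: upt_Suc map_eq_conv)
  qed
  have gen': "Dp (\<lambda>e. A (w e @ [g e]) (\<lambda>i. h i e))" if w: "DV k w" and "DF g" "\<And>i. DF (h i)" for w g h
  proof -
    have "Dp (\<lambda>e. A (map (\<lambda>i. if i < k then w e ! i else g e) [0..<Suc k]) (\<lambda>i. h i e))"
    proof (rule gen)
      show "DF (\<lambda>e. if i < k then w e ! i else g e)" for i using DF_nth[OF w] that(2) by (cases "i < k") auto
    qed (rule that(3))
    moreover have "map (\<lambda>i. if i < k then w e ! i else g e) [0..<Suc k] = w e @ [g e]" for e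
      using w unfolding DV_def by (intro nth_equalityI) (auto simp: nth_append less_Suc_eq simp del: upt_Suc)
    ultimately show ?thesis by (simp del: upt_Suc map_eq_conv)
  qed
  have "Dp (\<lambda>e. \<exists>t. A (map e [0..<k] @ [t]) (\<lambda>i. e (i + k)))"
    by (rule Dp_ex, rule gen'[OF DV_map]) (rule DF_var)+
  from Suc.IH[of "\<lambda>x e. \<exists>t. A (x @ [t]) e", OF this]
  obtain v where v1: "DV k v" and "\<forall>e. \<forall>x\<in>Rn k. (\<exists>t. A (x @ [t]) e) --> (\<exists>t. A (v e @ [t]) e)"
    by (elim exE conjE)
  hence v2: "\<exists>t. A (v e @ [t]) e" if "length x = k" "A (x @ [t]) e" for e x t
    using that by (metis Rn_iff)
  have "Dp (\<lambda>e. A (v (\<lambda>i. e (Suc i)) @ [e 0]) (\<lambda>i. e (Suc i)))"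
    by (rule gen'[OF DV_ren[OF v1]]) (rule DF_var)+
  then obtain f where f1: "DF f" and f2: "\<And>e x. A (v e @ [x]) e ==> A (v e @ [f e]) e"
  proof (rule definable_choice1[of "\<lambda>t e. A (v e @ [t]) e"])
    fix f assume "DF f" "\<And>e x. A (v e @ [x]) e ==> A (v e @ [f e]) e"
    thus thesis by (rule that)
  qed
  show ?case
  proof (intro exI[of _ "\<lambda>e. v e @ [f e]"] conjI allI ballI impI)
    fix e x assume "x \<in> Rn (Suc k)" and A: "A x e"
    then obtain y t where y: "x = y @ [t]" "length y = k" by (auto simp: length_Suc_conv_rev)
    obtain t' where "A (v e @ [t']) e" using v2[OF y(2), of t e] A unfolding y(1) by blast
    thus "A (v e @ [f e]) e" by (rule f2)
  qed (rule DV_snoc[OF v1 f1])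
qed

text \<open>Passes from environments to lists: the environment used is \<open>x\<close> padded by
  zeros, which is definable in \<open>x\<close>.\<close>

lemma choice_fun:
  assumes "Dp (\<lambda>e. P (map (\<lambda>i. e (i + k)) [0..<n]) (map e [0..<k]))"
  obtains z where "\<And>x. length (z x) = k" "\<And>j. j < k ==> dfun n (\<lambda>x. z x ! j)"
    "\<And>x y. length x = n ==> length y = k ==> P x y ==> P x (z x)"
proof -
  obtain v where v: "DV k v" "\<forall>e. \<forall>x\<in>Rn k. P (map e [0..<n]) x --> P (map e [0..<n]) (v e)"
    using definable_choice[of "\<lambda>y e. P (map e [0..<n]) y" k, OF assms] by (elim exE conjE)
  define ext where "ext x i = (if i < n then x ! i else (0::'r))" for x i
  have ext: "map (ext x) [0..<n] = x" if "length x = n" for x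
    using that by (intro nth_equalityI) (auto simp: ext_def)
  show thesis
  proof (rule that[of "\<lambda>x. v (ext x)"])
    show "dfun n (\<lambda>x. v (ext x) ! j)" if "j < k" for j unfolding dfun_def
    proof (rule DF_subst[OF DF_nth[OF v(1) that]])
      show "DF (\<lambda>e. ext (map e [0..<n]) i)" for i
        unfolding ext_def by (cases "i < n") (auto intro: DF_var DF_const)
    qed
    show "P x (v (ext x))" if "length x = n" "length y = k" "P x y" for x y
      using v(2)[rule_format, of y "ext x"] that unfolding ext[OF that(1)] by simp
  qed (use v(1) in \<open>auto simp: DV_def\<close>)
qed

lemma DV_app: assumes "\<And>x. length (z x) = k" "\<And>j. j < k ==> dfun n (\<lambda>x. z x ! j)" "DV n v"
  shows "DV k (\<lambda>e. z (v e))"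
  unfolding DV_def by (intro conjI allI impI assms(1) DF_app[OF assms(2) assms(3)])

section \<open>Local and global monotonicity in one variable\<close>

text \<open>The arguments of \<open>R\<close> keep the order of the points, here and in
  \<open>lg\<close>. So \<open>lg (<) f x\<close> and \<open>rg (<) f x\<close> both say that
  \<open>f\<close> increases through \<open>x\<close>, while a strict local minimum is
  \<open>lg (>) f x\<close> together with \<open>rg (<) f x\<close>.\<close>

definition rg :: "('r \<Rightarrow> 'r \<Rightarrow> bool) \<Rightarrow> ('r \<Rightarrow> 'r) \<Rightarrow> 'r \<Rightarrow> bool" where
  "rg R f x \<longleftrightarrow> (\<exists>d>0. \<forall>y. x < y \<and> y < x + d --> R (f x) (f y))"

definition lg :: "('r \<Rightarrow> 'r \<Rightarrow> bool) \<Rightarrow> ('r \<Rightarrow> 'r) \<Rightarrow> 'r \<Rightarrow> bool" where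
  "lg R f x \<longleftrightarrow> (\<exists>d>0. \<forall>y. x - d < y \<and> y < x --> R (f y) (f x))"

definition ctd1 :: "('r \<Rightarrow> 'r) \<Rightarrow> 'r \<Rightarrow> bool" where
  "ctd1 f x \<longleftrightarrow> (\<forall>e>0. \<exists>d>0. \<forall>y. \<bar>y - x\<bar> < d --> \<bar>f y - f x\<bar> < e)"

definition dv1 :: "('r \<Rightarrow> 'r) \<Rightarrow> 'r \<Rightarrow> 'r \<Rightarrow> bool" where
  "dv1 f x D \<longleftrightarrow> (\<forall>e>0. \<exists>d>0. \<forall>y. \<bar>y - x\<bar> < d --> \<bar>f y - f x - D * (y - x)\<bar> \<le> e * \<bar>y - x\<bar>)"

lemma rg_trichotomy: assumes f: "DF (\<lambda>e. f (e 0))" shows "rg (<) f x \<or> rg (=) f x \<or> rg (>) f x"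
proof -
  have 1: "Dp (\<lambda>e. f x < f (e 0))" by (intro dfi f)
  have 2: "Dp (\<lambda>e. f x = f (e 0))" by (intro dfi f)
  obtain b where b: "b > x" "(\<forall>y. x < y \<and> y < b --> f x < f y) \<or> (\<forall>y. x < y \<and> y < b --> \<not> f x < f y)"
    using germ_right[OF 1] by metis
  obtain c where c: "c > x" "(\<forall>y. x < y \<and> y < c --> f x = f y) \<or> (\<forall>y. x < y \<and> y < c --> \<not> f x = f y)"
    using germ_right[OF 2] by metis
  define d where "d = min b c - x"
  have "(\<forall>y. x < y \<and> y < x + d --> f x < f y) \<or> (\<forall>y. x < y \<and> y < x + d --> f x = f y) \<or> (\<forall>y. x < y \<and> y < x + d --> f x > f y)"
  proof (cases "\<forall>y. x < y \<and> y < b --> f x < f y")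
    case True thus ?thesis unfolding d_def by auto
  next
    case nb: False
    show ?thesis
    proof (cases "\<forall>y. x < y \<and> y < c --> f x = f y")
      case True thus ?thesis unfolding d_def by auto
    next
      case False
      have "f y < f x" if "x < y" "y < x + d" for y
        using nb False b(2) c(2) that linorder_less_linear[of "f x" "f y"] unfolding d_def by auto
      thus ?thesis by blast
    qed
  qed
  moreover have "d > 0" using b c by (simp add: d_def)
  ultimately show ?thesis unfolding rg_def by metis
qed

lemma lg_mirror: "lg R f x \<longleftrightarrow> rg (\<lambda>a b. R b a) (\<lambda>y. f (- y)) (- x)"
proof
  assume "lg R f x"
  then obtain d where d: "d > 0" "\<forall>y. x - d < y \<and> y < x --> R (f y) (f x)" unfolding lg_def by blast
  have "R (f (- y)) (f x)" if "- x < y" "y < - x + d" for y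
    using d(2)[rule_format, of "- y"] that by simp
  thus "rg (\<lambda>a b. R b a) (\<lambda>y. f (- y)) (- x)" unfolding rg_def using d(1) by (intro exI[of _ d]) simp
next
  assume "rg (\<lambda>a b. R b a) (\<lambda>y. f (- y)) (- x)"
  then obtain d where d: "d > 0" "\<forall>y. - x < y \<and> y < - x + d --> R (f (- y)) (f x)" unfolding rg_def by auto
  have "R (f y) (f x)" if "x - d < y" "y < x" for y
    using d(2)[rule_format, of "- y"] that by simp
  thus "lg R f x" unfolding lg_def using d(1) by (intro exI[of _ d]) simp
qed

lemma lg_trichotomy: assumes f: "DF (\<lambda>e. f (e 0))" shows "lg (<) f x \<or> lg (=) f x \<or> lg (>) f x"
proof -
  have "DF (\<lambda>e. f (- e 0))" by (intro DF_app1[OF f] dfi)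
  from rg_trichotomy[OF this, of "-x"] show ?thesis unfolding lg_mirror by (auto simp: eq_commute[of "f x"] rg_def)
qed

text \<open>A supremum argument: let \<open>s\<close> be the last point up to which the relation to
  \<open>f x\<close> holds. The left germ at \<open>s\<close> and transitivity carry the relation to
  \<open>s\<close> itself, and the right germ would carry it beyond \<open>s\<close> if
  \<open>s < z\<close>.\<close>

lemma local_to_global:
  assumes R: "\<And>a b c. R a b ==> R b c ==> R a c" and dR: "\<And>c. Dp (\<lambda>e. R c (f (e 0)))"
    and loc: "\<And>x. a < x ==> x < b ==> lg R f x \<and> rg R f x" and "a < x" "x < z" "z < b"
  shows "R (f x) (f z)"
proof -
  define X where "X y \<longleftrightarrow> x < y \<and> y \<le> z \<and> (\<forall>t. x < t \<and> t \<le> y --> R (f x) (f t))" for y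
  have dX: "Dp (\<lambda>e. X (e 0))" unfolding X_def by (intro dfi dR)
  have ext: "\<exists>y>s. y \<le> z \<and> (\<forall>t. s < t \<and> t \<le> y --> R (f s) (f t))" if s: "a < s" "s < z" for s
  proof -
    obtain d where d: "d > 0" "\<forall>y. s < y \<and> y < s + d --> R (f s) (f y)"
      using loc[of s] s assms unfolding rg_def by (meson less_trans)
    have "s < min z (s + d)" using d(1) s by simp
    then obtain y where "s < y" "y < min z (s + d)" using dense by blast
    thus ?thesis using d(2) by (intro exI[of _ y]) auto
  qed
  obtain y0 where y0: "X y0" using ext[of x] assms unfolding X_def by blast
  obtain s where s: "\<And>y. X y ==> y \<le> s" "\<And>u. (\<And>y. X y ==> y \<le> u) ==> s \<le> u"
    by (rule definable_sup[OF dX y0, of z]) (auto simp: X_def)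
  have xs: "x < s" using s(1)[OF y0] y0 unfolding X_def by simp
  have sz: "s \<le> z" by (rule s(2)) (simp add: X_def)
  have below: "R (f x) (f t)" if "x < t" "t < s" for t
  proof -
    have "\<exists>y. X y \<and> t < y" using s(2)[of t] that(2) by force
    thus ?thesis using that(1) unfolding X_def by force
  qed
  obtain d where d: "d > 0" "\<forall>y. s - d < y \<and> y < s --> R (f y) (f s)"
    using loc[of s] xs sz assms unfolding lg_def by (meson less_trans le_less_trans)
  have "max x (s - d) < s" using xs d by simp
  then obtain t where t: "max x (s - d) < t" "t < s" using dense by blast
  have fs: "R (f x) (f s)" using R[OF below[of t]] t d(2) by simp
  have "s = z"
  proof (rule ccontr)
    assume "s \<noteq> z"
    then obtain y where y: "y > s" "y \<le> z" "\<forall>t. s < t \<and> t \<le> y --> R (f s) (f t)" using ext[of s] xs sz assms by force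
    have "R (f x) (f t)" if "x < t" "t \<le> y" for t
      using below[of t] fs y(3) R[OF fs, of "f t"] that by (cases t s rule: linorder_cases) auto
    hence "X y" unfolding X_def using xs y by simp
    thus False using s(1) y(1) by force
  qed
  thus ?thesis using fs by simp
qed

text \<open>On a subinterval either every radius is admissible everywhere, or each point has a
  threshold, the supremum of its admissible radii. Finitely many thresholds have a positive minimum.
  Otherwise the thresholds fill an interval; for \<open>w\<close> inside it infinitely many points
  admit the radius \<open>w\<close>, so by o-minimality these points contain an interval.\<close>

lemma uniform1:
  assumes E: "Dp (\<lambda>e. E (e 0) (e 1))" and mono: "\<And>d d' x. 0 < d' ==> d' \<le> d ==> E d x ==> E d' x"
    and ex: "\<And>x. a < x ==> x < b ==> \<exists>d>0. E d x" and ab: "a < b"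
  obtains d a' b' where "d > 0" "a \<le> a'" "a' < b'" "b' \<le> b" "\<And>x. a' < x ==> x < b' ==> E d x"
proof -
  have E2: "Dp (\<lambda>e. E (g e) (h e))" if "DF g" "DF h" for g h
  proof -
    have "Dp (\<lambda>e. E (if (0::nat) = 0 then g e else h e) (if (1::nat) = 0 then g e else h e))"
    proof (rule Dp_subst[OF E, of "\<lambda>(i::nat) e. if i = 0 then g e else h e"])
      show "DF (\<lambda>e. if i = 0 then g e else h e)" for i :: nat using that by (cases "i = 0") auto
    qed
    thus ?thesis by simp
  qed
  have d1: "Dp (\<lambda>e. \<forall>d>0. E d (e 0))" by (intro dfi E2)
  obtain c d where c: "a \<le> c" "c < d" "d \<le> b" and
    alt: "(\<forall>x. c < x \<and> x < d --> (\<forall>d>0. E d x)) \<or> (\<forall>x. c < x \<and> x < d --> \<not> (\<forall>d>0. E d x))"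
    by (rule dichotomy1[OF d1 ab])
  show thesis
  proof (cases "\<forall>x. c < x \<and> x < d --> (\<forall>d>0. E d x)")
    case True thus ?thesis using c that[of 1 c d] by simp
  next
    case False
    hence nE: "\<And>x. c < x ==> x < d ==> \<exists>d>0. \<not> E d x" using alt by blast
    define V where "V v x \<longleftrightarrow> 0 < v \<and> c < x \<and> x < d \<and> (\<forall>w. 0 < w \<and> w < v --> E w x) \<and> (\<forall>w. w > v --> \<not> E w x)" for v x
    have Vu: "V v x ==> V w x ==> v = w" for v w x
    proof (rule ccontr)
      assume V: "V v x" "V w x" "v \<noteq> w"
      have "min v w < max v w" using V(3) by (cases "v < w") auto
      then obtain u where "min v w < u" "u < max v w" using dense by blast
      thus False using V unfolding V_def by (cases "v < w") (auto simp: min_def max_def split: if_splits)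
    qed
    have Vex: "\<exists>v. V v x" if x: "c < x" "x < d" for x
    proof -
      obtain e0 where e0: "e0 > 0" "\<not> E e0 x" using nE[OF x] by blast
      obtain w0 where w0: "0 < w0" "E w0 x" using ex[of x] x c by force
      have P: "Dp (\<lambda>e. 0 < e 0 \<and> E (e 0) x)" by (intro dfi E2)
      obtain v where v: "\<And>w. 0 < w \<and> E w x ==> w \<le> v" "\<And>u. (\<And>w. 0 < w \<and> E w x ==> w \<le> u) ==> v \<le> u"
      proof (rule definable_sup[OF P, of w0 e0])
        show "w \<le> e0" if "0 < w \<and> E w x" for w using mono[of e0 w x] e0 that by force
      qed (use w0 in auto)
      have "E w x" if "0 < w" "w < v" for w
      proof -
        have "\<exists>w'. 0 < w' \<and> E w' x \<and> w < w'" using v(2)[of w] that by force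
        thus ?thesis using mono[OF that(1)] less_imp_le by blast
      qed
      moreover have "0 < v" using v(1)[of w0] w0 by simp
      moreover have "\<not> E w x" if "w > v" for w using v(1)[of w] that \<open>0 < v\<close> by force
      ultimately show ?thesis unfolding V_def using x by blast
    qed
    have dV: "Dp (\<lambda>e. \<exists>x. V (e 0) x)" unfolding V_def by (intro dfi E2)
    show ?thesis
    proof (cases "finite {v. \<exists>x. V v x}")
      case True
      obtain x0 where "c < x0" "x0 < d" using dense[OF c(2)] by blast
      hence ne: "{v. \<exists>x. V v x} \<noteq> {}" using Vex by blast
      define m where "m = Min {v. \<exists>x. V v x}"
      have "m \<in> {v. \<exists>x. V v x}" unfolding m_def by (rule Min_in[OF True ne])
      hence m0: "m > 0" unfolding V_def by auto
      have "E (m / 2) x" if x: "c < x" "x < d" for x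
      proof -
        obtain v where v: "V v x" using Vex[OF x] by blast
        have "m \<le> v" unfolding m_def by (rule Min_le[OF True]) (use v in auto)
        hence "0 < m / 2" "m / 2 < v" using m0 by auto
        thus ?thesis using v unfolding V_def by blast
      qed
      thus ?thesis using that[of "m/2" c d] m0 c by simp
    next
      case False
      then obtain u v where uv: "u < v" "\<forall>w. u < w \<and> w < v --> (\<exists>x. V w x)"
        using finite_or_interval[OF dV] by (elim disjE) (simp, elim exE conjE)
      hence uv: "u < v" "\<And>w. u < w ==> w < v ==> \<exists>x. V w x" by auto
      obtain w where w: "u < w" "w < v" using dense[OF uv(1)] by blast
      have w0: "w > 0" using uv(2)[OF w] unfolding V_def by blast
      have dW: "Dp (\<lambda>e. c < e 0 \<and> e 0 < d \<and> E w (e 0))" by (intro dfi E2)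
      have "infinite {x. c < x \<and> x < d \<and> E w x}"
      proof
        assume fin: "finite {x. c < x \<and> x < d \<and> E w x}"
        \<comment> \<open>Each point has a single threshold, so an interval of thresholds cannot
          come from finitely many points.\<close>
        have "{w<..<v} \<subseteq> (\<lambda>x. THE v. V v x) ` {x. c < x \<and> x < d \<and> E w x}"
        proof
          fix z assume "z \<in> {w<..<v}"
          hence z: "w < z" "z < v" by auto
          then obtain x where x: "V z x" using uv(2)[of z] w by auto
          have "(THE v. V v x) = z" using x Vu by (intro the_equality) auto
          thus "z \<in> (\<lambda>x. THE v. V v x) ` {x. c < x \<and> x < d \<and> E w x}"
            using x z w0 unfolding V_def by (intro image_eqI[of _ _ x]) auto
        qed
        hence "finite {w<..<v}" by (rule finite_surj[OF fin])
        thus False using infinite_Ioo[OF w(2)] by simp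
      qed
      then obtain p q where pq: "p < q" "\<forall>x. p < x \<and> x < q --> c < x \<and> x < d \<and> E w x"
        using finite_or_interval[OF dW] by (elim disjE) (simp, elim exE conjE)
      hence pq: "p < q" "\<And>x. p < x ==> x < q ==> c < x \<and> x < d \<and> E w x" by auto
      have cp: "c \<le> p"
      proof (rule ccontr)
        assume "\<not> c \<le> p"
        hence "p < min c q" using pq(1) by simp
        then obtain x where "p < x" "x < min c q" using dense by blast
        thus False using pq(2)[of x] by simp
      qed
      have qd: "q \<le> d"
      proof (rule ccontr)
        assume "\<not> q \<le> d"
        hence "max d p < q" using pq(1) by simp
        then obtain x where "max d p < x" "x < q" using dense by blast
        thus False using pq(2)[of x] by simp
      qed
      show ?thesis
      proof (rule that[of w p q, OF w0 _ pq(1)])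
        show "a \<le> p" "q \<le> b" using c cp qd by auto
        show "E w x" if "p < x" "x < q" for x using pq(2)[OF that] by simp
      qed
    qed
  qed
qed

text \<open>With a common radius of strict minimality on an interval, two points closer than this
  radius would each have the smaller value.\<close>

lemma no_strict_local_min:
  assumes f: "DF (\<lambda>e. f (e 0))" and "a < b" shows "\<exists>x. a < x \<and> x < b \<and> \<not> (lg (>) f x \<and> rg (<) f x)"
proof (rule ccontr)
  assume neg: "\<not> ?thesis"
  define E where "E d x \<longleftrightarrow> (\<forall>y. y \<noteq> x \<and> \<bar>y - x\<bar> < d --> f x < f y)" for d x
  have ex: "\<exists>d>0. E d x" if x: "a < x" "x < b" for x
  proof -
    obtain d1 where d1: "d1 > 0" "\<forall>y. x < y \<and> y < x + d1 --> f x < f y" using neg x unfolding rg_def by blast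
    obtain d2 where d2: "d2 > 0" "\<forall>y. x - d2 < y \<and> y < x --> f x < f y" using neg x unfolding lg_def by blast
    have "f x < f y" if "y \<noteq> x" "\<bar>y - x\<bar> < min d1 d2" for y
      using d1(2)[rule_format, of y] d2(2)[rule_format, of y] that by (cases "x < y") auto
    thus ?thesis unfolding E_def using d1(1) d2(1) by (intro exI[of _ "min d1 d2"]) auto
  qed
  have dE: "Dp (\<lambda>e. E (e 0) (e 1))" unfolding E_def by (intro dfi DF_app1[OF f])
  have mE: "\<And>d d' x. 0 < d' ==> d' \<le> d ==> E d x ==> E d' x" unfolding E_def by force
  obtain d a' b' where d: "d > 0" "a \<le> a'" "a' < b'" "b' \<le> b" and E: "\<And>x. a' < x ==> x < b' ==> E d x"
  proof (rule uniform1[OF dE, of a b])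
    show "E d' x" if "0 < d'" "d' \<le> d" "E d x" for d d' x by (rule mE[OF that])
    show "\<exists>d>0. E d x" if "a < x" "x < b" for x by (rule ex[OF that])
    show "a < b" by (rule assms(2))
  qed (rule that)
  obtain x where x: "a' < x" "x < b'" using dense[OF d(3)] by blast
  have "x < min b' (x + d)" using x d by simp
  then obtain y where y: "x < y" "y < min b' (x + d)" using dense by blast
  have "f x < f y" using E[OF x] y unfolding E_def by auto
  moreover have "f y < f x" using E[of y] x y unfolding E_def by auto
  ultimately show False by simp
qed

lemma rg_minus: "rg (<) (\<lambda>x. - f x) x = rg (>) f x" "rg (>) (\<lambda>x. - f x) x = rg (<) f x"
  and lg_minus: "lg (<) (\<lambda>x. - f x) x = lg (>) f x" "lg (>) (\<lambda>x. - f x) x = lg (<) f x"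
  unfolding rg_def lg_def by simp_all

lemma no_strict_local_max:
  assumes f: "DF (\<lambda>e. f (e 0))" and "a < b" shows "\<exists>x. a < x \<and> x < b \<and> \<not> (lg (<) f x \<and> rg (>) f x)"
  using no_strict_local_min[of "\<lambda>x. - f x" a b] assms DF_uminus[OF f] unfolding rg_minus lg_minus by blast

text \<open>Four applications of the dichotomy make the type of the germ constant on the right and
  on the left. Of the nine combinations only the three pure ones survive, and
  \<open>local_to_global\<close> turns them into monotonicity. Only a subinterval is claimed, which
  is what genericity arguments ask for.\<close>

lemma monotone_subinterval:
  assumes f: "DF (\<lambda>e. f (e 0))" and ab: "a < b"
  obtains c d R where "a \<le> c" "c < d" "d \<le> b" "R \<in> {(<), (=), (>)}" "\<And>x y. c < x ==> x < y ==> y < d ==> R (f x) (f y)"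
proof -
  note df = DF_app1[OF f]
  have dr: "Dp (\<lambda>e. rg (<) f (e 0))" "Dp (\<lambda>e. rg (=) f (e 0))" "Dp (\<lambda>e. lg (<) f (e 0))" "Dp (\<lambda>e. lg (=) f (e 0))"
    unfolding rg_def lg_def by (intro dfi df)+
  obtain c1 d1 where 1: "a \<le> c1" "c1 < d1" "d1 \<le> b" "(\<forall>x. c1 < x \<and> x < d1 --> rg (<) f x) \<or> (\<forall>x. c1 < x \<and> x < d1 --> \<not> rg (<) f x)"
    by (rule dichotomy1[OF dr(1) ab])
  obtain c2 d2 where 2: "c1 \<le> c2" "c2 < d2" "d2 \<le> d1" "(\<forall>x. c2 < x \<and> x < d2 --> rg (=) f x) \<or> (\<forall>x. c2 < x \<and> x < d2 --> \<not> rg (=) f x)"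
    by (rule dichotomy1[OF dr(2) 1(2)])
  obtain c3 d3 where 3: "c2 \<le> c3" "c3 < d3" "d3 \<le> d2" "(\<forall>x. c3 < x \<and> x < d3 --> lg (<) f x) \<or> (\<forall>x. c3 < x \<and> x < d3 --> \<not> lg (<) f x)"
    by (rule dichotomy1[OF dr(3) 2(2)])
  obtain c d where 4: "c3 \<le> c" "c < d" "d \<le> d3" "(\<forall>x. c < x \<and> x < d --> lg (=) f x) \<or> (\<forall>x. c < x \<and> x < d --> \<not> lg (=) f x)"
    by (rule dichotomy1[OF dr(4) 3(2)])
  define I where "I = {x. c < x \<and> x < d}"
  have sub: "c1 < x \<and> x < d1" "c2 < x \<and> x < d2" "c3 < x \<and> x < d3" "c < x \<and> x < d" if "x \<in> I" for x
    using that 1(1,3) 2(1,3) 3(1,3) 4(1,3) unfolding I_def by auto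
  have r: "(\<forall>x\<in>I. rg (<) f x) \<or> (\<forall>x\<in>I. rg (=) f x) \<or> (\<forall>x\<in>I. rg (>) f x)"
    using 1(4) 2(4) sub rg_trichotomy[OF f] by meson
  have l: "(\<forall>x\<in>I. lg (<) f x) \<or> (\<forall>x\<in>I. lg (=) f x) \<or> (\<forall>x\<in>I. lg (>) f x)"
    using 3(4) 4(4) sub lg_trichotomy[OF f] by meson
  obtain x0 where x0: "x0 \<in> I" using dense[OF 4(2)] unfolding I_def by blast
  \<comment> \<open>A left germ of type equality at \<open>x0\<close> makes \<open>f\<close>
    constant on an interval, and inside it no right germ can be strict.\<close>
  have leq: "\<forall>x\<in>I. rg (=) f x" if l: "\<forall>x\<in>I. lg (=) f x"
  proof -
    obtain e where e: "e > 0" "\<forall>y. x0 - e < y \<and> y < x0 --> f y = f x0" using l x0 unfolding lg_def by blast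
    have "max c (x0 - e) < x0" using e x0 by (simp add: I_def)
    then obtain y where y: "max c (x0 - e) < y" "y < x0" using dense by blast
    have yI: "y \<in> I" using y x0 by (simp add: I_def)
    { fix d :: 'r assume "d > 0"
      hence "y < min x0 (y + d)" using y by simp
      then obtain z where z: "y < z" "z < min x0 (y + d)" using dense by blast
      hence "f z = f y" using e(2)[rule_format, of y] e(2)[rule_format, of z] y by simp
      hence "\<exists>z. y < z \<and> z < y + d \<and> f z = f y" using z by auto }
    hence "\<not> rg (<) f y" "\<not> rg (>) f y" unfolding rg_def by (metis order_less_irrefl)+
    thus ?thesis using r yI by blast
  qed
  have req: "\<forall>x\<in>I. lg (=) f x" if rr: "\<forall>x\<in>I. rg (=) f x"
  proof -
    obtain e where e: "e > 0" "\<forall>y. x0 < y \<and> y < x0 + e --> f x0 = f y" using rr x0 unfolding rg_def by blast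
    have "x0 < min d (x0 + e)" using e x0 by (simp add: I_def)
    then obtain y where y: "x0 < y" "y < min d (x0 + e)" using dense by blast
    have yI: "y \<in> I" using y x0 by (simp add: I_def)
    { fix d :: 'r assume "d > 0"
      hence "max x0 (y - d) < y" using y by simp
      then obtain z where z: "max x0 (y - d) < z" "z < y" using dense by blast
      hence "f z = f y" using e(2)[rule_format, of y] e(2)[rule_format, of z] y by simp
      hence "\<exists>z. y - d < z \<and> z < y \<and> f z = f y" using z by auto }
    hence "\<not> lg (<) f y" "\<not> lg (>) f y" unfolding lg_def by (metis order_less_irrefl)+
    thus ?thesis using l yI by blast
  qed
  \<comment> \<open>The remaining mixed types would make every point of the interval a strict local
    extremum.\<close>
  have nmin: "\<not> ((\<forall>x\<in>I. lg (>) f x) \<and> (\<forall>x\<in>I. rg (<) f x))" using no_strict_local_min[OF f 4(2)] unfolding I_def by blast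
  have nmax: "\<not> ((\<forall>x\<in>I. lg (<) f x) \<and> (\<forall>x\<in>I. rg (>) f x))" using no_strict_local_max[OF f 4(2)] unfolding I_def by blast
  have key: "(\<forall>x\<in>I. lg (<) f x \<and> rg (<) f x) \<or> (\<forall>x\<in>I. lg (=) f x \<and> rg (=) f x) \<or> (\<forall>x\<in>I. lg (>) f x \<and> rg (>) f x)"
    using r l leq req nmin nmax by blast
  have a: "a \<le> c" "d \<le> b" using 1 2 3 4 by linarith+
  from key show thesis
  proof (elim disjE)
    assume *: "\<forall>x\<in>I. lg (<) f x \<and> rg (<) f x"
    show ?thesis
    proof (rule that[of c d "(<)", OF a(1) 4(2) a(2)])
      fix x y assume xy: "c < x" "x < y" "y < d"
      show "f x < f y" by (rule local_to_global[of "(<)" f c d]) (use xy * in \<open>auto simp: I_def intro!: dfi df\<close>)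
    qed simp
  next
    assume *: "\<forall>x\<in>I. lg (=) f x \<and> rg (=) f x"
    show ?thesis
    proof (rule that[of c d "(=)", OF a(1) 4(2) a(2)])
      fix x y assume xy: "c < x" "x < y" "y < d"
      show "f x = f y" by (rule local_to_global[of "(=)" f c d]) (use xy * in \<open>auto simp: I_def intro!: dfi df\<close>)
    qed simp
  next
    assume *: "\<forall>x\<in>I. lg (>) f x \<and> rg (>) f x"
    show ?thesis
    proof (rule that[of c d "(>)", OF a(1) 4(2) a(2)])
      fix x y assume xy: "c < x" "x < y" "y < d"
      show "f x > f y" by (rule local_to_global[of "(>)" f c d]) (use xy * in \<open>auto simp: I_def intro!: dfi df\<close>)
    qed simp
  qed
qed

text \<open>The image is infinite, hence contains an interval. Between the preimages of two of its
  inner points the function is strictly increasing and takes all intermediate values, which forces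
  continuity.\<close>

lemma increasing_continuous_subinterval:
  assumes f: "DF (\<lambda>e. f (e 0))" and "c < d" "\<And>x y. c < x ==> x < y ==> y < d ==> f x < f y"
  obtains c' d' where "c \<le> c'" "c' < d'" "d' \<le> d" "\<And>x. c' < x ==> x < d' ==> ctd1 f x"
proof -
  have dW: "Dp (\<lambda>e. \<exists>x. c < x \<and> x < d \<and> f x = e 0)" by (intro dfi DF_app1[OF f])
  have inj: "inj_on f {c<..<d}" using assms(3) by (intro inj_onI) (metis greaterThanLessThan_iff linorder_neqE order_less_irrefl)
  have "f ` {c<..<d} = {y. \<exists>x. c < x \<and> x < d \<and> f x = y}" by auto
  hence "infinite {y. \<exists>x. c < x \<and> x < d \<and> f x = y}" using inj infinite_Ioo[OF assms(2)] finite_imageD by metis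
  then obtain u v where uv: "u < v" "\<And>y. u < y ==> y < v ==> \<exists>x. c < x \<and> x < d \<and> f x = y"
    using finite_or_interval[OF dW] by blast
  obtain u' where u': "u < u'" "u' < v" using dense[OF uv(1)] by blast
  obtain v' where v': "u' < v'" "v' < v" using dense[OF u'(2)] by blast
  obtain c' where c': "c < c'" "c' < d" "f c' = u'" using uv(2) u' by blast
  obtain d' where d': "c < d'" "d' < d" "f d' = v'" using uv(2)[of v'] u' v' by force
  have mono: "x < y" if "f x < f y" "c < x" "x < d" "c < y" "y < d" for x y
    using assms(3)[of y x] that by (cases x y rule: linorder_cases) auto
  show thesis
  proof (rule that[of c' d'])
    show "c' < d'" using mono[of c' d'] c' d' v' by simp
    fix x assume x: "c' < x" "x < d'"
    have fx: "u' < f x" "f x < v'" using assms(3)[of c' x] assms(3)[of x d'] x c' d' by auto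
    show "ctd1 f x" unfolding ctd1_def
    proof (intro allI impI)
      fix e :: 'r assume e: "e > 0"
      have "max u' (f x - e) < f x" "f x < min v' (f x + e)" using fx e by auto
      then obtain y1 y2 where y: "max u' (f x - e) < y1" "y1 < f x" "f x < y2" "y2 < min v' (f x + e)" using dense by metis
      obtain x1 where x1: "c < x1" "x1 < d" "f x1 = y1" using uv(2)[of y1] y u' fx v' by force
      obtain x2 where x2: "c < x2" "x2 < d" "f x2 = y2" using uv(2)[of y2] y u' fx v' by force
      have lt: "x1 < x" "x < x2" using mono[of x1 x] mono[of x x2] x1 x2 y x c' d' by auto
      show "\<exists>d>0. \<forall>y. \<bar>y - x\<bar> < d --> \<bar>f y - f x\<bar> < e"
      proof (intro exI[of _ "min (x - x1) (x2 - x)"] conjI allI impI)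
        fix z assume "\<bar>z - x\<bar> < min (x - x1) (x2 - x)"
        hence z: "x1 < z" "z < x2" by (auto simp: abs_less_iff)
        have "f x1 < f z" "f z < f x2" using assms(3) z x1 x2 by auto
        thus "\<bar>f z - f x\<bar> < e" using x1 x2 y by (auto simp: abs_less_iff)
      qed (use lt in simp)
    qed
  qed (use c' d' in auto)
qed

lemma ctd1_minus: "ctd1 (\<lambda>x. - f x) x = ctd1 f x"
proof -
  have "\<bar>- f y - - f x\<bar> = \<bar>f y - f x\<bar>" for y using abs_minus_commute[of "f x" "f y"] by simp
  thus ?thesis unfolding ctd1_def by simp
qed

lemma monotone_continuous_subinterval:
  assumes f: "DF (\<lambda>e. f (e 0))" and ab: "a < b"
  obtains c d R where "a \<le> c" "c < d" "d \<le> b" "R \<in> {(<), (=), (>)}" "\<And>x y. c < x ==> x < y ==> y < d ==> R (f x) (f y)"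
    "\<And>x. c < x ==> x < d ==> ctd1 f x"
proof -
  obtain c d R where 1: "a \<le> c" "c < d" "d \<le> b" "R \<in> {(<), (=), (>)}" "\<And>x y. c < x ==> x < y ==> y < d ==> R (f x) (f y)"
    by (rule monotone_subinterval[OF assms]) (rule that)
  have "\<exists>c' d'. c \<le> c' \<and> c' < d' \<and> d' \<le> d \<and> (\<forall>x. c' < x \<and> x < d' --> ctd1 f x)"
  proof -
    from 1(4) consider "R = (<)" | "R = (=)" | "R = (>)" by blast
    thus ?thesis
    proof cases
      case R: 1
      obtain c' d' where *: "c \<le> c'" "c' < d'" "d' \<le> d" "\<And>x. c' < x ==> x < d' ==> ctd1 f x"
        by (rule increasing_continuous_subinterval[OF f \<open>c < d\<close>]) (use 1(5) R in auto)
      thus ?thesis by (intro exI[of _ c'] exI[of _ d']) auto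
    next
      case 2
      have eq: "f x = f y" if "c < x" "x < d" "c < y" "y < d" for x y
        using 1(5)[of x y] 1(5)[of y x] 2 that by (cases x y rule: linorder_cases) auto
      have "ctd1 f x" if x: "c < x" "x < d" for x unfolding ctd1_def
      proof (intro allI impI exI[of _ "min (x - c) (d - x)"] conjI)
        fix e y :: 'r assume "0 < e" "\<bar>y - x\<bar> < min (x - c) (d - x)"
        hence "f y = f x" using eq[of y x] x by (auto simp: abs_less_iff)
        thus "\<bar>f y - f x\<bar> < e" using \<open>0 < e\<close> by simp
      qed (use x in simp)
      thus ?thesis using \<open>c < d\<close> by (intro exI[of _ c] exI[of _ d]) auto
    next
      case 3
      obtain c' d' where *: "c \<le> c'" "c' < d'" "d' \<le> d" "\<And>x. c' < x ==> x < d' ==> ctd1 (\<lambda>x. - f x) x"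
      proof (rule increasing_continuous_subinterval[of "\<lambda>x. - f x" c d])
        show "- f x < - f y" if "c < x" "x < y" "y < d" for x y using 1(5)[OF that] 3 by simp
      qed (use \<open>c < d\<close> DF_uminus[OF f] that in auto)
      thus ?thesis unfolding ctd1_minus by (intro exI[of _ c'] exI[of _ d']) auto
    qed
  qed
  then obtain c' d' where c': "c \<le> c'" "c' < d'" "d' \<le> d" "\<And>x. c' < x ==> x < d' ==> ctd1 f x" by blast
  show thesis by (rule that[of c' d' R]) (use 1 c' in auto)
qed

lemma ctd1D: "ctd1 f x ==> e > 0 ==> \<exists>d>0. \<forall>y. \<bar>y - x\<bar> < d --> \<bar>f y - f x\<bar> < e"
  unfolding ctd1_def by blast

text \<open>Monotonicity from right germs and continuity, the basis of the mean value estimates. The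
  supremum argument starts at an inner point \<open>v\<close>, since nothing is assumed about the
  germ at \<open>x\<close>; continuity at \<open>x\<close> then allows \<open>v\<close> to be taken
  close to \<open>x\<close>.\<close>

lemma right_increasing_le:
  assumes f: "DF (\<lambda>e. f (e 0))" and "x < z" and ct: "\<And>w. x \<le> w ==> w \<le> z ==> ctd1 f w"
    and rg: "\<And>w. x < w ==> w < z ==> rg (\<le>) f w"
  shows "f x \<le> f z"
proof -
  have *: "f v \<le> f z" if v: "x < v" "v < z" for v
  proof -
    define X where "X y \<longleftrightarrow> v \<le> y \<and> y \<le> z \<and> (\<forall>t. v \<le> t \<and> t \<le> y --> f v \<le> f t)" for y
    have dX: "Dp (\<lambda>e. X (e 0))" unfolding X_def by (intro dfi DF_app1[OF f])
    have Xv: "X v" unfolding X_def using v by auto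
    obtain s where s: "\<And>y. X y ==> y \<le> s" "\<And>u. (\<And>y. X y ==> y \<le> u) ==> s \<le> u"
      by (rule definable_sup[OF dX Xv, of z]) (auto simp: X_def)
    have vs: "v \<le> s" using s(1)[OF Xv] .
    have sz: "s \<le> z" by (rule s(2)) (simp add: X_def)
    have below: "f v \<le> f t" if "v \<le> t" "t < s" for t
    proof -
      have "\<exists>y. X y \<and> t < y" using s(2)[of t] that(2) by force
      thus ?thesis using that(1) unfolding X_def by force
    qed
    have fs: "f v \<le> f s"
    proof (cases "v = s")
      case False
      show ?thesis
      proof (rule ccontr)
        assume "\<not> f v \<le> f s"
        hence "f v - f s > 0" by simp
        then obtain d where d: "d > 0" "\<forall>y. \<bar>y - s\<bar> < d --> \<bar>f y - f s\<bar> < f v - f s"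
          using ctd1D[OF ct[of s]] vs v sz by (metis less_imp_le order_trans)
        have "max v (s - d) < s" using False vs d by simp
        then obtain t where t: "max v (s - d) < t" "t < s" using dense by blast
        have "\<bar>f t - f s\<bar> < f v - f s" using d(2)[rule_format, of t] t by (simp add: abs_less_iff)
        thus False using below[of t] t by simp
      qed
    qed simp
    have "s = z"
    proof (rule ccontr)
      assume "s \<noteq> z"
      hence "s < z" using sz by simp
      then obtain d where d: "d > 0" "\<forall>y. s < y \<and> y < s + d --> f s \<le> f y" using rg[of s] vs v unfolding rg_def by force
      have "s < min z (s + d)" using \<open>s < z\<close> d by simp
      then obtain y where y: "s < y" "y < min z (s + d)" using dense by blast
      have "f v \<le> f t" if "v \<le> t" "t \<le> y" for t
      proof (cases t s rule: linorder_cases)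
        case greater thus ?thesis using d(2)[rule_format, of t] that y fs by simp
      qed (use below that fs in auto)
      hence "X y" unfolding X_def using vs y by simp
      thus False using s(1) y(1) by force
    qed
    thus ?thesis using fs by simp
  qed
  show ?thesis
  proof (rule ccontr)
    assume "\<not> f x \<le> f z"
    hence "f x - f z > 0" by simp
    then obtain d where d: "d > 0" "\<forall>y. \<bar>y - x\<bar> < d --> \<bar>f y - f x\<bar> < f x - f z"
      using ctd1D[OF ct[of x], of "f x - f z"] \<open>x < z\<close> by auto
    have "x < min z (x + d)" using \<open>x < z\<close> d by simp
    then obtain v where v: "x < v" "v < min z (x + d)" using dense by blast
    have "\<bar>f v - f x\<bar> < f x - f z" using d(2) v by auto
    thus False using *[of v] v by simp
  qed
qed

section \<open>Derivatives and mean value inequalities in one variable\<close>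

lemma dv1_ctd1: assumes "dv1 f x D" shows "ctd1 f x" unfolding ctd1_def
proof (intro allI impI)
  fix e :: 'r assume e: "e > 0"
  obtain d where d: "d > 0" "\<forall>y. \<bar>y - x\<bar> < d --> \<bar>f y - f x - D * (y - x)\<bar> \<le> 1 * \<bar>y - x\<bar>"
    using assms unfolding dv1_def by (metis zero_less_one)
  have D: "1 + \<bar>D\<bar> > 0" by (simp add: add_pos_nonneg)
  show "\<exists>d>0. \<forall>y. \<bar>y - x\<bar> < d --> \<bar>f y - f x\<bar> < e"
  proof (intro exI[of _ "min d (e / (1 + \<bar>D\<bar>))"] conjI allI impI)
    fix y assume y: "\<bar>y - x\<bar> < min d (e / (1 + \<bar>D\<bar>))"
    have "\<bar>f y - f x\<bar> \<le> \<bar>f y - f x - D * (y - x)\<bar> + \<bar>D * (y - x)\<bar>" by linarith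
    also have "\<dots> \<le> 1 * \<bar>y - x\<bar> + \<bar>D\<bar> * \<bar>y - x\<bar>" using d(2) y unfolding abs_mult by (intro add_mono) auto
    also have "\<dots> = (1 + \<bar>D\<bar>) * \<bar>y - x\<bar>" by (simp add: algebra_simps)
    also have "\<dots> < e" using y D by (simp add: field_simps)
    finally show "\<bar>f y - f x\<bar> < e" .
  qed (use d e D in simp)
qed

lemma dv1_unique: assumes "dv1 f x D" "dv1 f x D'" shows "D = D'"
proof (rule ccontr)
  assume "D \<noteq> D'"
  hence e: "\<bar>D - D'\<bar> / 3 > 0" by simp
  obtain d where d: "d > 0" "\<forall>y. \<bar>y - x\<bar> < d --> \<bar>f y - f x - D * (y - x)\<bar> \<le> \<bar>D - D'\<bar> / 3 * \<bar>y - x\<bar>"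
    using assms(1) e unfolding dv1_def by blast
  obtain d' where d': "d' > 0" "\<forall>y. \<bar>y - x\<bar> < d' --> \<bar>f y - f x - D' * (y - x)\<bar> \<le> \<bar>D - D'\<bar> / 3 * \<bar>y - x\<bar>"
    using assms(2) e unfolding dv1_def by blast
  define h where "h = min d d' / 2"
  have h: "h > 0" "h < d" "h < d'" using d d' unfolding h_def by (auto simp: min_def)
  have 1: "\<bar>f (x + h) - f x - D * h\<bar> \<le> \<bar>D - D'\<bar> / 3 * h" using d(2)[rule_format, of "x + h"] h by simp
  have 2: "\<bar>f (x + h) - f x - D' * h\<bar> \<le> \<bar>D - D'\<bar> / 3 * h" using d'(2)[rule_format, of "x + h"] h by simp
  have "\<bar>D - D'\<bar> * h = \<bar>D * h - D' * h\<bar>" using h(1) by (simp add: abs_mult flip: left_diff_distrib)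
  also have "\<dots> \<le> 2 * (\<bar>D - D'\<bar> / 3 * h)" using 1 2 by linarith
  finally have "\<bar>D - D'\<bar> * h \<le> (2 / 3) * (\<bar>D - D'\<bar> * h)" by simp
  moreover have "\<bar>D - D'\<bar> * h > 0" using h e by simp
  ultimately show False by linarith
qed

lemma dv1_lin: assumes "dv1 f x D" shows "dv1 (\<lambda>y. c * y - f y) x (c - D)"
proof -
  have "\<bar>c * y - f y - (c * x - f x) - (c - D) * (y - x)\<bar> = \<bar>f y - f x - D * (y - x)\<bar>" for y
    by (subst abs_minus_commute[symmetric]) (simp add: algebra_simps)
  thus ?thesis using assms unfolding dv1_def by simp
qed

lemma dv1_pos_rg: assumes "dv1 f x D" "D > 0" shows "rg (\<le>) f x"
proof -
  obtain d where d: "d > 0" "\<forall>y. \<bar>y - x\<bar> < d --> \<bar>f y - f x - D * (y - x)\<bar> \<le> D * \<bar>y - x\<bar>"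
    using assms unfolding dv1_def by blast
  have "f x \<le> f y" if "x < y" "y < x + d" for y
  proof -
    have "\<bar>f y - f x - D * (y - x)\<bar> \<le> D * (y - x)" using d(2)[rule_format, of y] that by simp
    thus ?thesis by linarith
  qed
  thus ?thesis unfolding rg_def using d(1) by blast
qed

lemma ctd1_lin: assumes "ctd1 f x" shows "ctd1 (\<lambda>y. c * y - f y) x" unfolding ctd1_def
proof (intro allI impI)
  fix e :: 'r assume e: "e > 0"
  hence "e / 2 > 0" by simp
  from ctd1D[OF assms this] obtain d where d: "d > 0" "\<forall>y. \<bar>y - x\<bar> < d --> \<bar>f y - f x\<bar> < e / 2" by blast
  have c: "2 * (1 + \<bar>c\<bar>) > 0" by (simp add: add_pos_nonneg)
  show "\<exists>d>0. \<forall>y. \<bar>y - x\<bar> < d --> \<bar>c * y - f y - (c * x - f x)\<bar> < e"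
  proof (intro exI[of _ "min d (e / (2 * (1 + \<bar>c\<bar>)))"] conjI allI impI)
    fix y assume y: "\<bar>y - x\<bar> < min d (e / (2 * (1 + \<bar>c\<bar>)))"
    have "\<bar>c * y - f y - (c * x - f x)\<bar> \<le> \<bar>f y - f x\<bar> + \<bar>c * (y - x)\<bar>" by (simp add: algebra_simps)
    moreover have "\<bar>c * (y - x)\<bar> \<le> (1 + \<bar>c\<bar>) * \<bar>y - x\<bar>" unfolding abs_mult by (intro mult_right_mono) auto
    moreover have "(1 + \<bar>c\<bar>) * \<bar>y - x\<bar> < e / 2" using y c by (simp add: field_simps)
    moreover have "\<bar>f y - f x\<bar> < e / 2" using d(2) y by simp
    ultimately show "\<bar>c * y - f y - (c * x - f x)\<bar> < e" by linarith
  qed (use d e c in simp)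
qed

text \<open>For \<open>c > C\<close> the function \<open>c * y - f y\<close> has a positive
  derivative, so its right germs are weakly increasing and \<open>right_increasing_le\<close>
  applies. The estimate for \<open>C\<close> itself follows because \<open>c\<close> may be taken
  arbitrarily close to \<open>C\<close>.\<close>

lemma mvt_le:
  assumes f: "DF (\<lambda>e. f (e 0))" and xz: "x < z" and ct: "\<And>w. x \<le> w ==> w \<le> z ==> ctd1 f w"
    and dv: "\<And>w. x < w ==> w < z ==> \<exists>D. dv1 f w D \<and> D \<le> C"
  shows "f z - f x \<le> C * (z - x)"
proof -
  have *: "f z - f x \<le> c * (z - x)" if c: "c > C" for c
  proof -
    have "c * x - f x \<le> c * z - f z"
    proof (rule right_increasing_le[of "\<lambda>y. c * y - f y"])
      show "DF (\<lambda>e. c * e 0 - f (e 0))" by (intro dfi f)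
      show "rg (\<le>) (\<lambda>y. c * y - f y) w" if w: "x < w" "w < z" for w
      proof -
        obtain D where D: "dv1 f w D" "D \<le> C" using dv[OF w] by blast
        show ?thesis by (rule dv1_pos_rg[OF dv1_lin[OF D(1)]]) (use D c in simp)
      qed
    qed (use xz ct ctd1_lin in auto)
    thus ?thesis by (simp add: algebra_simps)
  qed
  show ?thesis
  proof (rule ccontr)
    assume neg: "\<not> ?thesis"
    \<comment> \<open>If the estimate failed, this difference quotient would exceed
      \<open>C\<close>; a slope strictly between the two contradicts the case already
      settled.\<close>
    define g where "g = (f z - f x) / (z - x)"
    have "g > C" using neg xz unfolding g_def by (simp add: field_simps)
    then obtain c where c: "C < c" "c < g" using dense by blast
    have "f z - f x = g * (z - x)" using xz unfolding g_def by simp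
    hence "g * (z - x) \<le> c * (z - x)" using *[OF c(1)] by simp
    thus False using c(2) xz by simp
  qed
qed

lemma mvt_ge:
  assumes f: "DF (\<lambda>e. f (e 0))" and xz: "x < z" and ct: "\<And>w. x \<le> w ==> w \<le> z ==> ctd1 f w"
    and dv: "\<And>w. x < w ==> w < z ==> \<exists>D. dv1 f w D \<and> C \<le> D"
  shows "C * (z - x) \<le> f z - f x"
proof -
  have "(0 * z - f z) - (0 * x - f x) \<le> (- C) * (z - x)"
  proof (rule mvt_le[of "\<lambda>y. 0 * y - f y"])
    show "DF (\<lambda>e. 0 * e 0 - f (e 0))" by (intro dfi f)
    show "\<exists>D. dv1 (\<lambda>y. 0 * y - f y) w D \<and> D \<le> - C" if w: "x < w" "w < z" for w
    proof -
      obtain D where D: "dv1 f w D" "C \<le> D" using dv[OF w] by blast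
      thus ?thesis using dv1_lin[OF D(1), of 0] by (intro exI[of _ "0 - D"]) auto
    qed
    show "ctd1 (\<lambda>y. 0 * y - f y) w" if "x \<le> w" "w \<le> z" for w by (rule ctd1_lin[OF ct[OF that]])
  qed (rule xz)
  thus ?thesis by simp
qed

lemma mvt_abs:
  assumes f: "DF (\<lambda>e. f (e 0))" and xz: "x < z" and ct: "\<And>w. x \<le> w ==> w \<le> z ==> ctd1 f w"
    and dv: "\<And>w. x < w ==> w < z ==> \<exists>D. dv1 f w D \<and> \<bar>D - L\<bar> \<le> C"
  shows "\<bar>f z - f x - L * (z - x)\<bar> \<le> C * (z - x)"
proof -
  have "f z - f x \<le> (L + C) * (z - x)"
  proof (rule mvt_le[OF f xz ct])
    show "\<exists>D. dv1 f w D \<and> D \<le> L + C" if "x < w" "w < z" for w using dv[OF that] by (force simp: abs_le_iff)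
  qed
  moreover have "(L - C) * (z - x) \<le> f z - f x"
  proof (rule mvt_ge[OF f xz ct])
    show "\<exists>D. dv1 f w D \<and> L - C \<le> D" if "x < w" "w < z" for w using dv[OF that] by (force simp: abs_le_iff)
  qed
  ultimately show ?thesis by (simp add: abs_le_iff algebra_simps)
qed

text \<open>\<open>slope f x v\<close> says that \<open>v\<close> is the right derivative of \<open>f\<close> at \<open>x\<close>, expressed as a Dedekind cut.\<close>

definition rs :: "('r \<Rightarrow> 'r) \<Rightarrow> 'r \<Rightarrow> 'r \<Rightarrow> bool" where
  "rs f x c \<longleftrightarrow> (\<exists>d>0. \<forall>y. x < y \<and> y < x + d --> c * (y - x) < f y - f x)"

lemma rs_rg: "rs f x c \<longleftrightarrow> rg (<) (\<lambda>y. f y - c * y) x"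
proof -
  have "c * (y - x) < f y - f x \<longleftrightarrow> f x - c * x < f y - c * y" for y by (simp add: algebra_simps)
  thus ?thesis unfolding rs_def rg_def by simp
qed

lemma rs_down: assumes "rs f x c" "c' \<le> c" shows "rs f x c'"
proof -
  obtain d where d: "d > 0" "\<forall>y. x < y \<and> y < x + d --> c * (y - x) < f y - f x" using assms(1) unfolding rs_def by blast
  have "c' * (y - x) < f y - f x" if "x < y" "y < x + d" for y
  proof -
    have "c' * (y - x) \<le> c * (y - x)" using assms(2) that by (simp add: mult_right_mono)
    also have "\<dots> < f y - f x" using d(2) that by blast
    finally show ?thesis .
  qed
  thus ?thesis unfolding rs_def using d(1) by blast
qed

text \<open>The germ of \<open>f y - c * y\<close> at \<open>x\<close> has one of three types. If it
  is not increasing, then \<open>f\<close> grows to the right at most with slope \<open>c\<close>,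
  hence strictly less than with slope \<open>c'\<close>.\<close>

lemma not_rs: assumes f: "DF (\<lambda>e. f (e 0))" and "\<not> rs f x c" "c < c'"
  shows "\<exists>d>0. \<forall>y. x < y \<and> y < x + d --> f y - f x < c' * (y - x)"
proof -
  have "DF (\<lambda>e. f (e 0) - c * e 0)" by (intro dfi f)
  from rg_trichotomy[OF this, of x] assms(2)
  have "rg (=) (\<lambda>y. f y - c * y) x \<or> rg (>) (\<lambda>y. f y - c * y) x" unfolding rs_rg by blast
  then obtain d where d: "d > 0" "\<forall>y. x < y \<and> y < x + d --> f y - c * y \<le> f x - c * x"
    unfolding rg_def by (metis order_less_imp_le order_refl)
  have "f y - f x < c' * (y - x)" if "x < y" "y < x + d" for y
  proof -
    have "c * (y - x) < c' * (y - x)" using assms(3) that by simp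
    thus ?thesis using d(2)[rule_format, of y] that by (simp add: algebra_simps)
  qed
  thus ?thesis using d(1) by blast
qed

text \<open>Excludes the right derivative plus infinity on a whole interval. If every slope were
  admissible at every point, \<open>f y - C * y\<close> would be weakly increasing for a constant
  \<open>C\<close> that exceeds a difference quotient of \<open>f\<close> by 1.\<close>

lemma rs_not_all:
  assumes f: "DF (\<lambda>e. f (e 0))" and ab: "a < b" and ct: "\<And>x. a < x ==> x < b ==> ctd1 f x"
  shows "\<exists>x. a < x \<and> x < b \<and> (\<exists>c. \<not> rs f x c)"
proof (rule ccontr)
  assume neg: "\<not> ?thesis"
  obtain x where x: "a < x" "x < b" using dense[OF ab] by blast
  obtain z where z: "x < z" "z < b" using dense[OF x(2)] by blast
  define C where "C = (f z - f x) / (z - x) + 1"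
  have "C * x - f x \<ge> C * z - f z"
  proof -
    have "- (C * x - f x) \<le> - (C * z - f z)"
    proof (rule right_increasing_le[of "\<lambda>y. - (C * y - f y)" x z])
      show "DF (\<lambda>e. - (C * e 0 - f (e 0)))" by (intro dfi f)
      show "rg (\<le>) (\<lambda>y. - (C * y - f y)) w" if "x < w" "w < z" for w
      proof -
        have "rs f w C" using neg x z that by auto
        thus ?thesis unfolding rs_def rg_def by (auto simp: algebra_simps) (metis less_imp_le)
      qed
      show "ctd1 (\<lambda>y. - (C * y - f y)) w" if "x \<le> w" "w \<le> z" for w
        unfolding ctd1_minus by (rule ctd1_lin[OF ct]) (use that x z in auto)
    qed (use z in simp)
    thus ?thesis by simp
  qed
  hence "C * (z - x) \<le> f z - f x" by (simp add: algebra_simps)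
  moreover have "C * (z - x) = (f z - f x) + (z - x)" using z unfolding C_def by (simp add: field_simps)
  ultimately show False using z by simp
qed

definition slope :: "('r \<Rightarrow> 'r) \<Rightarrow> 'r \<Rightarrow> 'r \<Rightarrow> bool" where
  "slope f x v \<longleftrightarrow> (\<forall>c<v. rs f x c) \<and> (\<forall>c>v. \<not> rs f x c)"

text \<open>The admissible slopes at \<open>x\<close> are closed downwards, so their supremum is a
  right derivative unless all slopes or none are admissible. By the dichotomy each exception holds
  throughout or nowhere on a subinterval; holding throughout is refuted by
  \<open>rs_not_all\<close>, applied to \<open>f\<close> or to its negative.\<close>

lemma slope_exists_subinterval:
  assumes f: "DF (\<lambda>e. f (e 0))" and ab: "a < b"
  shows "\<exists>c d. a \<le> c \<and> c < d \<and> d \<le> b \<and> (\<forall>x. c < x \<and> x < d --> (\<exists>v. slope f x v))"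
proof -
  note df = DF_app1[OF f]
  obtain a1 b1 R where 1: "a \<le> a1" "a1 < b1" "b1 \<le> b" and R: "R \<in> {(<), (=), (>)}" "\<And>x y. a1 < x ==> x < y ==> y < b1 ==> R (f x) (f y)"
    and ct: "\<And>x. a1 < x ==> x < b1 ==> ctd1 f x"
    by (rule monotone_continuous_subinterval[OF assms]) (rule that)
  have d1: "Dp (\<lambda>e. \<forall>c. rs f (e 0) c)" and d2: "Dp (\<lambda>e. \<forall>c. \<not> rs f (e 0) c)" unfolding rs_def by (intro dfi df)+
  obtain a2 b2 where 2: "a1 \<le> a2" "a2 < b2" "b2 \<le> b1" "(\<forall>x. a2 < x \<and> x < b2 --> (\<forall>c. rs f x c)) \<or> (\<forall>x. a2 < x \<and> x < b2 --> \<not> (\<forall>c. rs f x c))"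
    by (rule dichotomy1[OF d1 1(2)])
  have 22: "\<forall>x. a2 < x \<and> x < b2 --> \<not> (\<forall>c. rs f x c)"
  proof (rule ccontr)
    assume "\<not> ?thesis"
    hence *: "\<forall>x. a2 < x \<and> x < b2 --> (\<forall>c. rs f x c)" using 2(4) by blast
    have "ctd1 f x" if "a2 < x" "x < b2" for x using ct[of x] that 2 by auto
    from rs_not_all[OF f 2(2) this] show False using * by blast
  qed
  obtain a3 b3 where 3: "a2 \<le> a3" "a3 < b3" "b3 \<le> b2" "(\<forall>x. a3 < x \<and> x < b3 --> (\<forall>c. \<not> rs f x c)) \<or> (\<forall>x. a3 < x \<and> x < b3 --> \<not> (\<forall>c. \<not> rs f x c))"
    by (rule dichotomy1[OF d2 2(2)])
  have 33: "\<forall>x. a3 < x \<and> x < b3 --> \<not> (\<forall>c. \<not> rs f x c)"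
  proof (rule ccontr)
    assume "\<not> ?thesis"
    hence *: "\<forall>x. a3 < x \<and> x < b3 --> (\<forall>c. \<not> rs f x c)" using 3(4) by blast
    have "ctd1 (\<lambda>x. - f x) x" if "a3 < x" "x < b3" for x using ct[of x] that 2 3 by (auto simp: ctd1_minus)
    from rs_not_all[OF DF_uminus[OF f] 3(2) this] obtain x c where x: "a3 < x" "x < b3" "\<not> rs (\<lambda>x. - f x) x c" by blast
    have "\<not> rs f x (- c - 1)" using * x by blast
    from not_rs[OF f this, of "- c"] have "rs (\<lambda>x. - f x) x c" unfolding rs_def by (auto simp: algebra_simps)
    thus False using x(3) by simp
  qed
  have "\<exists>v. slope f x v" if x: "a3 < x" "x < b3" for x
  proof -
    obtain c0 where c0: "rs f x c0" using 33 x by blast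
    obtain c1 where c1: "\<not> rs f x c1" using 22 x 3 by force
    have dP: "Dp (\<lambda>e. rs f x (e 0))" unfolding rs_def by (intro dfi df)
    obtain v where v: "\<And>c. rs f x c ==> c \<le> v" "\<And>u. (\<And>c. rs f x c ==> c \<le> u) ==> v \<le> u"
    proof (rule definable_sup[OF dP c0, of c1])
      show "c \<le> c1" if "rs f x c" for c using rs_down[OF that, of c1] c1 by force
    qed (rule that; blast)
    have "rs f x c" if "c < v" for c
    proof -
      have "\<exists>c'. rs f x c' \<and> c < c'" using v(2)[of c] that by force
      thus ?thesis using rs_down by (meson less_imp_le)
    qed
    moreover have "\<not> rs f x c" if "c > v" for c using v(1)[of c] that by force
    ultimately show ?thesis unfolding slope_def by blast
  qed
  moreover have "a \<le> a3" "b3 \<le> b" using 1 2 3 by auto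
  ultimately show ?thesis using 3(2) by blast
qed

lemma slope_right: assumes f: "DF (\<lambda>e. f (e 0))" and s: "slope f x v" and e: "e > 0"
  shows "\<exists>d>0. \<forall>y. x < y \<and> y < x + d --> \<bar>f y - f x - v * (y - x)\<bar> \<le> e * (y - x)"
proof -
  have "rs f x (v - e)" using s e unfolding slope_def by simp
  then obtain d1 where d1: "d1 > 0" "\<forall>y. x < y \<and> y < x + d1 --> (v - e) * (y - x) < f y - f x" unfolding rs_def by blast
  have "\<not> rs f x (v + e / 2)" using s e unfolding slope_def by simp
  from not_rs[OF f this, of "v + e"] e obtain d2 where d2: "d2 > 0" "\<forall>y. x < y \<and> y < x + d2 --> f y - f x < (v + e) * (y - x)" by auto
  show ?thesis
  proof (intro exI[of _ "min d1 d2"] conjI allI impI)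
    fix y assume "x < y \<and> y < x + min d1 d2"
    hence "(v - e) * (y - x) < f y - f x" "f y - f x < (v + e) * (y - x)" using d1 d2 by auto
    thus "\<bar>f y - f x - v * (y - x)\<bar> \<le> e * (y - x)" by (simp add: abs_le_iff algebra_simps)
  qed (use d1 d2 in simp)
qed

text \<open>The point reflection \<open>y \<mapsto> - f (- y)\<close> preserves slopes and exchanges
  the sides, so its right derivative at \<open>- x\<close> is the left derivative of
  \<open>f\<close> at \<open>x\<close>.\<close>

lemma slopes_dv1:
  assumes f: "DF (\<lambda>e. f (e 0))" and "slope f x v" "slope (\<lambda>y. - f (- y)) (- x) v"
  shows "dv1 f x v" unfolding dv1_def
proof (intro allI impI)
  fix e :: 'r assume e: "e > 0"
  have f': "DF (\<lambda>e. - f (- e 0))" by (intro dfi DF_app1[OF f])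
  obtain d1 where d1: "d1 > 0" "\<forall>y. x < y \<and> y < x + d1 --> \<bar>f y - f x - v * (y - x)\<bar> \<le> e * (y - x)"
    using slope_right[OF f assms(2) e] by blast
  obtain d2 where d2: "d2 > 0" "\<forall>y. - x < y \<and> y < - x + d2 --> \<bar>- f (- y) - - f (- (- x)) - v * (y - - x)\<bar> \<le> e * (y - - x)"
    using slope_right[OF f' assms(3) e] by blast
  show "\<exists>d>0. \<forall>y. \<bar>y - x\<bar> < d --> \<bar>f y - f x - v * (y - x)\<bar> \<le> e * \<bar>y - x\<bar>"
  proof (intro exI[of _ "min d1 d2"] conjI allI impI)
    fix y assume y: "\<bar>y - x\<bar> < min d1 d2"
    show "\<bar>f y - f x - v * (y - x)\<bar> \<le> e * \<bar>y - x\<bar>"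
    proof (cases y x rule: linorder_cases)
      case greater thus ?thesis using d1(2)[rule_format, of y] y by auto
    next
      case less
      have "\<bar>- f y + f x - v * (x - y)\<bar> \<le> e * (x - y)" using d2(2)[rule_format, of "- y"] less y by (auto simp: algebra_simps)
      moreover have "- f y + f x - v * (x - y) = - (f y - f x - v * (y - x))" by (simp add: algebra_simps)
      ultimately have "\<bar>f y - f x - v * (y - x)\<bar> \<le> e * (x - y)" by (metis abs_minus_cancel)
      thus ?thesis using less by simp
    qed simp
  qed (use d1 d2 in simp)
qed

text \<open>Right and left derivatives exist and are continuous on a common subinterval. If they
  differed at \<open>x\<close>, a slope \<open>c\<close> strictly between them would by continuity
  stay between them near \<open>x\<close>, and \<open>f y - c * y\<close> would have a strict local
  extremum at every nearby point.\<close>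

lemma differentiable_subinterval:
  assumes f: "DF (\<lambda>e. f (e 0))" and ab: "a < b"
  shows "\<exists>c d. a \<le> c \<and> c < d \<and> d \<le> b \<and> (\<forall>x. c < x \<and> x < d --> (\<exists>D. dv1 f x D))"
proof -
  note df = DF_app1[OF f]
  define g where "g y = - f (- y)" for y
  have g: "DF (\<lambda>e. g (e 0))" unfolding g_def by (intro dfi df)
  note dg = DF_app1[OF g]
  obtain a1 b1 where 1: "a \<le> a1" "a1 < b1" "b1 \<le> b" "\<forall>x. a1 < x \<and> x < b1 --> (\<exists>v. slope f x v)"
    using slope_exists_subinterval[OF f ab] by blast
  obtain a2 b2 where 2: "- b1 \<le> a2" "a2 < b2" "b2 \<le> - a1" "\<forall>x. a2 < x \<and> x < b2 --> (\<exists>v. slope g x v)"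
    using slope_exists_subinterval[OF g, of "- b1" "- a1"] 1(2) by auto
  \<comment> \<open>The one-sided derivatives are selected by a definable function, so that the
    monotonicity theorem makes them continuous on a subinterval.\<close>
  have choose: "\<exists>r. DF (\<lambda>e. r (e 0)) \<and> (\<forall>x v. slope h x v --> slope h x (r x))" if h: "DF (\<lambda>e. h (e 0))" for h
  proof -
    have "Dp (\<lambda>e. slope h (e (Suc 0)) (e 0))" unfolding slope_def rs_def by (intro dfi DF_app1[OF h])
    then obtain F where F: "DF F" "\<And>e v. slope h (e 0) v ==> slope h (e 0) (F e)"
      by (rule definable_choice1[of "\<lambda>v e. slope h (e 0) v"]) (rule that)
    show ?thesis using F(2) by (intro exI[of _ "\<lambda>x. F (\<lambda>i. x)"] conjI DF_subst[OF F(1)] DF_var) auto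
  qed
  obtain r where r: "DF (\<lambda>e. r (e 0))" "\<forall>x v. slope f x v --> slope f x (r x)" using choose[OF f] by blast
  obtain l' where l': "DF (\<lambda>e. l' (e 0))" "\<forall>x v. slope g x v --> slope g x (l' x)" using choose[OF g] by blast
  define l where "l x = l' (- x)" for x
  have l: "DF (\<lambda>e. l (e 0))" unfolding l_def by (intro dfi DF_app1[OF l'(1)])
  obtain a3 b3 R where 3: "- b2 \<le> a3" "a3 < b3" "b3 \<le> - a2" and R3: "R \<in> {(<), (=), (>)}" "\<And>x y. a3 < x ==> x < y ==> y < b3 ==> R (r x) (r y)"
    and ctr: "\<And>x. a3 < x ==> x < b3 ==> ctd1 r x"
    by (rule monotone_continuous_subinterval[OF r(1), of "- b2" "- a2"]) (use 2 that in auto)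
  obtain a4 b4 R' where 4: "a3 \<le> a4" "a4 < b4" "b4 \<le> b3" and R4: "R' \<in> {(<), (=), (>)}" "\<And>x y. a4 < x ==> x < y ==> y < b4 ==> R' (l x) (l y)"
    and ctl: "\<And>x. a4 < x ==> x < b4 ==> ctd1 l x"
    by (rule monotone_continuous_subinterval[OF l(1) 3(2)]) (use that in auto)
  have rl: "slope f x (r x)" "slope g (- x) (l x)" if "a4 < x" "x < b4" for x
  proof -
    have "\<exists>v. slope f x v" using 1(4)[rule_format, of x] that 2 3 4 by auto
    thus "slope f x (r x)" using r(2) by blast
    have "\<exists>v. slope g (- x) v" using 2(4)[rule_format, of "- x"] that 3 4 by auto
    thus "slope g (- x) (l x)" using l'(2) unfolding l_def by blast
  qed
  have eq: "r x = l x" if x: "a4 < x" "x < b4" for x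
  proof (rule ccontr)
    assume ne: "r x \<noteq> l x"
    define c where "c = (r x + l x) / 2"
    define e where "e = \<bar>r x - l x\<bar> / 2"
    have e0: "e > 0" using ne by (simp add: e_def)
    obtain d1 where d1: "d1 > 0" "\<forall>y. \<bar>y - x\<bar> < d1 --> \<bar>r y - r x\<bar> < e" using ctd1D[OF ctr[of x] e0] x 4 by auto
    obtain d2 where d2: "d2 > 0" "\<forall>y. \<bar>y - x\<bar> < d2 --> \<bar>l y - l x\<bar> < e" using ctd1D[OF ctl[of x] e0] x by auto
    define p where "p = max a4 (x - min d1 d2)"
    define q where "q = min b4 (x + min d1 d2)"
    have pq: "p < q" using x d1(1) d2(1) unfolding p_def q_def by (auto simp: max_def min_def)
    have near: "\<bar>y - x\<bar> < d1 \<and> \<bar>y - x\<bar> < d2 \<and> a4 < y \<and> y < b4" if "p < y" "y < q" for y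
      using that unfolding p_def q_def by (auto simp: abs_less_iff)
    have dh: "DF (\<lambda>e. f (e 0) - c * e 0)" by (intro dfi df)
    show False
    proof (cases "r x < l x")
      case True
      have "lg (<) (\<lambda>y. f y - c * y) y \<and> rg (>) (\<lambda>y. f y - c * y) y" if y: "p < y" "y < q" for y
      proof
        have "c = r x + e" "c = l x - e" using True unfolding c_def e_def by (auto simp: field_simps)
        hence ry: "r y < c" "c < l y" using d1(2)[rule_format, of y] d2(2)[rule_format, of y] near[OF y] by (auto simp: abs_less_iff)
        obtain m where m: "r y < m" "m < c" using dense[OF ry(1)] by blast
        have "\<not> rs f y m" using rl(1)[of y] near[OF y] m unfolding slope_def by blast
        from not_rs[OF f this m(2)] show "rg (>) (\<lambda>y. f y - c * y) y" unfolding rg_def by (auto simp: algebra_simps)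
        have "rs g (- y) c" using rl(2)[of y] near[OF y] ry unfolding slope_def by blast
        then obtain d where d: "d > 0" "\<forall>w. - y < w \<and> w < - y + d --> c * (w - - y) < g w - g (- y)" unfolding rs_def by blast
        show "lg (<) (\<lambda>y. f y - c * y) y" unfolding lg_def
        proof (intro exI[of _ d] conjI allI impI)
          fix w assume "y - d < w \<and> w < y"
          hence "c * (- w - - y) < g (- w) - g (- y)" using d(2)[rule_format, of "- w"] by auto
          thus "f w - c * w < f y - c * y" unfolding g_def by (simp add: algebra_simps)
        qed (rule d)
      qed
      thus False using no_strict_local_max[OF dh pq] by blast
    next
      case False
      have "lg (>) (\<lambda>y. f y - c * y) y \<and> rg (<) (\<lambda>y. f y - c * y) y" if y: "p < y" "y < q" for y
      proof
        have "c = r x - e" "c = l x + e" using False unfolding c_def e_def by (auto simp: field_simps)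
        hence ry: "l y < c" "c < r y" using d1(2)[rule_format, of y] d2(2)[rule_format, of y] near[OF y] by (auto simp: abs_less_iff)
        obtain m where m: "l y < m" "m < c" using dense[OF ry(1)] by blast
        show "rg (<) (\<lambda>y. f y - c * y) y" using rl(1)[of y] near[OF y] ry unfolding slope_def rs_rg by blast
        have "\<not> rs g (- y) m" using rl(2)[of y] near[OF y] m unfolding slope_def by blast
        from not_rs[OF g this m(2)] obtain d where d: "d > 0" "\<forall>w. - y < w \<and> w < - y + d --> g w - g (- y) < c * (w - - y)" by blast
        show "lg (>) (\<lambda>y. f y - c * y) y" unfolding lg_def
        proof (intro exI[of _ d] conjI allI impI)
          fix w assume "y - d < w \<and> w < y"
          hence "g (- w) - g (- y) < c * (- w - - y)" using d(2)[rule_format, of "- w"] by auto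
          thus "f y - c * y < f w - c * w" unfolding g_def by (simp add: algebra_simps)
        qed (rule d)
      qed
      thus False using no_strict_local_min[OF dh pq] by blast
    qed
  qed
  have "dv1 f x (r x)" if x: "a4 < x" "x < b4" for x
    by (rule slopes_dv1[OF f]) (use rl[OF x] eq[OF x] in \<open>simp_all add: g_def[abs_def]\<close>)
  moreover have "a \<le> a4" "b4 \<le> b" using 1 2 3 4 by auto
  ultimately show ?thesis using 4(2) by blast
qed

subsection \<open>Differential calculus in several variables\<close>

definition near :: "nat \<Rightarrow> 'r \<Rightarrow> 'r list \<Rightarrow> 'r list \<Rightarrow> bool" where
  "near n d x y \<longleftrightarrow> (\<forall>i<n. \<bar>y ! i - x ! i\<bar> < d)"

text \<open>Neighbourhoods are cut down to lists of length \<open>n\<close>, so eventual statements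
  may use the length. As a filter they turn epsilon-delta arguments into
  \<open>eventually_elim\<close> steps.\<close>

definition nb :: "nat \<Rightarrow> 'r list \<Rightarrow> 'r list filter" where
  "nb n x = (INF d\<in>{0<..}. principal {y. length y = n \<and> near n d x y})"

lemma eventually_nb: "eventually P (nb n x) \<longleftrightarrow> (\<exists>d>0. \<forall>y\<in>Rn n. near n d x y --> P y)"
proof -
  have "eventually P (nb n x) \<longleftrightarrow> (\<exists>d\<in>{0<..}. eventually P (principal {y. length y = n \<and> near n d x y}))"
    unfolding nb_def
  proof (rule eventually_INF_base)
    fix a b :: 'r assume "a \<in> {0<..}" "b \<in> {0<..}"
    thus "\<exists>c\<in>{0<..}. principal {y. length y = n \<and> near n c x y} \<le>
        inf (principal {y. length y = n \<and> near n a x y}) (principal {y. length y = n \<and> near n b x y})"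
      by (intro bexI[of _ "min a b"]) (auto simp: near_def)
  qed (auto intro: exI[of _ 1])
  thus ?thesis by (simp add: eventually_principal Bex_def Ball_def imp_conjL)
qed

lemma ev_self: "eventually P (nb n x) ==> length x = n ==> P x"
  unfolding eventually_nb by (auto simp: near_def)

lemma ev_length: "eventually (\<lambda>y. length y = n) (nb n x)"
  unfolding eventually_nb by (auto intro: exI[of _ 1])

lemma ev_near: "d > 0 ==> eventually (\<lambda>y. near n d x y) (nb n x)"
  unfolding eventually_nb by blast

lemma ev_ev: assumes "eventually P (nb n x)" shows "eventually (\<lambda>y. eventually P (nb n y)) (nb n x)"
proof -
  obtain d where d: "d > 0" "\<forall>y\<in>Rn n. near n d x y --> P y" using assms unfolding eventually_nb by blast
  show ?thesis unfolding eventually_nb[of _ n x]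
  proof (intro exI[of _ "d / 2"] conjI ballI impI)
    fix y :: "'r list" assume y: "y \<in> Rn n" "near n (d / 2) x y"
    have "near n d x z" if "near n (d / 2) y z" for z unfolding near_def
    proof (intro allI impI)
      fix i assume "i < n"
      hence "\<bar>z ! i - y ! i\<bar> < d / 2" "\<bar>y ! i - x ! i\<bar> < d / 2" using that y unfolding near_def by auto
      thus "\<bar>z ! i - x ! i\<bar> < d" by linarith
    qed
    thus "eventually P (nb n y)" unfolding eventually_nb using d by (intro exI[of _ "d/2"]) auto
  qed (use d in simp)
qed

lemma Dp_ev: assumes "DV n v" "Dp (\<lambda>e. P (map e [0..<n]) (\<lambda>i. e (Suc i + n)))"
  shows "Dp (\<lambda>e. eventually (\<lambda>y. P y e) (nb n (v e)))"
  unfolding eventually_nb near_def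
  by (intro dfi) (rule DV_vars DV_ren[OF assms(1)] assms(2) | assumption)+

lemma open_in_Rn_iff: "open_in_Rn n U \<longleftrightarrow> U \<subseteq> Rn n \<and> (\<forall>x\<in>U. eventually (\<lambda>y. y \<in> U) (nb n x))"
  unfolding open_in_Rn_def eventually_nb near_def by blast

section \<open>Landau symbols, total derivatives and regularity\<close>

definition n1 :: "nat \<Rightarrow> 'r list \<Rightarrow> 'r list \<Rightarrow> 'r" where "n1 n x y = (\<Sum>i<n. \<bar>y ! i - x ! i\<bar>)"

text \<open>The Landau symbol \<open>o\<close> relative to the distance from \<open>x\<close>;
  \<open>bo\<close> below is the symbol \<open>O\<close>. The distance \<open>n1\<close> is a sum
  over coordinates, which suits estimates made one coordinate at a time.\<close>

definition lo :: "nat \<Rightarrow> 'r list \<Rightarrow> ('r list \<Rightarrow> 'r) \<Rightarrow> bool" where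
  "lo n x r \<longleftrightarrow> (\<forall>e>0. eventually (\<lambda>y. \<bar>r y\<bar> \<le> e * n1 n x y) (nb n x))"

definition bo :: "nat \<Rightarrow> 'r list \<Rightarrow> ('r list \<Rightarrow> 'r) \<Rightarrow> bool" where
  "bo n x r \<longleftrightarrow> (\<exists>C>0. eventually (\<lambda>y. \<bar>r y\<bar> \<le> C * n1 n x y) (nb n x))"

definition ctd :: "nat \<Rightarrow> ('r list \<Rightarrow> 'r) \<Rightarrow> 'r list \<Rightarrow> bool" where
  "ctd n f x \<longleftrightarrow> (\<forall>e>0. eventually (\<lambda>y. \<bar>f y - f x\<bar> < e) (nb n x))"

definition hdv :: "nat \<Rightarrow> ('r list \<Rightarrow> 'r) \<Rightarrow> (nat \<Rightarrow> 'r) \<Rightarrow> 'r list \<Rightarrow> bool" where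
  "hdv n f D x \<longleftrightarrow> lo n x (\<lambda>y. f y - f x - (\<Sum>i<n. D i * (y ! i - x ! i)))"

text \<open>\<open>reg p n f x\<close>: \<open>f\<close> is of class \<open>C^p\<close> in a neighbourhood of \<open>x\<close>.\<close>

fun reg :: "nat \<Rightarrow> nat \<Rightarrow> ('r list \<Rightarrow> 'r) \<Rightarrow> 'r list \<Rightarrow> bool" where
  "reg 0 n f x = eventually (ctd n f) (nb n x)"
| "reg (Suc p) n f x = (\<exists>D. eventually (\<lambda>y. hdv n f (\<lambda>i. D i y) y) (nb n x) \<and> (\<forall>i<n. reg p n (D i) x))"

lemma n1_nonneg: "0 \<le> n1 n x y"
  unfolding n1_def by (simp add: sum_nonneg)

lemma n1_self [simp]: "n1 n x x = 0"
  unfolding n1_def by simp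

lemma n1_coord: "i < n ==> \<bar>y ! i - x ! i\<bar> \<le> n1 n x y"
  unfolding n1_def by (rule member_le_sum) auto

lemma ev_n1: assumes "d > 0" shows "eventually (\<lambda>y. n1 n x y < d) (nb n x)"
proof -
  have N: "of_nat (Suc n) > (0::'r)" by (simp only: of_nat_0_less_iff zero_less_Suc)
  hence "d / of_nat (Suc n) > 0" using assms by (rule divide_pos_pos[rotated])
  from ev_near[OF this, of n x] show ?thesis
  proof eventually_elim
    case (elim y)
    have "n1 n x y \<le> of_nat (card {..<n}) * (d / of_nat (Suc n))" unfolding n1_def
      by (rule sum_bounded_above) (use elim in \<open>auto simp: near_def intro: less_imp_le\<close>)
    also have "\<dots> < d" using assms N by (simp add: field_simps)
    finally show ?case .
  qed
qed

lemma lo_add: assumes "lo n x r" "lo n x s" shows "lo n x (\<lambda>y. r y + s y)" unfolding lo_def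
proof (intro allI impI)
  fix e :: 'r assume "e > 0" hence e: "e / 2 > 0" by simp
  have "eventually (\<lambda>y. \<bar>r y\<bar> \<le> e / 2 * n1 n x y) (nb n x)" "eventually (\<lambda>y. \<bar>s y\<bar> \<le> e / 2 * n1 n x y) (nb n x)"
    using assms e unfolding lo_def by blast+
  thus "eventually (\<lambda>y. \<bar>r y + s y\<bar> \<le> e * n1 n x y) (nb n x)"
  proof eventually_elim
    case (elim y)
    have "e * n1 n x y = e / 2 * n1 n x y + e / 2 * n1 n x y" by (simp add: field_simps)
    thus ?case using elim by linarith
  qed
qed

lemma lo_dom: assumes "lo n x r" "C > 0" "eventually (\<lambda>y. \<bar>s y\<bar> \<le> C * \<bar>r y\<bar>) (nb n x)" shows "lo n x s" unfolding lo_def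
proof (intro allI impI)
  fix e :: 'r assume "e > 0"
  hence "e / C > 0" using assms(2) by simp
  hence "eventually (\<lambda>y. \<bar>r y\<bar> \<le> e / C * n1 n x y) (nb n x)" using assms(1) unfolding lo_def by auto
  with assms(3) show "eventually (\<lambda>y. \<bar>s y\<bar> \<le> e * n1 n x y) (nb n x)"
  proof eventually_elim
    case (elim y)
    have "C * \<bar>r y\<bar> \<le> C * (e / C * n1 n x y)" using elim(2) assms(2) by (intro mult_left_mono) auto
    also have "\<dots> = e * n1 n x y" using assms(2) by simp
    finally show ?case using elim(1) by simp
  qed
qed

lemma lo_cmul: assumes "lo n x r" shows "lo n x (\<lambda>y. c * r y)"
  by (rule lo_dom[OF assms, of "1 + \<bar>c\<bar>"])
    (auto simp: abs_mult add_pos_nonneg intro!: always_eventually mult_right_mono)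

lemma lo_zero: "lo n x (\<lambda>y. 0)"
  unfolding lo_def using n1_nonneg by (auto intro!: always_eventually)

lemma lo_sum: "(\<And>j. j < m ==> lo n x (r j)) ==> lo n x (\<lambda>y. \<Sum>j<(m::nat). r j y)"
  by (induction m) (simp_all add: lo_zero lo_add)

lemma lo_cong: assumes "lo n x r" "eventually (\<lambda>y. r y = s y) (nb n x)" shows "lo n x s"
proof (rule lo_dom[OF assms(1), of 1])
  show "eventually (\<lambda>y. \<bar>s y\<bar> \<le> 1 * \<bar>r y\<bar>) (nb n x)" using assms(2) by (rule eventually_mono) simp
qed simp

lemma lo_eq: assumes "lo n x r" "\<And>y. r y = s y" shows "lo n x s"
proof -
  have "r = s" using assms(2) by auto
  thus ?thesis using assms(1) by simp
qed

lemma lo_mult: assumes "bo n x r" "\<And>e. e > 0 ==> eventually (\<lambda>y. \<bar>s y\<bar> < e) (nb n x)"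
  shows "lo n x (\<lambda>y. r y * s y)" unfolding lo_def
proof (intro allI impI)
  fix e :: 'r assume e: "e > 0"
  obtain C where C: "C > 0" "eventually (\<lambda>y. \<bar>r y\<bar> \<le> C * n1 n x y) (nb n x)" using assms(1) unfolding bo_def by blast
  have "e / C > 0" using e C by simp
  from assms(2)[OF this] C(2) show "eventually (\<lambda>y. \<bar>r y * s y\<bar> \<le> e * n1 n x y) (nb n x)"
  proof eventually_elim
    case (elim y)
    have "\<bar>r y * s y\<bar> \<le> (C * n1 n x y) * (e / C)" unfolding abs_mult using elim C(1) n1_nonneg[of n x y]
      by (intro mult_mono) auto
    thus ?case using C(1) by (simp add: mult.commute)
  qed
qed

lemma hdv_bo: assumes "hdv n f D x" shows "bo n x (\<lambda>y. f y - f x)"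
proof -
  define C where "C = 1 + (\<Sum>i<n. \<bar>D i\<bar>)"
  have C: "C > 0" unfolding C_def by (simp add: add_pos_nonneg sum_nonneg)
  have "eventually (\<lambda>y. \<bar>f y - f x - (\<Sum>i<n. D i * (y ! i - x ! i))\<bar> \<le> 1 * n1 n x y) (nb n x)"
    using assms unfolding hdv_def lo_def by (meson zero_less_one)
  hence "eventually (\<lambda>y. \<bar>f y - f x\<bar> \<le> C * n1 n x y) (nb n x)"
  proof eventually_elim
    case (elim y)
    have "\<bar>\<Sum>i<n. D i * (y ! i - x ! i)\<bar> \<le> (\<Sum>i<n. \<bar>D i * (y ! i - x ! i)\<bar>)" by (rule sum_abs)
    also have "\<dots> \<le> (\<Sum>i<n. \<bar>D i\<bar> * n1 n x y)" unfolding abs_mult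
      by (intro sum_mono mult_left_mono n1_coord) auto
    finally have "\<bar>\<Sum>i<n. D i * (y ! i - x ! i)\<bar> \<le> (\<Sum>i<n. \<bar>D i\<bar>) * n1 n x y" by (simp add: sum_distrib_right)
    moreover have "C * n1 n x y = n1 n x y + (\<Sum>i<n. \<bar>D i\<bar>) * n1 n x y" unfolding C_def by (simp add: algebra_simps)
    ultimately show ?case using elim by linarith
  qed
  thus ?thesis unfolding bo_def using C by blast
qed

lemma bo_ctd: assumes "bo n x (\<lambda>y. f y - f x)" shows "ctd n f x" unfolding ctd_def
proof (intro allI impI)
  fix e :: 'r assume e: "e > 0"
  obtain C where C: "C > 0" "eventually (\<lambda>y. \<bar>f y - f x\<bar> \<le> C * n1 n x y) (nb n x)" using assms unfolding bo_def by blast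
  have "e / C > 0" using e C by simp
  from ev_n1[OF this, of n x] C(2) show "eventually (\<lambda>y. \<bar>f y - f x\<bar> < e) (nb n x)"
  proof eventually_elim
    case (elim y)
    have "C * n1 n x y < e" using elim(1) C(1) by (simp add: field_simps)
    thus ?case using elim(2) by simp
  qed
qed

lemma hdv_ctd: "hdv n f D x ==> ctd n f x"
  by (rule bo_ctd[OF hdv_bo])

lemma ctdD: "ctd n f x ==> e > 0 ==> eventually (\<lambda>y. \<bar>f y - f x\<bar> < e) (nb n x)"
  unfolding ctd_def by blast

lemma ctd_cong: assumes "ctd n f x" "eventually (\<lambda>y. f y = g y) (nb n x)" "length x = n" shows "ctd n g x"
  unfolding ctd_def
proof (intro allI impI)
  fix e :: 'r assume "e > 0"
  have "f x = g x" using ev_self[OF assms(2,3)] .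
  with ctdD[OF assms(1) \<open>e > 0\<close>] assms(2) show "eventually (\<lambda>y. \<bar>g y - g x\<bar> < e) (nb n x)"
    by (auto elim: eventually_elim2)
qed

lemma hdv_cong: assumes "hdv n f D x" "eventually (\<lambda>y. f y = g y) (nb n x)" "length x = n" shows "hdv n g D x"
proof -
  have "f x = g x" using ev_self[OF assms(2,3)] .
  with assms(1,2) show ?thesis unfolding hdv_def
    by (elim lo_cong) (auto elim: eventually_mono)
qed

lemma reg_cong: "reg p n f x ==> eventually (\<lambda>y. f y = g y) (nb n x) ==> reg p n g x"
proof (cases p)
  case 0
  assume "reg p n f x" and fg: "eventually (\<lambda>y. f y = g y) (nb n x)"
  hence "eventually (ctd n f) (nb n x)" using 0 by simp
  with ev_ev[OF fg] ev_length[of n x] show "reg p n g x" unfolding 0 reg.simps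
    by eventually_elim (rule ctd_cong)
next
  case (Suc q)
  assume "reg p n f x" and fg: "eventually (\<lambda>y. f y = g y) (nb n x)"
  then obtain D where D: "eventually (\<lambda>y. hdv n f (\<lambda>i. D i y) y) (nb n x)" "\<forall>i<n. reg q n (D i) x" using Suc by auto
  from D(1) ev_ev[OF fg] ev_length[of n x] have "eventually (\<lambda>y. hdv n g (\<lambda>i. D i y) y) (nb n x)"
    by eventually_elim (rule hdv_cong)
  thus "reg p n g x" using D(2) Suc by auto
qed

lemma reg_ev_ctd: "reg p n f x ==> eventually (ctd n f) (nb n x)"
  by (cases p) (auto elim!: eventually_mono intro: hdv_ctd)

lemma reg_ctd: "reg p n f x ==> length x = n ==> ctd n f x"
  using ev_self[OF reg_ev_ctd] .

lemma reg_dec: "reg (Suc p) n f x ==> reg p n f x"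
proof (induction p arbitrary: f)
  case 0 thus ?case using reg_ev_ctd[of "Suc 0" n f x] by simp
next
  case (Suc p)
  then obtain D where "eventually (\<lambda>y. hdv n f (\<lambda>i. D i y) y) (nb n x)" "\<forall>i<n. reg (Suc p) n (D i) x" by auto
  thus ?case using Suc.IH by auto
qed

lemma hdv_const: "hdv n (\<lambda>y. c) (\<lambda>i. 0) x"
  unfolding hdv_def by (simp add: lo_zero)

lemma reg_const: "reg p n (\<lambda>y. c) x"
proof (induction p arbitrary: c)
  case 0 show ?case by (simp add: always_eventually hdv_ctd[OF hdv_const])
next
  case (Suc p) thus ?case by (auto intro!: exI[of _ "\<lambda>i y. 0"] always_eventually hdv_const)
qed

lemma hdv_nth: assumes "k < n" shows "hdv n (\<lambda>y. y ! k) (\<lambda>i. if i = k then 1 else 0) x"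
proof -
  have "(\<Sum>i<n. (if i = k then 1 else 0) * (y ! i - x ! i)) = y ! k - x ! k" for y
    using assms by (simp add: if_distrib[of "\<lambda>a. a * _"] sum.delta cong: if_cong)
  thus ?thesis unfolding hdv_def by (simp add: lo_zero)
qed

lemma reg_nth: assumes "k < n" shows "reg p n (\<lambda>y. y ! k) x"
proof (cases p)
  case 0 thus ?thesis by (simp add: always_eventually hdv_ctd[OF hdv_nth[OF assms]])
next
  case (Suc q)
  have "hdv n (\<lambda>y. y ! k) (\<lambda>i. (\<lambda>i z. if i = k then 1 else 0) i y) y" for y using hdv_nth[OF assms] by simp
  moreover have "reg q n ((\<lambda>i z. if i = k then 1 else 0) i) x" for i using reg_const[of q n "if i = k then 1 else 0" x] by simp
  ultimately show ?thesis unfolding Suc reg.simps by (intro exI[of _ "\<lambda>i z. if i = k then 1 else 0"]) (simp add: always_eventually)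
qed

lemma hdv_add: assumes "hdv n f D x" "hdv n g E x" shows "hdv n (\<lambda>y. f y + g y) (\<lambda>i. D i + E i) x"
  unfolding hdv_def
  by (rule lo_eq[OF lo_add[OF assms[unfolded hdv_def]]]) (simp add: algebra_simps sum.distrib sum_subtractf)

lemma hdv_mult: assumes "hdv n f D x" "hdv n g E x"
  shows "hdv n (\<lambda>y. f y * g y) (\<lambda>i. f x * E i + D i * g x) x"
proof -
  have 1: "lo n x (\<lambda>y. (f y - f x) * (g y - g x))"
    by (rule lo_mult[OF hdv_bo[OF assms(1)]]) (rule ctdD[OF hdv_ctd[OF assms(2)]])
  have 2: "lo n x (\<lambda>y. f x * (g y - g x - (\<Sum>i<n. E i * (y ! i - x ! i))))" using assms(2) unfolding hdv_def by (rule lo_cmul)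
  have 3: "lo n x (\<lambda>y. g x * (f y - f x - (\<Sum>i<n. D i * (y ! i - x ! i))))" using assms(1) unfolding hdv_def by (rule lo_cmul)
  have "(\<Sum>i<n. (f x * E i + D i * g x) * (y ! i - x ! i)) = f x * (\<Sum>i<n. E i * (y ! i - x ! i)) + g x * (\<Sum>i<n. D i * (y ! i - x ! i))" for y
    by (simp add: sum_distrib_left algebra_simps sum.distrib sum_subtractf)
  thus ?thesis unfolding hdv_def by (intro lo_eq[OF lo_add[OF 1 lo_add[OF 2 3]]]) (simp add: algebra_simps)
qed

lemma ctd_add: assumes "ctd n f x" "ctd n g x" shows "ctd n (\<lambda>y. f y + g y) x" unfolding ctd_def
proof (intro allI impI)
  fix e :: 'r assume "e > 0" hence "e / 2 > 0" by simp
  from ctdD[OF assms(1) this] ctdD[OF assms(2) this] show "eventually (\<lambda>y. \<bar>f y + g y - (f x + g x)\<bar> < e) (nb n x)"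
  proof eventually_elim
    case (elim y)
    have "e = e / 2 + e / 2" by simp
    thus ?case using elim by linarith
  qed
qed

lemma ctd_const: "ctd n (\<lambda>y. c) x"
  by (rule hdv_ctd[OF hdv_const])

lemma ctd_nth: "k < n ==> ctd n (\<lambda>y. y ! k) x"
  by (rule hdv_ctd[OF hdv_nth])

lemma ctd_comp:
  assumes F: "ctd m F (map (\<lambda>j. G j x) [0..<m])" and G: "\<And>j. j < m ==> ctd n (G j) x"
  shows "ctd n (\<lambda>y. F (map (\<lambda>j. G j y) [0..<m])) x" unfolding ctd_def
proof (intro allI impI)
  fix e :: 'r assume "e > 0"
  from ctdD[OF F this] obtain d where d: "d > 0"
    "\<forall>z\<in>Rn m. near m d (map (\<lambda>j. G j x) [0..<m]) z --> \<bar>F z - F (map (\<lambda>j. G j x) [0..<m])\<bar> < e" unfolding eventually_nb by blast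
  have "\<forall>j\<in>{..<m}. eventually (\<lambda>y. \<bar>G j y - G j x\<bar> < d) (nb n x)" using ctdD[OF G d(1)] by auto
  hence "eventually (\<lambda>y. \<forall>j\<in>{..<m}. \<bar>G j y - G j x\<bar> < d) (nb n x)" by (intro eventually_ball_finite) auto
  thus "eventually (\<lambda>y. \<bar>F (map (\<lambda>j. G j y) [0..<m]) - F (map (\<lambda>j. G j x) [0..<m])\<bar> < e) (nb n x)"
    by (rule eventually_mono) (use d(2) in \<open>auto simp: near_def\<close>)
qed

lemma ev_comp: assumes "eventually P (nb m (map (\<lambda>j. G j x) [0..<m]))" and G: "\<And>j. j < m ==> ctd n (G j) x"
  shows "eventually (\<lambda>y. P (map (\<lambda>j. G j y) [0..<m])) (nb n x)"
proof -
  obtain d where d: "d > 0" "\<forall>z\<in>Rn m. near m d (map (\<lambda>j. G j x) [0..<m]) z --> P z" using assms(1) unfolding eventually_nb by blast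
  have "\<forall>j\<in>{..<m}. eventually (\<lambda>y. \<bar>G j y - G j x\<bar> < d) (nb n x)" using ctdD[OF G d(1)] by auto
  hence "eventually (\<lambda>y. \<forall>j\<in>{..<m}. \<bar>G j y - G j x\<bar> < d) (nb n x)" by (intro eventually_ball_finite) auto
  thus ?thesis by (rule eventually_mono) (use d(2) in \<open>auto simp: near_def\<close>)
qed

lemma ctd_mult: assumes "ctd n f x" "ctd n g x" shows "ctd n (\<lambda>y. f y * g y) x"
proof -
  have "ctd n (\<lambda>y. (\<lambda>z. z ! 0 * z ! 1) (map (\<lambda>j. (if j = 0 then f else g) y) [0..<2])) x"
    by (rule ctd_comp, rule hdv_ctd, rule hdv_mult[OF hdv_nth hdv_nth]) (use assms in auto)
  thus ?thesis by simp
qed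

text \<open>Substitute the linear approximations of the \<open>G j\<close> into that of
  \<open>F\<close>. The remainder of \<open>F\<close> stays small because the inner map satisfies a
  Lipschitz estimate at \<open>x\<close> with the constant \<open>K\<close>.\<close>

lemma hdv_comp:
  assumes F: "hdv m F D (map (\<lambda>j. G j x) [0..<m])" and G: "\<And>j. j < m ==> hdv n (G j) (E j) x"
  shows "hdv n (\<lambda>y. F (map (\<lambda>j. G j y) [0..<m])) (\<lambda>i. \<Sum>j<m. D j * E j i) x"
proof -
  define z where "z y = map (\<lambda>j. G j y) [0..<m]" for y
  define r where "r w = F w - F (z x) - (\<Sum>j<m. D j * (w ! j - z x ! j))" for w
  have r: "lo m (z x) r" using F unfolding hdv_def r_def z_def .
  have "\<forall>j. \<exists>C>0. j < m --> eventually (\<lambda>y. \<bar>G j y - G j x\<bar> \<le> C * n1 n x y) (nb n x)"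
    using hdv_bo[OF G] unfolding bo_def by (meson zero_less_one)
  then obtain C where C: "\<And>j. C j > 0" "\<And>j. j < m ==> eventually (\<lambda>y. \<bar>G j y - G j x\<bar> \<le> C j * n1 n x y) (nb n x)" by metis
  define K where "K = 1 + (\<Sum>j<m. C j)"
  have K: "K > 0" unfolding K_def using C(1) by (simp add: add_pos_nonneg sum_nonneg less_imp_le)
  have "eventually (\<lambda>y. \<forall>j\<in>{..<m}. \<bar>G j y - G j x\<bar> \<le> C j * n1 n x y) (nb n x)" using C(2) by (intro eventually_ball_finite) auto
  hence n1z: "eventually (\<lambda>y. n1 m (z x) (z y) \<le> K * n1 n x y) (nb n x)"
  proof eventually_elim
    case (elim y)
    have "n1 m (z x) (z y) \<le> (\<Sum>j<m. C j * n1 n x y)" unfolding n1_def[of m] z_def using elim by (intro sum_mono) auto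
    also have "\<dots> \<le> K * n1 n x y" unfolding K_def using n1_nonneg[of n x y] by (simp add: algebra_simps sum_distrib_right sum_distrib_left)
    finally show ?case .
  qed
  have 1: "lo n x (\<lambda>y. r (z y))" unfolding lo_def
  proof (intro allI impI)
    fix e :: 'r assume "e > 0"
    hence "e / K > 0" using K by simp
    hence "eventually (\<lambda>w. \<bar>r w\<bar> \<le> e / K * n1 m (z x) w) (nb m (z x))" using r unfolding lo_def by auto
    hence "eventually (\<lambda>y. \<bar>r (z y)\<bar> \<le> e / K * n1 m (z x) (z y)) (nb n x)" unfolding z_def
      by (rule ev_comp) (rule hdv_ctd[OF G])
    with n1z show "eventually (\<lambda>y. \<bar>r (z y)\<bar> \<le> e * n1 n x y) (nb n x)"
    proof eventually_elim
      case (elim y)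
      have "e / K * n1 m (z x) (z y) \<le> e / K * (K * n1 n x y)" using elim(1) \<open>e / K > 0\<close> by (intro mult_left_mono) auto
      thus ?case using elim(2) K by simp
    qed
  qed
  have 2: "lo n x (\<lambda>y. \<Sum>j<m. D j * (G j y - G j x - (\<Sum>i<n. E j i * (y ! i - x ! i))))"
    by (rule lo_sum, rule lo_cmul) (use G in \<open>simp add: hdv_def\<close>)
  have eq: "F (z y) - F (z x) - (\<Sum>i<n. (\<Sum>j<m. D j * E j i) * (y ! i - x ! i)) =
    r (z y) + (\<Sum>j<m. D j * (G j y - G j x - (\<Sum>i<n. E j i * (y ! i - x ! i))))" for y
  proof -
    have "(\<Sum>i<n. (\<Sum>j<m. D j * E j i) * (y ! i - x ! i)) = (\<Sum>i<n. \<Sum>j<m. D j * (E j i * (y ! i - x ! i)))"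
      by (simp add: sum_distrib_right mult.assoc)
    also have "\<dots> = (\<Sum>j<m. \<Sum>i<n. D j * (E j i * (y ! i - x ! i)))" by (rule sum.swap)
    finally have "(\<Sum>i<n. (\<Sum>j<m. D j * E j i) * (y ! i - x ! i)) = (\<Sum>j<m. D j * (\<Sum>i<n. E j i * (y ! i - x ! i)))"
      by (simp add: sum_distrib_left)
    moreover have "(\<Sum>j<m. D j * (z y ! j - z x ! j)) = (\<Sum>j<m. D j * (G j y - G j x))" unfolding z_def by (intro sum.cong) auto
    ultimately show ?thesis unfolding r_def by (simp add: right_diff_distrib sum_subtractf)
  qed
  have "lo n x (\<lambda>y. F (z y) - F (z x) - (\<Sum>i<n. (\<Sum>j<m. D j * E j i) * (y ! i - x ! i)))"
    unfolding eq by (rule lo_add[OF 1 2])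
  thus ?thesis unfolding hdv_def z_def .
qed

lemma reg_add: "reg p n f x ==> reg p n g x ==> reg p n (\<lambda>y. f y + g y) x"
proof (induction p arbitrary: f g)
  case 0
  hence "eventually (ctd n f) (nb n x)" "eventually (ctd n g) (nb n x)" by auto
  thus ?case unfolding reg.simps by eventually_elim (rule ctd_add)
next
  case (Suc p)
  obtain D where D: "eventually (\<lambda>y. hdv n f (\<lambda>i. D i y) y) (nb n x)" "\<forall>i<n. reg p n (D i) x" using Suc.prems(1) by auto
  obtain E where E: "eventually (\<lambda>y. hdv n g (\<lambda>i. E i y) y) (nb n x)" "\<forall>i<n. reg p n (E i) x" using Suc.prems(2) by auto
  from D(1) E(1) have "eventually (\<lambda>y. hdv n (\<lambda>y. f y + g y) (\<lambda>i. D i y + E i y) y) (nb n x)"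
    by eventually_elim (rule hdv_add)
  thus ?case unfolding reg.simps using D(2) E(2) Suc.IH by (intro exI[of _ "\<lambda>i y. D i y + E i y"]) simp
qed

lemma reg_mult: "reg p n f x ==> reg p n g x ==> reg p n (\<lambda>y. f y * g y) x"
proof (induction p arbitrary: f g)
  case 0
  hence "eventually (ctd n f) (nb n x)" "eventually (ctd n g) (nb n x)" by auto
  thus ?case unfolding reg.simps by eventually_elim (rule ctd_mult)
next
  case (Suc p)
  obtain D where D: "eventually (\<lambda>y. hdv n f (\<lambda>i. D i y) y) (nb n x)" "\<forall>i<n. reg p n (D i) x" using Suc.prems(1) by auto
  obtain E where E: "eventually (\<lambda>y. hdv n g (\<lambda>i. E i y) y) (nb n x)" "\<forall>i<n. reg p n (E i) x" using Suc.prems(2) by auto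
  from D(1) E(1) have "eventually (\<lambda>y. hdv n (\<lambda>y. f y * g y) (\<lambda>i. f y * E i y + D i y * g y) y) (nb n x)"
    by eventually_elim (rule hdv_mult)
  moreover have "reg p n f x" "reg p n g x" using Suc.prems reg_dec by blast+
  ultimately show ?case unfolding reg.simps using D(2) E(2) Suc.IH
    by (intro exI[of _ "\<lambda>i y. f y * E i y + D i y * g y"]) (simp add: reg_add)
qed

lemma reg_uminus: "reg p n f x ==> reg p n (\<lambda>y. - f y) x"
  using reg_mult[OF reg_const[of p n "-1"]] by simp

lemma reg_diff: "reg p n f x ==> reg p n g x ==> reg p n (\<lambda>y. f y - g y) x"
  using reg_add[OF _ reg_uminus, of p n f x g] by simp

lemma reg_sum: "(\<And>j. j < m ==> reg p n (f j) x) ==> reg p n (\<lambda>y. \<Sum>j<(m::nat). f j y) x"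
  by (induction m) (simp_all add: reg_const reg_add)

text \<open>By the chain rule the gradient of the composite consists of sums of products of
  \<open>D j\<close> after \<open>G\<close> with the gradients of the \<open>G j\<close>. The
  induction hypothesis covers the first factors because it is stated for all outer functions
  \<open>F\<close>; the inner functions stay fixed and only lose one order.\<close>

lemma reg_comp:
  "reg p m F (map (\<lambda>j. G j x) [0..<m]) ==> (\<And>j. j < m ==> reg p n (G j) x) ==> length x = n ==>
    reg p n (\<lambda>y. F (map (\<lambda>j. G j y) [0..<m])) x"
proof (induction p arbitrary: F)
  case 0
  have "eventually (\<lambda>y. ctd m F (map (\<lambda>j. G j y) [0..<m])) (nb n x)"
    by (rule ev_comp) (use 0 ev_self[of "ctd n _"] in auto)
  moreover have "eventually (\<lambda>y. \<forall>j\<in>{..<m}. ctd n (G j) y) (nb n x)" using 0 by (intro eventually_ball_finite) auto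
  ultimately have "eventually (ctd n (\<lambda>y. F (map (\<lambda>j. G j y) [0..<m]))) (nb n x)"
    by eventually_elim (auto intro!: ctd_comp)
  thus ?case by simp
next
  case (Suc p)
  obtain D where D: "eventually (\<lambda>z. hdv m F (\<lambda>j. D j z) z) (nb m (map (\<lambda>j. G j x) [0..<m]))"
    "\<forall>j<m. reg p m (D j) (map (\<lambda>j. G j x) [0..<m])" using Suc.prems(1) by auto
  have "\<forall>j. \<exists>E. j < m --> eventually (\<lambda>y. hdv n (G j) (\<lambda>i. E i y) y) (nb n x) \<and> (\<forall>i<n. reg p n (E i) x)"
    using Suc.prems(2) by auto
  then obtain E where E: "\<And>j. j < m ==> eventually (\<lambda>y. hdv n (G j) (\<lambda>i. E j i y) y) (nb n x)"
    "\<And>j i. j < m ==> i < n ==> reg p n (E j i) x" by metis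
  have G: "reg p n (G j) x" if "j < m" for j using Suc.prems(2)[OF that] reg_dec by blast
  have "eventually (\<lambda>y. hdv m F (\<lambda>j. D j (map (\<lambda>j. G j y) [0..<m])) (map (\<lambda>j. G j y) [0..<m])) (nb n x)"
    by (rule ev_comp[where P = "\<lambda>z. hdv m F (\<lambda>j. D j z) z" and G = G and x = x, OF D(1)]) (rule reg_ctd[OF G Suc.prems(3)])
  moreover have "eventually (\<lambda>y. \<forall>j\<in>{..<m}. hdv n (G j) (\<lambda>i. E j i y) y) (nb n x)" using E(1) by (intro eventually_ball_finite) auto
  ultimately have "eventually (\<lambda>y. hdv n (\<lambda>y. F (map (\<lambda>j. G j y) [0..<m]))
      (\<lambda>i. \<Sum>j<m. D j (map (\<lambda>j. G j y) [0..<m]) * E j i y) y) (nb n x)"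
    by eventually_elim (rule hdv_comp, auto)
  moreover have "reg p n (\<lambda>y. \<Sum>j<m. D j (map (\<lambda>j. G j y) [0..<m]) * E j i y) x" if "i < n" for i
    using D(2) E(2) G that Suc.IH Suc.prems(3) by (intro reg_sum reg_mult) auto
  ultimately show ?case unfolding reg.simps by (intro exI[of _ "\<lambda>i y. \<Sum>j<m. D j (map (\<lambda>j. G j y) [0..<m]) * E j i y"]) simp
qed

text \<open>Exactly, \<open>1 / f y - 1 / f x + (f y - f x) / (f x)^2\<close> equals
  \<open>(f y - f x)^2 / ((f x)^2 * f y)\<close>, which is of smaller order once \<open>f y\<close>
  is bounded away from zero.\<close>

lemma hdv_inverse: assumes f: "hdv n f D x" and nz: "f x \<noteq> 0"
  shows "hdv n (\<lambda>y. inverse (f y)) (\<lambda>i. - (D i * (inverse (f x) * inverse (f x)))) x"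
proof -
  let ?a = "inverse (f x)"
  have 1: "lo n x (\<lambda>y. (f y - f x) * (f y - f x))"
    by (rule lo_mult[OF hdv_bo[OF f]]) (rule ctdD[OF hdv_ctd[OF f]])
  have pos: "\<bar>f x\<bar> / 2 > 0" using nz by simp
  have 2: "lo n x (\<lambda>y. inverse (f y) - ?a + ?a * ?a * (f y - f x))"
  proof (rule lo_dom[OF 1])
    show "2 * (\<bar>?a\<bar> * \<bar>?a\<bar> * \<bar>?a\<bar>) > 0" using nz by simp
    from ctdD[OF hdv_ctd[OF f] pos]
    show "eventually (\<lambda>y. \<bar>inverse (f y) - ?a + ?a * ?a * (f y - f x)\<bar> \<le> 2 * (\<bar>?a\<bar> * \<bar>?a\<bar> * \<bar>?a\<bar>) * \<bar>(f y - f x) * (f y - f x)\<bar>) (nb n x)"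
    proof eventually_elim
      case (elim y)
      have fy: "\<bar>f y\<bar> \<ge> \<bar>f x\<bar> / 2" using elim by linarith
      hence fy0: "f y \<noteq> 0" using pos by auto
      have "inverse (f y) - ?a + ?a * ?a * (f y - f x) = ((f y - f x) * (f y - f x)) * (?a * ?a) * inverse (f y)"
        using fy0 nz by (simp add: field_simps)
      hence "\<bar>inverse (f y) - ?a + ?a * ?a * (f y - f x)\<bar> = \<bar>(f y - f x) * (f y - f x)\<bar> * (\<bar>?a\<bar> * \<bar>?a\<bar>) * inverse \<bar>f y\<bar>"
        by (simp add: abs_mult)
      also have "\<dots> \<le> \<bar>(f y - f x) * (f y - f x)\<bar> * (\<bar>?a\<bar> * \<bar>?a\<bar>) * inverse (\<bar>f x\<bar> / 2)"
        by (intro mult_left_mono le_imp_inverse_le fy pos) auto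
      also have "\<dots> = 2 * (\<bar>?a\<bar> * \<bar>?a\<bar> * \<bar>?a\<bar>) * \<bar>(f y - f x) * (f y - f x)\<bar>" using nz by (simp add: field_simps)
      finally show ?case .
    qed
  qed
  have 3: "lo n x (\<lambda>y. (- (?a * ?a)) * (f y - f x - (\<Sum>i<n. D i * (y ! i - x ! i))))" using f unfolding hdv_def by (rule lo_cmul)
  have "(\<Sum>i<n. - (D i * (?a * ?a)) * (y ! i - x ! i)) = - (?a * ?a) * (\<Sum>i<n. D i * (y ! i - x ! i))" for y
    by (subst sum_distrib_left) (intro sum.cong, auto simp: algebra_simps)
  thus ?thesis unfolding hdv_def by (intro lo_eq[OF lo_add[OF 2 3]]) (simp add: algebra_simps)
qed

lemma ctd_inverse: assumes "ctd n f x" "f x \<noteq> 0" shows "ctd n (\<lambda>y. inverse (f y)) x"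
proof -
  have "ctd n (\<lambda>y. (\<lambda>z. inverse (z ! 0)) (map (\<lambda>j. f y) [0..<1])) x"
    by (rule ctd_comp, rule hdv_ctd, rule hdv_inverse[OF hdv_nth]) (use assms in auto)
  thus ?thesis by simp
qed

lemma ctd_nonzero: assumes "ctd n f x" "f x \<noteq> 0" shows "eventually (\<lambda>y. f y \<noteq> 0) (nb n x)"
  using ctdD[OF assms(1), of "\<bar>f x\<bar>"] assms(2) by (auto elim: eventually_mono)

lemma ctd_pos: assumes "ctd n f x" "f x > 0" shows "eventually (\<lambda>y. f y > 0) (nb n x)"
  using ctdD[OF assms(1), of "f x"] assms(2) by (auto elim!: eventually_mono simp: abs_less_iff)

lemma reg_inverse: "reg p n f x ==> f x \<noteq> 0 ==> length x = n ==> reg p n (\<lambda>y. inverse (f y)) x"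
proof (induction p)
  case 0
  have "eventually (\<lambda>y. f y \<noteq> 0) (nb n x)" by (rule ctd_nonzero[OF reg_ctd[OF 0(1,3)] 0(2)])
  with reg_ev_ctd[OF 0(1)] show ?case unfolding reg.simps by eventually_elim (rule ctd_inverse)
next
  case (Suc p)
  obtain D where D: "eventually (\<lambda>y. hdv n f (\<lambda>i. D i y) y) (nb n x)" "\<forall>i<n. reg p n (D i) x" using Suc.prems(1) by auto
  have "eventually (\<lambda>y. f y \<noteq> 0) (nb n x)" by (rule ctd_nonzero[OF reg_ctd[OF Suc.prems(1,3)] Suc.prems(2)])
  with D(1) have "eventually (\<lambda>y. hdv n (\<lambda>y. inverse (f y)) (\<lambda>i. - (D i y * (inverse (f y) * inverse (f y)))) y) (nb n x)"
    by eventually_elim (rule hdv_inverse)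
  moreover have "reg p n (\<lambda>y. inverse (f y)) x" using Suc reg_dec by blast
  ultimately show ?case unfolding reg.simps using D(2)
    by (intro exI[of _ "\<lambda>i y. - (D i y * (inverse (f y) * inverse (f y)))"]) (simp add: reg_uminus reg_mult)
qed

lemma reg_divide: "reg p n f x ==> reg p n g x ==> g x \<noteq> 0 ==> length x = n ==> reg p n (\<lambda>y. f y / g y) x"
  unfolding divide_inverse by (intro reg_mult reg_inverse)

section \<open>Partial derivatives and definability of regularity\<close>

definition pdv :: "nat \<Rightarrow> ('r list \<Rightarrow> 'r) \<Rightarrow> nat \<Rightarrow> 'r list \<Rightarrow> 'r \<Rightarrow> bool" where
  "pdv n f i x D \<longleftrightarrow> dv1 (\<lambda>t. f (x[i := t])) (x ! i) D"

text \<open>A canonical value, 0 where no derivative exists: unlike the existentially quantified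
  gradient in \<open>reg\<close>, it is definable together with \<open>f\<close>.\<close>

definition pd :: "nat \<Rightarrow> nat \<Rightarrow> ('r list \<Rightarrow> 'r) \<Rightarrow> 'r list \<Rightarrow> 'r" where
  "pd n i f x = (if \<exists>D. pdv n f i x D then THE D. pdv n f i x D else 0)"

lemma pd_eq: "pdv n f i x D ==> pd n i f x = D"
  unfolding pd_def pdv_def using dv1_unique by (auto intro!: the_equality)

lemma hdv_pdv: assumes "hdv n f D x" "length x = n" "i < n" shows "pdv n f i x (D i)"
  unfolding pdv_def dv1_def
proof (intro allI impI)
  fix e :: 'r assume "e > 0"
  then obtain d where d: "d > 0" "\<forall>y\<in>Rn n. near n d x y --> \<bar>f y - f x - (\<Sum>j<n. D j * (y ! j - x ! j))\<bar> \<le> e * n1 n x y"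
    using assms(1) unfolding hdv_def lo_def eventually_nb by blast
  show "\<exists>d>0. \<forall>t. \<bar>t - x ! i\<bar> < d --> \<bar>f (x[i := t]) - f (x[i := x ! i]) - D i * (t - x ! i)\<bar> \<le> e * \<bar>t - x ! i\<bar>"
  proof (intro exI[of _ d] conjI allI impI d(1))
    fix t assume t: "\<bar>t - x ! i\<bar> < d"
    have c: "x[i := t] ! j - x ! j = (if j = i then t - x ! i else 0)" if "j < n" for j using that assms by simp
    have "near n d x (x[i := t])" unfolding near_def using c t d(1) by auto
    moreover have "(\<Sum>j<n. D j * (x[i := t] ! j - x ! j)) = (\<Sum>j<n. if j = i then D i * (t - x ! i) else 0)" using c by (intro sum.cong) auto
    moreover have "n1 n x (x[i := t]) = (\<Sum>j<n. if j = i then \<bar>t - x ! i\<bar> else 0)" unfolding n1_def using c by (intro sum.cong) auto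
    ultimately show "\<bar>f (x[i := t]) - f (x[i := x ! i]) - D i * (t - x ! i)\<bar> \<le> e * \<bar>t - x ! i\<bar>"
      using d(2)[rule_format, of "x[i := t]"] assms(2,3) by simp
  qed
qed

lemma hdv_pd: "hdv n f D x ==> length x = n ==> i < n ==> pd n i f x = D i"
  by (rule pd_eq[OF hdv_pdv])

lemma hdv_weaken: assumes "hdv n f D x" "\<And>i. i < n ==> D i = E i" shows "hdv n f E x"
proof -
  have "(\<Sum>i<n. D i * (y ! i - x ! i)) = (\<Sum>i<n. E i * (y ! i - x ! i))" for y using assms(2) by (intro sum.cong) auto
  thus ?thesis using assms(1) unfolding hdv_def by simp
qed

text \<open>Gradients are unique, so the one hidden in \<open>reg\<close> agrees near
  \<open>x\<close> with the partial derivatives. In this form \<open>reg\<close> becomes a definable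
  condition, and generic regularity becomes accessible to induction on the order.\<close>

lemma reg_Suc_pd: assumes "length x = n"
  shows "reg (Suc p) n f x \<longleftrightarrow> eventually (\<lambda>y. hdv n f (\<lambda>i. pd n i f y) y) (nb n x) \<and> (\<forall>i<n. reg p n (pd n i f) x)"
proof
  assume "reg (Suc p) n f x"
  then obtain D where D: "eventually (\<lambda>y. hdv n f (\<lambda>i. D i y) y) (nb n x)" "\<forall>i<n. reg p n (D i) x" by auto
  from D(1) ev_length[of n x] have eq: "eventually (\<lambda>y. \<forall>i<n. D i y = pd n i f y) (nb n x)"
    by eventually_elim (use hdv_pd in fastforce)
  with D(1) have "eventually (\<lambda>y. hdv n f (\<lambda>i. pd n i f y) y) (nb n x)"
    by eventually_elim (erule hdv_weaken, simp)
  moreover have "reg p n (pd n i f) x" if "i < n" for i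
    by (rule reg_cong[OF D(2)[rule_format, OF that]]) (use eq that in \<open>auto elim: eventually_mono\<close>)
  ultimately show "eventually (\<lambda>y. hdv n f (\<lambda>i. pd n i f y) y) (nb n x) \<and> (\<forall>i<n. reg p n (pd n i f) x)" by blast
qed auto

lemma mvt_sym:
  assumes f: "DF (\<lambda>e. f (e 0))"
    and dv: "\<And>w. min a b \<le> w ==> w \<le> max a b ==> \<exists>D. dv1 f w D \<and> \<bar>D - L\<bar> \<le> C"
  shows "\<bar>f b - f a - L * (b - a)\<bar> \<le> C * \<bar>b - a\<bar>"
proof -
  have ct: "ctd1 f w" if "min a b \<le> w" "w \<le> max a b" for w using dv[OF that] dv1_ctd1 by blast
  show ?thesis
  proof (cases a b rule: linorder_cases)
    case less
    have "\<bar>f b - f a - L * (b - a)\<bar> \<le> C * (b - a)"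
      by (rule mvt_abs[OF f less]) (use ct dv less in auto)
    thus ?thesis using less by simp
  next
    case greater
    have "\<bar>f a - f b - L * (a - b)\<bar> \<le> C * (a - b)"
      by (rule mvt_abs[OF f greater]) (use ct dv greater in auto)
    moreover have "f b - f a - L * (b - a) = - (f a - f b - L * (a - b))" by (simp add: algebra_simps)
    ultimately have "\<bar>f b - f a - L * (b - a)\<bar> \<le> C * (a - b)" by (metis abs_minus_cancel)
    thus ?thesis using greater by simp
  qed simp
qed

text \<open>Walk from \<open>x\<close> to \<open>y\<close> changing one coordinate at a time, and
  apply the one-variable mean value estimate on each leg. Continuity of the partial derivatives at
  \<open>x\<close> keeps each of them within \<open>e\<close> of its value there.\<close>

lemma C1_hdv:
  assumes f: "dfun n f" and len: "length x = n"
    and pdv: "eventually (\<lambda>y. \<forall>i<n. pdv n f i y (D i y)) (nb n x)" and ct: "\<And>i. i < n ==> ctd n (D i) x"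
  shows "hdv n f (\<lambda>i. D i x) x"
  unfolding hdv_def lo_def
proof (intro allI impI)
  fix e :: 'r assume e: "e > 0"
  have "\<forall>i\<in>{..<n}. eventually (\<lambda>y. \<bar>D i y - D i x\<bar> < e) (nb n x)" using ctdD[OF ct e] by auto
  hence "eventually (\<lambda>y. \<forall>i\<in>{..<n}. \<bar>D i y - D i x\<bar> < e) (nb n x)" by (intro eventually_ball_finite) auto
  with pdv have "eventually (\<lambda>y. \<forall>i<n. pdv n f i y (D i y) \<and> \<bar>D i y - D i x\<bar> \<le> e) (nb n x)"
    by eventually_elim (auto intro: less_imp_le)
  then obtain d where d: "d > 0" "\<forall>y\<in>Rn n. near n d x y --> (\<forall>i<n. pdv n f i y (D i y) \<and> \<bar>D i y - D i x\<bar> \<le> e)"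
    unfolding eventually_nb by blast
  show "eventually (\<lambda>y. \<bar>f y - f x - (\<Sum>i<n. D i x * (y ! i - x ! i))\<bar> \<le> e * n1 n x y) (nb n x)"
    unfolding eventually_nb
  proof (intro exI[of _ d] conjI d(1) ballI impI)
    fix y :: "'r list" assume y: "y \<in> Rn n" "near n d x y"
    define z where "z k = map (\<lambda>j. if j < k then y ! j else x ! j) [0..<n]" for k
    have z0: "z 0 = x" using len unfolding z_def by (intro nth_equalityI) auto
    have zn: "z n = y" using y(1) unfolding z_def by (intro nth_equalityI) auto
    have step: "\<bar>f (z (Suc k)) - f (z k) - D k x * (y ! k - x ! k)\<bar> \<le> e * \<bar>y ! k - x ! k\<bar>" if k: "k < n" for k
    proof -
      define g where "g t = f ((z k)[k := t])" for t
      have g: "DF (\<lambda>e. g (e 0))" unfolding g_def by (intro DF_app[OF f] DV_update DV_const DF_var) (simp add: z_def)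
      have "\<bar>g (y ! k) - g (x ! k) - D k x * (y ! k - x ! k)\<bar> \<le> e * \<bar>y ! k - x ! k\<bar>"
      proof (rule mvt_sym[OF g])
        fix w assume w: "min (x ! k) (y ! k) \<le> w" "w \<le> max (x ! k) (y ! k)"
        define u where "u = (z k)[k := w]"
        have yk: "\<bar>y ! k - x ! k\<bar> < d" using y(2) k unfolding near_def by simp
        hence "\<bar>w - x ! k\<bar> < d" using w by (cases "x ! k \<le> y ! k") (auto simp: abs_less_iff min_def max_def)
        moreover have "u ! i = (if i = k then w else if i < k then y ! i else x ! i)" if "i < n" for i
          unfolding u_def z_def using that by (cases "i = k") auto
        ultimately have "near n d x u" using y(2) d(1) unfolding near_def by auto
        moreover have lu: "length u = n" unfolding u_def z_def by simp
        ultimately have "pdv n f k u (D k u)" "\<bar>D k u - D k x\<bar> \<le> e" using d(2) k by auto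
        moreover have "u ! k = w" "(\<lambda>t. f (u[k := t])) = g" using k unfolding u_def g_def z_def by auto
        ultimately show "\<exists>D'. dv1 g w D' \<and> \<bar>D' - D k x\<bar> \<le> e" unfolding pdv_def by auto
      qed
      moreover have "(z k)[k := y ! k] = z (Suc k)" unfolding z_def using k by (intro nth_equalityI) (auto simp: nth_list_update less_Suc_eq)
      moreover have "(z k)[k := x ! k] = z k" unfolding z_def using k by (intro nth_equalityI) (auto simp: nth_list_update)
      ultimately show ?thesis unfolding g_def by simp
    qed
    have "f y - f x = (\<Sum>k<n. f (z (Suc k)) - f (z k))" using sum_lessThan_telescope[of "\<lambda>k. f (z k)" n] z0 zn by simp
    hence "f y - f x - (\<Sum>i<n. D i x * (y ! i - x ! i)) = (\<Sum>k<n. f (z (Suc k)) - f (z k) - D k x * (y ! k - x ! k))"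
      by (simp add: sum_subtractf)
    also have "\<bar>\<dots>\<bar> \<le> (\<Sum>k<n. \<bar>f (z (Suc k)) - f (z k) - D k x * (y ! k - x ! k)\<bar>)" by (rule sum_abs)
    also have "\<dots> \<le> (\<Sum>k<n. e * \<bar>y ! k - x ! k\<bar>)" using step by (intro sum_mono) auto
    finally show "\<bar>f y - f x - (\<Sum>i<n. D i x * (y ! i - x ! i))\<bar> \<le> e * n1 n x y" unfolding n1_def by (simp add: sum_distrib_left)
  qed
qed

lemma Dp_pdv: assumes f: "dfun n f" and v: "DV n v" and c: "DF c" and i: "i < n"
  shows "Dp (\<lambda>e. pdv n f i (v e) (c e))"
  unfolding pdv_def dv1_def
  by (intro Dp_all Dp_ex Dp_imp Dp_conj Dp_less Dp_le DF_mult DF_abs DF_diff DF_app[OF f] DV_update DF_var DF_const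
    DV_ren[OF v] DF_ren[OF c] DF_nth[OF DV_ren[OF v] i])

lemma dfun_pd: assumes f: "dfun n f" and i: "i < n" shows "dfun n (pd n i f)"
  unfolding dfun_def
proof (rule DF_graph)
  show "y = pd n i f (map e [0..<n]) \<longleftrightarrow> ((\<exists>D. pdv n f i (map e [0..<n]) D) --> pdv n f i (map e [0..<n]) y) \<and>
     (\<not> (\<exists>D. pdv n f i (map e [0..<n]) D) --> y = 0)" for e y
  proof (cases "\<exists>D. pdv n f i (map e [0..<n]) D")
    case True
    then obtain D where "pdv n f i (map e [0..<n]) D" by blast
    moreover from this have "pd n i f (map e [0..<n]) = D" by (rule pd_eq)
    ultimately show ?thesis using pd_eq[of n f i "map e [0..<n]" y] True by auto
  qed (simp add: pd_def)
  show "Dp (\<lambda>e. ((\<exists>D. pdv n f i (map (\<lambda>i. e (Suc i)) [0..<n]) D) --> pdv n f i (map (\<lambda>i. e (Suc i)) [0..<n]) (e 0)) \<and>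
     (\<not> (\<exists>D. pdv n f i (map (\<lambda>i. e (Suc i)) [0..<n]) D) --> e 0 = 0))"
    by (intro Dp_conj Dp_imp Dp_not Dp_ex Dp_eq Dp_pdv[OF f _ _ i] DV_map DF_var DF_const)
qed

lemma Dp_ctd: assumes f: "dfun n f" and v: "DV n v" shows "Dp (\<lambda>e. ctd n f (v e))"
  unfolding ctd_def
  by (intro Dp_all Dp_imp Dp_ev Dp_less DF_abs DF_diff DF_app[OF f] DV_ren[OF v] DV_map DF_var DF_const)

lemma Dp_hdv: assumes f: "dfun n f" and g: "\<And>i. i < n ==> dfun n (g i)" and v: "DV n v"
  shows "Dp (\<lambda>e. hdv n f (\<lambda>i. g i (v e)) (v e))"
  unfolding hdv_def lo_def n1_def
  by (intro Dp_all Dp_imp Dp_ev Dp_less Dp_le DF_abs DF_diff DF_sum DF_mult DF_app[OF f] DF_app[OF g] DF_nth[OF DV_ren[OF v]] DF_nth[OF DV_vars]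
    DV_ren[OF v] DV_map DF_var DF_const)

lemma Dp_reg: "dfun n f ==> DV n v ==> Dp (\<lambda>e. reg p n f (v e))"
proof (induction p arbitrary: f v)
  case 0
  show ?case unfolding reg.simps by (intro Dp_ev Dp_ctd 0 DV_map DF_var)
next
  case (Suc p)
  have l: "length (v e) = n" for e using Suc.prems(2) unfolding DV_def by blast
  have "Dp (\<lambda>e. eventually (\<lambda>y. hdv n f (\<lambda>i. pd n i f y) y) (nb n (v e)) \<and> (\<forall>i<n. reg p n (pd n i f) (v e)))"
    by (intro Dp_conj Dp_all_less Dp_ev Dp_hdv Suc.IH dfun_pd Suc.prems DV_map DF_var)
  thus ?case unfolding reg_Suc_pd[OF l] .
qed

lemma hdv_line: assumes "hdv n f D (map (\<lambda>i. a i + s * w i) [0..<n])"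
  shows "dv1 (\<lambda>s. f (map (\<lambda>i. a i + s * w i) [0..<n])) s (\<Sum>i<n. D i * w i)"
proof -
  have G: "hdv 1 (\<lambda>y. a j + y ! 0 * w j) (\<lambda>i. w j) [s]" for j
  proof -
    have "hdv 1 (\<lambda>y. a j + y ! 0 * w j) (\<lambda>i. 0 + ([s] ! 0 * 0 + (if i = 0 then 1 else 0) * w j)) [s]"
      by (intro hdv_add hdv_mult hdv_const hdv_nth) simp
    thus ?thesis by (rule hdv_weaken) simp
  qed
  have "hdv 1 (\<lambda>y. f (map (\<lambda>j. a j + y ! 0 * w j) [0..<n])) (\<lambda>i. \<Sum>j<n. D j * w j) [s]"
    by (rule hdv_comp) (use assms G in auto)
  from hdv_pdv[OF this, of 0] show ?thesis unfolding pdv_def by simp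
qed

lemma choice_vector:
  assumes "Dp (\<lambda>e. P (map (\<lambda>i. e (i + k)) [0..<n]) (map e [0..<k]))"
  shows "\<exists>z. (\<forall>x. length (z x) = k) \<and> (\<forall>j<k. dfun n (\<lambda>x. z x ! j)) \<and>
    (\<forall>x y. length x = n --> length y = k --> P x y --> P x (z x))"
proof (rule choice_fun[OF assms])
  fix z assume "\<And>x. length (z x) = k" "\<And>j. j < k ==> dfun n (\<lambda>x. z x ! j)"
    "\<And>x y. length x = n ==> length y = k ==> P x y ==> P x (z x)"
  thus ?thesis by (intro exI[of _ z] conjI allI impI) simp_all
qed

lemma choice_scalar:
  assumes "Dp (\<lambda>e. P (map (\<lambda>i. e (Suc i)) [0..<n]) (e 0))"
  shows "\<exists>z. dfun n z \<and> (\<forall>x y. length x = n --> P x y --> P x (z x))"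
proof -
  have "Dp (\<lambda>e. P (map (\<lambda>i. e (i + 1)) [0..<n]) (map e [0..<1] ! 0))" using assms by simp
  from choice_vector[of "\<lambda>x y. P x (y ! 0)", OF this] obtain z where z: "\<forall>j<1. dfun n (\<lambda>x. z x ! j)"
    "\<forall>x y. length x = n --> length y = 1 --> P x (y ! 0) --> P x (z x ! 0)" by (elim exE conjE)
  show ?thesis
  proof (intro exI[of _ "\<lambda>x. z x ! 0"] conjI allI impI)
    fix x y assume "length x = n" "P x y"
    thus "P x (z x ! 0)" using z(2)[rule_format, of x "[y]"] by simp
  qed (use z(1) in simp)
qed

definition cube :: "nat \<Rightarrow> 'r list \<Rightarrow> 'r \<Rightarrow> 'r list set" where
  "cube n c r = {y \<in> Rn n. near n r c y}"

subsection \<open>Generic regularity\<close>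

text \<open>Genericity replaces dimension theory: a definable set is small if its complement is generic. No cell decomposition is needed.\<close>

definition Gen :: "nat \<Rightarrow> ('r list \<Rightarrow> bool) \<Rightarrow> bool" where
  "Gen n P \<longleftrightarrow> (\<forall>U. open_in_Rn n U \<and> U \<noteq> {} --> (\<exists>V. open_in_Rn n V \<and> V \<noteq> {} \<and> V \<subseteq> U \<and> (\<forall>x\<in>V. P x)))"

lemma ev_coord_gt: assumes "i < n" "a < x ! i" shows "eventually (\<lambda>z. a < z ! i) (nb n x)"
proof -
  have "x ! i - a > 0" using assms by simp
  from ctdD[OF ctd_nth[OF assms(1)] this] show ?thesis by (rule eventually_mono) (simp add: abs_less_iff)
qed

lemma ev_coord_lt: assumes "i < n" "x ! i < a" shows "eventually (\<lambda>z. z ! i < a) (nb n x)"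
proof -
  have "a - x ! i > 0" using assms by simp
  from ctdD[OF ctd_nth[OF assms(1)] this] show ?thesis by (rule eventually_mono) (simp add: abs_less_iff)
qed

lemma ev_all_less: "(\<And>i. i < m ==> eventually (P i) F) ==> eventually (\<lambda>x. \<forall>i<(m::nat). P i x) F"
  using eventually_ball_finite[of "{..<m}" "\<lambda>x i. P i x" F] by (simp add: Ball_def)

lemma ev_near_open: assumes "near k r c y" "k \<le> n" shows "eventually (\<lambda>z. near k r c z) (nb n y)"
  unfolding near_def
proof (rule ev_all_less)
  fix i assume i: "i < k"
  hence "c ! i - r < y ! i" "y ! i < c ! i + r" using assms unfolding near_def by (auto simp: abs_less_iff)
  hence "eventually (\<lambda>z. c ! i - r < z ! i) (nb n y)" "eventually (\<lambda>z. z ! i < c ! i + r) (nb n y)"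
    using ev_coord_gt ev_coord_lt i assms(2) by auto
  thus "eventually (\<lambda>z. \<bar>z ! i - c ! i\<bar> < r) (nb n y)" by eventually_elim (simp add: abs_less_iff)
qed

lemma open_cube: "open_in_Rn n (cube n c r)"
  unfolding open_in_Rn_iff cube_def using ev_near_open[of n r c _ n] ev_length
  by (auto intro: eventually_conj)

lemma open_contains_cube: assumes "open_in_Rn n U" "x \<in> U" obtains r where "r > 0" "cube n x r \<subseteq> U"
  using assms unfolding open_in_Rn_iff eventually_nb cube_def by blast

lemma cube_center: "length c = n ==> r > 0 ==> c \<in> cube n c r"
  unfolding cube_def near_def by simp

lemma open_len: "open_in_Rn n U ==> x \<in> U ==> length x = n"
  unfolding open_in_Rn_def by auto

lemma open_ev: "open_in_Rn n U ==> x \<in> U ==> eventually (\<lambda>y. y \<in> U) (nb n x)"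
  unfolding open_in_Rn_iff by blast

lemma GenD: "Gen n P ==> open_in_Rn n U ==> U \<noteq> {} ==>
    \<exists>V. open_in_Rn n V \<and> V \<noteq> {} \<and> V \<subseteq> U \<and> (\<forall>x\<in>V. P x)"
  unfolding Gen_def by simp

lemma Gen_mono: "Gen n P ==> (\<And>x. length x = n ==> P x ==> Q x) ==> Gen n Q"
  unfolding Gen_def using open_len by meson

lemma Gen_conj: "Gen n P ==> Gen n Q ==> Gen n (\<lambda>x. P x \<and> Q x)"
  unfolding Gen_def[of n "\<lambda>x. P x \<and> Q x"]
proof (intro allI impI)
  fix U :: "'r list set" assume PQ: "Gen n P" "Gen n Q" and "open_in_Rn n U \<and> U \<noteq> {}"
  then obtain V where V: "open_in_Rn n V" "V \<noteq> {}" "V \<subseteq> U" "\<forall>x\<in>V. P x" using GenD[OF PQ(1)] by blast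
  obtain W where W: "open_in_Rn n W" "W \<noteq> {}" "W \<subseteq> V" "\<forall>x\<in>W. Q x" using GenD[OF PQ(2) V(1,2)] by blast
  show "\<exists>V. open_in_Rn n V \<and> V \<noteq> {} \<and> V \<subseteq> U \<and> (\<forall>x\<in>V. P x \<and> Q x)"
    using V W by (intro exI[of _ W]) auto
qed

lemma Gen_all_less: "(\<And>i. i < m ==> Gen n (P i)) ==> Gen n (\<lambda>x. \<forall>i<(m::nat). P i x)"
proof (induction m)
  case 0 show ?case unfolding Gen_def by auto
next
  case (Suc m)
  have "Gen n (\<lambda>x. (\<forall>i<m. P i x) \<and> P m x)" using Suc by (intro Gen_conj) auto
  thus ?case by (rule Gen_mono) (auto simp: less_Suc_eq)
qed

lemma Gen_ev: assumes "Gen n P" shows "Gen n (\<lambda>x. eventually P (nb n x))"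
  unfolding Gen_def
proof (intro allI impI)
  fix U :: "'r list set" assume "open_in_Rn n U \<and> U \<noteq> {}"
  then obtain V where V: "open_in_Rn n V" "V \<noteq> {}" "V \<subseteq> U" "\<forall>x\<in>V. P x" using GenD[OF assms] by blast
  have "eventually P (nb n x)" if "x \<in> V" for x using open_ev[OF V(1) that] by (rule eventually_mono) (use V in blast)
  thus "\<exists>V. open_in_Rn n V \<and> V \<noteq> {} \<and> V \<subseteq> U \<and> (\<forall>x\<in>V. eventually P (nb n x))" using V by blast
qed

section \<open>Dichotomy and generic continuity\<close>

definition dichot :: "nat \<Rightarrow> bool" where
  "dichot n \<longleftrightarrow> (\<forall>X\<in>S n. \<forall>U. open_in_Rn n U \<and> U \<noteq> {} -->
     (\<exists>V. open_in_Rn n V \<and> V \<noteq> {} \<and> V \<subseteq> U \<and> (V \<subseteq> X \<or> V \<inter> X = {})))"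

lemma dichotE: assumes "dichot n" "Dp (\<lambda>e. P (map e [0..<n]))" "open_in_Rn n U" "U \<noteq> {}"
  shows "\<exists>V. open_in_Rn n V \<and> V \<noteq> {} \<and> V \<subseteq> U \<and> ((\<forall>x\<in>V. P x) \<or> (\<forall>x\<in>V. \<not> P x))"
proof -
  have "{x \<in> Rn n. P x} \<in> S n" by (rule S_Collect[OF assms(2)])
  from assms(1)[unfolded dichot_def, rule_format, OF this, of U] assms(3,4)
  obtain V where V: "open_in_Rn n V" "V \<noteq> {}" "V \<subseteq> U" "V \<subseteq> {x \<in> Rn n. P x} \<or> V \<inter> {x \<in> Rn n. P x} = {}"
    by blast
  have "\<forall>x\<in>V. x \<in> Rn n" using open_len[OF V(1)] by simp
  hence "(\<forall>x\<in>V. P x) \<or> (\<forall>x\<in>V. \<not> P x)" using V(4) by blast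
  thus ?thesis using V(1-3) by blast
qed

text \<open>By the dichotomy every open set contains an open piece on which \<open>P\<close> has a
  constant truth value, and a single good point decides which one. Many generic statements below are
  proved by contradiction from this, with a definable selection of bad points.\<close>

lemma dichot_Gen: assumes "dichot n" "Dp (\<lambda>e. P (map e [0..<n]))"
  "\<And>U. open_in_Rn n U ==> U \<noteq> {} ==> \<exists>x\<in>U. P x" shows "Gen n P"
  unfolding Gen_def
proof (intro allI impI)
  fix U :: "'r list set" assume "open_in_Rn n U \<and> U \<noteq> {}"
  then obtain V where V: "open_in_Rn n V" "V \<noteq> {}" "V \<subseteq> U" "(\<forall>x\<in>V. P x) \<or> (\<forall>x\<in>V. \<not> P x)"
    using dichotE[OF assms(1,2)] by blast
  moreover obtain x where "x \<in> V" "P x" using assms(3)[OF V(1,2)] by blast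
  ultimately show "\<exists>V. open_in_Rn n V \<and> V \<noteq> {} \<and> V \<subseteq> U \<and> (\<forall>x\<in>V. P x)" by blast
qed

lemma DV_take: "DV m v ==> n \<le> m ==> DV n (\<lambda>e. take n (v e))"
  unfolding DV_def by auto

lemma snoc_take: "length z = Suc n ==> take n z @ [z ! n] = z"
  by (simp add: take_Suc_conv_app_nth[symmetric])

lemma dfun_snoc: assumes "dfun (Suc n) f" "DV n v" "DF t" shows "DF (\<lambda>e. f (v e @ [t e]))"
  by (rule DF_app[OF assms(1) DV_snoc[OF assms(2,3)]])

text \<open>Select the upper end \<open>\<beta>\<close> of the fibre interval definably. Where
  \<open>\<beta>\<close> is continuous it stays above some \<open>t1 > t0\<close>, and a thin box
  between these heights lies in \<open>Y\<close>.\<close>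

lemma open_over:
  assumes IH: "\<And>f. dfun n f ==> Gen n (ctd n f)" and Y: "Y \<in> S (Suc n)" and V1: "open_in_Rn n V1" "V1 \<noteq> {}"
    and c: "length c = n" "V1 \<subseteq> cube n c r" "r > 0"
    and A: "\<And>x. x \<in> V1 ==> \<exists>b>t0. \<forall>t. t0 < t \<and> t < b --> x @ [t] \<in> Y"
  shows "\<exists>V. open_in_Rn (Suc n) V \<and> V \<noteq> {} \<and> V \<subseteq> cube (Suc n) (c @ [t0]) r \<and> V \<subseteq> Y"
proof -
  let ?P = "\<lambda>x b. b > t0 \<and> (\<forall>t. t0 < t \<and> t < b --> x @ [t] \<in> Y)"
  have "Dp (\<lambda>e. ?P (map (\<lambda>i. e (Suc i)) [0..<n]) (e 0))"
    by (intro Dp_conj Dp_all Dp_imp Dp_less DF_const DF_var Dp_mem[OF Y] DV_snoc DV_map)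
  from choice_scalar[of ?P, OF this]
  obtain \<beta> where d\<beta>: "dfun n \<beta>" and z: "\<forall>x b. length x = n --> ?P x b --> ?P x (\<beta> x)" by (elim exE conjE)
  have \<beta>: "\<beta> x > t0" "\<And>t. t0 < t ==> t < \<beta> x ==> x @ [t] \<in> Y" if xV: "x \<in> V1" for x
  proof -
    obtain b where "b > t0" "\<forall>t. t0 < t \<and> t < b --> x @ [t] \<in> Y" using A[OF xV] by blast
    hence "?P x (\<beta> x)" using z[rule_format, of x b] open_len[OF V1(1) xV] by simp
    thus "\<beta> x > t0" "\<And>t. t0 < t ==> t < \<beta> x ==> x @ [t] \<in> Y" by auto
  qed
  from GenD[OF IH[OF d\<beta>] V1] obtain V2 where V2: "open_in_Rn n V2" "V2 \<noteq> {}" "V2 \<subseteq> V1" "\<forall>x\<in>V2. ctd n \<beta> x" by blast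
  obtain x0 where x0: "x0 \<in> V2" using V2(2) by blast
  have l0: "length x0 = n" using open_len V2(1) x0 by blast
  have "\<beta> x0 > t0" using \<beta>(1) x0 V2(3) by blast
  then obtain t1 where t1: "t0 < t1" "t1 < \<beta> x0" using dense by blast
  have "\<beta> x0 - t1 > 0" using t1 by simp
  from ctdD[OF V2(4)[rule_format, OF x0] this] open_ev[OF V2(1) x0]
  have "eventually (\<lambda>x. t1 < \<beta> x \<and> x \<in> V2) (nb n x0)" by eventually_elim (simp add: abs_less_iff)
  then obtain r2 where r2: "r2 > 0" "\<forall>x\<in>Rn n. near n r2 x0 x --> t1 < \<beta> x \<and> x \<in> V2" unfolding eventually_nb by blast
  \<comment> \<open>Capped by \<open>t0 + r\<close> so that the box stays in the prescribed
    cube.\<close>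
  define t2 where "t2 = min t1 (t0 + r)"
  have t2: "t0 < t2" using t1 c(3) unfolding t2_def by simp
  define V where "V = {w \<in> Rn (Suc n). near n r2 x0 w \<and> t0 < w ! n \<and> w ! n < t2}"
  have key: "near n r2 x0 (take n w)" "take n w \<in> Rn n" if "w \<in> V" for w using that unfolding V_def near_def by auto
  have "open_in_Rn (Suc n) V" unfolding open_in_Rn_iff
  proof (intro conjI ballI)
    show "V \<subseteq> Rn (Suc n)" unfolding V_def by auto
    fix w assume "w \<in> V"
    hence w: "near n r2 x0 w" "t0 < w ! n" "w ! n < t2" unfolding V_def by auto
    from ev_near_open[OF w(1), of "Suc n"] ev_coord_gt[of n "Suc n", OF _ w(2)] ev_coord_lt[of n "Suc n", OF _ w(3)] ev_length[of "Suc n" w]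
    show "eventually (\<lambda>y. y \<in> V) (nb (Suc n) w)" unfolding V_def by (auto intro!: eventually_conj)
  qed
  moreover have "V \<noteq> {}"
  proof -
    obtain t where "t0 < t" "t < t2" using dense[OF t2] by blast
    hence "x0 @ [t] \<in> V" unfolding V_def near_def using l0 r2(1) by (auto simp: nth_append)
    thus ?thesis by blast
  qed
  moreover have "V \<subseteq> cube (Suc n) (c @ [t0]) r"
  proof
    fix w assume w: "w \<in> V"
    hence l: "length w = Suc n" "t0 < w ! n" "w ! n < t0 + r" unfolding V_def t2_def by auto
    have "take n w \<in> cube n c r" using r2(2)[rule_format, OF key(2)[OF w] key(1)[OF w]] V2(3) c(2) by blast
    hence "\<bar>w ! i - c ! i\<bar> < r" if "i < n" for i using that unfolding cube_def near_def by auto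
    thus "w \<in> cube (Suc n) (c @ [t0]) r" unfolding cube_def near_def using l c(1) by (auto simp: nth_append less_Suc_eq)
  qed
  moreover have "V \<subseteq> Y"
  proof
    fix w assume w: "w \<in> V"
    hence l: "length w = Suc n" "t0 < w ! n" "w ! n < t1" unfolding V_def t2_def by auto
    have "t1 < \<beta> (take n w)" "take n w \<in> V1" using r2(2)[rule_format, OF key(2)[OF w] key(1)[OF w]] V2(3) by blast+
    hence "take n w @ [w ! n] \<in> Y" using \<beta>(2)[of "take n w" "w ! n"] l by simp
    thus "w \<in> Y" using snoc_take[OF l(1)] by simp
  qed
  ultimately show ?thesis by blast
qed

text \<open>Just above height \<open>t0\<close> the fibre of \<open>X\<close> over a base point is
  either full or empty. Which case occurs is a definable question about the base, hence constant on
  an open set; \<open>open_over\<close> then produces an open piece inside \<open>X\<close> or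
  inside its complement.\<close>

lemma dichot_Suc:
  assumes IH: "dichot n" "\<And>f. dfun n f ==> Gen n (ctd n f)" shows "dichot (Suc n)"
  unfolding dichot_def
proof (intro ballI allI impI)
  fix X U :: "'r list set" assume X: "X \<in> S (Suc n)" and "open_in_Rn (Suc n) U \<and> U \<noteq> {}"
  then obtain c where U: "open_in_Rn (Suc n) U" and c: "c \<in> U" by blast
  obtain r where r: "r > 0" "cube (Suc n) c r \<subseteq> U" by (rule open_contains_cube[OF U c])
  have lc: "length c = Suc n" using open_len U c by blast
  define c' where "c' = take n c"
  define t0 where "t0 = c ! n"
  have c': "c = c' @ [t0]" "length c' = n" using snoc_take[OF lc] lc unfolding c'_def t0_def by auto
  have XC: "Rn (Suc n) - X \<in> S (Suc n)" by (rule S_compl[OF X])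
  have "Dp (\<lambda>e. \<exists>b>t0. \<forall>t. t0 < t \<and> t < b --> map e [0..<n] @ [t] \<in> X)"
    by (intro Dp_ex Dp_conj Dp_all Dp_imp Dp_less DF_const DF_var Dp_mem[OF X] DV_snoc DV_map)
  from dichotE[OF IH(1) this open_cube[of n c' r]] cube_center[OF c'(2) r(1)]
  obtain V1 where V1: "open_in_Rn n V1" "V1 \<noteq> {}" "V1 \<subseteq> cube n c' r"
    and alt: "(\<forall>x\<in>V1. \<exists>b>t0. \<forall>t. t0 < t \<and> t < b --> x @ [t] \<in> X) \<or> (\<forall>x\<in>V1. \<not> (\<exists>b>t0. \<forall>t. t0 < t \<and> t < b --> x @ [t] \<in> X))" by blast
  from alt show "\<exists>V. open_in_Rn (Suc n) V \<and> V \<noteq> {} \<and> V \<subseteq> U \<and> (V \<subseteq> X \<or> V \<inter> X = {})"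
  proof
    assume "\<forall>x\<in>V1. \<exists>b>t0. \<forall>t. t0 < t \<and> t < b --> x @ [t] \<in> X"
    hence "\<exists>V. open_in_Rn (Suc n) V \<and> V \<noteq> {} \<and> V \<subseteq> cube (Suc n) (c' @ [t0]) r \<and> V \<subseteq> X"
      by (intro open_over[OF IH(2) X V1(1,2) c'(2) V1(3) r(1)]) auto
    thus ?thesis using r(2) c'(1) by blast
  next
    assume neg: "\<forall>x\<in>V1. \<not> (\<exists>b>t0. \<forall>t. t0 < t \<and> t < b --> x @ [t] \<in> X)"
    have "\<exists>b>t0. \<forall>t. t0 < t \<and> t < b --> x @ [t] \<in> Rn (Suc n) - X" if x: "x \<in> V1" for x
    proof -
      have lx: "length x = n" using open_len V1(1) x by blast
      have "Dp (\<lambda>e. x @ [e 0] \<in> X)" by (intro Dp_mem[OF X] DV_snoc DV_const lx DF_var)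
      from germ_right[OF this, of t0] neg x lx show ?thesis by auto
    qed
    hence "\<exists>V. open_in_Rn (Suc n) V \<and> V \<noteq> {} \<and> V \<subseteq> cube (Suc n) (c' @ [t0]) r \<and> V \<subseteq> Rn (Suc n) - X"
      by (intro open_over[OF IH(2) XC V1(1,2) c'(2) V1(3) r(1)]) auto
    thus ?thesis using r(2) c'(1) by blast
  qed
qed

definition lmono :: "('r \<Rightarrow> 'r \<Rightarrow> bool) \<Rightarrow> ('r \<Rightarrow> 'r) \<Rightarrow> 'r \<Rightarrow> bool" where
  "lmono R g t \<longleftrightarrow> (\<exists>d>0. \<forall>s u. t - d < s \<and> s < u \<and> u < t + d --> R (g s) (g u))"

lemma lmono_rg_lg: assumes "lmono R g t" shows "rg R g t" "lg R g t"
proof -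
  obtain d where d: "d > 0" "\<forall>s u. t - d < s \<and> s < u \<and> u < t + d --> R (g s) (g u)" using assms unfolding lmono_def by blast
  show "rg R g t" unfolding rg_def using d by (intro exI[of _ d]) auto
  show "lg R g t" unfolding lg_def using d by (intro exI[of _ d]) auto
qed

text \<open>After shrinking, \<open>f\<close> is continuous in the first \<open>n\<close> variables
  and, in the last one, continuous and locally monotone of one fixed type \<open>R\<close>. The
  value over \<open>x\<close> at a height near \<open>t0\<close> is then squeezed between the values
  over \<open>x\<close> at the two heights \<open>t0 - d'\<close> and \<open>t0 + d'\<close>, and
  these are controlled by continuity in \<open>x\<close> alone.\<close>

lemma ctd_Suc:
  assumes IH: "dichot n" "\<And>f. dfun n f ==> Gen n (ctd n f)" and f: "dfun (Suc n) f"
  shows "Gen (Suc n) (ctd (Suc n) f)"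
proof -
  have dS: "dichot (Suc n)" by (rule dichot_Suc[OF IH(1)]) (rule IH(2))
  show ?thesis
proof (rule dichot_Gen[OF dS])
  show "Dp (\<lambda>e. ctd (Suc n) f (map e [0..<Suc n]))" by (rule Dp_ctd[OF f DV_vars])
next
  fix U :: "'r list set" assume U: "open_in_Rn (Suc n) U" "U \<noteq> {}"
  note D = dichotE[OF dS]
  note fs = dfun_snoc[OF f]
  have vt: "DV n (\<lambda>e. take n (map (\<lambda>i. e (\<sigma> i)) [0..<Suc n]))" for \<sigma> :: "nat \<Rightarrow> nat"
    by (rule DV_take[OF DV_map]) (auto intro: DF_var)
  have vn: "DF (\<lambda>e. map (\<lambda>i. e (\<sigma> i)) [0..<Suc n] ! n)" for \<sigma> :: "nat \<Rightarrow> nat"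
    by (rule DF_nth[OF DV_map]) (auto intro: DF_var)
  let ?C1 = "\<lambda>z. ctd n (\<lambda>x. f (x @ [z ! n])) (take n z)"
  have d1: "Dp (\<lambda>e. ?C1 (map e [0..<Suc n]))" unfolding ctd_def
    by (intro Dp_all Dp_imp Dp_ev Dp_less DF_abs DF_diff fs vt vn DV_map DF_var DF_const)
  from D[OF d1 U] obtain V1 where V1: "open_in_Rn (Suc n) V1" "V1 \<noteq> {}" "V1 \<subseteq> U" "(\<forall>z\<in>V1. ?C1 z) \<or> (\<forall>z\<in>V1. \<not> ?C1 z)" by blast
  \<comment> \<open>Otherwise continuity in the first \<open>n\<close> variables fails on an open
    set, which contains a piece of a slice of constant height; there generic continuity in
    \<open>n\<close> variables applies.\<close>
  have C1: "\<forall>z\<in>V1. ?C1 z"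
  proof (rule ccontr)
    assume "\<not> ?thesis"
    hence neg: "\<forall>z\<in>V1. \<not> ?C1 z" using V1(4) by blast
    obtain z0 where z0: "z0 \<in> V1" using V1(2) by blast
    have l0: "length z0 = Suc n" using open_len V1(1) z0 by blast
    obtain r where r: "r > 0" "cube (Suc n) z0 r \<subseteq> V1" by (rule open_contains_cube[OF V1(1) z0])
    define t where "t = z0 ! n"
    have "dfun n (\<lambda>x. f (x @ [t]))" unfolding dfun_def by (intro fs DV_map DF_var DF_const)
    from GenD[OF IH(2)[OF this] open_cube[of n "take n z0" r]] cube_center[of "take n z0" n r] l0 r(1)
    obtain W where W: "W \<noteq> {}" "W \<subseteq> cube n (take n z0) r" "\<forall>x\<in>W. ctd n (\<lambda>x. f (x @ [t])) x" by auto
    obtain x where x: "x \<in> W" using W(1) by blast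
    hence "near n r (take n z0) x" "length x = n" using W(2) unfolding cube_def by auto
    hence "x @ [t] \<in> cube (Suc n) z0 r" unfolding cube_def near_def t_def using r(1) l0 by (auto simp: nth_append less_Suc_eq)
    hence "\<not> ?C1 (x @ [t])" using neg r(2) by blast
    thus False using W(3) x \<open>length x = n\<close> by (simp add: nth_append)
  qed
  let ?g = "\<lambda>z t. f (take n z @ [t])"
  let ?T = "\<lambda>R z. lmono R (?g z) (z ! n)"
  let ?Q = "\<lambda>z. ctd1 (?g z) (z ! n) \<and> (?T (<) z \<or> ?T (=) z \<or> ?T (>) z)"
  have dT: "Dp (\<lambda>e. ?T (<) (map e [0..<Suc n]))" "Dp (\<lambda>e. ?T (=) (map e [0..<Suc n]))" "Dp (\<lambda>e. ?T (>) (map e [0..<Suc n]))"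
    unfolding lmono_def
    by (intro Dp_ex Dp_all Dp_imp Dp_conj Dp_less Dp_eq DF_add DF_abs DF_diff fs vt vn DF_var DF_const)+
  have dQ: "Dp (\<lambda>e. ?Q (map e [0..<Suc n]))"
    by (intro Dp_conj Dp_disj dT, unfold ctd1_def)
      (intro Dp_ex Dp_all Dp_imp Dp_conj Dp_less DF_add DF_abs DF_diff fs vt vn DF_var DF_const)
  from D[OF dQ V1(1,2)] obtain V2 where V2: "open_in_Rn (Suc n) V2" "V2 \<noteq> {}" "V2 \<subseteq> V1" "(\<forall>z\<in>V2. ?Q z) \<or> (\<forall>z\<in>V2. \<not> ?Q z)" by blast
  have Q: "\<forall>z\<in>V2. ?Q z"
  proof (rule ccontr)
    assume "\<not> ?thesis"
    hence neg: "\<forall>z\<in>V2. \<not> ?Q z" using V2(4) by blast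
    obtain z0 where z0: "z0 \<in> V2" using V2(2) by blast
    have l0: "length z0 = Suc n" using open_len V2(1) z0 by blast
    obtain r where r: "r > 0" "cube (Suc n) z0 r \<subseteq> V2" by (rule open_contains_cube[OF V2(1) z0])
    have g: "DF (\<lambda>e. ?g z0 (e 0))" by (intro fs DV_const DF_var) (use l0 in simp)
    have lt: "z0 ! n < z0 ! n + r" using r(1) by simp
    obtain c d R where cd: "z0 ! n \<le> c" "c < d" "d \<le> z0 ! n + r" "R \<in> {(<), (=), (>)}"
      "\<And>x y. c < x ==> x < y ==> y < d ==> R (?g z0 x) (?g z0 y)" "\<And>x. c < x ==> x < d ==> ctd1 (?g z0) x"
      by (rule monotone_continuous_subinterval[OF g lt]) (rule that)
    obtain t where t: "c < t" "t < d" using dense[OF cd(2)] by blast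
    let ?z = "take n z0 @ [t]"
    have "?z \<in> cube (Suc n) z0 r" unfolding cube_def near_def using r(1) l0 t cd by (auto simp: nth_append less_Suc_eq)
    hence nQ: "\<not> ?Q ?z" using neg r(2) by blast
    have zz: "?g ?z = ?g z0" "?z ! n = t" using l0 by (auto simp: nth_append)
    have "lmono R (?g z0) t" unfolding lmono_def
      by (intro exI[of _ "min (t - c) (d - t)"]) (use t cd(5) in auto)
    moreover have "ctd1 (?g z0) t" using cd(6) t by blast
    ultimately have "?Q ?z" unfolding zz using cd(4) by auto
    thus False using nQ by simp
  qed
  from D[OF dT(1) V2(1,2)] obtain V3 where V3: "open_in_Rn (Suc n) V3" "V3 \<noteq> {}" "V3 \<subseteq> V2" "(\<forall>z\<in>V3. ?T (<) z) \<or> (\<forall>z\<in>V3. \<not> ?T (<) z)" by blast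
  from D[OF dT(2) V3(1,2)] obtain V where V: "open_in_Rn (Suc n) V" "V \<noteq> {}" "V \<subseteq> V3" "(\<forall>z\<in>V. ?T (=) z) \<or> (\<forall>z\<in>V. \<not> ?T (=) z)" by blast
  have "(\<forall>z\<in>V. ?T (<) z) \<or> (\<forall>z\<in>V. ?T (=) z) \<or> (\<forall>z\<in>V. ?T (>) z)" using V3(3,4) V(3,4) Q by blast
  then obtain R where R: "R \<in> {(<), (=), (>)}" "\<forall>z\<in>V. ?T R z" by blast
  have dR: "Dp (\<lambda>e. R c (g (e 0)))" if "DF (\<lambda>e. g (e 0))" for g c
    using R(1) by (elim insertE emptyE) (simp_all add: Dp_less Dp_eq DF_const that)
  have tR: "R a b ==> R b c ==> R a c" for a b c using R(1) by auto
  obtain z0 where z0: "z0 \<in> V" using V(2) by blast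
  have l0: "length z0 = Suc n" using open_len V(1) z0 by blast
  obtain r where r: "r > 0" "cube (Suc n) z0 r \<subseteq> V" by (rule open_contains_cube[OF V(1) z0])
  define x0 where "x0 = take n z0"
  define t0 where "t0 = z0 ! n"
  have lx0: "length x0 = n" and z0eq: "z0 = x0 @ [t0]" using l0 snoc_take[OF l0] unfolding x0_def t0_def by auto
  have inV: "x @ [t] \<in> V" if "length x = n" "near n r x0 x" "\<bar>t - t0\<bar> < r" for x t
    using r(2) that lx0 unfolding cube_def near_def z0eq by (auto simp: nth_append less_Suc_eq subset_iff)
  \<comment> \<open>Local monotonicity of a single type at every point of a vertical segment becomes
    monotonicity along the whole segment.\<close>
  have mono: "R (f (x @ [s])) (f (x @ [u]))" if x: "length x = n" "near n r x0 x" and su: "t0 - r < s" "s < u" "u < t0 + r" for x s u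
  proof (rule local_to_global[of R "\<lambda>t. f (x @ [t])" "t0 - r" "t0 + r"])
    show "Dp (\<lambda>e. R c (f (x @ [e 0])))" for c by (rule dR) (intro fs DV_const x DF_var)
    show "lg R (\<lambda>t. f (x @ [t])) t \<and> rg R (\<lambda>t. f (x @ [t])) t" if "t0 - r < t" "t < t0 + r" for t
    proof -
      have "x @ [t] \<in> V" using inV[OF x] that by (simp add: abs_less_iff)
      hence "?T R (x @ [t])" using R(2) by blast
      hence "lmono R (\<lambda>t. f (x @ [t])) t" using x(1) by (simp add: nth_append)
      thus ?thesis using lmono_rg_lg by blast
    qed
  qed (use su tR in auto)
  have "ctd (Suc n) f z0" unfolding ctd_def
  proof (intro allI impI)
    fix e :: 'r assume "e > 0"
    hence e: "e / 2 > 0" by simp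
    have "ctd1 (?g z0) (z0 ! n)" using Q z0 V(3) V3(3) by blast
    hence "ctd1 (\<lambda>t. f (x0 @ [t])) t0" unfolding x0_def t0_def .
    from ctd1D[OF this e] obtain d where d: "d > 0" "\<forall>t. \<bar>t - t0\<bar> < d --> \<bar>f (x0 @ [t]) - f z0\<bar> < e / 2" unfolding z0eq by blast
    define d' where "d' = min d r / 2"
    have d': "d' > 0" "d' < d" "d' < r" using d(1) r(1) unfolding d'_def by (auto simp: min_def)
    have ev: "eventually (\<lambda>x. \<bar>f (x @ [t]) - f z0\<bar> < e) (nb n x0)" if t: "\<bar>t - t0\<bar> = d'" for t
    proof -
      have "x0 @ [t] \<in> V" using inV[OF lx0, of t] t d' r(1) by (simp add: near_def)
      hence "?C1 (x0 @ [t])" using C1 V(3) V3(3) V2(3) by blast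
      hence "ctd n (\<lambda>x. f (x @ [t])) x0" using lx0 by (simp add: nth_append)
      from ctdD[OF this e] show ?thesis
      proof eventually_elim
        case (elim x)
        have "\<bar>f (x0 @ [t]) - f z0\<bar> < e / 2" using d(2) t d' by simp
        moreover have "e = e / 2 + e / 2" by simp
        ultimately show ?case using elim by linarith
      qed
    qed
    have "\<bar>t0 - d' - t0\<bar> = d'" "\<bar>t0 + d' - t0\<bar> = d'" using d'(1) by auto
    from ev[OF this(1)] ev[OF this(2)] ev_near[OF r(1), of n x0]
    have "eventually (\<lambda>x. \<bar>f (x @ [t0 - d']) - f z0\<bar> < e \<and> \<bar>f (x @ [t0 + d']) - f z0\<bar> < e \<and> near n r x0 x) (nb n x0)" by eventually_elim simp
    then obtain r' where r': "r' > 0" "\<forall>x\<in>Rn n. near n r' x0 x --> \<bar>f (x @ [t0 - d']) - f z0\<bar> < e \<and> \<bar>f (x @ [t0 + d']) - f z0\<bar> < e \<and> near n r x0 x"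
      unfolding eventually_nb by blast
    show "eventually (\<lambda>z. \<bar>f z - f z0\<bar> < e) (nb (Suc n) z0)" unfolding eventually_nb
    proof (intro exI[of _ "min r' d'"] conjI ballI impI)
      fix z :: "'r list" assume z: "z \<in> Rn (Suc n)" "near (Suc n) (min r' d') z0 z"
      define x where "x = take n z"
      define t where "t = z ! n"
      have zeq: "z = x @ [t]" and lx: "length x = n" using snoc_take[of z n] z(1) unfolding x_def t_def by auto
      have nx: "near n r' x0 x" using z(2) lx lx0 unfolding near_def zeq z0eq by (auto simp: nth_append less_Suc_eq)
      have "\<bar>t - t0\<bar> < d'" using z(2) lx lx0 unfolding near_def zeq z0eq by (auto simp: nth_append)
      hence t: "t0 - d' < t" "t < t0 + d'" by (auto simp: abs_less_iff)
      have b: "\<bar>f (x @ [t0 - d']) - f z0\<bar> < e" "\<bar>f (x @ [t0 + d']) - f z0\<bar> < e" "near n r x0 x" using r'(2) nx lx by auto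
      have "R (f (x @ [t0 - d'])) (f (x @ [t]))" "R (f (x @ [t])) (f (x @ [t0 + d']))"
        using mono[OF lx b(3)] t d' by auto
      thus "\<bar>f z - f z0\<bar> < e" unfolding zeq using R(1) b(1,2) by (auto simp: abs_less_iff)
    qed (use r' d' in simp)
  qed
  moreover have "z0 \<in> U" using z0 V(3) V3(3) V2(3) V1(3) by blast
  ultimately show "\<exists>x\<in>U. ctd (Suc n) f x" by blast
qed
qed

lemma Rn0: "open_in_Rn 0 (U :: 'r list set) ==> U \<noteq> {} ==> U = {[]}"
  unfolding open_in_Rn_def by (auto simp: Rn_def)

text \<open>The two statements feed each other: the dichotomy for \<open>n + 1\<close> needs
  continuous end points over \<open>n\<close> coordinates, and generic continuity for
  \<open>n + 1\<close> needs the dichotomy for \<open>n + 1\<close>.\<close>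

lemma dichot_and_ctd: "dichot n \<and> (\<forall>f. dfun n f --> Gen n (ctd n f))"
proof (induction n)
  case 0
  have "dichot 0" unfolding dichot_def
  proof (intro ballI allI impI)
    fix X U :: "'r list set" assume "open_in_Rn 0 U \<and> U \<noteq> {}"
    moreover from this have "U = {[]}" using Rn0 by blast
    ultimately show "\<exists>V. open_in_Rn 0 V \<and> V \<noteq> {} \<and> V \<subseteq> U \<and> (V \<subseteq> X \<or> V \<inter> X = {})" by (intro exI[of _ U]) auto
  qed
  moreover have "Gen 0 (ctd 0 f)" for f unfolding Gen_def
  proof (intro allI impI)
    fix U :: "'r list set" assume "open_in_Rn 0 U \<and> U \<noteq> {}"
    moreover from this have "U = {[]}" using Rn0 by blast
    moreover have "ctd 0 f []" unfolding ctd_def eventually_nb by (auto intro: exI[of _ 1])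
    ultimately show "\<exists>V. open_in_Rn 0 V \<and> V \<noteq> {} \<and> V \<subseteq> U \<and> (\<forall>x\<in>V. ctd 0 f x)" by (intro exI[of _ U]) auto
  qed
  ultimately show ?case by blast
next
  case (Suc n)
  hence IH: "dichot n" "\<And>f. dfun n f ==> Gen n (ctd n f)" by auto
  have "dichot (Suc n)" by (rule dichot_Suc[OF IH(1)]) (rule IH(2))
  moreover have "Gen (Suc n) (ctd (Suc n) f)" if "dfun (Suc n) f" for f by (rule ctd_Suc[OF IH(1) _ that]) (rule IH(2))
  ultimately show ?case by blast
qed

lemmas dichotomy = dichotE[OF dichot_and_ctd[THEN conjunct1]]
lemmas GenI = dichot_Gen[OF dichot_and_ctd[THEN conjunct1]]

lemma Gen_ctd: "dfun n f ==> Gen n (ctd n f)"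
  using dichot_and_ctd by blast

section \<open>Generic differentiability\<close>

text \<open>On a line parallel to axis \<open>i\<close> inside the given open set, the one-variable
  theorem supplies a point of differentiability, and \<open>GenI\<close> asks for one point
  only.\<close>

lemma Gen_pdv: assumes f: "dfun n f" and i: "i < n" shows "Gen n (\<lambda>x. pdv n f i x (pd n i f x))"
proof -
  have "Gen n (\<lambda>x. \<exists>D. pdv n f i x D)"
  proof (rule GenI)
    show "Dp (\<lambda>e. \<exists>D. pdv n f i (map e [0..<n]) D)" by (intro Dp_ex Dp_pdv[OF f _ _ i] DV_map DF_var)
    fix U :: "'r list set" assume "open_in_Rn n U" "U \<noteq> {}"
    then obtain x where U: "open_in_Rn n U" and x: "x \<in> U" by blast
    have lx: "length x = n" using open_len U x by blast
    obtain r where r: "r > 0" "cube n x r \<subseteq> U" by (rule open_contains_cube[OF U x])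
    have g: "DF (\<lambda>e. f (x[i := e 0]))" by (intro DF_app[OF f] DV_update DV_const lx DF_var)
    have "x ! i < x ! i + r" using r(1) by simp
    from differentiable_subinterval[OF g this] obtain c d where cd: "x ! i \<le> c" "c < d" "d \<le> x ! i + r"
      "\<forall>t. c < t \<and> t < d --> (\<exists>D. dv1 (\<lambda>t. f (x[i := t])) t D)" by blast
    obtain t where t: "c < t" "t < d" using dense[OF cd(2)] by blast
    have "\<bar>x[i := t] ! j - x ! j\<bar> < r" if "j < n" for j using that lx t cd r(1) by (cases "j = i") auto
    hence "x[i := t] \<in> U" using r(2) lx unfolding cube_def near_def by auto
    moreover have "\<exists>D. pdv n f i (x[i := t]) D" unfolding pdv_def using cd(4) t lx i by simp
    ultimately show "\<exists>x\<in>U. \<exists>D. pdv n f i x D" by blast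
  qed
  thus ?thesis
  proof (rule Gen_mono)
    fix x assume "\<exists>D. pdv n f i x D"
    then obtain D where D: "pdv n f i x D" by blast
    thus "pdv n f i x (pd n i f x)" using pd_eq[OF D] by simp
  qed
qed

text \<open>At a generic point the partial derivatives exist nearby and, by the induction
  hypothesis, are continuous nearby, so \<open>C1_hdv\<close> yields total derivatives.\<close>

lemma Gen_reg: "dfun n f ==> Gen n (reg p n f)"
proof (induction p arbitrary: f)
  case 0 show ?case using Gen_ev[OF Gen_ctd[OF 0]] by simp
next
  case (Suc p)
  have 1: "Gen n (\<lambda>x. eventually (\<lambda>y. \<forall>i<n. pdv n f i y (pd n i f y)) (nb n x))" by (intro Gen_ev Gen_all_less Gen_pdv Suc.prems)
  have 2: "Gen n (\<lambda>x. \<forall>i<n. reg p n (pd n i f) x)" by (intro Gen_all_less Suc.IH dfun_pd Suc.prems)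
  have "Gen n (\<lambda>x. eventually (\<lambda>y. hdv n f (\<lambda>i. pd n i f y) y) (nb n x) \<and> (\<forall>i<n. reg p n (pd n i f) x))"
  proof (rule Gen_mono[OF Gen_conj[OF 1 2]])
    fix x assume lx: "length x = n" and x: "eventually (\<lambda>y. \<forall>i<n. pdv n f i y (pd n i f y)) (nb n x) \<and> (\<forall>i<n. reg p n (pd n i f) x)"
    have "eventually (\<lambda>y. \<forall>i<n. ctd n (pd n i f) y) (nb n x)" by (rule ev_all_less) (use x reg_ev_ctd in blast)
    with ev_ev[OF conjunct1[OF x]] ev_length[of n x] have "eventually (\<lambda>y. hdv n f (\<lambda>i. pd n i f y) y) (nb n x)"
      by eventually_elim (rule C1_hdv[OF Suc.prems], auto)
    thus "eventually (\<lambda>y. hdv n f (\<lambda>i. pd n i f y) y) (nb n x) \<and> (\<forall>i<n. reg p n (pd n i f) x)" using x by blast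
  qed
  thus ?case by (rule Gen_mono) (rule iffD2[OF reg_Suc_pd])
qed

subsection \<open>Covering open sets by bump functions\<close>

text \<open>Regularity is asked only where \<open>h\<close> is positive, since the constructions
  below establish only continuity at the zeros. The bound by 1 allows composition with functions
  that are controlled only on an interval around \<open>(0, 1]\<close>.\<close>

definition nice :: "nat \<Rightarrow> nat \<Rightarrow> ('r list \<Rightarrow> 'r) \<Rightarrow> bool" where
  "nice p n h \<longleftrightarrow> dfun n h \<and> (\<forall>x\<in>Rn n. 0 \<le> h x \<and> h x \<le> 1) \<and> (\<forall>x\<in>Rn n. ctd n h x) \<and>
     (\<forall>e>0. \<exists>B. \<forall>x\<in>Rn n. e \<le> h x --> (\<forall>i<n. \<bar>x ! i\<bar> \<le> B)) \<and> (\<forall>x\<in>Rn n. 0 < h x --> reg p n h x)"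

definition supp :: "nat \<Rightarrow> ('r list \<Rightarrow> 'r) \<Rightarrow> 'r list set" where
  "supp n h = {x \<in> Rn n. 0 < h x}"

text \<open>Supports must lie in \<open>W\<close>, while only \<open>Z\<close> has to be covered;
  separating the two sets allows different parts of \<open>W\<close> to be treated by different
  constructions.\<close>

definition covered :: "nat \<Rightarrow> nat \<Rightarrow> 'r list set \<Rightarrow> 'r list set \<Rightarrow> bool" where
  "covered p n W Z \<longleftrightarrow> (\<exists>H. finite H \<and> (\<forall>h\<in>H. nice p n h \<and> supp n h \<subseteq> W) \<and> Z \<subseteq> (\<Union>h\<in>H. supp n h))"

definition prj :: "nat list \<Rightarrow> 'r list \<Rightarrow> 'r list" where
  "prj js z = map (\<lambda>j. z ! (js ! j)) [0..<length js]"

text \<open>Both covering properties are proved by a simultaneous induction: each construction succeeds off a small set, and the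
  part lying over the exceptional set is finite-to-one over one coordinate fewer, so that \<open>fibre_covered\<close> applies to it.\<close>

definition open_covered :: "nat \<Rightarrow> nat \<Rightarrow> bool" where
  "open_covered p n \<longleftrightarrow> (\<forall>W\<in>S n. open_in_Rn n W --> covered p n W W)"

definition fibre_covered :: "nat \<Rightarrow> nat \<Rightarrow> bool" where
  "fibre_covered p d \<longleftrightarrow> (\<forall>m js W Z. length js = d --> set js \<subseteq> {..<m} --> W \<in> S m --> open_in_Rn m W --> Z \<in> S m --> Z \<subseteq> W -->
     (\<forall>x. finite {z \<in> Z. prj js z = x}) --> covered p m W Z)"

lemma covered_empty: "covered p n W {}"
  unfolding covered_def by (intro exI[of _ "{}"]) auto

lemma covered_subset: "covered p n W Z ==> Z' \<subseteq> Z ==> covered p n W Z'"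
  unfolding covered_def by (meson subset_trans)

lemma covered_Un: assumes "covered p n W Z" "covered p n W Z'" shows "covered p n W (Z \<union> Z')"
proof -
  obtain H where H: "finite H" "\<forall>h\<in>H. nice p n h \<and> supp n h \<subseteq> W" "Z \<subseteq> (\<Union>h\<in>H. supp n h)" using assms(1) unfolding covered_def by (elim exE conjE)
  obtain H' where H': "finite H'" "\<forall>h\<in>H'. nice p n h \<and> supp n h \<subseteq> W" "Z' \<subseteq> (\<Union>h\<in>H'. supp n h)" using assms(2) unfolding covered_def by (elim exE conjE)
  show ?thesis unfolding covered_def by (rule exI[of _ "H \<union> H'"]) (use H H' in auto)
qed

lemma covered_UN: "finite L ==> (\<And>l. l \<in> L ==> covered p n W (Z l)) ==> covered p n W (\<Union>l\<in>L. Z l)"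
  by (induction L rule: finite_induct) (auto simp: covered_empty intro: covered_Un)

lemma prj_length [simp]: "length (prj js z) = length js"
  unfolding prj_def by simp

lemma prj_nth [simp]: "j < length js ==> prj js z ! j = z ! (js ! j)"
  unfolding prj_def by simp

lemma js_nth: "set js \<subseteq> {..<m} ==> j < length js ==> js ! j < m"
  using nth_mem by blast

lemma DV_prj: assumes "set js \<subseteq> {..<m}" "DV m v" shows "DV (length js) (\<lambda>e. prj js (v e))"
  unfolding prj_def by (intro DV_map DF_nth[OF assms(2)] js_nth[OF assms(1)])

lemma ctd_prj: assumes "set js \<subseteq> {..<m}" "ctd (length js) f (prj js y)" shows "ctd m (\<lambda>y. f (prj js y)) y"
  using ctd_comp[of "length js" f "\<lambda>j y. y ! (js ! j)" y m] assms ctd_nth[OF js_nth[OF assms(1)]] unfolding prj_def by blast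

lemma reg_prj: assumes "set js \<subseteq> {..<m}" "reg p (length js) f (prj js y)" "length y = m" shows "reg p m (\<lambda>y. f (prj js y)) y"
  using reg_comp[of p "length js" f "\<lambda>j y. y ! (js ! j)" y m] assms reg_nth[OF js_nth[OF assms(1)]] unfolding prj_def by blast

lemma ev_prj: assumes "set js \<subseteq> {..<m}" "eventually P (nb (length js) (prj js y))" shows "eventually (\<lambda>y. P (prj js y)) (nb m y)"
  using ev_comp[of P "length js" "\<lambda>j y. y ! (js ! j)" y m] assms ctd_nth[OF js_nth[OF assms(1)]] unfolding prj_def by blast

section \<open>Lifting bump functions from the base\<close>

text \<open>\<open>k\<close> behaves well only over generic points of the base. Its products with
  \<open>h \<circ> prj js\<close>, for bump functions \<open>h\<close> covering the good open set
  \<open>G\<close> of the base, behave well everywhere. The hypothesis on \<open>e\<close> and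
  \<open>B\<close> bounds \<open>y\<close> once \<open>k y\<close> is not small and its base point
  is bounded, which makes the superlevel sets of the products bounded.\<close>

lemma lift_nice:
  assumes js: "set js \<subseteq> {..<m}" "length js = d" and CL: "open_covered p d" and k: "dfun m k" "\<And>y. length y = m ==> 0 \<le> k y \<and> k y \<le> 1"
    and W: "\<And>y. length y = m ==> 0 < k y ==> y \<in> W"
    and bd: "\<And>e B. e > 0 ==> \<exists>B'. \<forall>y\<in>Rn m. e \<le> k y --> (\<forall>i<d. \<bar>prj js y ! i\<bar> \<le> B) --> (\<forall>i<m. \<bar>y ! i\<bar> \<le> B')"
    and good: "Gen d (\<lambda>x. \<forall>y\<in>Rn m. prj js y = x --> ctd m k y \<and> (0 < k y --> reg p m k y))"
  shows "\<exists>G. G \<in> S d \<and> open_in_Rn d G \<and> Gen d (\<lambda>x. x \<in> G) \<and> covered p m W {y \<in> Rn m. 0 < k y \<and> prj js y \<in> G}"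
proof -
  define P where "P x \<longleftrightarrow> (\<forall>y\<in>Rn m. prj js y = x --> ctd m k y \<and> (0 < k y --> reg p m k y))" for x
  define G where "G = {x \<in> Rn d. eventually P (nb d x)}"
  have eqP: "P x \<longleftrightarrow> (\<forall>y\<in>Rn m. (\<forall>j<d. prj js y ! j = x ! j) --> ctd m k y \<and> (0 < k y --> reg p m k y))" if "length x = d" for x
  proof -
    have "prj js y = x \<longleftrightarrow> (\<forall>j<d. prj js y ! j = x ! j)" for y using that js(2) by (auto simp: list_eq_iff_nth_eq)
    thus ?thesis unfolding P_def by simp
  qed
  have "Dp (\<lambda>e. \<forall>y\<in>Rn m. (\<forall>j<d. prj js y ! j = map (\<lambda>i. e (\<sigma> i)) [0..<d] ! j) --> ctd m k y \<and> (0 < k y --> reg p m k y))" for \<sigma> :: "nat \<Rightarrow> nat"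
    by (intro Dp_allv Dp_imp Dp_all_less Dp_conj Dp_eq Dp_less Dp_ctd Dp_reg k DF_app[OF k(1)] DV_map DF_var DF_const
      DF_nth[OF DV_prj[OF js(1) DV_vars, unfolded js(2)]] DF_nth[OF DV_map])
  hence dP: "Dp (\<lambda>e. P (map (\<lambda>i. e (\<sigma> i)) [0..<d]))" for \<sigma> by (simp add: eqP)
  have G: "G \<in> S d" unfolding G_def by (rule S_Collect, rule Dp_ev[OF DV_vars], rule dP)
  have oG: "open_in_Rn d G" unfolding open_in_Rn_iff G_def
    using ev_ev[of P d] ev_length[of d] by (auto intro: eventually_conj)
  have genG: "Gen d (\<lambda>x. x \<in> G)"
    by (rule Gen_mono[OF Gen_ev[OF good[folded P_def]]]) (simp add: G_def)
  have GP: "P x" if "x \<in> G" for x using that ev_self[of P d x] unfolding G_def by auto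
  obtain H where H: "finite H" "\<forall>h\<in>H. nice p d h \<and> supp d h \<subseteq> G" "G \<subseteq> (\<Union>h\<in>H. supp d h)"
    using CL G oG unfolding open_covered_def covered_def by (metis (no_types, lifting))
  define L where "L h y = h (prj js y) * k y" for h y
  have nl: "nice p m (L h)" and sl: "supp m (L h) = {y \<in> Rn m. 0 < k y \<and> prj js y \<in> supp d h}" if h: "h \<in> H" for h
  proof -
    have n: "nice p d h" and s: "supp d h \<subseteq> G" using H(2) h by auto
    have h01: "0 \<le> h (prj js y) \<and> h (prj js y) \<le> 1" for y using n js(2) unfolding nice_def by simp
    show sl: "supp m (L h) = {y \<in> Rn m. 0 < k y \<and> prj js y \<in> supp d h}"
    proof -
      have "0 < L h y \<longleftrightarrow> 0 < k y \<and> prj js y \<in> supp d h" if "length y = m" for y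
        unfolding L_def supp_def using h01[of y] k(2)[OF that] js(2) by (auto simp: zero_less_mult_iff)
      thus ?thesis unfolding supp_def[of m] by auto
    qed
    show "nice p m (L h)" unfolding nice_def
    proof (intro conjI ballI allI impI)
      show "dfun m (L h)" unfolding dfun_def L_def
        using n k(1) DV_prj[OF js(1) DV_vars] js(2) unfolding nice_def by (intro DF_mult DF_app[of d h] DF_app[of m k] DV_vars) auto
      fix y :: "'r list" assume "y \<in> Rn m"
      hence ly: "length y = m" by simp
      show "0 \<le> L h y" "L h y \<le> 1" unfolding L_def using h01[of y] k(2)[OF ly] by (auto intro: mult_le_one)
      have ch: "ctd m (\<lambda>y. h (prj js y)) y" by (rule ctd_prj[OF js(1)]) (use n js(2) in \<open>auto simp: nice_def\<close>)
      show "ctd m (L h) y"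
      proof (cases "prj js y \<in> G")
        case True
        hence "ctd m k y" using GP[OF True] ly unfolding P_def by simp
        thus ?thesis unfolding L_def by (intro ctd_mult ch)
      next
        \<comment> \<open>Over a base point outside \<open>G\<close> the factor \<open>h\<close>
          vanishes, and \<open>k \<le> 1\<close> makes the product tend to zero even if
          \<open>k\<close> is discontinuous.\<close>
        case False
        hence "prj js y \<notin> supp d h" using s by blast
        hence h0: "h (prj js y) = 0" unfolding supp_def using h01[of y] js(2) by simp
        show ?thesis unfolding ctd_def
        proof (intro allI impI)
          fix e :: 'r assume "e > 0"
          from ctdD[OF ch this] ev_length[of m y] show "eventually (\<lambda>z. \<bar>L h z - L h y\<bar> < e) (nb m y)"
          proof eventually_elim
            case (elim z)
            have "\<bar>L h z\<bar> \<le> \<bar>h (prj js z)\<bar>" unfolding L_def abs_mult using k(2)[OF elim(2)] by (simp add: mult_left_le)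
            thus ?case using elim(1) h0 unfolding L_def by simp
          qed
        qed
      qed
      show "reg p m (L h) y" if "0 < L h y"
      proof -
        have "y \<in> supp m (L h)" unfolding supp_def[of m] using ly that by simp
        hence y: "0 < k y" "prj js y \<in> supp d h" unfolding sl by simp_all
        have "prj js y \<in> G" using y(2) s by blast
        from GP[OF this, unfolded P_def, rule_format, of y] have "reg p m k y" using y(1) ly by simp
        moreover have "reg p m (\<lambda>y. h (prj js y)) y"
          by (rule reg_prj[OF js(1) _ ly]) (use n y(2) js(2) in \<open>auto simp: nice_def supp_def\<close>)
        ultimately show ?thesis unfolding L_def by (intro reg_mult)
      qed
    next
      fix e :: 'r assume e: "e > 0"
      obtain B where B: "\<forall>x\<in>Rn d. e \<le> h x --> (\<forall>i<d. \<bar>x ! i\<bar> \<le> B)" using n e unfolding nice_def by metis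
      obtain B' where B': "\<forall>y\<in>Rn m. e \<le> k y --> (\<forall>i<d. \<bar>prj js y ! i\<bar> \<le> B) --> (\<forall>i<m. \<bar>y ! i\<bar> \<le> B')" using bd[OF e] by blast
      show "\<exists>B. \<forall>x\<in>Rn m. e \<le> L h x --> (\<forall>i<m. \<bar>x ! i\<bar> \<le> B)"
      proof (intro exI[of _ B'] ballI impI)
        fix y :: "'r list" assume y: "y \<in> Rn m" "e \<le> L h y"
        have "L h y \<le> h (prj js y)" "L h y \<le> k y" unfolding L_def using h01[of y] k(2)[of y] y(1)
          by (auto simp: mult_left_le mult_left_le_one_le)
        hence "e \<le> h (prj js y)" "e \<le> k y" using y(2) by auto
        thus "\<forall>i<m. \<bar>y ! i\<bar> \<le> B'" using B[rule_format, of "prj js y"] B'[rule_format, OF y(1)] js(2) by auto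
      qed
    qed
  qed
  have "covered p m W {y \<in> Rn m. 0 < k y \<and> prj js y \<in> G}" unfolding covered_def
  proof (intro exI[of _ "L ` H"] conjI ballI)
    fix l assume "l \<in> L ` H"
    then obtain h where h: "h \<in> H" "l = L h" by blast
    show "nice p m l" using nl h by simp
    show "supp m l \<subseteq> W" using sl[OF h(1)] W h(2) by auto
  next
    show "{y \<in> Rn m. 0 < k y \<and> prj js y \<in> G} \<subseteq> (\<Union>h\<in>L ` H. supp m h)" using H(3) sl by auto
  qed (use H(1) in simp)
  thus ?thesis using G oG genG by blast
qed

section \<open>Small sets and finite fibres\<close>

text \<open>If the fibres over all points of an open set contained intervals, their end points could
  be selected definably, hence continuously on a smaller open set, and \<open>open_over\<close>
  would produce an open subset of \<open>X\<close>.\<close>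

lemma Gen_fiber_finite:
  assumes X: "X \<in> S (Suc d)" and small: "Gen (Suc d) (\<lambda>x. x \<notin> X)"
  shows "Gen d (\<lambda>x. \<not> (\<exists>a b. a < b \<and> (\<forall>t. a < t \<and> t < b --> x @ [t] \<in> X)))"
proof (rule GenI)
  show "Dp (\<lambda>e. \<not> (\<exists>a b. a < b \<and> (\<forall>t. a < t \<and> t < b --> map e [0..<d] @ [t] \<in> X)))"
    by (intro Dp_not Dp_ex Dp_conj Dp_all Dp_imp Dp_less Dp_mem[OF X] DV_snoc DV_map DF_var)
  fix U :: "'r list set" assume U: "open_in_Rn d U" "U \<noteq> {}"
  let ?P = "\<lambda>x y. y ! 0 < y ! 1 \<and> (\<forall>t. y ! 0 < t \<and> t < y ! 1 --> x @ [t] \<in> X)"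
  show "\<exists>x\<in>U. \<not> (\<exists>a b. a < b \<and> (\<forall>t. a < t \<and> t < b --> x @ [t] \<in> X))"
  proof (rule ccontr)
    assume "\<not> ?thesis"
    hence neg: "\<exists>a b. a < b \<and> (\<forall>t. a < t \<and> t < b --> x @ [t] \<in> X)" if "x \<in> U" for x using that by blast
    have "Dp (\<lambda>e. ?P (map (\<lambda>i. e (i + 2)) [0..<d]) (map e [0..<2]))"
      by (intro Dp_conj Dp_all Dp_imp Dp_less Dp_mem[OF X] DV_snoc DV_map DF_var DF_nth[of 2]) auto
    from choice_vector[of ?P, OF this] obtain z where z: "\<forall>j<2. dfun d (\<lambda>x. z x ! j)"
      "\<forall>x y. length x = d --> length y = 2 --> ?P x y --> ?P x (z x)" by (elim exE conjE)
    have zz: "?P x (z x)" if "x \<in> U" for x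
    proof -
      obtain a b where "a < b" "\<forall>t. a < t \<and> t < b --> x @ [t] \<in> X" using neg[OF \<open>x \<in> U\<close>] by blast
      thus ?thesis using z(2)[rule_format, of x "[a, b]"] open_len[OF U(1) \<open>x \<in> U\<close>] by simp
    qed
    have "Gen d (\<lambda>x. ctd d (\<lambda>x. z x ! 0) x \<and> ctd d (\<lambda>x. z x ! 1) x)" by (intro Gen_conj Gen_ctd) (use z(1) in auto)
    from GenD[OF this U] obtain V where V: "open_in_Rn d V" "V \<noteq> {}" "V \<subseteq> U" "\<forall>x\<in>V. ctd d (\<lambda>x. z x ! 0) x \<and> ctd d (\<lambda>x. z x ! 1) x" by blast
    obtain x0 where x0: "x0 \<in> V" using V(2) by blast
    have "z x0 ! 0 < z x0 ! 1" using zz x0 V(3) by blast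
    then obtain t0 where t0: "z x0 ! 0 < t0" "t0 < z x0 ! 1" using dense by blast
    have "t0 - z x0 ! 0 > 0" "z x0 ! 1 - t0 > 0" using t0 by auto
    with V(4)[rule_format, OF x0] have "eventually (\<lambda>x. \<bar>z x ! 0 - z x0 ! 0\<bar> < t0 - z x0 ! 0) (nb d x0)"
      "eventually (\<lambda>x. \<bar>z x ! 1 - z x0 ! 1\<bar> < z x0 ! 1 - t0) (nb d x0)" using ctdD by blast+
    with open_ev[OF V(1) x0] have "eventually (\<lambda>x. x \<in> V \<and> z x ! 0 < t0 \<and> t0 < z x ! 1) (nb d x0)"
      by eventually_elim (auto simp: abs_less_iff)
    then obtain r where r: "r > 0" "\<forall>x\<in>Rn d. near d r x0 x --> x \<in> V \<and> z x ! 0 < t0 \<and> t0 < z x ! 1" unfolding eventually_nb by blast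
    have l0: "length x0 = d" using open_len V(1) x0 by blast
    have "\<exists>V. open_in_Rn (Suc d) V \<and> V \<noteq> {} \<and> V \<subseteq> cube (Suc d) (x0 @ [t0]) r \<and> V \<subseteq> X"
    proof (rule open_over[OF Gen_ctd X open_cube[of d x0 r]])
      show "cube d x0 r \<noteq> {}" using cube_center[OF l0 r(1)] by blast
      fix x assume "x \<in> cube d x0 r"
      hence x: "x \<in> V" "z x ! 0 < t0" "t0 < z x ! 1" using r(2) unfolding cube_def by auto
      show "\<exists>b>t0. \<forall>t. t0 < t \<and> t < b --> x @ [t] \<in> X" using zz[of x] x V(3) by (intro exI[of _ "z x ! 1"]) auto
    qed (use l0 r in auto)
    then obtain O' where O': "open_in_Rn (Suc d) O'" "O' \<noteq> {}" "O' \<subseteq> X" by blast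
    from GenD[OF small O'(1,2)] O'(3) show False by blast
  qed
qed

text \<open>Takes the place of \<open>dim X < d\<close>. Where the fibre in the last coordinate
  contains no interval it is finite, and the other coordinates serve. The remaining base points form
  a small set \<open>T\<close> in the space with one coordinate fewer; the recursion decomposes it,
  and the last coordinate is added to each index list.\<close>

lemma small_decomposition:
  "X \<in> S d ==> Gen d (\<lambda>x. x \<notin> X) ==> \<exists>L. finite L \<and> X \<subseteq> (\<Union>(J, Y)\<in>L. Y) \<and>
    (\<forall>(J, Y)\<in>L. Y \<in> S d \<and> Suc (length J) = d \<and> set J \<subseteq> {..<d} \<and> (\<forall>x. finite {z \<in> Y. prj J z = x}))"
proof (induction d arbitrary: X)
  case 0
  \<comment> \<open>In dimension zero a small set is empty, because the single point is
    open.\<close>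
  have "open_in_Rn 0 {[]::'r list}" unfolding open_in_Rn_def by (auto intro: exI[of _ 1])
  from GenD[OF 0(2) this] have "[] \<notin> X" by auto
  hence "X = {}" using S_len[OF 0(1)] by (metis equals0I length_0_conv)
  thus ?case by (intro exI[of _ "{}"]) auto
next
  case (Suc d)
  define T where "T = {x \<in> Rn d. \<exists>a b. a < b \<and> (\<forall>t. a < t \<and> t < b --> x @ [t] \<in> X)}"
  have T: "T \<in> S d" unfolding T_def
    by (rule S_Collect) (intro Dp_ex Dp_conj Dp_all Dp_imp Dp_less Dp_mem[OF Suc.prems(1)] DV_snoc DV_map DF_var)
  have "Gen d (\<lambda>x. x \<notin> T)" by (rule Gen_mono[OF Gen_fiber_finite[OF Suc.prems]]) (simp add: T_def)
  from Suc.IH[OF T this] obtain L where L: "finite L" "T \<subseteq> (\<Union>(J, Y)\<in>L. Y)"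
    "\<forall>(J, Y)\<in>L. Y \<in> S d \<and> Suc (length J) = d \<and> set J \<subseteq> {..<d} \<and> (\<forall>x. finite {z \<in> Y. prj J z = x})" by (elim exE conjE)
  define Y0 where "Y0 = {z \<in> Rn (Suc d). z \<in> X \<and> take d z \<notin> T}"
  have tk: "DV d (\<lambda>e. take d (map e [0..<Suc d]))" by (rule DV_take[OF DV_vars]) simp
  have Y0: "Y0 \<in> S (Suc d)" unfolding Y0_def
    by (rule S_Collect) (intro Dp_conj Dp_not Dp_mem[OF Suc.prems(1)] Dp_mem[OF T] DV_vars tk)
  have fin0: "finite {z \<in> Y0. prj [0..<d] z = x}" for x
  proof (cases "x \<in> Rn d \<and> x \<notin> T")
    case True
    have "finite {t. x @ [t] \<in> X}"
    proof -
      have "Dp (\<lambda>e. x @ [e 0] \<in> X)" by (intro Dp_mem[OF Suc.prems(1)] DV_snoc DV_const DF_var) (use True in simp)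
      from finite_or_interval[OF this] True show ?thesis unfolding T_def by auto
    qed
    moreover have "{z \<in> Y0. prj [0..<d] z = x} \<subseteq> (\<lambda>t. x @ [t]) ` {t. x @ [t] \<in> X}"
    proof
      fix z assume "z \<in> {z \<in> Y0. prj [0..<d] z = x}"
      hence z: "length z = Suc d" "z \<in> X" "prj [0..<d] z = x" unfolding Y0_def by auto
      have "take d z = x" unfolding z(3)[symmetric] using z(1) by (intro nth_equalityI) auto
      hence "z = x @ [z ! d]" using snoc_take[OF z(1)] by simp
      thus "z \<in> (\<lambda>t. x @ [t]) ` {t. x @ [t] \<in> X}" using z(2) by (metis image_eqI mem_Collect_eq)
    qed
    ultimately show ?thesis using finite_surj by blast
  next
    case False
    have "{z \<in> Y0. prj [0..<d] z = x} = {}"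
    proof -
      have "prj [0..<d] z = take d z" if "z \<in> Y0" for z using that unfolding Y0_def by (intro nth_equalityI) auto
      thus ?thesis using False unfolding Y0_def by auto
    qed
    thus ?thesis by (simp only: finite.emptyI)
  qed
  define Lf where "Lf = (\<lambda>(J, Y). (J @ [d], {z \<in> Rn (Suc d). z \<in> X \<and> take d z \<in> Y}))"
  have good: "Y' \<in> S (Suc d) \<and> Suc (length J') = Suc d \<and> set J' \<subseteq> {..<Suc d} \<and> (\<forall>x. finite {z \<in> Y'. prj J' z = x})"
    if mem: "(J', Y') \<in> Lf ` L" for J' Y'
  proof -
    obtain J Y where JY: "(J, Y) \<in> L" "J' = J @ [d]" "Y' = {z \<in> Rn (Suc d). z \<in> X \<and> take d z \<in> Y}" using mem unfolding Lf_def by auto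
    have *: "Y \<in> S d" "Suc (length J) = d" "set J \<subseteq> {..<d}" "\<And>x. finite {z \<in> Y. prj J z = x}" using L(3) JY(1) by auto
    have 1: "Y' \<in> S (Suc d)" unfolding JY(3) by (rule S_Collect) (intro Dp_conj Dp_mem[OF Suc.prems(1)] Dp_mem[OF *(1)] DV_vars tk)
    have "finite {z \<in> Y'. prj J' z = x}" for x
    proof -
      have "{z \<in> Y'. prj J' z = x} \<subseteq> (\<lambda>y. y @ [x ! length J]) ` {y \<in> Y. prj J y = take (length J) x}"
      proof
        fix z assume "z \<in> {z \<in> Y'. prj J' z = x}"
        hence z: "length z = Suc d" "take d z \<in> Y" "prj (J @ [d]) z = x" unfolding JY(2,3) by auto
        have "prj J (take d z) = take (length J) x" unfolding z(3)[symmetric]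
        proof (rule nth_equalityI)
          fix i assume "i < length (prj J (take d z))"
          hence i: "i < length J" by simp
          hence "J ! i < d" using js_nth[OF *(3)] by blast
          thus "prj J (take d z) ! i = take (length J) (prj (J @ [d]) z) ! i" using i by (simp add: nth_append)
        qed simp
        moreover have "x ! length J = z ! d" unfolding z(3)[symmetric] by (subst prj_nth) (auto simp: nth_append)
        ultimately show "z \<in> (\<lambda>y. y @ [x ! length J]) ` {y \<in> Y. prj J y = take (length J) x}"
          using z(2) snoc_take[OF z(1)] by (intro image_eqI[of _ _ "take d z"]) auto
      qed
      thus ?thesis using *(4) finite_surj by blast
    qed
    thus ?thesis using 1 * JY(2) by auto
  qed
  show ?case
  proof (intro exI[of _ "insert ([0..<d], Y0) (Lf ` L)"] conjI)
    show "X \<subseteq> (\<Union>(J, Y)\<in>insert ([0..<d], Y0) (Lf ` L). Y)"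
    proof
      fix z assume z: "z \<in> X"
      have lz: "length z = Suc d" using S_len[OF Suc.prems(1) z] .
      show "z \<in> (\<Union>(J, Y)\<in>insert ([0..<d], Y0) (Lf ` L). Y)"
      proof (cases "take d z \<in> T")
        case True
        then obtain J Y where "(J, Y) \<in> L" "take d z \<in> Y" using L(2) by auto
        hence "Lf (J, Y) \<in> Lf ` L" "z \<in> snd (Lf (J, Y))" using z lz unfolding Lf_def by auto
        thus ?thesis by force
      next
        case False thus ?thesis using z lz unfolding Y0_def by auto
      qed
    qed
    show "\<forall>(J, Y)\<in>insert ([0..<d], Y0) (Lf ` L). Y \<in> S (Suc d) \<and> Suc (length J) = Suc d \<and> set J \<subseteq> {..<Suc d} \<and> (\<forall>x. finite {z \<in> Y. prj J z = x})"
    proof (rule ballI)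
      fix l assume l: "l \<in> insert ([0..<d], Y0) (Lf ` L)"
      obtain J Y where JY: "l = (J, Y)" by fastforce
      have "Y \<in> S (Suc d) \<and> Suc (length J) = Suc d \<and> set J \<subseteq> {..<Suc d} \<and> (\<forall>x. finite {z \<in> Y. prj J z = x})"
      proof (cases "l = ([0..<d], Y0)")
        case True thus ?thesis using JY Y0 fin0 by auto
      next
        case False
        hence "(J, Y) \<in> Lf ` L" using l unfolding JY insert_iff by (elim disjE) simp_all
        thus ?thesis by (rule good)
      qed
      thus "case l of (J, Y) \<Rightarrow> Y \<in> S (Suc d) \<and> Suc (length J) = Suc d \<and> set J \<subseteq> {..<Suc d} \<and> (\<forall>x. finite {z \<in> Y. prj J z = x})"
        unfolding JY prod.case .
    qed
  qed (use L(1) in simp)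
qed

section \<open>Tubes around finite fibres\<close>

text \<open>The squared Euclidean distance: being polynomial, it preserves class \<open>C^p\<close>
  when functions are inserted, which a norm would not.\<close>

definition sqdist :: "nat \<Rightarrow> 'r list \<Rightarrow> 'r list \<Rightarrow> 'r" where
  "sqdist m y z = (\<Sum>i<m. (y ! i - z ! i) * (y ! i - z ! i))"

lemma sqdist_nonneg: "0 \<le> sqdist m y z"
  unfolding sqdist_def by (simp add: sum_nonneg)

lemma sqdist_coord: "i < m ==> (y ! i - z ! i) * (y ! i - z ! i) \<le> sqdist m y z"
  unfolding sqdist_def by (rule member_le_sum) auto

lemma sqdist_self [simp]: "sqdist m z z = 0"
  unfolding sqdist_def by simp

lemma sqdist_pos: assumes "y \<noteq> z" "length y = m" "length z = m" shows "0 < sqdist m y z"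
proof -
  obtain i where i: "i < m" "y ! i \<noteq> z ! i" using assms by (auto simp: list_eq_iff_nth_eq)
  have "0 < (y ! i - z ! i) * (y ! i - z ! i)" using i(2) by (simp add: zero_less_mult_iff) (metis linorder_neqE)
  thus ?thesis using sqdist_coord[OF i(1), of y z] by simp
qed

text \<open>Coordinatewise it amounts to \<open>0 \<le> (2 * x - y - z)^2\<close>. The factor 2 is
  the price for working with squares, which do not obey the triangle inequality.\<close>

lemma sqdist_triangle: "sqdist m y z \<le> 2 * sqdist m x y + 2 * sqdist m x z"
proof -
  have "(y ! i - z ! i) * (y ! i - z ! i) \<le> 2 * ((x ! i - y ! i) * (x ! i - y ! i)) + 2 * ((x ! i - z ! i) * (x ! i - z ! i))" for i
  proof -
    have "0 \<le> (2 * x ! i - y ! i - z ! i) * (2 * x ! i - y ! i - z ! i)" by simp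
    thus ?thesis by (simp add: algebra_simps)
  qed
  hence "sqdist m y z \<le> (\<Sum>i<m. 2 * ((x ! i - y ! i) * (x ! i - y ! i)) + 2 * ((x ! i - z ! i) * (x ! i - z ! i)))" unfolding sqdist_def by (intro sum_mono)
  thus ?thesis unfolding sqdist_def by (simp add: sum.distrib sum_distrib_left)
qed

lemma DF_sqdist: "DV m v ==> DV m w ==> DF (\<lambda>e. sqdist m (v e) (w e))"
  unfolding sqdist_def by (intro DF_sum DF_mult DF_diff DF_nth) auto

lemma finite_positive:
  "finite A ==> (\<And>a. a \<in> A ==> \<exists>r>0. \<forall>s. 0 < s \<and> s \<le> r --> C a s) ==> \<exists>r>(0::'r). \<forall>s. 0 < s \<and> s \<le> r --> (\<forall>a\<in>A. C a s)"
proof (induction A rule: finite_induct)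
  case empty show ?case by (intro exI[of _ 1]) auto
next
  case (insert a A)
  obtain r where r: "r > 0" "\<forall>s. 0 < s \<and> s \<le> r --> (\<forall>a\<in>A. C a s)" using insert.IH insert.prems by auto
  obtain r' where r': "r' > 0" "\<forall>s. 0 < s \<and> s \<le> r' --> C a s" using insert.prems[of a] by auto
  show ?case by (intro exI[of _ "min r r'"]) (use r r' in auto)
qed

text \<open>Each requirement has its own use. The bound on \<open>r * (z ! i * z ! i)\<close> gives
  far points thin tubes, which later bounds superlevel sets; the second keeps the tubes inside
  \<open>W\<close>; the third, whose constant 4 is matched to \<open>sqdist_triangle\<close>, makes
  tubes over one base point disjoint.\<close>

lemma tube_radius:
  assumes "finite Zx" "Zx \<subseteq> W" "open_in_Rn m W"
  shows "\<exists>r. 0 < r \<and> r \<le> 1 \<and> (\<forall>z\<in>Zx. (\<forall>i<m. r * (z ! i * z ! i) \<le> 1) \<and> (\<forall>y\<in>Rn m. sqdist m y z < r --> y \<in> W) \<and> (\<forall>z'\<in>Zx. z' \<noteq> z --> 4 * r \<le> sqdist m z z'))"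
proof -
  have lz: "length z = m" if "z \<in> Zx" for z using that assms open_len by blast
  have 1: "\<exists>r>0. \<forall>s. 0 < s \<and> s \<le> r --> (\<forall>i<m. s * (z ! i * z ! i) \<le> 1)" if z: "z \<in> Zx" for z
  proof -
    have "\<exists>r>0. \<forall>s. 0 < s \<and> s \<le> r --> (\<forall>i\<in>{..<m}. s * (z ! i * z ! i) \<le> 1)"
    proof (rule finite_positive)
      fix i
      have p: "1 + z ! i * z ! i > 0" by (simp add: add_pos_nonneg)
      show "\<exists>r>0. \<forall>s. 0 < s \<and> s \<le> r --> s * (z ! i * z ! i) \<le> 1"
      proof (intro exI[of _ "inverse (1 + z ! i * z ! i)"] conjI allI impI)
        fix s assume s: "0 < s \<and> s \<le> inverse (1 + z ! i * z ! i)"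
        have "s * (z ! i * z ! i) \<le> s * (1 + z ! i * z ! i)" using s by (intro mult_left_mono) auto
        also have "\<dots> \<le> inverse (1 + z ! i * z ! i) * (1 + z ! i * z ! i)" using s p by (intro mult_right_mono) auto
        also have "\<dots> = 1" using p by simp
        finally show "s * (z ! i * z ! i) \<le> 1" .
      qed (use p in simp)
    qed simp
    thus ?thesis by auto
  qed
  have 2: "\<exists>r>0. \<forall>s. 0 < s \<and> s \<le> r --> (\<forall>y\<in>Rn m. sqdist m y z < s --> y \<in> W)" if z: "z \<in> Zx" for z
  proof -
    have zW: "z \<in> W" using z assms(2) by blast
    obtain r where r: "r > 0" "cube m z r \<subseteq> W" by (rule open_contains_cube[OF assms(3) zW])
    show ?thesis
    proof (intro exI[of _ "r * r"] conjI allI impI ballI)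
      fix s y assume s: "0 < s \<and> s \<le> r * r" and y: "y \<in> Rn m" "sqdist m y z < s"
      have "\<bar>y ! i - z ! i\<bar> < r" if "i < m" for i
      proof (rule ccontr)
        assume "\<not> \<bar>y ! i - z ! i\<bar> < r"
        hence "r * r \<le> \<bar>y ! i - z ! i\<bar> * \<bar>y ! i - z ! i\<bar>" using r(1) by (intro mult_mono) auto
        also have "\<dots> = (y ! i - z ! i) * (y ! i - z ! i)" by simp
        also have "\<dots> \<le> sqdist m y z" by (rule sqdist_coord[OF that])
        finally show False using s y by simp
      qed
      hence "y \<in> cube m z r" using y(1) unfolding cube_def near_def by simp
      thus "y \<in> W" using r(2) by blast
    qed (use r in simp)
  qed
  have 3: "\<exists>r>0. \<forall>s. 0 < s \<and> s \<le> r --> (\<forall>z'\<in>Zx. z' \<noteq> z --> 4 * s \<le> sqdist m z z')" if z: "z \<in> Zx" for z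
  proof (rule finite_positive[OF assms(1)])
    fix z' assume z': "z' \<in> Zx"
    show "\<exists>r>0. \<forall>s. 0 < s \<and> s \<le> r --> z' \<noteq> z --> 4 * s \<le> sqdist m z z'"
    proof (cases "z' = z")
      case False
      hence "sqdist m z z' / 4 > 0" using sqdist_pos[of z z' m] lz z z' by simp
      thus ?thesis by (intro exI[of _ "sqdist m z z' / 4"]) auto
    qed (auto intro: exI[of _ 1])
  qed
  have "\<exists>r>0. \<forall>s. 0 < s \<and> s \<le> r --> (\<forall>z\<in>Zx. (\<forall>i<m. s * (z ! i * z ! i) \<le> 1) \<and> (\<forall>y\<in>Rn m. sqdist m y z < s --> y \<in> W) \<and> (\<forall>z'\<in>Zx. z' \<noteq> z --> 4 * s \<le> sqdist m z z'))"
  proof (rule finite_positive[OF assms(1)])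
    fix z assume z: "z \<in> Zx"
    obtain r1 where r1: "r1 > 0" "\<forall>s. 0 < s \<and> s \<le> r1 --> (\<forall>i<m. s * (z ! i * z ! i) \<le> 1)" using 1[OF z] by blast
    obtain r2 where r2: "r2 > 0" "\<forall>s. 0 < s \<and> s \<le> r2 --> (\<forall>y\<in>Rn m. sqdist m y z < s --> y \<in> W)" using 2[OF z] by blast
    obtain r3 where r3: "r3 > 0" "\<forall>s. 0 < s \<and> s \<le> r3 --> (\<forall>z'\<in>Zx. z' \<noteq> z --> 4 * s \<le> sqdist m z z')" using 3[OF z] by blast
    show "\<exists>r>0. \<forall>s. 0 < s \<and> s \<le> r --> (\<forall>i<m. s * (z ! i * z ! i) \<le> 1) \<and> (\<forall>y\<in>Rn m. sqdist m y z < s --> y \<in> W) \<and> (\<forall>z'\<in>Zx. z' \<noteq> z --> 4 * s \<le> sqdist m z z')"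
      by (intro exI[of _ "min r1 (min r2 r3)"]) (use r1 r2 r3 in auto)
  qed
  then obtain r where r: "r > 0" "\<forall>s. 0 < s \<and> s \<le> r --> (\<forall>z\<in>Zx. (\<forall>i<m. s * (z ! i * z ! i) \<le> 1) \<and> (\<forall>y\<in>Rn m. sqdist m y z < s --> y \<in> W) \<and> (\<forall>z'\<in>Zx. z' \<noteq> z --> 4 * s \<le> sqdist m z z'))" by blast
  show ?thesis using r(2)[rule_format, of "min r 1"] r(1) by (intro exI[of _ "min r 1"]) auto
qed

lemma reg_sqdist_prj:
  assumes js: "set js \<subseteq> {..<m}" and y: "length y = m" and z: "\<And>j. j < m ==> reg p (length js) (\<lambda>x. z x ! j) (prj js y)"
  shows "reg p m (\<lambda>y. sqdist m y (z (prj js y))) y"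
  unfolding sqdist_def by (intro reg_sum reg_mult reg_diff reg_nth reg_prj[OF js z y])

text \<open>The bump functions are \<open>\<rho>(x) - |y - z|^2\<close> for \<open>z\<close> in the finite fibre over \<open>x\<close>, with a definably chosen
  radius \<open>\<rho>\<close> that keeps the tubes around different points disjoint.\<close>

lemma tube_covered:
  assumes js: "set js \<subseteq> {..<m}" "length js = d" and CL: "open_covered p d" and W: "W \<in> S m" "open_in_Rn m W"
    and Z: "Z \<in> S m" "Z \<subseteq> W" and fin: "\<And>x. finite {z \<in> Z. prj js z = x}"
  shows "\<exists>G. G \<in> S d \<and> open_in_Rn d G \<and> Gen d (\<lambda>x. x \<in> G) \<and> covered p m W {z \<in> Z. prj js z \<in> G}"
proof -
  have peq: "prj js y = x \<longleftrightarrow> (\<forall>j<d. prj js y ! j = x ! j)" if "length x = d" for x y using that js(2) by (auto simp: list_eq_iff_nth_eq)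
  \<comment> \<open>The conditions of \<open>tube_radius\<close> as a formula: fibres and inequality
    of points are expressed by coordinates, so that a radius can be chosen definably.\<close>
  let ?R = "\<lambda>x r. 0 < r \<and> r \<le> 1 \<and> (\<forall>z\<in>Rn m. z \<in> Z \<and> (\<forall>j<d. prj js z ! j = x ! j) --> (\<forall>i<m. r * (z ! i * z ! i) \<le> 1) \<and>
      (\<forall>y\<in>Rn m. sqdist m y z < r --> y \<in> W) \<and> (\<forall>z'\<in>Rn m. z' \<in> Z \<and> (\<forall>j<d. prj js z' ! j = x ! j) \<and> (\<exists>i<m. z' ! i \<noteq> z ! i) --> 4 * r \<le> sqdist m z z'))"
  have pv: "DF (\<lambda>e. prj js (map (\<lambda>i. e (\<sigma> i)) [0..<m]) ! j)" if "j < d" for \<sigma> :: "nat \<Rightarrow> nat" and j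
    by (rule DF_nth[OF DV_prj[OF js(1) DV_map]]) (use that js(2) in \<open>auto intro: DF_var\<close>)
  have nv: "DF (\<lambda>e. map (\<lambda>i. e (\<sigma> i)) [0..<k] ! j)" if "j < k" for \<sigma> :: "nat \<Rightarrow> nat" and j k
    by (rule DF_nth[OF DV_map]) (use that in \<open>auto intro: DF_var\<close>)
  have "Dp (\<lambda>e. ?R (map (\<lambda>i. e (Suc i)) [0..<d]) (e 0))"
    by (intro Dp_conj Dp_not Dp_imp Dp_allv Dp_all_less Dp_ex_less Dp_less Dp_le Dp_eq DF_mult pv nv DF_sqdist Dp_mem[OF W(1)] Dp_mem[OF Z(1)] DV_map DF_var DF_const)
  from choice_scalar[of ?R, OF this] obtain \<rho> where d\<rho>: "dfun d \<rho>" and \<rho>': "\<forall>x r. length x = d --> ?R x r --> ?R x (\<rho> x)" by (elim exE conjE)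
  have "?R x (\<rho> x)" if lx: "length x = d" for x
  proof -
    have "{z \<in> Z. prj js z = x} \<subseteq> W" using Z(2) by blast
    from tube_radius[OF fin this W(2)] obtain r where r: "0 < r" "r \<le> 1"
      "\<forall>z\<in>{z \<in> Z. prj js z = x}. (\<forall>i<m. r * (z ! i * z ! i) \<le> 1) \<and> (\<forall>y\<in>Rn m. sqdist m y z < r --> y \<in> W) \<and> (\<forall>z'\<in>{z \<in> Z. prj js z = x}. z' \<noteq> z --> 4 * r \<le> sqdist m z z')" by (elim exE conjE)
    have "?R x r" using r unfolding peq[OF lx] by auto
    thus ?thesis using \<rho>' lx by blast
  qed
  note Rr = this
  have \<rho>1: "0 < \<rho> x" "\<rho> x \<le> 1" if "length x = d" for x using Rr[OF that] by auto
  have \<rho>2: "\<rho> (prj js z) * (z ! i * z ! i) \<le> 1" if "z \<in> Z" "i < m" for z i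
    using Rr[of "prj js z"] that S_len[OF Z(1) that(1)] js(2) by auto
  have \<rho>3: "y \<in> W" if "z \<in> Z" "length y = m" "sqdist m y z < \<rho> (prj js z)" for y z
    using Rr[of "prj js z"] that S_len[OF Z(1) that(1)] js(2) by auto
  have \<rho>4: "4 * \<rho> (prj js z) \<le> sqdist m z z'" if "z \<in> Z" "z' \<in> Z" "prj js z' = prj js z" "z' \<noteq> z" for z z'
  proof -
    have l: "length z = m" "length z' = m" using S_len[OF Z(1)] that by auto
    hence "\<exists>i<m. z' ! i \<noteq> z ! i" using that(4) by (auto simp: list_eq_iff_nth_eq)
    moreover have "\<forall>j<d. prj js z' ! j = prj js z ! j" using that(3) by simp
    moreover have "\<forall>z'\<in>Rn m. z' \<in> Z \<and> (\<forall>j<d. prj js z' ! j = prj js z ! j) \<and> (\<exists>i<m. z' ! i \<noteq> z ! i) --> 4 * \<rho> (prj js z) \<le> sqdist m z z'"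
      using Rr[of "prj js z"] that(1) l(1) js(2) by simp
    ultimately show ?thesis using that(2) l(2) by simp
  qed
  \<comment> \<open>\<open>z\<close> is the centre of the tube containing \<open>y\<close>. By the
    factor 4 there is at most one, so \<open>k\<close> below is well defined: positive inside the
    tubes and 0 outside.\<close>
  define C where "C y z \<longleftrightarrow> z \<in> Z \<and> prj js z = prj js y \<and> sqdist m y z < \<rho> (prj js y)" for y z
  have Cu: "z = z'" if "C y z" "C y z'" for y z z'
  proof (rule ccontr)
    assume ne: "z \<noteq> z'"
    have "4 * \<rho> (prj js y) \<le> sqdist m z z'" using \<rho>4[of z z'] ne that unfolding C_def by auto
    also have "\<dots> \<le> 2 * sqdist m y z + 2 * sqdist m y z'" by (rule sqdist_triangle)
    finally show False using that unfolding C_def by linarith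
  qed
  define k where "k y = (if \<exists>z. C y z then \<rho> (prj js y) - sqdist m y (THE z. C y z) else 0)" for y
  have kC: "k y = \<rho> (prj js y) - sqdist m y z" if "C y z" for y z
  proof -
    have "(THE z. C y z) = z" using that Cu by blast
    thus ?thesis unfolding k_def using that by auto
  qed
  have k0: "k y = 0" if "\<And>z. \<not> C y z" for y using that unfolding k_def by auto
  have kpos: "0 < k y \<longleftrightarrow> (\<exists>z. C y z)" for y using kC k0 unfolding C_def by fastforce
  have k01: "0 \<le> k y \<and> k y \<le> 1" for y
  proof (cases "\<exists>z. C y z")
    case True
    then obtain z where z: "C y z" by blast
    thus ?thesis using kC[OF z] sqdist_nonneg[of m y z] \<rho>1[of "prj js y"] js(2) unfolding C_def by auto
  qed (use k0 in auto)
  have Cl: "C y z ==> length z = m" for y z using S_len[OF Z(1)] unfolding C_def by blast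
  have Ceq: "C y z \<longleftrightarrow> z \<in> Z \<and> (\<forall>j<d. prj js z ! j = prj js y ! j) \<and> sqdist m y z < \<rho> (prj js y)" for y z
    unfolding C_def using peq[of "prj js y" z] js(2) by simp
  have dC: "Dp (\<lambda>e. C (v e) (w e))" if "DV m v" "DV m w" for v w unfolding Ceq
    by (intro Dp_conj Dp_all_less Dp_eq Dp_less Dp_mem[OF Z(1)] DF_sqdist DF_app[OF d\<rho>] that DF_nth[OF DV_prj[OF js(1) that(1)]] DF_nth[OF DV_prj[OF js(1) that(2)]] DV_prj[OF js(1) that(1), unfolded js(2)])
      (use js(2) in auto)
  have dk: "dfun m k" unfolding dfun_def
  proof (rule DF_graph)
    fix e :: "nat \<Rightarrow> 'r" and y
    let ?v = "map e [0..<m]"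
    show "y = k ?v \<longleftrightarrow> (\<exists>z\<in>Rn m. C ?v z \<and> y = \<rho> (prj js ?v) - sqdist m ?v z) \<or> ((\<forall>z\<in>Rn m. \<not> C ?v z) \<and> y = 0)"
    proof (cases "\<exists>z. C ?v z")
      case True
      then obtain z where z: "C ?v z" by blast
      have "(\<exists>z\<in>Rn m. C ?v z \<and> y = \<rho> (prj js ?v) - sqdist m ?v z) \<longleftrightarrow> y = k ?v"
      proof
        assume "\<exists>z\<in>Rn m. C ?v z \<and> y = \<rho> (prj js ?v) - sqdist m ?v z"
        then obtain w where w: "C ?v w" "y = \<rho> (prj js ?v) - sqdist m ?v w" by blast
        thus "y = k ?v" using kC[OF w(1)] by simp
      next
        assume "y = k ?v"
        thus "\<exists>z\<in>Rn m. C ?v z \<and> y = \<rho> (prj js ?v) - sqdist m ?v z" using z Cl[OF z] kC[OF z] by (intro bexI[of _ z]) simp_all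
      qed
      thus ?thesis using z Cl[OF z] by auto
    next
      case False thus ?thesis using k0[of ?v] by auto
    qed
  next
    show "Dp (\<lambda>e. (\<exists>z\<in>Rn m. C (map (\<lambda>i. e (Suc i)) [0..<m]) z \<and> e 0 = \<rho> (prj js (map (\<lambda>i. e (Suc i)) [0..<m])) - sqdist m (map (\<lambda>i. e (Suc i)) [0..<m]) z) \<or>
        ((\<forall>z\<in>Rn m. \<not> C (map (\<lambda>i. e (Suc i)) [0..<m]) z) \<and> e 0 = 0))"
      by (intro Dp_disj Dp_exv Dp_allv Dp_conj Dp_not dC Dp_eq DF_diff DF_app[OF d\<rho>] DF_sqdist DV_prj[OF js(1), unfolded js(2)] DV_map DF_var DF_const)
  qed
  have kW: "y \<in> W" if ly: "length y = m" and ky: "0 < k y" for y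
  proof -
    obtain z where z: "C y z" using ky kpos by blast
    thus ?thesis using \<rho>3[of z y] ly unfolding C_def by auto
  qed
  \<comment> \<open>\<open>e \<le> k y\<close> bounds the radius below by \<open>e\<close>, so each
    squared coordinate of the centre is at most \<open>1 / e\<close>, while the squared distance of
    \<open>y\<close> from the centre is at most 1. The inequality \<open>|t| \<le> 1 + t * t\<close>
    converts squares into the stated bound.\<close>
  have bd: "\<exists>B'. \<forall>y\<in>Rn m. e \<le> k y --> (\<forall>i<d. \<bar>prj js y ! i\<bar> \<le> B) --> (\<forall>i<m. \<bar>y ! i\<bar> \<le> B')" if e: "e > 0" for e B
  proof (intro exI[of _ "3 + inverse e"] ballI impI allI)
    fix y i assume y: "y \<in> Rn m" "e \<le> k y" and i: "i < m"
    have "0 < k y" using e y(2) by simp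
    then obtain z where z: "C y z" using kpos by blast
    have \<rho>e: "e \<le> \<rho> (prj js y)" "\<rho> (prj js y) \<le> 1" using kC[OF z] y(2) sqdist_nonneg[of m y z] \<rho>1[of "prj js y"] js(2) by auto
    have "e * (z ! i * z ! i) \<le> \<rho> (prj js z) * (z ! i * z ! i)" using \<rho>e z unfolding C_def by (intro mult_right_mono) auto
    also have "\<dots> \<le> 1" using \<rho>2[of z i] z i unfolding C_def by auto
    finally have "z ! i * z ! i \<le> inverse e" using e by (simp add: field_simps)
    moreover have sq: "\<bar>t\<bar> \<le> 1 + t * t" for t :: 'r
    proof -
      have "0 \<le> (\<bar>t\<bar> - 1) * (\<bar>t\<bar> - 1)" by simp
      hence "2 * \<bar>t\<bar> \<le> 1 + t * t" by (simp add: algebra_simps)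
      thus ?thesis using abs_ge_zero[of t] by linarith
    qed
    ultimately have "\<bar>z ! i\<bar> \<le> 1 + inverse e" using sq[of "z ! i"] by linarith
    moreover have "(y ! i - z ! i) * (y ! i - z ! i) \<le> 1" using sqdist_coord[OF i, of y z] z \<rho>e unfolding C_def by linarith
    hence "\<bar>y ! i - z ! i\<bar> \<le> 2" using sq[of "y ! i - z ! i"] by linarith
    ultimately show "\<bar>y ! i\<bar> \<le> 3 + inverse e" by linarith
  qed
  \<comment> \<open>Suppose bad points lie over every point of an open set, and select one,
    \<open>Y x\<close>, definably. Generically \<open>Y\<close> is of class \<open>C^p\<close>, and
    on a smaller open set either all \<open>Y x\<close> lie in tubes or none does.\<close>
  have good: "Gen d (\<lambda>x. \<forall>y\<in>Rn m. prj js y = x --> ctd m k y \<and> (0 < k y --> reg p m k y))"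
  proof -
    let ?bad = "\<lambda>x y. (\<forall>j<d. prj js y ! j = x ! j) \<and> \<not> (ctd m k y \<and> (0 < k y --> reg p m k y))"
    have db: "Dp (\<lambda>e. ?bad (map (\<lambda>i. e (\<sigma> i)) [0..<d]) (map e [0..<m]))" for \<sigma> :: "nat \<Rightarrow> nat"
      by (intro Dp_conj Dp_not Dp_imp Dp_all_less Dp_eq Dp_less Dp_ctd[OF dk] Dp_reg[OF dk] DF_app[OF dk] pv[of _ "\<lambda>i. i"] nv DV_vars DF_const)
    have "Gen d (\<lambda>x. \<not> (\<exists>y\<in>Rn m. ?bad x y))"
    proof (rule GenI)
      show "Dp (\<lambda>e. \<not> (\<exists>y\<in>Rn m. ?bad (map e [0..<d]) y))" by (intro Dp_not Dp_exv db)
      fix U :: "'r list set" assume U: "open_in_Rn d U" "U \<noteq> {}"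
      show "\<exists>x\<in>U. \<not> (\<exists>y\<in>Rn m. ?bad x y)"
      proof (rule ccontr)
        assume "\<not> ?thesis"
        hence neg: "\<exists>y\<in>Rn m. ?bad x y" if "x \<in> U" for x using that by blast
        from choice_vector[of ?bad, OF db] obtain Y where Y: "\<forall>x. length (Y x) = m" "\<forall>j<m. dfun d (\<lambda>x. Y x ! j)"
          "\<forall>x y. length x = d --> length y = m --> ?bad x y --> ?bad x (Y x)" by (elim exE conjE)
        have YU: "?bad x (Y x)" if "x \<in> U" for x
        proof -
          obtain y where "y \<in> Rn m" "?bad x y" using neg[OF \<open>x \<in> U\<close>] by blast
          thus ?thesis using Y(3)[rule_format, of x y] open_len[OF U(1) \<open>x \<in> U\<close>] by simp
        qed
        have Yp: "prj js (Y x) = x" if "x \<in> U" for x using YU[OF that] peq[OF open_len[OF U(1) that], of "Y x"] by blast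
        have DY: "DV m (\<lambda>e. Y (v e))" if "DV d v" for v by (rule DV_app) (use Y that in auto)
        have "Dp (\<lambda>e. C (Y (map (\<lambda>i. e (i + m)) [0..<d])) (map e [0..<m]))" by (intro dC DY DV_map DF_var)
        from choice_vector[of "\<lambda>x z. C (Y x) z", OF this] obtain z where z: "\<forall>j<m. dfun d (\<lambda>x. z x ! j)"
          "\<forall>x y. length x = d --> length y = m --> C (Y x) y --> C (Y x) (z x)" by (elim exE conjE)
        have "Dp (\<lambda>e. \<exists>w\<in>Rn m. C (Y (map e [0..<d])) w)" by (intro Dp_exv dC DY DV_map DF_var)
        from dichotomy[OF this U] obtain V where V: "open_in_Rn d V" "V \<noteq> {}" "V \<subseteq> U"
          "(\<forall>x\<in>V. \<exists>w\<in>Rn m. C (Y x) w) \<or> (\<forall>x\<in>V. \<not> (\<exists>w\<in>Rn m. C (Y x) w))" by blast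
        have "Gen d (\<lambda>x. reg p d \<rho> x \<and> (\<forall>j<m. reg p d (\<lambda>x. Y x ! j) x) \<and> (\<forall>j<m. reg p d (\<lambda>x. z x ! j) x))"
          by (intro Gen_conj Gen_all_less Gen_reg d\<rho> Y(2)[rule_format] z(1)[rule_format])
        from GenD[OF this V(1,2)] obtain V' where V': "open_in_Rn d V'" "V' \<noteq> {}" "V' \<subseteq> V"
          "\<forall>x\<in>V'. reg p d \<rho> x \<and> (\<forall>j<m. reg p d (\<lambda>x. Y x ! j) x) \<and> (\<forall>j<m. reg p d (\<lambda>x. z x ! j) x)" by (elim exE conjE)
        obtain x0 where x0: "x0 \<in> V'" using V'(2) by blast
        define y0 where "y0 = Y x0"
        have l0: "length x0 = d" and ly0: "length y0 = m" and py0: "prj js y0 = x0"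
          using open_len[OF V'(1) x0] Y(1) Yp[of x0] x0 V'(3) V(3) unfolding y0_def by auto
        have r\<rho>: "reg p m (\<lambda>y. \<rho> (prj js y)) y0" by (rule reg_prj[OF js(1) _ ly0]) (use V'(4) x0 py0 js(2) in auto)
        have bad0: "\<not> (ctd m k y0 \<and> (0 < k y0 --> reg p m k y0))" using YU[of x0] x0 V'(3) V(3) unfolding y0_def by blast
        have evV: "eventually (\<lambda>y. prj js y \<in> V') (nb m y0)"
          by (rule ev_prj[OF js(1)]) (use open_ev[OF V'(1) x0] py0 js(2) in simp)
        from V(4) show False
        proof
          assume E: "\<forall>x\<in>V. \<exists>w\<in>Rn m. C (Y x) w"
          have zC: "C (Y x) (z x)" if "x \<in> V" for x
          proof -
            obtain w where "w \<in> Rn m" "C (Y x) w" using E \<open>x \<in> V\<close> by blast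
            thus ?thesis using z(2)[rule_format, of x w] open_len[OF V(1) \<open>x \<in> V\<close>] by simp
          qed
          \<comment> \<open>Inside a tube the centre is generically a \<open>C^p\<close> function of
            the base point, and near \<open>y0\<close> the function \<open>k\<close> coincides with
            this explicit expression, so \<open>y0\<close> is not bad.\<close>
          let ?g = "\<lambda>y. \<rho> (prj js y) - sqdist m y (z (prj js y))"
          have rg: "reg p m ?g y0"
            by (rule reg_diff[OF r\<rho> reg_sqdist_prj[OF js(1) ly0]]) (use V'(4) x0 py0 js(2) in auto)
          have "?g y0 > 0" using zC[of x0] x0 V'(3) py0 unfolding C_def y0_def by auto
          from ctd_pos[OF reg_ctd[OF rg ly0] this] evV have "eventually (\<lambda>y. ?g y = k y) (nb m y0)"
          proof eventually_elim
            case (elim y)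
            have x: "prj js y \<in> V" using elim(2) V'(3) by blast
            have "C y (z (prj js y))" using zC[OF x] Yp[of "prj js y"] x V(3) elim(1) unfolding C_def by auto
            thus ?case using kC by simp
          qed
          from reg_cong[OF rg this] have "reg p m k y0" .
          thus False using bad0 reg_ctd[of p m k y0] ly0 by blast
        next
          assume N: "\<forall>x\<in>V. \<not> (\<exists>w\<in>Rn m. C (Y x) w)"
          have N': "\<not> C (Y x) w" if "x \<in> V" for x w using N that Cl[of "Y x" w] by auto
          have k00: "k y0 = 0" using k0[of y0] N' x0 V'(3) unfolding y0_def by blast
          \<comment> \<open>If \<open>Y x\<close> lies in no tube and \<open>y\<close> lies in the
            tube around \<open>w\<close>, then \<open>k y\<close> is at most
            \<open>sqdist m (Y x) w - sqdist m y w\<close>, a sum of products with the small factors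
            \<open>Y x ! i - y ! i\<close>. \<open>K\<close> bounds the coordinates of
            \<open>w\<close>, \<open>Lc i\<close> bounds the other factor, and \<open>Ls\<close>
            exceeds the sum of the \<open>Lc i\<close>.\<close>
          define K where "K = 1 + 2 * inverse (\<rho> x0)"
          define Lc where "Lc i = 2 * (\<bar>y0 ! i\<bar> + 1) + 2 * K" for i
          have \<rho>0: "\<rho> x0 > 0" using \<rho>1 l0 by blast
          have K0: "K > 0" unfolding K_def using \<rho>0 by (simp add: add_pos_pos)
          have Lc0: "Lc i > 0" for i unfolding Lc_def using K0 by (simp add: add_pos_pos add_nonneg_pos)
          define Ls where "Ls = 1 + (\<Sum>i<m. Lc i)"
          have Ls0: "Ls > 0" unfolding Ls_def using Lc0 by (simp add: add_pos_nonneg sum_nonneg less_imp_le)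
          have "ctd m k y0" unfolding ctd_def
          proof (intro allI impI)
            fix e :: 'r assume e: "e > 0"
            have cY: "ctd m (\<lambda>y. Y (prj js y) ! i) y0" if "i < m" for i
              by (rule reg_ctd[OF reg_prj[OF js(1) _ ly0, of p] ly0]) (use V'(4) x0 py0 js(2) that in auto)
            have cg: "ctd m (\<lambda>y. Y (prj js y) ! i + (-1) * y ! i) y0" if "i < m" for i
              by (intro ctd_add ctd_mult ctd_const ctd_nth cY that)
            have eL: "e / Ls > 0" using e Ls0 by simp
            have "eventually (\<lambda>y. \<bar>Y (prj js y) ! i - y ! i\<bar> < e / Ls) (nb m y0)" if "i < m" for i
              using ctdD[OF cg[OF that] eL] py0 unfolding y0_def by simp
            hence e1: "eventually (\<lambda>y. \<forall>i<m. \<bar>Y (prj js y) ! i - y ! i\<bar> < e / Ls) (nb m y0)" by (rule ev_all_less)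
            have "eventually (\<lambda>y. \<bar>Y (prj js y) ! i - Y (prj js y0) ! i\<bar> < 1) (nb m y0)" if "i < m" for i
              using ctdD[OF cY[OF that]] by simp
            hence e2: "eventually (\<lambda>y. \<forall>i<m. \<bar>Y (prj js y) ! i - Y (prj js y0) ! i\<bar> < 1) (nb m y0)" by (rule ev_all_less)
            have e3: "eventually (\<lambda>y. near m 1 y0 y) (nb m y0)" by (rule ev_near) simp
            have "\<rho> x0 / 2 > 0" using \<rho>0 by simp
            from ctdD[OF reg_ctd[OF r\<rho> ly0] this] have e4: "eventually (\<lambda>y. \<bar>\<rho> (prj js y) - \<rho> x0\<bar> < \<rho> x0 / 2) (nb m y0)" unfolding py0 .
            from e1 e2 e3 e4 evV show "eventually (\<lambda>y. \<bar>k y - k y0\<bar> < e) (nb m y0)"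
            proof eventually_elim
              case (elim y)
              show ?case
              proof (cases "\<exists>w. C y w")
                case False thus ?thesis using k0[of y] k00 e by auto
              next
                case True
                then obtain w where w: "C y w" by blast
                define x where "x = prj js y"
                have xV: "x \<in> V" using elim(5) V'(3) unfolding x_def by blast
                have wx: "w \<in> Z" "prj js w = x" using w unfolding C_def x_def by auto
                have "\<not> C (Y x) w" using N'[OF xV] .
                hence "\<rho> x \<le> sqdist m (Y x) w" using wx Yp[of x] xV V(3) unfolding C_def by (auto simp: not_less)
                hence "k y \<le> sqdist m (Y x) w - sqdist m y w" using kC[OF w] unfolding x_def by simp
                also have "\<dots> = (\<Sum>i<m. (Y x ! i - y ! i) * (Y x ! i + y ! i - 2 * w ! i))" unfolding sqdist_def
                  by (simp add: sum_subtractf[symmetric] algebra_simps)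
                also have "\<dots> \<le> (\<Sum>i<m. (e / Ls) * Lc i)"
                proof (rule sum_mono)
                  fix i assume "i \<in> {..<m}"
                  hence i: "i < m" by simp
                  have "\<rho> x0 / 2 \<le> \<rho> x" using elim(4) unfolding x_def abs_less_iff by linarith
                  hence "\<rho> x0 / 2 * (w ! i * w ! i) \<le> \<rho> x * (w ! i * w ! i)" by (intro mult_right_mono) auto
                  also have "\<dots> \<le> 1" using \<rho>2[OF wx(1) i] wx(2) by simp
                  finally have "w ! i * w ! i \<le> 2 * inverse (\<rho> x0)" using \<rho>0 by (simp add: field_simps)
                  moreover have "0 \<le> (\<bar>w ! i\<bar> - 1) * (\<bar>w ! i\<bar> - 1)" by simp
                  hence "2 * \<bar>w ! i\<bar> \<le> 1 + w ! i * w ! i" by (simp add: algebra_simps)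
                  ultimately have wK: "\<bar>w ! i\<bar> \<le> K" unfolding K_def using abs_ge_zero[of "w ! i"] by linarith
                  have "\<bar>Y x ! i - y0 ! i\<bar> < 1" using elim(2) i py0 unfolding x_def y0_def by simp
                  moreover have "\<bar>y ! i - y0 ! i\<bar> < 1" using elim(3) i unfolding near_def by simp
                  ultimately have "\<bar>Y x ! i\<bar> \<le> \<bar>y0 ! i\<bar> + 1" "\<bar>y ! i\<bar> \<le> \<bar>y0 ! i\<bar> + 1" by linarith+
                  moreover have "\<bar>Y x ! i + y ! i - 2 * w ! i\<bar> \<le> \<bar>Y x ! i\<bar> + \<bar>y ! i\<bar> + 2 * \<bar>w ! i\<bar>" by linarith
                  ultimately have "\<bar>Y x ! i + y ! i - 2 * w ! i\<bar> \<le> Lc i" unfolding Lc_def using wK by simp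
                  hence "\<bar>Y x ! i - y ! i\<bar> * \<bar>Y x ! i + y ! i - 2 * w ! i\<bar> \<le> (e / Ls) * Lc i"
                    using elim(1) i eL unfolding x_def by (intro mult_mono) (auto intro: less_imp_le)
                  moreover have "(Y x ! i - y ! i) * (Y x ! i + y ! i - 2 * w ! i) \<le> \<bar>Y x ! i - y ! i\<bar> * \<bar>Y x ! i + y ! i - 2 * w ! i\<bar>"
                    unfolding abs_mult[symmetric] by (rule abs_ge_self)
                  ultimately show "(Y x ! i - y ! i) * (Y x ! i + y ! i - 2 * w ! i) \<le> (e / Ls) * Lc i" by (rule order_trans[rotated])
                qed
                also have "\<dots> = (e / Ls) * (\<Sum>i<m. Lc i)" by (simp add: sum_distrib_left)
                also have "\<dots> < (e / Ls) * Ls" unfolding Ls_def using eL[unfolded Ls_def] by (intro mult_strict_left_mono) auto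
                also have "\<dots> = e" using Ls0 by simp
                finally show ?thesis using k01[of y] k00 by simp
              qed
            qed
          qed
          thus False using bad0 k00 by simp
        qed
      qed
    qed
    thus ?thesis
    proof (rule Gen_mono)
      fix x assume lx: "length x = d" and nb: "\<not> (\<exists>y\<in>Rn m. ?bad x y)"
      show "\<forall>y\<in>Rn m. prj js y = x --> ctd m k y \<and> (0 < k y --> reg p m k y)"
        using nb unfolding peq[OF lx] by blast
    qed
  qed
  have "\<exists>G. G \<in> S d \<and> open_in_Rn d G \<and> Gen d (\<lambda>x. x \<in> G) \<and> covered p m W {y \<in> Rn m. 0 < k y \<and> prj js y \<in> G}"
    by (rule lift_nice[OF js CL dk k01 _ _ good]) (rule kW bd; assumption)+
  then obtain G where G: "G \<in> S d" "open_in_Rn d G" "Gen d (\<lambda>x. x \<in> G)"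
    "covered p m W {y \<in> Rn m. 0 < k y \<and> prj js y \<in> G}" by (elim exE conjE)
  have "{z \<in> Z. prj js z \<in> G} \<subseteq> {y \<in> Rn m. 0 < k y \<and> prj js y \<in> G}"
  proof
    fix z assume z: "z \<in> {z \<in> Z. prj js z \<in> G}"
    hence "C z z" unfolding C_def using \<rho>1[of "prj js z"] js(2) by simp
    thus "z \<in> {y \<in> Rn m. 0 < k y \<and> prj js y \<in> G}" using z kpos[of z] S_len[OF Z(1), of z] by auto
  qed
  from covered_subset[OF G(4) this] show ?thesis using G by blast
qed

section \<open>Fibrewise distance to the complement\<close>

lemma prj_take: "length y = Suc d ==> prj [0..<d] y = take d y"
  by (intro nth_equalityI) auto

lemma js_upt: "set [0..<d] \<subseteq> {..<Suc d}"
  by auto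

lemma reg_take: assumes "reg p d f (take d y)" "length y = Suc d" shows "reg p (Suc d) (\<lambda>y. f (take d y)) y"
proof -
  have "reg p (Suc d) (\<lambda>y. f (prj [0..<d] y)) y" by (rule reg_prj[OF js_upt]) (use assms prj_take in auto)
  thus ?thesis by (rule reg_cong) (use ev_length[of "Suc d" y] prj_take in \<open>auto elim!: eventually_mono\<close>)
qed

lemma ev_take: assumes "eventually P (nb d (take d y))" "length y = Suc d" shows "eventually (\<lambda>y. P (take d y)) (nb (Suc d) y)"
proof -
  have "eventually (\<lambda>y. P (prj [0..<d] y)) (nb (Suc d) y)" by (rule ev_prj[OF js_upt]) (use assms prj_take in auto)
  with ev_length[of "Suc d" y] show ?thesis by eventually_elim (simp add: prj_take)
qed

text \<open>\<open>kl\<close> measures how far the last coordinate can be lowered without leaving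
  \<open>W\<close>, compressed to at most 1. The bound by \<open>y ! d - s\<close> holds because
  \<open>a y\<close> is the highest missing point below \<open>y\<close>; it later gives continuity
  outside \<open>W\<close>. Near a point of \<open>W\<close> selected over a generic base point,
  \<open>a\<close> depends on the base point alone, so generic regularity over the base
  suffices.\<close>

lemma half_factor:
  assumes W: "W \<in> S (Suc d)" "open_in_Rn (Suc d) W"
  shows "\<exists>kl. dfun (Suc d) kl \<and> (\<forall>y\<in>Rn (Suc d). 0 \<le> kl y \<and> kl y \<le> 1 \<and> (0 < kl y \<longleftrightarrow> y \<in> W)) \<and>
     (\<forall>y\<in>Rn (Suc d). \<forall>s. s < y ! d \<and> take d y @ [s] \<notin> W --> kl y \<le> y ! d - s) \<and>
     Gen d (\<lambda>x. \<forall>y\<in>Rn (Suc d). take d y = x --> y \<in> W --> reg p (Suc d) kl y)"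
proof -
  let ?P = "\<lambda>y a. a < y ! d \<and> take d y @ [a] \<notin> W \<and> (\<forall>s. a < s \<and> s \<le> y ! d --> take d y @ [s] \<in> W)"
  let ?E = "\<lambda>y. \<exists>s<y ! d. take d y @ [s] \<notin> W"
  have vt: "DV d (\<lambda>e. take d (v e))" if "DV (Suc d) v" for v by (rule DV_take[OF that]) simp
  have vn: "DF (\<lambda>e. v e ! d)" if "DV (Suc d) v" for v by (rule DF_nth[OF that]) simp
  have "Dp (\<lambda>e. ?P (map (\<lambda>i. e (Suc i)) [0..<Suc d]) (e 0))"
    by (intro Dp_conj Dp_not Dp_all Dp_imp Dp_less Dp_le Dp_mem[OF W(1)] DV_snoc vt vn DV_map DF_var)
  from choice_scalar[of ?P, OF this] obtain a where da: "dfun (Suc d) a" and a': "\<forall>y b. length y = Suc d --> ?P y b --> ?P y (a y)" by (elim exE conjE)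
  have Pu: "b = c" if "?P y b" "?P y c" for y b c
    using that by (cases b c rule: linorder_cases) auto
  have Pex: "\<exists>b. ?P y b" if y: "y \<in> W" "?E y" for y
  proof -
    have ly: "length y = Suc d" using S_len[OF W(1) y(1)] .
    define t where "t = y ! d"
    define x where "x = take d y"
    have lx: "length x = d" and yx: "y = x @ [t]" using ly snoc_take[OF ly] unfolding x_def t_def by auto
    obtain s0 where s0: "s0 < t \<and> x @ [s0] \<notin> W" using y(2) unfolding t_def x_def by blast
    have dS: "Dp (\<lambda>e. e 0 < t \<and> x @ [e 0] \<notin> W)" by (intro Dp_conj Dp_not Dp_less Dp_mem[OF W(1)] DV_snoc DV_const lx DF_var DF_const)
    obtain s where s: "\<And>u. u < t \<and> x @ [u] \<notin> W ==> u \<le> s" "\<And>v. (\<And>u. u < t \<and> x @ [u] \<notin> W ==> u \<le> v) ==> s \<le> v"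
      by (rule definable_sup[OF dS, of s0 t]) (use s0 in auto)
    have st: "s \<le> t" by (rule s(2)) auto
    have sW: "x @ [s] \<notin> W"
    proof
      assume sW: "x @ [s] \<in> W"
      obtain r where r: "r > 0" "cube (Suc d) (x @ [s]) r \<subseteq> W" by (rule open_contains_cube[OF W(2) sW])
      have "s \<le> s - r"
      proof (rule s(2))
        fix u assume u: "u < t \<and> x @ [u] \<notin> W"
        show "u \<le> s - r"
        proof (rule ccontr)
          assume "\<not> u \<le> s - r"
          hence "\<bar>u - s\<bar> < r" using s(1)[OF u] by simp
          hence "x @ [u] \<in> cube (Suc d) (x @ [s]) r" unfolding cube_def near_def using lx r(1) by (auto simp: nth_append less_Suc_eq)
          thus False using r(2) u by blast
        qed
      qed
      thus False using r(1) by simp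
    qed
    hence "s \<noteq> t" using y(1) yx by auto
    hence "s < t" using st by simp
    moreover have "x @ [u] \<in> W" if "s < u" "u \<le> t" for u
    proof (rule ccontr)
      assume "x @ [u] \<notin> W"
      moreover from this have "u < t" using y(1) yx that(2) by (cases "u = t") auto
      ultimately show False using s(1)[of u] that(1) by simp
    qed
    ultimately have "?P y s" using sW unfolding t_def[symmetric] x_def[symmetric] by blast
    thus ?thesis by blast
  qed
  have Pa: "?P y (a y)" if y: "y \<in> W" "?E y" for y
  proof -
    obtain b where "?P y b" using Pex[OF y] by blast
    thus ?thesis using a' S_len[OF W(1) y(1)] by blast
  qed
  \<comment> \<open>Compresses positive lengths to at most 1, keeping them smooth and not above the
    original length.\<close>
  define u where "u t = t / (1 + t)" for t :: 'r
  have u: "0 < u t \<and> u t \<le> 1 \<and> u t \<le> t" if "0 < t" for t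
  proof -
    have "0 < 1 + t" using that by simp
    thus ?thesis unfolding u_def using that by (simp add: divide_le_eq mult_le_cancel_left algebra_simps)
  qed
  define kl where "kl y = (if y \<in> W then (if ?E y then u (y ! d - a y) else 1) else 0)" for y
  have dkl: "dfun (Suc d) kl" unfolding dfun_def kl_def u_def
    by (intro DF_if Dp_ex Dp_conj Dp_not Dp_less DF_divide DF_add DF_diff Dp_mem[OF W(1)] DF_app[OF da] DV_snoc vt vn DV_map DF_var DF_const)
  have b1: "0 \<le> kl y \<and> kl y \<le> 1 \<and> (0 < kl y \<longleftrightarrow> y \<in> W)" for y
  proof (cases "y \<in> W \<and> ?E y")
    case True
    hence "0 < y ! d - a y" using Pa[of y] by auto
    thus ?thesis using True u[of "y ! d - a y"] unfolding kl_def by auto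
  qed (auto simp: kl_def)
  have b2: "kl y \<le> y ! d - s" if s: "s < y ! d" "take d y @ [s] \<notin> W" for y s
  proof (cases "y \<in> W")
    case True
    have E: "?E y" using s by blast
    have P: "?P y (a y)" by (rule Pa[OF True E])
    hence "s \<le> a y" using s by (meson less_imp_le not_le_imp_less)
    moreover have "kl y \<le> y ! d - a y" using True E u[of "y ! d - a y"] P unfolding kl_def by auto
    ultimately show ?thesis by simp
  next
    case False thus ?thesis using s unfolding kl_def by simp
  qed
  have "Gen d (\<lambda>x. \<forall>y\<in>Rn (Suc d). take d y = x --> y \<in> W --> reg p (Suc d) kl y)"
  proof -
    let ?bad = "\<lambda>x y. (\<forall>j<d. y ! j = x ! j) \<and> y \<in> W \<and> \<not> reg p (Suc d) kl y"
    have db: "Dp (\<lambda>e. ?bad (map (\<lambda>i. e (\<sigma> i)) [0..<d]) (map e [0..<Suc d]))" for \<sigma> :: "nat \<Rightarrow> nat"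
      by (intro Dp_conj Dp_not Dp_all_less Dp_eq Dp_reg[OF dkl] Dp_mem[OF W(1)] DF_nth[OF DV_vars] DF_nth[OF DV_map] DV_vars DF_var) auto
    have "Gen d (\<lambda>x. \<not> (\<exists>y\<in>Rn (Suc d). ?bad x y))"
    proof (rule GenI)
      show "Dp (\<lambda>e. \<not> (\<exists>y\<in>Rn (Suc d). ?bad (map e [0..<d]) y))" by (rule Dp_not, rule Dp_exv, rule db)
      fix U :: "'r list set" assume U: "open_in_Rn d U" "U \<noteq> {}"
      show "\<exists>x\<in>U. \<not> (\<exists>y\<in>Rn (Suc d). ?bad x y)"
      proof (rule ccontr)
        assume "\<not> ?thesis"
        hence neg: "\<exists>y\<in>Rn (Suc d). ?bad x y" if "x \<in> U" for x using that by blast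
        from choice_vector[of ?bad, OF db] obtain Y where Y: "\<forall>x. length (Y x) = Suc d" "\<forall>j<Suc d. dfun d (\<lambda>x. Y x ! j)"
          "\<forall>x y. length x = d --> length y = Suc d --> ?bad x y --> ?bad x (Y x)" by (elim exE conjE)
        have YU: "?bad x (Y x)" if xU: "x \<in> U" for x
        proof -
          obtain y where "y \<in> Rn (Suc d)" "?bad x y" using neg[OF xU] by blast
          thus ?thesis using Y(3)[rule_format, of x y] open_len[OF U(1) xU] by simp
        qed
        have Yt: "take d (Y x) = x" if "x \<in> U" for x using YU[OF that] Y(1) open_len[OF U(1) that] by (intro nth_equalityI) auto
        have DY: "DV (Suc d) (\<lambda>e. Y (v e))" if "DV d v" for v by (rule DV_app) (use Y that in auto)
        define \<tau> where "\<tau> x = Y x ! d" for x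
        define \<alpha> where "\<alpha> x = a (Y x)" for x
        have d\<tau>: "dfun d \<tau>" unfolding \<tau>_def using Y(2) by simp
        have d\<alpha>: "dfun d \<alpha>" unfolding \<alpha>_def dfun_def by (intro DF_app[OF da] DY DV_vars)
        have "Dp (\<lambda>e. ?E (Y (map e [0..<d])))"
          by (intro Dp_ex Dp_conj Dp_not Dp_less Dp_mem[OF W(1)] DV_snoc vt vn DY DV_map DF_var)
        from dichotomy[OF this U] obtain V where V: "open_in_Rn d V" "V \<noteq> {}" "V \<subseteq> U" "(\<forall>x\<in>V. ?E (Y x)) \<or> (\<forall>x\<in>V. \<not> ?E (Y x))" by blast
        have "Gen d (\<lambda>x. reg p d \<tau> x \<and> reg p d \<alpha> x)" by (intro Gen_conj Gen_reg d\<tau> d\<alpha>)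
        from GenD[OF this V(1,2)] obtain V' where V': "open_in_Rn d V'" "V' \<noteq> {}" "V' \<subseteq> V" "\<forall>x\<in>V'. reg p d \<tau> x \<and> reg p d \<alpha> x" by (elim exE conjE)
        obtain x0 where x0: "x0 \<in> V'" using V'(2) by blast
        have x0U: "x0 \<in> U" using x0 V'(3) V(3) by blast
        define y0 where "y0 = Y x0"
        have ly0: "length y0 = Suc d" and ty0: "take d y0 = x0" and y0W: "y0 \<in> W" and nreg: "\<not> reg p (Suc d) kl y0"
          using Y(1) Yt[OF x0U] YU[OF x0U] unfolding y0_def by auto
        have t0: "y0 ! d = \<tau> x0" unfolding y0_def \<tau>_def ..
        obtain r where r: "r > 0" "cube (Suc d) y0 r \<subseteq> W" by (rule open_contains_cube[OF W(2) y0W])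
        have r\<tau>: "reg p (Suc d) (\<lambda>y. \<tau> (take d y)) y0" and r\<alpha>: "reg p (Suc d) (\<lambda>y. \<alpha> (take d y)) y0"
          using V'(4) x0 ty0 ly0 by (auto intro!: reg_take)
        have e1: "eventually (\<lambda>y. take d y \<in> V') (nb (Suc d) y0)" by (rule ev_take) (use open_ev[OF V'(1) x0] ty0 ly0 in auto)
        have e2: "eventually (\<lambda>y. near (Suc d) r y0 y) (nb (Suc d) y0)" by (rule ev_near[OF r(1)])
        have e3: "eventually (\<lambda>y. \<bar>\<tau> (take d y) - \<tau> x0\<bar> < r) (nb (Suc d) y0)" using ctdD[OF reg_ctd[OF r\<tau> ly0] r(1)] unfolding ty0 .
        note e4 = ev_length[of "Suc d" y0]
        \<comment> \<open>In a cube contained in \<open>W\<close>, the vertical segment between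
          \<open>y\<close> and the selected point over the same base point stays in
          \<open>W\<close>. Hence both have the same highest missing point below them.\<close>
        have seg: "take d y @ [s] \<in> W" if "length y = Suc d" "near (Suc d) r y0 y" "\<bar>s - \<tau> x0\<bar> < r" for y s
        proof -
          have "take d y @ [s] \<in> cube (Suc d) y0 r" unfolding cube_def near_def using that t0 unfolding near_def by (auto simp: nth_append less_Suc_eq)
          thus ?thesis using r(2) by blast
        qed
        have seg2: "take d y @ [s] \<in> W" if y: "length y = Suc d" "near (Suc d) r y0 y" "\<bar>\<tau> (take d y) - \<tau> x0\<bar> < r"
          and s: "\<tau> (take d y) \<le> s" "s \<le> y ! d" for y s
        proof (rule seg[OF y(1,2)])
          have "\<bar>y ! d - \<tau> x0\<bar> < r" using y(2) t0 unfolding near_def by auto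
          thus "\<bar>s - \<tau> x0\<bar> < r" using y(3) s by (simp add: abs_less_iff)
        qed
        have inW: "y \<in> W" if y: "length y = Suc d" "near (Suc d) r y0 y" for y using r(2) y unfolding cube_def by auto
        from V(4) have "reg p (Suc d) kl y0"
        proof
          assume nE: "\<forall>x\<in>V. \<not> ?E (Y x)"
          from e1 e2 e3 e4 have "eventually (\<lambda>y. 1 = kl y) (nb (Suc d) y0)"
          proof eventually_elim
            case (elim y)
            have x: "take d y \<in> V" "take d y \<in> U" using elim(1) V'(3) V(3) by auto
            have "take d y @ [s] \<in> W" if s: "s < y ! d" for s
            proof (cases "s < \<tau> (take d y)")
              case True thus ?thesis using nE x Yt[OF x(2)] unfolding \<tau>_def by auto
            next
              case False thus ?thesis using seg2[OF elim(4,2,3)] s by simp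
            qed
            hence "\<not> ?E y" by blast
            thus ?case using inW[OF elim(4,2)] unfolding kl_def by auto
          qed
          from reg_cong[OF reg_const this] show ?thesis .
        next
          assume E: "\<forall>x\<in>V. ?E (Y x)"
          have PY: "?P (Y x) (\<alpha> x)" if "x \<in> V" for x unfolding \<alpha>_def by (rule Pa) (use YU[of x] E that V(3) in auto)
          let ?g = "\<lambda>y. y ! d - \<alpha> (take d y)"
          have rg: "reg p (Suc d) ?g y0" by (intro reg_diff reg_nth r\<alpha>) simp
          have g0: "?g y0 > 0" using PY[of x0] x0 V'(3) ty0 unfolding y0_def by auto
          have "reg p (Suc d) (\<lambda>y. ?g y / (1 + ?g y)) y0" by (rule reg_divide[OF rg reg_add[OF reg_const rg] _ ly0]) (use g0 in simp)
          moreover from ctd_pos[OF reg_ctd[OF rg ly0] g0] e1 e2 e3 e4 have "eventually (\<lambda>y. ?g y / (1 + ?g y) = kl y) (nb (Suc d) y0)"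
          proof eventually_elim
            case (elim y)
            have x: "take d y \<in> V" "take d y \<in> U" using elim(2) V'(3) V(3) by auto
            have PY': "\<alpha> (take d y) < \<tau> (take d y)" "take d y @ [\<alpha> (take d y)] \<notin> W" "\<And>s. \<alpha> (take d y) < s ==> s \<le> \<tau> (take d y) ==> take d y @ [s] \<in> W"
              using PY[OF x(1)] Yt[OF x(2)] unfolding \<tau>_def by auto
            have P: "?P y (\<alpha> (take d y))"
            proof (intro conjI allI impI)
              show "\<alpha> (take d y) < y ! d" using elim(1) by simp
              show "take d y @ [\<alpha> (take d y)] \<notin> W" by (rule PY'(2))
              fix s assume s: "\<alpha> (take d y) < s \<and> s \<le> y ! d"
              show "take d y @ [s] \<in> W"
              proof (cases "s \<le> \<tau> (take d y)")
                case True thus ?thesis using PY'(3) s by blast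
              next
                case False thus ?thesis using seg2[OF elim(5,3,4)] s by simp
              qed
            qed
            have yW: "y \<in> W" by (rule inW[OF elim(5,3)])
            have E: "?E y" using P by blast
            have "a y = \<alpha> (take d y)" by (rule Pu[OF Pa[OF yW E] P])
            thus ?case using yW E unfolding kl_def u_def by simp
          qed
          ultimately show ?thesis by (rule reg_cong)
        qed
        thus False using nreg by simp
      qed
    qed
    thus ?thesis
    proof (rule Gen_mono)
      fix x assume nb: "\<not> (\<exists>y\<in>Rn (Suc d). ?bad x y)"
      show "\<forall>y\<in>Rn (Suc d). take d y = x --> y \<in> W --> reg p (Suc d) kl y"
      proof (intro ballI impI)
        fix y assume "y \<in> Rn (Suc d)" "take d y = x" "y \<in> W"
        moreover from this have "\<forall>j<d. y ! j = x ! j" by auto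
        ultimately show "reg p (Suc d) kl y" using nb by blast
      qed
    qed
  qed
  thus ?thesis using dkl b1 b2 by (intro exI[of _ kl]) simp
qed

text \<open>Reflection in the last coordinate, which turns the lower one-sided distance of
  \<open>half_factor\<close> into the upper one.\<close>

definition flip :: "nat \<Rightarrow> 'r list \<Rightarrow> 'r list" where
  "flip d y = map (\<lambda>j. if j = d then - y ! d else y ! j) [0..<Suc d]"

lemma flip_simps: "length (flip d y) = Suc d" "flip d y ! d = - y ! d" "take d (flip d y) = take d y" if "length y = Suc d"
proof -
  show "length (flip d y) = Suc d" "flip d y ! d = - y ! d" unfolding flip_def by (simp_all del: upt_Suc)
  show "take d (flip d y) = take d y" unfolding flip_def using that by (intro nth_equalityI) (auto simp del: upt_Suc)
qed

lemma flip_snoc: assumes "length x = d" shows "flip d (x @ [t]) = x @ [- t]"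
  unfolding flip_def using assms by (intro nth_equalityI) (auto simp: nth_append less_Suc_eq simp del: upt_Suc)

lemma flip_comp: assumes "length y = Suc d"
  shows "eventually P (nb (Suc d) (flip d y)) ==> eventually (\<lambda>y. P (flip d y)) (nb (Suc d) y)"
    "reg p (Suc d) f (flip d y) ==> reg p (Suc d) (\<lambda>y. f (flip d y)) y"
proof -
  have r: "reg q (Suc d) (\<lambda>y. if j = d then - y ! d else y ! j) y" if "j < Suc d" for q j
    using that reg_uminus[OF reg_nth[of d "Suc d"]] reg_nth[of j "Suc d"] by (cases "j = d") auto
  show "eventually P (nb (Suc d) (flip d y)) ==> eventually (\<lambda>y. P (flip d y)) (nb (Suc d) y)" unfolding flip_def
    by (rule ev_comp) (assumption | rule reg_ctd[OF r[of _ 0] assms])+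
  show "reg p (Suc d) f (flip d y) ==> reg p (Suc d) (\<lambda>y. f (flip d y)) y" unfolding flip_def
    by (rule reg_comp) (assumption | rule r assms)+
qed

lemma DV_flip: "DV (Suc d) v ==> DV (Suc d) (\<lambda>e. flip d (v e))"
  unfolding flip_def by (rule DV_map, rename_tac i, case_tac "i = d") (simp_all add: DF_uminus DF_nth)

section \<open>The simultaneous induction\<close>

text \<open>\<open>tube_covered\<close> settles the part over a generic open set \<open>G\<close>.
  The complement of \<open>G\<close> is small, so its pieces are finite-to-one over
  \<open>d - 1\<close> coordinates, and so is the part of \<open>Z\<close> above them. For
  \<open>d = 0\<close> there are no such pieces, which matches the vacuous second
  hypothesis.\<close>

lemma fibre_covered_of_open:
  assumes CL: "open_covered p d" and FF: "\<And>c. Suc c = d ==> fibre_covered p c" shows "fibre_covered p d"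
  unfolding fibre_covered_def
proof (intro allI impI)
  fix m :: nat and js W Z
  assume js: "length js = d" "set js \<subseteq> {..<m}" and W: "W \<in> S m" "open_in_Rn m W" and Z: "Z \<in> S m" "Z \<subseteq> W"
    and fin: "\<forall>x. finite {z \<in> Z. prj js z = x}"
  from tube_covered[OF js(2,1) CL W Z fin[rule_format]] obtain G where G: "G \<in> S d" "open_in_Rn d G" "Gen d (\<lambda>x. x \<in> G)"
    "covered p m W {z \<in> Z. prj js z \<in> G}" by (elim exE conjE)
  have X: "Rn d - G \<in> S d" by (rule S_compl[OF G(1)])
  have "Gen d (\<lambda>x. x \<notin> Rn d - G)" by (rule Gen_mono[OF G(3)]) simp
  from small_decomposition[OF X this] obtain L where L: "finite L" "Rn d - G \<subseteq> (\<Union>(J, Y)\<in>L. Y)"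
    "\<forall>(J, Y)\<in>L. Y \<in> S d \<and> Suc (length J) = d \<and> set J \<subseteq> {..<d} \<and> (\<forall>x. finite {z \<in> Y. prj J z = x})" by (elim exE conjE)
  define ZL where "ZL l = {z \<in> Rn m. z \<in> Z \<and> prj js z \<in> snd l}" for l :: "nat list \<times> 'r list set"
  have cov: "covered p m W (ZL l)" if l: "l \<in> L" for l
  proof -
    obtain J Y where JY: "l = (J, Y)" by fastforce
    have *: "Y \<in> S d" "Suc (length J) = d" "set J \<subseteq> {..<d}" "\<And>x. finite {z \<in> Y. prj J z = x}" using L(3) l unfolding JY by auto
    \<comment> \<open>The composite of the two coordinate projections; its fibres in
      \<open>Z\<close> are finite unions of finite fibres.\<close>
    define js' where "js' = map (\<lambda>j. js ! j) J"
    have js': "length js' = length J" "set js' \<subseteq> {..<m}" using *(3) js unfolding js'_def by (auto dest: nth_mem)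
    have pj: "prj js' z = prj J (prj js z)" for z
    proof (rule nth_equalityI)
      fix i assume "i < length (prj js' z)"
      hence i: "i < length J" using js'(1) by simp
      hence "J ! i < d" using js_nth[OF *(3)] by blast
      thus "prj js' z ! i = prj J (prj js z) ! i" using i js(1) js'(1) by (simp add: js'_def)
    qed (use js' in simp)
    have Zl: "ZL l \<in> S m" unfolding ZL_def JY snd_conv
      by (rule S_Collect) (intro Dp_conj Dp_mem[OF Z(1)] Dp_mem[OF *(1)] DV_vars DV_prj[OF js(2) DV_vars, unfolded js(1)])
    have "finite {z \<in> ZL l. prj js' z = x}" for x
    proof -
      have "{z \<in> ZL l. prj js' z = x} \<subseteq> (\<Union>y\<in>{y \<in> Y. prj J y = x}. {z \<in> Z. prj js z = y})"
        unfolding ZL_def JY pj by auto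
      moreover have "finite (\<Union>y\<in>{y \<in> Y. prj J y = x}. {z \<in> Z. prj js z = y})" using *(4) fin by auto
      ultimately show ?thesis by (rule finite_subset)
    qed
    moreover have "ZL l \<subseteq> W" using Z(2) unfolding ZL_def by auto
    ultimately show ?thesis using FF[OF *(2), unfolded fibre_covered_def, rule_format, of js' m W "ZL l"] js' W Zl by simp
  qed
  have "covered p m W ({z \<in> Z. prj js z \<in> G} \<union> (\<Union>l\<in>L. ZL l))" by (rule covered_Un[OF G(4) covered_UN[OF L(1) cov]])
  moreover have "Z \<subseteq> {z \<in> Z. prj js z \<in> G} \<union> (\<Union>l\<in>L. ZL l)"
  proof
    fix z assume z: "z \<in> Z"
    show "z \<in> {z \<in> Z. prj js z \<in> G} \<union> (\<Union>l\<in>L. ZL l)"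
    proof (cases "prj js z \<in> G")
      case False
      hence "prj js z \<in> Rn d - G" using js(1) by simp
      hence "prj js z \<in> (\<Union>(J, Y)\<in>L. Y)" using L(2) by blast
      then obtain J Y where "(J, Y) \<in> L" "prj js z \<in> Y" by auto
      hence "z \<in> ZL (J, Y)" "(J, Y) \<in> L" using z S_len[OF Z(1) z] unfolding ZL_def by auto
      thus ?thesis by blast
    qed (use z in simp)
  qed
  ultimately show "covered p m W Z" by (rule covered_subset)
qed

text \<open>Product of the lower and the upper one-sided distance with the inverse of
  \<open>1 + y ! d * y ! d\<close>, which bounds superlevel sets in the fibre direction. Outside
  \<open>W\<close> continuity is generic: bad points selected over an open set would form the graph
  of a generically continuous function avoiding \<open>W\<close>, and \<open>k\<close> is at most
  the vertical distance to this graph.\<close>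

lemma fiber_function:
  assumes W: "W \<in> S (Suc d)" "open_in_Rn (Suc d) W"
  shows "\<exists>k. dfun (Suc d) k \<and> (\<forall>y\<in>Rn (Suc d). 0 \<le> k y \<and> k y \<le> 1 \<and> (0 < k y \<longleftrightarrow> y \<in> W)) \<and>
    (\<forall>y\<in>Rn (Suc d). k y \<le> inverse (1 + y ! d * y ! d)) \<and>
    Gen d (\<lambda>x. \<forall>y\<in>Rn (Suc d). take d y = x --> ctd (Suc d) k y \<and> (0 < k y --> reg p (Suc d) k y))"
proof -
  obtain kl where kl: "dfun (Suc d) kl" "\<forall>y\<in>Rn (Suc d). 0 \<le> kl y \<and> kl y \<le> 1 \<and> (0 < kl y \<longleftrightarrow> y \<in> W)"
    "\<forall>y\<in>Rn (Suc d). \<forall>s. s < y ! d \<and> take d y @ [s] \<notin> W --> kl y \<le> y ! d - s"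
    "Gen d (\<lambda>x. \<forall>y\<in>Rn (Suc d). take d y = x --> y \<in> W --> reg p (Suc d) kl y)" using half_factor[OF W, where p = p] by (elim exE conjE)
  define W' where "W' = {y \<in> Rn (Suc d). flip d y \<in> W}"
  have W'S: "W' \<in> S (Suc d)" unfolding W'_def by (rule S_Collect) (intro Dp_mem[OF W(1)] DV_flip DV_vars)
  have W'o: "open_in_Rn (Suc d) W'" unfolding open_in_Rn_iff
  proof (intro conjI ballI)
    fix y assume "y \<in> W'"
    hence y: "length y = Suc d" "flip d y \<in> W" unfolding W'_def by auto
    from flip_comp(1)[OF y(1) open_ev[OF W(2) y(2)]] ev_length[of "Suc d" y]
    show "eventually (\<lambda>y. y \<in> W') (nb (Suc d) y)" unfolding W'_def by eventually_elim simp
  qed (auto simp: W'_def)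
  obtain kf where kf: "dfun (Suc d) kf" "\<forall>y\<in>Rn (Suc d). 0 \<le> kf y \<and> kf y \<le> 1 \<and> (0 < kf y \<longleftrightarrow> y \<in> W')"
    "\<forall>y\<in>Rn (Suc d). \<forall>s. s < y ! d \<and> take d y @ [s] \<notin> W' --> kf y \<le> y ! d - s"
    "Gen d (\<lambda>x. \<forall>y\<in>Rn (Suc d). take d y = x --> y \<in> W' --> reg p (Suc d) kf y)" using half_factor[OF W'S W'o, where p = p] by (elim exE conjE)
  have ff: "flip d (flip d y) = y" if "length y = Suc d" for y
  proof -
    have "flip d y = take d y @ [- y ! d]" using flip_snoc[of "take d y" d "y ! d"] that snoc_take[OF that] by simp
    thus ?thesis using flip_snoc[of "take d y" d "- y ! d"] that snoc_take[OF that] by simp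
  qed
  define kr where "kr y = kf (flip d y)" for y
  have kr1: "0 \<le> kr y \<and> kr y \<le> 1 \<and> (0 < kr y \<longleftrightarrow> y \<in> W)" if y: "length y = Suc d" for y
    using kf(2)[rule_format, of "flip d y"] flip_simps[OF y] ff[OF y] unfolding kr_def W'_def by auto
  have kr2: "kr y \<le> s - y ! d" if y: "length y = Suc d" and s: "y ! d < s" "take d y @ [s] \<notin> W" for y s
  proof -
    have "flip d (take d y @ [- s]) = take d y @ [s]" using flip_snoc[of "take d y" d "- s"] y by simp
    hence "take d (flip d y) @ [- s] \<notin> W'" using s(2) flip_simps(3)[OF y] unfolding W'_def by auto
    thus ?thesis using kf(3)[rule_format, of "flip d y" "- s"] flip_simps[OF y] s(1) unfolding kr_def by auto
  qed
  define k where "k y = kl y * kr y * inverse (1 + y ! d * y ! d)" for y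
  have pos: "1 + t * t > 0" "inverse (1 + t * t) \<le> 1" for t :: 'r
  proof -
    show 1: "1 + t * t > 0" by (simp add: add_pos_nonneg)
    show "inverse (1 + t * t) \<le> 1" using le_imp_inverse_le[of 1 "1 + t * t"] by simp
  qed
  have dk: "dfun (Suc d) k" unfolding dfun_def k_def kr_def
    by (intro DF_mult DF_inverse DF_add DF_app[OF kl(1)] DF_app[OF kf(1)] DV_flip DV_vars DF_nth[OF DV_vars] DF_const) auto
  have kb: "0 \<le> k y \<and> k y \<le> kl y \<and> k y \<le> kr y \<and> k y \<le> inverse (1 + y ! d * y ! d) \<and> k y \<le> 1 \<and> (0 < k y \<longleftrightarrow> y \<in> W)" if y: "length y = Suc d" for y
  proof -
    define A B C where "A = kl y" and "B = kr y" and "C = inverse (1 + y ! d * y ! d)"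
    have b: "0 \<le> A" "A \<le> 1" "0 \<le> B" "B \<le> 1" "0 < C" "C \<le> 1"
      using kl(2) kr1[OF y] pos[of "y ! d"] y unfolding A_def B_def C_def by auto
    have "A * B \<le> A" "A * B \<le> B" "A * B \<le> 1" "0 \<le> A * B" using b by (auto simp: mult_left_le mult_left_le_one_le mult_le_one)
    moreover have "A * B * C \<le> A * B" using b \<open>0 \<le> A * B\<close> by (simp add: mult_left_le)
    moreover have "A * B * C \<le> C" using b \<open>A * B \<le> 1\<close> \<open>0 \<le> A * B\<close> by (simp add: mult_left_le_one_le)
    moreover have "0 \<le> A * B * C" using b by simp
    moreover have "0 < A * B * C \<longleftrightarrow> y \<in> W"
    proof -
      have "0 < A \<longleftrightarrow> y \<in> W" "0 < B \<longleftrightarrow> y \<in> W" using kl(2) kr1[OF y] y unfolding A_def B_def by auto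
      thus ?thesis using b by (auto simp: zero_less_mult_iff)
    qed
    ultimately show ?thesis unfolding k_def A_def[symmetric] B_def[symmetric] C_def[symmetric] by auto
  qed
  have g3: "Gen d (\<lambda>x. \<not> (\<exists>y\<in>Rn (Suc d). (\<forall>j<d. y ! j = x ! j) \<and> y \<notin> W \<and> \<not> ctd (Suc d) k y))"
  proof (rule GenI)
    let ?bad = "\<lambda>x y. (\<forall>j<d. y ! j = x ! j) \<and> y \<notin> W \<and> \<not> ctd (Suc d) k y"
    have db: "Dp (\<lambda>e. ?bad (map (\<lambda>i. e (\<sigma> i)) [0..<d]) (map e [0..<Suc d]))" for \<sigma> :: "nat \<Rightarrow> nat"
      by (intro Dp_conj Dp_not Dp_all_less Dp_eq Dp_ctd[OF dk] Dp_mem[OF W(1)] DF_nth[OF DV_vars] DF_nth[OF DV_map] DV_vars DF_var) auto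
    show "Dp (\<lambda>e. \<not> (\<exists>y\<in>Rn (Suc d). ?bad (map e [0..<d]) y))" by (rule Dp_not, rule Dp_exv, rule db)
    fix U :: "'r list set" assume U: "open_in_Rn d U" "U \<noteq> {}"
    show "\<exists>x\<in>U. \<not> (\<exists>y\<in>Rn (Suc d). ?bad x y)"
    proof (rule ccontr)
      assume "\<not> ?thesis"
      hence neg: "\<exists>y\<in>Rn (Suc d). ?bad x y" if "x \<in> U" for x using that by blast
      from choice_vector[of ?bad, OF db] obtain Y where Y: "\<forall>x. length (Y x) = Suc d" "\<forall>j<Suc d. dfun d (\<lambda>x. Y x ! j)"
        "\<forall>x y. length x = d --> length y = Suc d --> ?bad x y --> ?bad x (Y x)" by (elim exE conjE)
      have YU: "?bad x (Y x)" if xU: "x \<in> U" for x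
      proof -
        obtain y where "y \<in> Rn (Suc d)" "?bad x y" using neg[OF xU] by blast
        thus ?thesis using Y(3)[rule_format, of x y] open_len[OF U(1) xU] by simp
      qed
      have Yt: "take d (Y x) = x" if "x \<in> U" for x using YU[OF that] Y(1) open_len[OF U(1) that] by (intro nth_equalityI) auto
      define \<tau> where "\<tau> x = Y x ! d" for x
      have "dfun d \<tau>" unfolding \<tau>_def using Y(2) by simp
      from GenD[OF Gen_reg[OF this, of 0] U] obtain V where V: "open_in_Rn d V" "V \<noteq> {}" "V \<subseteq> U" "\<forall>x\<in>V. reg 0 d \<tau> x" by (elim exE conjE)
      obtain x0 where x0: "x0 \<in> V" using V(2) by blast
      have x0U: "x0 \<in> U" using x0 V(3) by blast
      define y0 where "y0 = Y x0"
      have ly0: "length y0 = Suc d" and ty0: "take d y0 = x0" and y0W: "y0 \<notin> W" and nctd: "\<not> ctd (Suc d) k y0"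
        using Y(1) Yt[OF x0U] YU[OF x0U] unfolding y0_def by auto
      have k0: "k y0 = 0" using kb[OF ly0] y0W by auto
      have "reg 0 (Suc d) (\<lambda>y. y ! d - \<tau> (take d y)) y0" by (rule reg_diff[OF reg_nth reg_take]) (use V(4) x0 ty0 ly0 in auto)
      from reg_ctd[OF this ly0] have cg: "ctd (Suc d) (\<lambda>y. y ! d - \<tau> (take d y)) y0" .
      have g0: "y0 ! d - \<tau> (take d y0) = 0" unfolding ty0 unfolding y0_def \<tau>_def by simp
      have "ctd (Suc d) k y0" unfolding ctd_def
      proof (intro allI impI)
        fix e :: 'r assume e: "e > 0"
        have e1: "eventually (\<lambda>y. take d y \<in> V) (nb (Suc d) y0)" by (rule ev_take) (use open_ev[OF V(1) x0] ty0 ly0 in auto)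
        from ctdD[OF cg e] e1 ev_length[of "Suc d" y0] show "eventually (\<lambda>y. \<bar>k y - k y0\<bar> < e) (nb (Suc d) y0)"
        proof eventually_elim
          case (elim y)
          have ab: "\<bar>y ! d - \<tau> (take d y)\<bar> < e" using elim(1) g0 by simp
          have xU: "take d y \<in> U" using elim(2) V(3) by blast
          have Yx: "Y (take d y) = take d y @ [\<tau> (take d y)]" using snoc_take[of "Y (take d y)" d] Y(1) Yt[OF xU] unfolding \<tau>_def by simp
          hence nW: "take d y @ [\<tau> (take d y)] \<notin> W" using YU[OF xU] by simp
          show ?case
          proof (cases "y \<in> W")
            case False thus ?thesis using kb[OF elim(3)] k0 e by auto
          next
            case True
            hence "\<tau> (take d y) \<noteq> y ! d" using nW snoc_take[OF elim(3)] by auto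
            \<comment> \<open>The graph point over the same base point is missing from
              \<open>W\<close>. Whichever side of \<open>y\<close> it lies on, one of the two
              one-sided factors is at most the vertical distance to it.\<close>
            then consider "\<tau> (take d y) < y ! d" | "y ! d < \<tau> (take d y)" by fastforce
            hence "k y \<le> \<bar>y ! d - \<tau> (take d y)\<bar>"
            proof cases
              case 1
              have "kl y \<le> y ! d - \<tau> (take d y)" using kl(3) 1 nW elim(3) by simp
              thus ?thesis using kb[OF elim(3)] by auto
            next
              case 2
              have "kr y \<le> \<tau> (take d y) - y ! d" using kr2[OF elim(3) 2 nW] .
              thus ?thesis using kb[OF elim(3)] by auto
            qed
            thus ?thesis using ab kb[OF elim(3)] k0 by auto
          qed
        qed
      qed
      thus False using nctd by simp
    qed
  qed
  have "Gen d (\<lambda>x. \<forall>y\<in>Rn (Suc d). take d y = x --> ctd (Suc d) k y \<and> (0 < k y --> reg p (Suc d) k y))"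
  proof (rule Gen_mono[OF Gen_conj[OF g3 Gen_conj[OF kl(4) kf(4)]]])
    fix x assume lx: "length x = d" and *: "\<not> (\<exists>y\<in>Rn (Suc d). (\<forall>j<d. y ! j = x ! j) \<and> y \<notin> W \<and> \<not> ctd (Suc d) k y) \<and>
      (\<forall>y\<in>Rn (Suc d). take d y = x --> y \<in> W --> reg p (Suc d) kl y) \<and> (\<forall>y\<in>Rn (Suc d). take d y = x --> y \<in> W' --> reg p (Suc d) kf y)"
    show "\<forall>y\<in>Rn (Suc d). take d y = x --> ctd (Suc d) k y \<and> (0 < k y --> reg p (Suc d) k y)"
    proof (intro ballI impI)
      fix y :: "'r list" assume "y \<in> Rn (Suc d)" and ty: "take d y = x"
      hence ly: "length y = Suc d" by simp
      show "ctd (Suc d) k y \<and> (0 < k y --> reg p (Suc d) k y)"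
      proof (cases "y \<in> W")
        case True
        have 1: "reg p (Suc d) kl y" using * True ly ty by simp
        have "flip d y \<in> W'" unfolding W'_def using True ff[OF ly] flip_simps(1)[OF ly] by simp
        hence "reg p (Suc d) kf (flip d y)" using * flip_simps[OF ly] ty by simp
        from flip_comp(2)[OF ly this] have 2: "reg p (Suc d) kr y" unfolding kr_def .
        have "reg p (Suc d) k y" unfolding k_def
          by (intro reg_mult reg_inverse reg_add reg_const reg_nth 1 2 ly) (use pos(1)[of "y ! d"] in auto)
        thus ?thesis using reg_ctd[OF _ ly] by blast
      next
        case False
        have "\<forall>j<d. y ! j = x ! j" using ty by auto
        hence "ctd (Suc d) k y" using * False ly by auto
        thus ?thesis using kb[OF ly] False by auto
      qed
    qed
  qed
  thus ?thesis using dk kb by (intro exI[of _ k]) simp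
qed

text \<open>Over the generic open set \<open>G\<close> the function \<open>k\<close> is lifted
  directly. Over a piece of the small complement the fibres of \<open>W\<close> may be infinite, so
  the last coordinate joins the index list; with the \<open>d - 1\<close> coordinates of the piece
  this makes \<open>d\<close>, the case covered by \<open>fibre_covered p d\<close>.\<close>

lemma open_covered_Suc: assumes CL: "open_covered p d" and FF: "fibre_covered p d" shows "open_covered p (Suc d)"
  unfolding open_covered_def
proof (intro ballI impI)
  fix W assume W: "W \<in> S (Suc d)" "open_in_Rn (Suc d) W"
  obtain k where k: "dfun (Suc d) k" "\<forall>y\<in>Rn (Suc d). 0 \<le> k y \<and> k y \<le> 1 \<and> (0 < k y \<longleftrightarrow> y \<in> W)"
    "\<forall>y\<in>Rn (Suc d). k y \<le> inverse (1 + y ! d * y ! d)"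
    "Gen d (\<lambda>x. \<forall>y\<in>Rn (Suc d). take d y = x --> ctd (Suc d) k y \<and> (0 < k y --> reg p (Suc d) k y))"
    using fiber_function[OF W, where p = p] by (elim exE conjE)
  have bd: "\<exists>B'. \<forall>y\<in>Rn (Suc d). e \<le> k y --> (\<forall>i<d. \<bar>prj [0..<d] y ! i\<bar> \<le> B) --> (\<forall>i<Suc d. \<bar>y ! i\<bar> \<le> B')" if e: "e > 0" for e B
  proof (intro exI[of _ "max B (1 + inverse e)"] ballI impI allI)
    fix y i assume y: "y \<in> Rn (Suc d)" "e \<le> k y" "\<forall>i<d. \<bar>prj [0..<d] y ! i\<bar> \<le> B" and i: "i < Suc d"
    show "\<bar>y ! i\<bar> \<le> max B (1 + inverse e)"
    proof (cases "i < d")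
      case True thus ?thesis using y(3) by (auto simp: le_max_iff_disj)
    next
      case False
      hence id: "i = d" using i by simp
      have p: "1 + y ! d * y ! d > 0" by (simp add: add_pos_nonneg)
      have "e \<le> inverse (1 + y ! d * y ! d)" using y k(3) by force
      hence "e * (1 + y ! d * y ! d) \<le> 1" using p by (simp add: field_simps)
      hence "1 + y ! d * y ! d \<le> inverse e" using e by (simp add: field_simps)
      moreover have "0 \<le> (\<bar>y ! d\<bar> - 1) * (\<bar>y ! d\<bar> - 1)" by simp
      hence "2 * \<bar>y ! d\<bar> \<le> 1 + y ! d * y ! d" by (simp add: algebra_simps)
      ultimately have "\<bar>y ! d\<bar> \<le> 1 + inverse e" using abs_ge_zero[of "y ! d"] by linarith
      thus ?thesis unfolding id by (simp add: le_max_iff_disj)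
    qed
  qed
  have good: "Gen d (\<lambda>x. \<forall>y\<in>Rn (Suc d). prj [0..<d] y = x --> ctd (Suc d) k y \<and> (0 < k y --> reg p (Suc d) k y))"
    by (rule Gen_mono[OF k(4)]) (simp add: prj_take)
  have "\<exists>G. G \<in> S d \<and> open_in_Rn d G \<and> Gen d (\<lambda>x. x \<in> G) \<and> covered p (Suc d) W {y \<in> Rn (Suc d). 0 < k y \<and> prj [0..<d] y \<in> G}"
    by (rule lift_nice[OF js_upt _ CL k(1) _ _ _ good]) (use k(2) bd in simp_all)
  then obtain G where G: "G \<in> S d" "open_in_Rn d G" "Gen d (\<lambda>x. x \<in> G)" "covered p (Suc d) W {y \<in> Rn (Suc d). 0 < k y \<and> prj [0..<d] y \<in> G}"
    by (elim exE conjE)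
  have X: "Rn d - G \<in> S d" by (rule S_compl[OF G(1)])
  have "Gen d (\<lambda>x. x \<notin> Rn d - G)" by (rule Gen_mono[OF G(3)]) simp
  from small_decomposition[OF X this] obtain L where L: "finite L" "Rn d - G \<subseteq> (\<Union>(J, Y)\<in>L. Y)"
    "\<forall>(J, Y)\<in>L. Y \<in> S d \<and> Suc (length J) = d \<and> set J \<subseteq> {..<d} \<and> (\<forall>x. finite {z \<in> Y. prj J z = x})" by (elim exE conjE)
  define ZL where "ZL l = {z \<in> Rn (Suc d). z \<in> W \<and> take d z \<in> snd l}" for l :: "nat list \<times> 'r list set"
  have cov: "covered p (Suc d) W (ZL l)" if l: "l \<in> L" for l
  proof -
    obtain J Y where JY: "l = (J, Y)" by fastforce
    have *: "Y \<in> S d" "Suc (length J) = d" "set J \<subseteq> {..<d}" "\<And>x. finite {z \<in> Y. prj J z = x}" using L(3) l unfolding JY by auto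
    have js': "length (J @ [d]) = d" "set (J @ [d]) \<subseteq> {..<Suc d}" using *(2,3) by auto
    have Zl: "ZL l \<in> S (Suc d)" unfolding ZL_def JY snd_conv
      by (rule S_Collect) (intro Dp_conj Dp_mem[OF W(1)] Dp_mem[OF *(1)] DV_vars DV_take[OF DV_vars] lessI less_imp_le)
    have "finite {z \<in> ZL l. prj (J @ [d]) z = x}" for x
    proof -
      have "{z \<in> ZL l. prj (J @ [d]) z = x} \<subseteq> (\<lambda>y. y @ [x ! length J]) ` {y \<in> Y. prj J y = take (length J) x}"
      proof
        fix z assume "z \<in> {z \<in> ZL l. prj (J @ [d]) z = x}"
        hence z: "length z = Suc d" "take d z \<in> Y" "prj (J @ [d]) z = x" unfolding ZL_def JY by auto
        have "prj J (take d z) = take (length J) x" unfolding z(3)[symmetric]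
        proof (rule nth_equalityI)
          fix i assume "i < length (prj J (take d z))"
          hence i: "i < length J" by simp
          hence "J ! i < d" using js_nth[OF *(3)] by blast
          thus "prj J (take d z) ! i = take (length J) (prj (J @ [d]) z) ! i" using i by (simp add: nth_append)
        qed simp
        moreover have "x ! length J = z ! d" unfolding z(3)[symmetric] by (subst prj_nth) (auto simp: nth_append)
        ultimately show "z \<in> (\<lambda>y. y @ [x ! length J]) ` {y \<in> Y. prj J y = take (length J) x}"
          using z(2) snoc_take[OF z(1)] by (intro image_eqI[of _ _ "take d z"]) auto
      qed
      thus ?thesis by (rule finite_surj[OF *(4)])
    qed
    moreover have "ZL l \<subseteq> W" unfolding ZL_def by auto
    ultimately show ?thesis using FF[unfolded fibre_covered_def, rule_format, of "J @ [d]" "Suc d" W "ZL l"] js' W Zl by simp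
  qed
  have "covered p (Suc d) W ({y \<in> Rn (Suc d). 0 < k y \<and> prj [0..<d] y \<in> G} \<union> (\<Union>l\<in>L. ZL l))" by (rule covered_Un[OF G(4) covered_UN[OF L(1) cov]])
  moreover have "W \<subseteq> {y \<in> Rn (Suc d). 0 < k y \<and> prj [0..<d] y \<in> G} \<union> (\<Union>l\<in>L. ZL l)"
  proof
    fix z assume z: "z \<in> W"
    have lz: "length z = Suc d" using S_len[OF W(1) z] .
    show "z \<in> {y \<in> Rn (Suc d). 0 < k y \<and> prj [0..<d] y \<in> G} \<union> (\<Union>l\<in>L. ZL l)"
    proof (cases "take d z \<in> G")
      case False
      hence "take d z \<in> Rn d - G" using lz by simp
      hence "take d z \<in> (\<Union>(J, Y)\<in>L. Y)" using L(2) by blast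
      then obtain J Y where "(J, Y) \<in> L" "take d z \<in> Y" by auto
      hence "z \<in> ZL (J, Y)" "(J, Y) \<in> L" using z lz unfolding ZL_def by auto
      thus ?thesis by blast
    next
      case True thus ?thesis using z lz k(2) prj_take[OF lz] by simp
    qed
  qed
  ultimately show "covered p (Suc d) W W" by (rule covered_subset)
qed

lemma open_covered_zero: "open_covered p 0"
  unfolding open_covered_def
proof (intro ballI impI)
  fix W assume W: "W \<in> S 0" "open_in_Rn 0 W"
  show "covered p 0 W W"
  proof (cases "W = {}")
    case True thus ?thesis using covered_empty by simp
  next
    case False
    hence "W = {[]}" using Rn0 W(2) by blast
    moreover have "nice p 0 (\<lambda>x. 1)" unfolding nice_def dfun_def by (simp add: DF_const ctd_const reg_const)
    moreover have "supp 0 (\<lambda>x. 1) = {[]}" unfolding supp_def by (auto simp: Rn_def)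
    ultimately show ?thesis unfolding covered_def by (intro exI[of _ "{\<lambda>x. 1}"]) auto
  qed
qed

text \<open>Both statements for \<open>d\<close> give the first one for \<open>d + 1\<close>; this
  and the second one for \<open>d\<close> give the second one for \<open>d + 1\<close>.\<close>

lemma open_and_fibre_covered: "open_covered p d \<and> fibre_covered p d"
proof (induction d)
  case 0 show ?case using open_covered_zero fibre_covered_of_open[OF open_covered_zero] by auto
next
  case (Suc d)
  have "open_covered p (Suc d)" using Suc open_covered_Suc by blast
  moreover have "fibre_covered p (Suc d)" by (rule fibre_covered_of_open[OF calculation]) (use Suc in auto)
  ultimately show ?case by blast
qed

lemma nice_cover: "W \<in> S n ==> open_in_Rn n W ==> covered p n W W"
  using open_and_fibre_covered unfolding open_covered_def by blast

subsection \<open>Cluster points and flat functions\<close>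

text \<open>This is the substitute for compactness of closed boxes, which fails in a field that is not complete.\<close>

lemma cluster_point:
  assumes "\<And>f v. DF f ==> DV m v ==> Dp (\<lambda>e. P (f e) (v e))"
    and "\<And>d d' z. 0 < d ==> d \<le> d' ==> P d z ==> P d' z"
    and "\<And>d. 0 < d ==> \<exists>z\<in>Rn m. (\<forall>i<m. \<bar>z ! i\<bar> \<le> B) \<and> P d z"
  shows "\<exists>c\<in>Rn m. \<forall>d>0. \<forall>r>0. \<exists>z\<in>Rn m. near m r c z \<and> P d z"
  using assms
proof (induction m arbitrary: P)
  case 0
  show ?case
  proof (rule bexI[of _ "[]"])
    show "\<forall>d>0. \<forall>r>0. \<exists>z\<in>Rn 0. near 0 r [] z \<and> P d z"
    proof (intro allI impI)
      fix d r :: 'r assume "d > 0"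
      from "0.prems"(3)[OF this] show "\<exists>z\<in>Rn 0. near 0 r [] z \<and> P d z" by (auto simp: near_def)
    qed
  qed simp
next
  case (Suc m)
  note dP = Suc.prems(1) and mono = Suc.prems(2) and ne = Suc.prems(3)
  define P1 where "P1 d t \<longleftrightarrow> (\<exists>x\<in>Rn m. (\<forall>i<m. \<bar>x ! i\<bar> \<le> B) \<and> P d (x @ [t]))" for d t
  have dP1: "Dp (\<lambda>e. P1 (f e) (g e))" if "DF f" "DF g" for f g unfolding P1_def
    by (intro Dp_exv Dp_conj Dp_all_less Dp_le DF_abs DF_nth[OF DV_vars] DF_const dP DV_snoc DV_vars DF_ren[OF that(1)] DF_ren[OF that(2)])
  have ne1: "\<exists>t. \<bar>t\<bar> \<le> B \<and> P1 d t" if d: "0 < d" for d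
  proof -
    obtain z where z: "z \<in> Rn (Suc m)" "\<forall>i<Suc m. \<bar>z ! i\<bar> \<le> B" "P d z" using ne[OF d] by blast
    have "take m z @ [z ! m] = z" using snoc_take z(1) by simp
    hence "P1 d (z ! m)" unfolding P1_def using z by (intro bexI[of _ "take m z"]) auto
    thus ?thesis using z(2) by auto
  qed
  have mono1: "P1 d' t" if "0 < d" "d \<le> d'" "P1 d t" for d d' t
    using that mono[OF that(1,2)] unfolding P1_def by blast
  \<comment> \<open>The supremum \<open>c\<close> of these lower bounds is the limit inferior, as
    \<open>d\<close> tends to 0, of the last coordinates of bounded points satisfying
    \<open>P d\<close>.\<close>
  define Q where "Q s \<longleftrightarrow> (\<exists>d>0. \<forall>t. \<bar>t\<bar> \<le> B \<and> P1 d t --> s \<le> t)" for s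
  have dQ: "Dp (\<lambda>e. Q (e 0))" unfolding Q_def
    by (intro Dp_ex Dp_conj Dp_all Dp_imp Dp_less Dp_le DF_abs DF_const DF_var dP1)
  have QB: "Q (- B)" unfolding Q_def by (intro exI[of _ 1]) (auto simp: abs_le_iff)
  have QBd: "s \<le> B" if s: "Q s" for s
  proof -
    obtain d where d: "d > 0" "\<forall>t. \<bar>t\<bar> \<le> B \<and> P1 d t --> s \<le> t" using s unfolding Q_def by blast
    obtain t where "\<bar>t\<bar> \<le> B" "P1 d t" using ne1[OF d(1)] by blast
    thus ?thesis using d(2) by (auto simp: abs_le_iff)
  qed
  obtain c where c: "\<And>s. Q s ==> s \<le> c" "\<And>u. (\<And>s. Q s ==> s \<le> u) ==> c \<le> u"
    by (rule definable_sup[OF dQ QB, of B]) (auto intro: QBd)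
  have cl: "\<exists>t. \<bar>t - c\<bar> < r \<and> P1 d t" if dr: "0 < d" "0 < r" for d r
  proof -
    have "\<exists>s. Q s \<and> c - r < s" using c(2)[of "c - r"] dr(2) by force
    then obtain s d0 where s: "c - r < s" and d0: "d0 > 0" "\<forall>t. \<bar>t\<bar> \<le> B \<and> P1 d0 t --> s \<le> t" unfolding Q_def by blast
    have "\<not> Q (c + r)" using c(1)[of "c + r"] dr(2) by auto
    moreover have m0: "min d d0 > 0" using dr d0 by simp
    ultimately obtain t where t: "\<bar>t\<bar> \<le> B" "P1 (min d d0) t" "t < c + r" unfolding Q_def by (meson not_le)
    have "P1 d0 t" "P1 d t" using mono1[OF m0 _ t(2)] by auto
    moreover from this have "s \<le> t" using d0(2) t(1) by blast
    ultimately show ?thesis using s t(3) by (intro exI[of _ t]) (auto simp: abs_less_iff)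
  qed
  \<comment> \<open>Keeps the points whose last coordinate is within \<open>d\<close> of
    \<open>c\<close> and forgets that coordinate; the induction finds a cluster point of the
    others.\<close>
  define P2 where "P2 d x \<longleftrightarrow> (\<forall>i<m. \<bar>x ! i\<bar> \<le> B) \<and> (\<exists>t. \<bar>t - c\<bar> < d \<and> P d (x @ [t]))" for d x
  have "\<exists>x\<in>Rn m. \<forall>d>0. \<forall>r>0. \<exists>z\<in>Rn m. near m r x z \<and> P2 d z"
  proof (rule Suc.IH)
    show "Dp (\<lambda>e. P2 (f e) (v e))" if "DF f" "DV m v" for f v unfolding P2_def
      by (intro Dp_ex Dp_conj Dp_all_less Dp_le Dp_less DF_abs DF_diff DF_nth[OF that(2)] DF_const DF_var dP DV_snoc DV_ren[OF that(2)] DF_ren[OF that(1)])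
    show "P2 d' z" if "0 < d" "d \<le> d'" "P2 d z" for d d' z
      using that mono[OF that(1,2)] unfolding P2_def by (meson less_le_trans)
    fix d :: 'r assume d: "0 < d"
    obtain t where t: "\<bar>t - c\<bar> < d" "P1 d t" using cl[OF d d] by blast
    then obtain x where "x \<in> Rn m" "\<forall>i<m. \<bar>x ! i\<bar> \<le> B" "P d (x @ [t])" unfolding P1_def by blast
    thus "\<exists>z\<in>Rn m. (\<forall>i<m. \<bar>z ! i\<bar> \<le> B) \<and> P2 d z" unfolding P2_def using t(1) by blast
  qed
  then obtain x where x: "length x = m" "\<forall>d>0. \<forall>r>0. \<exists>z\<in>Rn m. near m r x z \<and> P2 d z" by auto
  show ?case
  proof (rule bexI[of _ "x @ [c]"], intro allI impI)
    fix d r :: 'r assume dr: "0 < d" "0 < r"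
    hence m0: "min d r > 0" by simp
    obtain y where y: "y \<in> Rn m" "near m r x y" "P2 (min d r) y" using x(2) m0 dr(2) by blast
    then obtain t where t: "\<bar>t - c\<bar> < min d r" "P (min d r) (y @ [t])" unfolding P2_def by blast
    have "near (Suc m) r (x @ [c]) (y @ [t])" using y t x(1) unfolding near_def by (auto simp: nth_append less_Suc_eq)
    moreover have "P d (y @ [t])" using mono[OF m0 _ t(2)] by simp
    ultimately show "\<exists>z\<in>Rn (Suc m). near (Suc m) r (x @ [c]) z \<and> P d z" using y(1) by (intro bexI[of _ "y @ [t]"]) auto
  qed (use x in simp)
qed

section \<open>Growth of derivatives near zero\<close>

definition der1 :: "('r \<Rightarrow> 'r) \<Rightarrow> 'r \<Rightarrow> 'r" where
  "der1 f t = pd 1 0 (\<lambda>x. f (x ! 0)) [t]"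

lemma pdv1: "pdv 1 (\<lambda>x. f (x ! 0)) 0 [t] D \<longleftrightarrow> dv1 f t D"
  unfolding pdv_def by simp

lemma der1_eq: "dv1 f t D ==> der1 f t = D"
  unfolding der1_def by (rule pd_eq) (simp only: pdv1)

lemma dfun1: assumes "DF (\<lambda>e. f (e 0))" shows "dfun 1 (\<lambda>x. f (x ! 0))"
  unfolding dfun_def using assms by simp

lemma DF_der1: assumes "DF (\<lambda>e. f (e 0))" shows "DF (\<lambda>e. der1 f (e 0))"
proof -
  have "dfun 1 (pd 1 0 (\<lambda>x. f (x ! 0)))" by (rule dfun_pd[OF dfun1[OF assms]]) simp
  from DF_app[OF this DV_vars] show ?thesis unfolding der1_def by simp
qed

text \<open>Lets product and chain rule in one variable be inherited from lists of length
  one.\<close>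

lemma dv1_hdv: "dv1 f t D \<longleftrightarrow> hdv 1 (\<lambda>x. f (x ! 0)) (\<lambda>i. D) [t]"
proof
  assume f: "dv1 f t D"
  show "hdv 1 (\<lambda>x. f (x ! 0)) (\<lambda>i. D) [t]" unfolding hdv_def lo_def eventually_nb n1_def near_def
    using f unfolding dv1_def by simp (metis)
next
  assume "hdv 1 (\<lambda>x. f (x ! 0)) (\<lambda>i. D) [t]"
  from hdv_pdv[OF this, of 0] show "dv1 f t D" unfolding pdv1 by simp
qed

lemma ctd1_ctd: "ctd1 f t \<longleftrightarrow> ctd 1 (\<lambda>x. f (x ! 0)) [t]"
proof
  assume f: "ctd1 f t"
  show "ctd 1 (\<lambda>x. f (x ! 0)) [t]" unfolding ctd_def eventually_nb near_def
    using f unfolding ctd1_def by simp (metis)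
next
  assume f: "ctd 1 (\<lambda>x. f (x ! 0)) [t]"
  show "ctd1 f t" unfolding ctd1_def
  proof (intro allI impI)
    fix e :: 'r assume "e > 0"
    from ctdD[OF f this] obtain d where d: "d > 0" "\<forall>y\<in>Rn 1. near 1 d [t] y --> \<bar>f (y ! 0) - f ([t] ! 0)\<bar> < e" unfolding eventually_nb by blast
    have "\<bar>f s - f t\<bar> < e" if "\<bar>s - t\<bar> < d" for s using d(2)[rule_format, of "[s]"] that by (simp add: near_def)
    thus "\<exists>d>0. \<forall>y. \<bar>y - t\<bar> < d --> \<bar>f y - f t\<bar> < e" using d(1) by blast
  qed
qed

lemma dv1_mult: assumes "dv1 f t D" "dv1 g t E" shows "dv1 (\<lambda>t. f t * g t) t (f t * E + D * g t)"
  using hdv_mult[OF assms[unfolded dv1_hdv]] unfolding dv1_hdv by simp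

lemma dv1_id: "dv1 (\<lambda>t. t) t 1"
  unfolding dv1_def by (auto intro: exI[of _ 1])

lemma dv1_power: "dv1 (\<lambda>t. t ^ Suc m) t (of_nat (Suc m) * t ^ m)"
proof (induction m)
  case 0 show ?case using dv1_id by simp
next
  case (Suc m)
  from dv1_mult[OF dv1_id Suc] show ?case by (simp add: algebra_simps)
qed

lemma dv1_scale: assumes "dv1 f (c * t) D" shows "dv1 (\<lambda>t. a * f (c * t)) t (a * c * D)"
proof -
  have "hdv 1 (\<lambda>x. f (x ! 0)) (\<lambda>i. D) (map (\<lambda>i. 0 + t * c) [0..<1])" using assms unfolding dv1_hdv by (simp add: mult.commute)
  from hdv_line[OF this] have 1: "dv1 (\<lambda>s. f (c * s)) t (D * c)" by (simp add: mult.commute)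
  have 2: "dv1 (\<lambda>s. a) t 0" unfolding dv1_hdv by (rule hdv_const)
  from dv1_mult[OF 2 1] show ?thesis by (simp add: algebra_simps)
qed

text \<open>Differentiability is a definable condition, so on some interval to the right of 0 it
  holds throughout or fails throughout; failure contradicts
  \<open>differentiable_subinterval\<close>.\<close>

lemma differentiable_near_zero: assumes f: "DF (\<lambda>e. f (e 0))"
  shows "\<exists>\<epsilon>>0. \<forall>t. 0 < t \<and> t < \<epsilon> --> dv1 f t (der1 f t)"
proof -
  have "Dp (\<lambda>e. \<exists>D. dv1 f (e 0) D)" unfolding dv1_def by (intro dfi DF_app1[OF f])
  from germ_right[OF this, of 0] obtain b where b: "b > 0"
    "(\<forall>x. 0 < x \<and> x < b --> (\<exists>D. dv1 f x D)) \<or> (\<forall>x. 0 < x \<and> x < b --> \<not> (\<exists>D. dv1 f x D))" by blast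
  obtain c d where cd: "0 \<le> c" "c < d" "d \<le> b" "\<forall>x. c < x \<and> x < d --> (\<exists>D. dv1 f x D)" using differentiable_subinterval[OF f b(1)] by blast
  obtain t where "c < t" "t < d" using dense[OF cd(2)] by blast
  hence "0 < t \<and> t < b \<and> (\<exists>D. dv1 f t D)" using cd by auto
  hence *: "\<forall>x. 0 < x \<and> x < b --> (\<exists>D. dv1 f x D)" using b(2) by blast
  show ?thesis
  proof (intro exI[of _ b] conjI b(1) allI impI)
    fix t assume "0 < t \<and> t < b"
    then obtain D where D: "dv1 f t D" using * by blast
    thus "dv1 f t (der1 f t)" using der1_eq[OF D] by simp
  qed
qed

text \<open>Each of the three types of local monotonicity has a constant truth value on an interval
  to the right of 0; a monotone subinterval shows which one holds.\<close>

lemma monotone_near_zero: assumes f: "DF (\<lambda>e. f (e 0))"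
  shows "\<exists>\<epsilon>>0. \<exists>R\<in>{(<), (=), (>)}. \<forall>s u. 0 < s \<and> s < u \<and> u < \<epsilon> --> R (f s) (f u)"
proof -
  note df = DF_app1[OF f]
  have dl: "Dp (\<lambda>e. lmono (<) f (e 0))" "Dp (\<lambda>e. lmono (=) f (e 0))" "Dp (\<lambda>e. lmono (>) f (e 0))"
    unfolding lmono_def by (intro dfi df)+
  obtain b1 where b1: "b1 > 0" "(\<forall>x. 0 < x \<and> x < b1 --> lmono (<) f x) \<or> (\<forall>x. 0 < x \<and> x < b1 --> \<not> lmono (<) f x)" using germ_right[OF dl(1), of 0] by blast
  obtain b2 where b2: "b2 > 0" "(\<forall>x. 0 < x \<and> x < b2 --> lmono (=) f x) \<or> (\<forall>x. 0 < x \<and> x < b2 --> \<not> lmono (=) f x)" using germ_right[OF dl(2), of 0] by blast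
  obtain b3 where b3: "b3 > 0" "(\<forall>x. 0 < x \<and> x < b3 --> lmono (>) f x) \<or> (\<forall>x. 0 < x \<and> x < b3 --> \<not> lmono (>) f x)" using germ_right[OF dl(3), of 0] by blast
  define b where "b = min b1 (min b2 b3)"
  have b: "b > 0" using b1 b2 b3 by (simp add: b_def)
  obtain c d R where cd: "0 \<le> c" "c < d" "d \<le> b" and R: "R \<in> {(<), (=), (>)}" and mono: "\<And>x y. c < x ==> x < y ==> y < d ==> R (f x) (f y)"
    by (rule monotone_subinterval[OF f b]) (rule that)
  obtain t where t: "c < t" "t < d" using dense[OF cd(2)] by blast
  have "lmono R f t" unfolding lmono_def by (intro exI[of _ "min (t - c) (d - t)"]) (use t mono in auto)
  moreover have "0 < t" "t < b1" "t < b2" "t < b3" using t cd unfolding b_def by auto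
  ultimately have all: "\<forall>x. 0 < x \<and> x < b --> lmono R f x" using R b1(2) b2(2) b3(2) unfolding b_def by auto
  have "R (f s) (f u)" if su: "0 < s" "s < u" "u < b" for s u
  proof (rule local_to_global[of R f 0 b])
    show "R x y ==> R y z ==> R x z" for x y z using R by auto
    show "Dp (\<lambda>e. R c (f (e 0)))" for c using R by (elim insertE emptyE) (simp_all add: Dp_less Dp_eq DF_const f)
    show "lg R f x \<and> rg R f x" if "0 < x" "x < b" for x using all that lmono_rg_lg by blast
  qed (use su in auto)
  thus ?thesis using b R by (intro exI[of _ b] conjI bexI[of _ R]) auto
qed

text \<open>An increasing derivative is bounded by the slope of a chord: over
  \<open>(t, 2 * t)\<close> if it is nonnegative at \<open>t\<close>, over \<open>(t / 2, t)\<close>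
  if it is negative there. The sum of the three absolute values covers both cases, and the factor 2
  comes from the shorter interval.\<close>

lemma derivative_bound_incr:
  assumes f: "DF (\<lambda>e. f (e 0))" and dv: "\<And>t. 0 < t ==> t < \<epsilon> ==> dv1 f t (h t)"
    and mono: "\<And>s u. 0 < s ==> s < u ==> u < \<epsilon> ==> h s \<le> h u" and t: "0 < t" "2 * t < \<epsilon>"
  shows "t * \<bar>h t\<bar> \<le> 2 * (\<bar>f (2 * t)\<bar> + \<bar>f t\<bar> + \<bar>f (t / 2)\<bar>)"
proof -
  have gen1: "a - b \<le> 2 * (\<bar>a\<bar> + \<bar>b\<bar> + \<bar>c\<bar>)" for a b c :: 'r
    using abs_ge_self[of a] abs_ge_minus_self[of b] abs_ge_zero[of a] abs_ge_zero[of b] abs_ge_zero[of c] by (simp add: algebra_simps)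
  have gen2: "2 * (c - b) \<le> 2 * (\<bar>a\<bar> + \<bar>b\<bar> + \<bar>c\<bar>)" for a b c :: 'r
    using abs_ge_self[of c] abs_ge_minus_self[of b] abs_ge_zero[of a] by (simp add: algebra_simps)
  show ?thesis
proof (cases "h t \<ge> 0")
  case True
  have "h t * (2 * t - t) \<le> f (2 * t) - f t"
  proof (rule mvt_ge[OF f])
    show "t < 2 * t" using t by simp
    show "ctd1 f w" if "t \<le> w" "w \<le> 2 * t" for w by (rule dv1_ctd1[OF dv]) (use that t in auto)
    show "\<exists>D. dv1 f w D \<and> h t \<le> D" if "t < w" "w < 2 * t" for w
      using dv[of w] mono[of t w] that t by (intro exI[of _ "h w"]) auto
  qed
  hence "t * h t \<le> f (2 * t) - f t" by (simp add: algebra_simps)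
  also have "\<dots> \<le> 2 * (\<bar>f (2 * t)\<bar> + \<bar>f t\<bar> + \<bar>f (t / 2)\<bar>)" by (rule gen1)
  finally show ?thesis using True by simp
next
  case False
  have "f t - f (t / 2) \<le> h t * (t - t / 2)"
  proof (rule mvt_le[OF f])
    show "t / 2 < t" using t by simp
    show "ctd1 f w" if "t / 2 \<le> w" "w \<le> t" for w by (rule dv1_ctd1[OF dv]) (use that t in auto)
    show "\<exists>D. dv1 f w D \<and> D \<le> h t" if "t / 2 < w" "w < t" for w
    proof -
      have "0 < w" using that t by (meson half_gt_zero less_trans)
      thus ?thesis using dv[of w] mono[of w t] that t by (intro exI[of _ "h w"]) auto
    qed
  qed
  hence "t * - h t \<le> 2 * (f (t / 2) - f t)" by (simp add: field_simps)
  also have "\<dots> \<le> 2 * (\<bar>f (2 * t)\<bar> + \<bar>f t\<bar> + \<bar>f (t / 2)\<bar>)" by (rule gen2)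
  finally show ?thesis using False by simp
qed
qed

text \<open>The derivative is itself definable, hence monotone near 0; a decreasing one is treated
  through the negative of \<open>f\<close>. No growth condition on \<open>f\<close> is
  imposed.\<close>

lemma derivative_bound: assumes f: "DF (\<lambda>e. f (e 0))"
  shows "\<exists>\<epsilon>>0. \<forall>t. 0 < t \<and> t < \<epsilon> --> dv1 f t (der1 f t) \<and> t * \<bar>der1 f t\<bar> \<le> 2 * (\<bar>f (2 * t)\<bar> + \<bar>f t\<bar> + \<bar>f (t / 2)\<bar>)"
proof -
  obtain \<epsilon>1 where e1: "\<epsilon>1 > 0" "\<And>t. 0 < t ==> t < \<epsilon>1 ==> dv1 f t (der1 f t)" using differentiable_near_zero[OF f] by blast
  obtain \<epsilon>2 R where e2: "\<epsilon>2 > 0" and R: "R \<in> {(<), (=), (>)}" and mono: "\<forall>s u. 0 < s \<and> s < u \<and> u < \<epsilon>2 --> R (der1 f s) (der1 f u)"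
    using monotone_near_zero[OF DF_der1[OF f]] by blast
  define \<epsilon> where "\<epsilon> = min \<epsilon>1 \<epsilon>2"
  have bound: "t * \<bar>der1 f t\<bar> \<le> 2 * (\<bar>f (2 * t)\<bar> + \<bar>f t\<bar> + \<bar>f (t / 2)\<bar>)" if t: "0 < t" "2 * t < \<epsilon>" for t
  proof (cases "R = (>)")
    case False
    hence "der1 f s \<le> der1 f u" if "0 < s" "s < u" "u < \<epsilon>" for s u using R mono[rule_format, of s u] that unfolding \<epsilon>_def by auto
    thus ?thesis by (intro derivative_bound_incr[OF f _ _ t]) (use e1(2) in \<open>auto simp: \<epsilon>_def\<close>)
  next
    case True
    have "t * \<bar>- der1 f t\<bar> \<le> 2 * (\<bar>- f (2 * t)\<bar> + \<bar>- f t\<bar> + \<bar>- f (t / 2)\<bar>)"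
    proof (rule derivative_bound_incr[OF DF_uminus[OF f] _ _ t])
      show "dv1 (\<lambda>t. - f t) s (- der1 f s)" if "0 < s" "s < \<epsilon>" for s
        using dv1_lin[OF e1(2)[of s], of 0] that unfolding \<epsilon>_def by simp
      show "- der1 f s \<le> - der1 f u" if "0 < s" "s < u" "u < \<epsilon>" for s u
        using True mono[rule_format, of s u] that unfolding \<epsilon>_def by auto
    qed
    thus ?thesis by simp
  qed
  show ?thesis
  proof (intro exI[of _ "\<epsilon> / 2"] conjI allI impI)
    show "\<epsilon> / 2 > 0" using e1 e2 unfolding \<epsilon>_def by simp
    fix t assume t: "0 < t \<and> t < \<epsilon> / 2"
    hence "2 * t < \<epsilon>" by simp
    thus "t * \<bar>der1 f t\<bar> \<le> 2 * (\<bar>f (2 * t)\<bar> + \<bar>f t\<bar> + \<bar>f (t / 2)\<bar>)" using bound t by blast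
    show "dv1 f t (der1 f t)" by (rule e1(2)) (use t in \<open>auto simp: \<epsilon>_def\<close>)
  qed
qed

text \<open>\<open>t^(N - k) * fseq N g k t\<close> is the \<open>k\<close>-th derivative of \<open>t^N * g t\<close>.\<close>

fun fseq :: "nat \<Rightarrow> ('r \<Rightarrow> 'r) \<Rightarrow> nat \<Rightarrow> 'r \<Rightarrow> 'r" where
  "fseq N g 0 = g"
| "fseq N g (Suc k) = (\<lambda>t. of_nat (N - k) * fseq N g k t + t * der1 (fseq N g k) t)"

lemma DF_fseq: assumes g: "DF (\<lambda>e. g (e 0))" shows "DF (\<lambda>e. fseq N g k (e 0))"
proof (induction k)
  case (Suc k) show ?case unfolding fseq.simps by (intro DF_add DF_mult DF_const DF_var Suc DF_der1)
qed (use g in simp)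

text \<open>In the inductive step the three values produced by \<open>derivative_bound\<close> have
  arguments at most \<open>2 * t\<close>, and monotonicity of \<open>g\<close> replaces each of them
  by the value at \<open>2 ^ Suc k * t\<close>.\<close>

lemma fseq_bound:
  assumes g: "DF (\<lambda>e. g (e 0))" and mono0: "\<forall>s t. 0 < s \<and> s \<le> t --> 0 \<le> g s \<and> g s \<le> g t"
  shows "\<exists>C>0. \<exists>\<epsilon>>0. \<forall>t. 0 < t \<and> t < \<epsilon> --> \<bar>fseq N g k t\<bar> \<le> C * g (2 ^ k * t)"
proof (induction k)
  case 0
  have mono: "0 \<le> g s \<and> g s \<le> g t" if "0 < s" "s \<le> t" for s t using mono0 that by blast
  have "\<bar>g t\<bar> \<le> 1 * g t" if "0 < t" for t using mono[of t t] that by simp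
  thus ?case by (intro exI[of _ 1] conjI) auto
next
  case (Suc k)
  have mono: "0 \<le> g s \<and> g s \<le> g t" if "0 < s" "s \<le> t" for s t using mono0 that by blast
  from Suc obtain C \<epsilon> where C: "C > 0" "\<epsilon> > 0" and bd: "\<And>t. 0 < t ==> t < \<epsilon> ==> \<bar>fseq N g k t\<bar> \<le> C * g (2 ^ k * t)" by blast
  obtain \<epsilon>' where e': "\<epsilon>' > 0" and dv: "\<And>t. 0 < t ==> t < \<epsilon>' ==>
      t * \<bar>der1 (fseq N g k) t\<bar> \<le> 2 * (\<bar>fseq N g k (2 * t)\<bar> + \<bar>fseq N g k t\<bar> + \<bar>fseq N g k (t / 2)\<bar>)"
    using derivative_bound[OF DF_fseq[OF g, of N k]] by blast
  \<comment> \<open>\<open>of_nat N\<close> bounds the coefficient \<open>N - k\<close> from the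
    product rule; 6 is the factor 2 of \<open>derivative_bound\<close> times its three
    terms.\<close>
  define C' where "C' = (of_nat N + 6) * C"
  have N6: "0 < of_nat N + (6::'r)" by (simp add: add_nonneg_pos)
  have C0: "C' > 0" unfolding C'_def using C N6 by simp
  show ?case
  proof (rule exI[of _ C'], rule conjI[OF C0], rule exI[of _ "min (\<epsilon> / 2) \<epsilon>'"], intro conjI allI impI)
    show "min (\<epsilon> / 2) \<epsilon>' > 0" using C e' by simp
    fix t assume t: "0 < t \<and> t < min (\<epsilon> / 2) \<epsilon>'"
    define G where "G = g (2 ^ Suc k * t)"
    have G: "g (2 ^ k * s) \<le> G" if "0 < s" "s \<le> 2 * t" for s
    proof -
      have "2 ^ k * s \<le> 2 ^ k * (2 * t)" using that by (intro mult_left_mono) auto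
      also have "\<dots> = 2 ^ Suc k * t" by simp
      finally show ?thesis unfolding G_def using mono[of "2 ^ k * s" "2 ^ Suc k * t"] that(1) by simp
    qed
    have b: "\<bar>fseq N g k s\<bar> \<le> C * G" if "0 < s" "s \<le> 2 * t" for s
    proof -
      have "\<bar>fseq N g k s\<bar> \<le> C * g (2 ^ k * s)" using bd[of s] that t by auto
      also have "\<dots> \<le> C * G" using G[OF that] C by (intro mult_left_mono) auto
      finally show ?thesis .
    qed
    have b3: "\<bar>fseq N g k t\<bar> \<le> C * G" "\<bar>fseq N g k (2 * t)\<bar> \<le> C * G" "\<bar>fseq N g k (t / 2)\<bar> \<le> C * G" using b t by auto
    have "\<bar>fseq N g (Suc k) t\<bar> \<le> of_nat (N - k) * \<bar>fseq N g k t\<bar> + t * \<bar>der1 (fseq N g k) t\<bar>"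
      using abs_triangle_ineq[of "of_nat (N - k) * fseq N g k t" "t * der1 (fseq N g k) t"] t by (simp add: abs_mult)
    also have "\<dots> \<le> of_nat N * (C * G) + 2 * (C * G + C * G + C * G)"
    proof (rule add_mono)
      show "of_nat (N - k) * \<bar>fseq N g k t\<bar> \<le> of_nat N * (C * G)" using b3(1) by (intro mult_mono) auto
      have "t * \<bar>der1 (fseq N g k) t\<bar> \<le> 2 * (\<bar>fseq N g k (2 * t)\<bar> + \<bar>fseq N g k t\<bar> + \<bar>fseq N g k (t / 2)\<bar>)" using dv t by simp
      also have "\<dots> \<le> 2 * (C * G + C * G + C * G)" using b3 by (intro mult_left_mono add_mono) auto
      finally show "t * \<bar>der1 (fseq N g k) t\<bar> \<le> 2 * (C * G + C * G + C * G)" .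
    qed
    also have "\<dots> = C' * G" unfolding C'_def by (simp add: algebra_simps)
    finally show "\<bar>fseq N g (Suc k) t\<bar> \<le> C' * g (2 ^ Suc k * t)" unfolding G_def .
  qed
qed

lemma fseq_uniform:
  assumes g: "DF (\<lambda>e. g (e 0))" and mono0: "\<forall>s t. 0 < s \<and> s \<le> t --> 0 \<le> g s \<and> g s \<le> g t"
  shows "\<exists>C>0. \<exists>\<epsilon>>0. \<forall>k\<le>p. \<forall>t. 0 < t \<and> t < \<epsilon> --> \<bar>fseq N g k t\<bar> \<le> C * g (2 ^ k * t) \<and> dv1 (fseq N g k) t (der1 (fseq N g k) t)"
proof (induction p)
  case 0
  obtain C \<epsilon> where "C > 0" "\<epsilon> > 0" "\<forall>t. 0 < t \<and> t < \<epsilon> --> \<bar>fseq N g 0 t\<bar> \<le> C * g (2 ^ 0 * t)" using fseq_bound[OF g mono0, of N 0] by (elim exE conjE)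
  moreover obtain \<epsilon>' where "\<epsilon>' > 0" "\<forall>t. 0 < t \<and> t < \<epsilon>' --> dv1 (fseq N g 0) t (der1 (fseq N g 0) t)" using differentiable_near_zero[OF DF_fseq[OF g, of N 0]] by (elim exE conjE)
  ultimately show ?case by - (rule exI[of _ C], rule conjI, assumption, rule exI[of _ "min \<epsilon> \<epsilon>'"], auto)
next
  case (Suc p)
  then obtain C1 \<epsilon>1 where 1: "C1 > 0" "\<epsilon>1 > 0" "\<forall>k\<le>p. \<forall>t. 0 < t \<and> t < \<epsilon>1 --> \<bar>fseq N g k t\<bar> \<le> C1 * g (2 ^ k * t) \<and> dv1 (fseq N g k) t (der1 (fseq N g k) t)" by (elim exE conjE)
  obtain C \<epsilon> where 2: "C > 0" "\<epsilon> > 0" "\<forall>t. 0 < t \<and> t < \<epsilon> --> \<bar>fseq N g (Suc p) t\<bar> \<le> C * g (2 ^ Suc p * t)" using fseq_bound[OF g mono0, of N "Suc p"] by (elim exE conjE)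
  obtain \<epsilon>' where 3: "\<epsilon>' > 0" "\<forall>t. 0 < t \<and> t < \<epsilon>' --> dv1 (fseq N g (Suc p)) t (der1 (fseq N g (Suc p)) t)" using differentiable_near_zero[OF DF_fseq[OF g, of N "Suc p"]] by (elim exE conjE)
  show ?case
  proof (rule exI[of _ "max C C1"], rule conjI, simp add: 1(1) less_max_iff_disj, rule exI[of _ "min \<epsilon>1 (min \<epsilon> \<epsilon>')"], intro conjI allI impI)
    fix k t assume k: "k \<le> Suc p" and t: "0 < t \<and> t < min \<epsilon>1 (min \<epsilon> \<epsilon>')"
    have g0: "0 \<le> g (2 ^ k * t)" using mono0[rule_format, of "2 ^ k * t" "2 ^ k * t"] t by simp
    have mx: "D * g (2 ^ k * t) \<le> max C C1 * g (2 ^ k * t)" if "D = C \<or> D = C1" for D using g0 that by (intro mult_right_mono) auto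
    show "\<bar>fseq N g k t\<bar> \<le> max C C1 * g (2 ^ k * t)"
    proof (cases "k = Suc p")
      case True
      have "\<bar>fseq N g k t\<bar> \<le> C * g (2 ^ k * t)" unfolding True using 2(3) t by simp
      thus ?thesis using mx[of C] by simp
    next
      case False
      have "\<bar>fseq N g k t\<bar> \<le> C1 * g (2 ^ k * t)" using 1(3) False k t by simp
      thus ?thesis using mx[of C1] by simp
    qed
    show "dv1 (fseq N g k) t (der1 (fseq N g k) t)"
    proof (cases "k = Suc p")
      case True show ?thesis unfolding True using 3(2) t by simp
    next
      case False thus ?thesis using 1(3) k t by simp
    qed
  qed (use 1 2 3 in auto)
qed

section \<open>Majorants and the construction of \<theta>\<close>

definition majorant :: "('r \<Rightarrow> 'r) \<Rightarrow> bool" where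
  "majorant A \<longleftrightarrow> DF (\<lambda>e. A (e 0)) \<and> (\<forall>t>0. 0 \<le> A t) \<and> (\<forall>s t. 0 < s \<and> s \<le> t --> A t \<le> A s)"

text \<open>The witness is a rescaling of \<open>t^N * b(t / 2^p)\<close> with \<open>b = 1 / (1 + A)\<close>. Each derivative costs a factor \<open>1 / t\<close> and a doubling of
  the argument of \<open>b\<close>, as \<open>derivative_bound\<close> shows.\<close>

lemma theta_exists:
  assumes A: "majorant A"
  shows "\<exists>\<theta>. (\<forall>k. DF (\<lambda>e. \<theta> k (e 0))) \<and> (\<forall>k\<le>p. \<forall>t. 0 < t \<and> t < 2 --> dv1 (\<theta> k) t (\<theta> (Suc k) t)) \<and>
    (\<forall>t. 0 < t \<and> t < 2 --> 0 < \<theta> 0 t) \<and> (\<forall>k\<le>p. \<forall>t. 0 < t \<and> t \<le> 1 --> \<bar>\<theta> k t\<bar> * A t \<le> t)"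
proof -
  have dA: "DF (\<lambda>e. A (e 0))" and A0: "\<And>t. 0 < t ==> 0 \<le> A t" and Am: "\<And>s t. 0 < s ==> s \<le> t ==> A t \<le> A s"
    using A unfolding majorant_def by auto
  define b where "b t = inverse (1 + A t)" for t
  have b: "0 < b t \<and> b t * A t \<le> 1" if "0 < t" for t
  proof -
    have "0 < 1 + A t" using A0[OF that] by simp
    thus ?thesis unfolding b_def using A0[OF that] by (simp add: field_simps)
  qed
  have bm: "b s \<le> b t" if "0 < s" "s \<le> t" for s t
  proof -
    have "0 < 1 + A t" "1 + A t \<le> 1 + A s" using A0[of t] Am[OF that] that by auto
    thus ?thesis unfolding b_def by (rule le_imp_inverse_le[rotated])
  qed
  \<comment> \<open>Dividing the argument by \<open>2 ^ p\<close> in advance pays for up to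
    \<open>p\<close> doublings: \<open>g (2 ^ k * t) \<le> b t\<close> whenever
    \<open>k \<le> p\<close>.\<close>
  define g where "g t = b (t / 2 ^ p)" for t
  have g: "DF (\<lambda>e. g (e 0))" unfolding g_def b_def by (intro DF_inverse DF_add DF_const DF_app1[OF dA] DF_divide DF_var)
  have gm: "0 \<le> g s \<and> g s \<le> g t" if "0 < s" "s \<le> t" for s t
  proof -
    have "0 < s / 2 ^ p" "s / 2 ^ p \<le> t / 2 ^ p" using that by (auto simp: divide_right_mono)
    thus ?thesis unfolding g_def using b[of "s / 2 ^ p"] bm by auto
  qed
  hence gm0: "\<forall>s t. 0 < s \<and> s \<le> t --> 0 \<le> g s \<and> g s \<le> g t" by blast
  \<comment> \<open>For \<open>k \<le> p\<close> the \<open>k\<close>-th derivative keeps the factor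
    \<open>t ^ 2\<close> at least: one \<open>t\<close> absorbs the constant \<open>C\<close>, the
    other is the required bound.\<close>
  define N where "N = p + 2"
  obtain C \<epsilon> where C: "C > 0" "\<epsilon> > 0" and fs: "\<forall>k\<le>p. \<forall>t. 0 < t \<and> t < \<epsilon> --> \<bar>fseq N g k t\<bar> \<le> C * g (2 ^ k * t) \<and> dv1 (fseq N g k) t (der1 (fseq N g k) t)"
    using fseq_uniform[OF g gm0, of p N] by (elim exE conjE)
  define \<theta>0 where "\<theta>0 k t = t ^ (N - k) * fseq N g k t" for k t
  define \<eta> where "\<eta> = min \<epsilon> (min 1 (inverse C))"
  have \<eta>: "\<eta> > 0" unfolding \<eta>_def using C by simp
  have dv: "dv1 (\<theta>0 k) t (\<theta>0 (Suc k) t)" if k: "k \<le> p" and t: "0 < t" "t < \<eta>" for k t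
  proof -
    obtain m where m: "N - k = Suc m" "N - Suc k = m" using k unfolding N_def by (metis Suc_diff_le add_2_eq_Suc' diff_Suc_Suc le_SucI)
    have "dv1 (fseq N g k) t (der1 (fseq N g k) t)" using fs k t unfolding \<eta>_def by simp
    from dv1_mult[OF dv1_power[of m t] this] show ?thesis unfolding \<theta>0_def m fseq.simps
      by (simp add: algebra_simps)
  qed
  have bd: "\<bar>\<theta>0 k t\<bar> * A t \<le> t" if k: "k \<le> p" and t: "0 < t" "t < \<eta>" for k t
  proof -
    have "(2::'r) ^ k \<le> 2 ^ p" using k by (intro power_increasing) auto
    hence "2 ^ k * t \<le> 2 ^ p * t" using t by (intro mult_right_mono) auto
    hence "2 ^ k * t / 2 ^ p \<le> t" by (simp add: field_simps)
    hence gb: "g (2 ^ k * t) \<le> b t" unfolding g_def using t by (intro bm) auto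
    have "\<bar>fseq N g k t\<bar> * A t \<le> C * g (2 ^ k * t) * A t" using fs k t A0[of t] unfolding \<eta>_def by (intro mult_right_mono) auto
    also have "\<dots> \<le> C * b t * A t" using gb C A0[of t] t by (intro mult_right_mono mult_left_mono) auto
    also have "\<dots> \<le> C * 1" using b[OF t(1)] C by (simp add: mult.assoc)
    finally have 1: "\<bar>fseq N g k t\<bar> * A t \<le> C" by simp
    have t1: "t \<le> 1" "t * C \<le> 1" using t C unfolding \<eta>_def by (auto simp: field_simps)
    have "t ^ (N - k) \<le> t ^ 2" using k t t1 unfolding N_def by (intro power_decreasing) auto
    moreover have "0 \<le> \<bar>fseq N g k t\<bar> * A t" using A0[OF t(1)] by simp
    ultimately have "t ^ (N - k) * (\<bar>fseq N g k t\<bar> * A t) \<le> t ^ 2 * C" using 1 by (intro mult_mono) auto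
    also have "\<dots> = t * (t * C)" by (simp add: power2_eq_square)
    also have "\<dots> \<le> t * 1" using t t1 by (intro mult_left_mono) auto
    finally show ?thesis unfolding \<theta>0_def using t by (simp add: abs_mult mult.assoc)
  qed
  \<comment> \<open>Scaling by \<open>\<eta> / 2\<close> stretches \<open>(0, \<eta>)\<close> to
    \<open>(0, 2)\<close>, which contains \<open>(0, 1]\<close> in its interior on the right; as
    \<open>c \<le> 1\<close>, the powers \<open>c ^ k\<close> do not spoil the bounds.\<close>
  define c where "c = \<eta> / 2"
  have c: "0 < c" "c \<le> 1" unfolding c_def \<eta>_def using C by (auto simp: min_def)
  have ct: "0 < c * t" "c * t < \<eta>" if "0 < t" "t < 2" for t
  proof -
    show "0 < c * t" using c that by simp
    have "c * t < c * 2" using c that by (intro mult_strict_left_mono) auto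
    thus "c * t < \<eta>" unfolding c_def by simp
  qed
  define \<theta> where "\<theta> k t = c ^ k * \<theta>0 k (c * t)" for k t
  show ?thesis
  proof (intro exI[of _ \<theta>] conjI allI impI)
    show "DF (\<lambda>e. \<theta> k (e 0))" for k unfolding \<theta>_def \<theta>0_def
      by (intro DF_mult DF_const DF_power DF_var DF_app1[OF DF_fseq[OF g]])
    show "dv1 (\<theta> k) t (\<theta> (Suc k) t)" if "k \<le> p" "0 < t \<and> t < 2" for k t
    proof -
      have "dv1 (\<theta>0 k) (c * t) (\<theta>0 (Suc k) (c * t))" using dv that ct by simp
      from dv1_scale[OF this, of "c ^ k"] show ?thesis unfolding \<theta>_def by (simp add: mult.commute mult.left_commute)
    qed
    show "0 < \<theta> 0 t" if "0 < t \<and> t < 2" for t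
    proof -
      have "0 < c * t" using ct that by blast
      hence "0 < g (c * t)" unfolding g_def using b[of "c * t / 2 ^ p"] by simp
      thus ?thesis unfolding \<theta>_def \<theta>0_def using \<open>0 < c * t\<close> by simp
    qed
    show "\<bar>\<theta> k t\<bar> * A t \<le> t" if k: "k \<le> p" and t: "0 < t \<and> t \<le> 1" for k t
    proof -
      have t2: "0 < t" "t < 2" using t by (auto intro: le_less_trans)
      have "\<bar>\<theta> k t\<bar> \<le> \<bar>\<theta>0 k (c * t)\<bar>" unfolding \<theta>_def abs_mult using c by (simp add: mult_left_le_one_le power_le_one)
      moreover have ctt: "c * t \<le> t" using c t by (simp add: mult_left_le_one_le)
      hence "A t \<le> A (c * t)" using Am[of "c * t" t] ct[OF t2] by simp
      ultimately have "\<bar>\<theta> k t\<bar> * A t \<le> \<bar>\<theta>0 k (c * t)\<bar> * A (c * t)" using A0[of t] t by (intro mult_mono) auto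
      also have "\<dots> \<le> c * t" using bd[OF k ct[OF t2]] .
      finally show ?thesis using ctt by simp
    qed
  qed
qed

lemma majorant_zero: "majorant (\<lambda>t. 0)"
  unfolding majorant_def by (simp add: DF_const)

lemma majorant_add: "majorant A ==> majorant B ==> majorant (\<lambda>t. A t + B t)"
  unfolding majorant_def by (auto intro: DF_add add_mono)

lemma majorant_sum: "(\<And>i. i < n ==> majorant (A i)) ==> majorant (\<lambda>t. \<Sum>i<(n::nat). A i t)"
  by (induction n) (simp_all add: majorant_zero majorant_add)

lemma majorant_nonneg: "majorant A ==> 0 < t ==> 0 \<le> A t"
  unfolding majorant_def by blast

subsection \<open>Extension by zero\<close>

text \<open>\<open>A t\<close> is the supremum of \<open>|w|\<close> over the region
  \<open>K t\<close>: points of \<open>W\<close> with \<open>u \<ge> t\<close>, whose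
  \<open>t\<close>-box lies in \<open>W\<close> and whose coordinates are at most
  \<open>1 / t\<close>. A cluster point of points of \<open>K t\<close> still lies in
  \<open>W\<close> and has \<open>u \<ge> t\<close>, so \<open>w\<close> is continuous there and
  cannot be unbounded near it. The regions shrink as \<open>t\<close> grows, whence \<open>A\<close>
  is antitone.\<close>

lemma local_majorant:
  assumes W: "W \<in> S m" "open_in_Rn m W" and u: "dfun m u" "\<And>y. y \<in> W ==> ctd m u y"
    and w: "dfun m w" "\<And>y. y \<in> W ==> 0 < u y ==> ctd m w y"
  shows "\<exists>A. majorant A \<and> (\<forall>t>0. \<forall>y\<in>W. t \<le> u y --> (\<forall>z\<in>Rn m. near m t y z --> z \<in> W) --> (\<forall>i<m. \<bar>y ! i\<bar> \<le> inverse t) --> \<bar>w y\<bar> \<le> A t)"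
proof -
  define K where "K t y \<longleftrightarrow> y \<in> W \<and> t \<le> u y \<and> (\<forall>z\<in>Rn m. (\<forall>i<m. \<bar>z ! i - y ! i\<bar> < t) --> z \<in> W) \<and> (\<forall>i<m. \<bar>y ! i\<bar> \<le> inverse t)" for t y
  have dK: "Dp (\<lambda>e. K (f e) (v e))" if "DF f" "DV m v" for f v unfolding K_def
    by (intro Dp_conj Dp_imp Dp_allv Dp_all_less Dp_le Dp_less Dp_mem[OF W(1)] DF_app[OF u(1)] DF_abs DF_diff DF_inverse that
      DF_ren[OF that(1)] DF_nth[OF that(2)] DF_nth[OF DV_ren[OF that(2)]] DF_nth[OF DV_vars] DV_vars)
  have bounded: "\<exists>M. \<forall>y. K t y --> \<bar>w y\<bar> \<le> M" if t: "0 < t" for t :: 'r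
  proof (rule ccontr)
    assume "\<not> ?thesis"
    hence neg: "\<exists>y. K t y \<and> M < \<bar>w y\<bar>" for M by (meson not_le)
    \<comment> \<open>The condition \<open>inverse d \<le> |w z|\<close> with \<open>d\<close>
      tending to 0 expresses unboundedness in the monotone form that \<open>cluster_point\<close>
      requires.\<close>
    have "\<exists>c\<in>Rn m. \<forall>d>0. \<forall>r>0. \<exists>z\<in>Rn m. near m r c z \<and> (K t z \<and> inverse d \<le> \<bar>w z\<bar>)"
    proof (rule cluster_point[where P = "\<lambda>d z. K t z \<and> inverse d \<le> \<bar>w z\<bar>" and B = "inverse t"])
      show "Dp (\<lambda>e. K t (v e) \<and> inverse (f e) \<le> \<bar>w (v e)\<bar>)" if "DF f" "DV m v" for f v
        by (intro Dp_conj dK Dp_le DF_inverse DF_abs DF_app[OF w(1)] DF_const that)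
      show "K t z \<and> inverse d' \<le> \<bar>w z\<bar>" if "0 < d" "d \<le> d'" "K t z \<and> inverse d \<le> \<bar>w z\<bar>" for d d' z
        using that order_trans[OF le_imp_inverse_le[OF that(2,1)]] by blast
      fix d :: 'r
      obtain y where y: "K t y" "inverse d < \<bar>w y\<bar>" using neg by blast
      thus "\<exists>z\<in>Rn m. (\<forall>i<m. \<bar>z ! i\<bar> \<le> inverse t) \<and> (K t z \<and> inverse d \<le> \<bar>w z\<bar>)"
        using S_len[OF W(1), of y] unfolding K_def by (intro bexI[of _ y]) auto
    qed
    then obtain c where lc: "length c = m" and c: "\<forall>d>0. \<forall>r>0. \<exists>z\<in>Rn m. near m r c z \<and> (K t z \<and> inverse d \<le> \<bar>w z\<bar>)" by auto
    obtain z where z: "near m t c z" "K t z" using c t by (metis zero_less_one)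
    have "\<bar>c ! i - z ! i\<bar> < t" if "i < m" for i using z(1) that abs_minus_commute unfolding near_def by metis
    hence cW: "c \<in> W" using z(2) lc unfolding K_def by auto
    have uc: "t \<le> u c"
    proof (rule ccontr)
      assume "\<not> t \<le> u c"
      hence "t - u c > 0" by simp
      from ctdD[OF u(2)[OF cW] this] obtain r where r: "r > 0" "\<forall>z\<in>Rn m. near m r c z --> \<bar>u z - u c\<bar> < t - u c" unfolding eventually_nb by blast
      obtain z where z: "z \<in> Rn m" "near m r c z" "K t z" using c r(1) by (metis zero_less_one)
      have "\<bar>u z - u c\<bar> < t - u c" using r(2) z by blast
      thus False using z(3) unfolding K_def by (auto simp: abs_less_iff)
    qed
    hence "0 < u c" using t by simp
    from ctdD[OF w(2)[OF cW this] zero_less_one] obtain r where r: "r > 0" "\<forall>z\<in>Rn m. near m r c z --> \<bar>w z - w c\<bar> < 1" unfolding eventually_nb by blast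
    have p: "\<bar>w c\<bar> + 1 > 0" by (simp add: add_nonneg_pos)
    hence "inverse (\<bar>w c\<bar> + 1) > 0" by simp
    then obtain z where z: "z \<in> Rn m" "near m r c z" "inverse (inverse (\<bar>w c\<bar> + 1)) \<le> \<bar>w z\<bar>" using c r(1) by blast
    have "\<bar>w z - w c\<bar> < 1" using r(2) z by blast
    thus False using z(3) by simp
  qed
  \<comment> \<open>The value 0 keeps the set nonempty when \<open>K t\<close> is empty and makes
    the supremum nonnegative.\<close>
  define V where "V t v \<longleftrightarrow> v = 0 \<or> (\<exists>y\<in>Rn m. K t y \<and> v = \<bar>w y\<bar>)" for t v
  define L where "L t s \<longleftrightarrow> (\<forall>v. V t v --> v \<le> s) \<and> (\<forall>r. (\<forall>v. V t v --> v \<le> r) --> s \<le> r)" for t s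
  have dV: "Dp (\<lambda>e. V (f e) (g e))" if "DF f" "DF g" for f g unfolding V_def
    by (intro Dp_disj Dp_eq Dp_exv Dp_conj dK DF_abs DF_app[OF w(1)] DV_vars DF_ren[OF that(1)] DF_ren[OF that(2)] that DF_const)
  have "Dp (\<lambda>e. L (e (Suc 0)) (e 0))" unfolding L_def by (intro Dp_conj Dp_all Dp_imp dV Dp_le DF_var)
  then obtain F where F: "DF F" "\<And>e s. L (e 0) s ==> L (e 0) (F e)"
    by (rule definable_choice1[of "\<lambda>s e. L (e 0) s"]) (rule that)
  define A where "A t = F (\<lambda>i. t)" for t
  have dA: "DF (\<lambda>e. A (e 0))" unfolding A_def by (rule DF_subst[OF F(1)]) (rule DF_var)
  have LA: "L t (A t)" if t: "0 < t" for t :: 'r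
  proof -
    have dVt: "Dp (\<lambda>e. V t (e 0))" by (intro dV DF_const DF_var)
    obtain M where M: "\<forall>y. K t y --> \<bar>w y\<bar> \<le> M" using bounded[OF t] by blast
    have "\<exists>s. L t s"
    proof (rule definable_sup[OF dVt, of 0 "max M 0"])
      show "V t 0" unfolding V_def by simp
      show "v \<le> max M 0" if "V t v" for v using that M unfolding V_def by (auto simp: le_max_iff_disj)
      fix s assume "\<And>x. V t x ==> x \<le> s" "\<And>u. (\<And>x. V t x ==> x \<le> u) ==> s \<le> u"
      hence "L t s" unfolding L_def by blast
      thus "\<exists>s. L t s" by blast
    qed
    then obtain s where s: "L t s" by blast
    thus ?thesis using F(2)[of "\<lambda>i. t" s] unfolding A_def by simp
  qed
  have VA: "v \<le> A t" if "0 < t" "V t v" for t v using LA[OF that(1)] that(2) unfolding L_def by blast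
  have "majorant A" unfolding majorant_def
  proof (intro conjI dA allI impI)
    show "0 \<le> A t" if "t > 0" for t by (rule VA[OF that]) (simp add: V_def)
    fix s t :: 'r assume st: "0 < s \<and> s \<le> t"
    have "K s y" if k: "K t y" for y
    proof -
      have "inverse t \<le> inverse s" using st by (intro le_imp_inverse_le) auto
      thus ?thesis using k st unfolding K_def by (meson order_trans less_le_trans)
    qed
    hence "V s v" if "V t v" for v using that unfolding V_def by blast
    hence "\<forall>v. V t v --> v \<le> A s" using VA st by blast
    thus "A t \<le> A s" using LA[of t] st unfolding L_def by (meson less_le_trans)
  qed
  moreover have "\<bar>w y\<bar> \<le> A t" if "t > 0" "y \<in> W" "t \<le> u y" "\<forall>z\<in>Rn m. near m t y z --> z \<in> W" "\<forall>i<m. \<bar>y ! i\<bar> \<le> inverse t" for t y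
  proof (rule VA[OF that(1)])
    have "K t y" unfolding K_def using that unfolding near_def by blast
    thus "V t \<bar>w y\<bar>" unfolding V_def using S_len[OF W(1) that(2)] by auto
  qed
  ultimately show ?thesis by blast
qed

definition ext0 :: "'r list set \<Rightarrow> ('r list \<Rightarrow> 'r) \<Rightarrow> ('r \<Rightarrow> 'r) \<Rightarrow> ('r list \<Rightarrow> 'r) \<Rightarrow> 'r list \<Rightarrow> 'r" where
  "ext0 W u \<theta> w y = (if y \<in> W \<and> 0 < u y then \<theta> (u y) * w y else 0)"

lemma dfun_ext0: assumes "W \<in> S m" "dfun m u" "DF (\<lambda>e. \<theta> (e 0))" "dfun m w" shows "dfun m (ext0 W u \<theta> w)"
  unfolding dfun_def ext0_def
  by (intro DF_if Dp_conj Dp_mem[OF assms(1)] Dp_less DF_mult DF_const DF_app1[OF assms(3)] DF_app[OF assms(2)] DF_app[OF assms(4)] DV_vars)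

lemma ctd_theta: assumes "ctd m u y" "ctd1 \<theta> (u y)" shows "ctd m (\<lambda>y. \<theta> (u y)) y"
proof -
  have "ctd m (\<lambda>y. (\<lambda>z. \<theta> (z ! 0)) (map (\<lambda>j. u y) [0..<1])) y"
    by (rule ctd_comp) (use assms in \<open>simp_all add: ctd1_ctd\<close>)
  thus ?thesis by simp
qed

lemma hdv_theta: assumes "hdv m u D y" "dv1 \<theta> (u y) E" shows "hdv m (\<lambda>y. \<theta> (u y)) (\<lambda>i. E * D i) y"
  using hdv_comp[of 1 "\<lambda>z. \<theta> (z ! 0)" "\<lambda>j. E" "\<lambda>j. u" y m "\<lambda>j. D"] assms unfolding dv1_hdv by simp

lemma ext0_ev: assumes W: "open_in_Rn m W" and y: "y \<in> W" "0 < u y" and u: "ctd m u y"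
  shows "eventually (\<lambda>z. \<theta> (u z) * w z = ext0 W u \<theta> w z) (nb m y)"
  using open_ev[OF W y(1)] ctd_pos[OF u y(2)] by eventually_elim (simp add: ext0_def)

text \<open>At a zero of \<open>u\<close> in \<open>W\<close>, a nearby \<open>z\<close> with
  \<open>t = u z > 0\<close> belongs to the region where \<open>A t\<close> bounds \<open>w\<close>.
  So the product is at most \<open>|\<theta> t| * A t \<le> t\<close> there, and \<open>t\<close>
  tends to 0.\<close>

lemma ext0_ctd:
  assumes W: "open_in_Rn m W" and u: "\<And>y. y \<in> W ==> ctd m u y" "\<And>y. y \<in> W ==> 0 \<le> u y \<and> u y \<le> 1"
    and w: "\<And>y. y \<in> W ==> 0 < u y ==> ctd m w y" and \<theta>: "\<And>t. 0 < t ==> t < 2 ==> ctd1 \<theta> t" "\<And>t. 0 < t ==> t \<le> 1 ==> \<bar>\<theta> t\<bar> * A t \<le> t"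
    and A: "\<forall>t>0. \<forall>y\<in>W. t \<le> u y --> (\<forall>z\<in>Rn m. near m t y z --> z \<in> W) --> (\<forall>i<m. \<bar>y ! i\<bar> \<le> inverse t) --> \<bar>w y\<bar> \<le> A t"
    and y: "y \<in> W"
  shows "ctd m (ext0 W u \<theta> w) y"
proof (cases "0 < u y")
  case True
  have u2: "u y < 2" using u(2)[OF y] by (auto intro: le_less_trans)
  have "ctd m (\<lambda>y. \<theta> (u y) * w y) y" by (rule ctd_mult[OF ctd_theta[OF u(1)[OF y] \<theta>(1)[OF True u2]] w[OF y True]])
  thus ?thesis by (rule ctd_cong[OF _ ext0_ev[OF W y True u(1)[OF y]] open_len[OF W y]])
next
  case False
  hence uy: "u y = 0" using u(2)[OF y] by auto
  hence F0: "ext0 W u \<theta> w y = 0" unfolding ext0_def by simp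
  obtain r where r: "r > 0" "cube m y r \<subseteq> W" by (rule open_contains_cube[OF W y])
  define K where "K = 1 + (\<Sum>i<m. \<bar>y ! i\<bar>) + 1"
  have K: "0 < K" "\<And>i. i < m ==> \<bar>y ! i\<bar> + 1 \<le> K"
  proof -
    show "0 < K" unfolding K_def by (simp add: add_pos_nonneg sum_nonneg add_nonneg_pos)
    show "\<bar>y ! i\<bar> + 1 \<le> K" if "i < m" for i
      using member_le_sum[of i "{..<m}" "\<lambda>i. \<bar>y ! i\<bar>"] that unfolding K_def by simp
  qed
  show ?thesis unfolding ctd_def F0
  proof (intro allI impI)
    fix e :: 'r assume e: "e > 0"
    \<comment> \<open>The entry \<open>r / 2\<close> keeps the \<open>t\<close>-box around
      \<open>z\<close> inside \<open>W\<close>, and \<open>inverse K\<close> ensures that the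
      coordinates of \<open>z\<close> are at most \<open>1 / t\<close>.\<close>
    define e' where "e' = min e (min (r / 2) (inverse K))"
    have e': "e' > 0" unfolding e'_def using e r K by simp
    have "min (r / 2) 1 > 0" using r by simp
    from ctdD[OF u(1)[OF y] e'] ev_near[OF this, of m y] ev_length[of m y]
    show "eventually (\<lambda>z. \<bar>ext0 W u \<theta> w z - 0\<bar> < e) (nb m y)"
    proof eventually_elim
      case (elim z)
      show ?case
      proof (cases "z \<in> W \<and> 0 < u z")
        case False thus ?thesis unfolding ext0_def using e by auto
      next
        case True
        define t where "t = u z"
        have t: "0 < t" "t < e" "t < r / 2" "t < inverse K" "t \<le> 1"
          using True elim(1) uy u(2)[of z] unfolding t_def e'_def by auto
        have "\<bar>w z\<bar> \<le> A t"
        proof (rule A[rule_format, OF t(1)])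
          show "z \<in> W" "t \<le> u z" using True unfolding t_def by auto
          fix x assume x: "x \<in> Rn m" "near m t z x"
          have "\<bar>x ! i - y ! i\<bar> < r" if "i < m" for i
          proof -
            have "\<bar>x ! i - z ! i\<bar> < r / 2" "\<bar>z ! i - y ! i\<bar> < r / 2" using x(2) elim(2) that t(3) unfolding near_def by (auto intro: less_trans)
            thus ?thesis by linarith
          qed
          thus "x \<in> W" using r(2) x(1) unfolding cube_def near_def by auto
        next
          fix i assume i: "i < m"
          have "\<bar>z ! i - y ! i\<bar> < 1" using elim(2) i unfolding near_def by auto
          hence "\<bar>z ! i\<bar> \<le> K" using K(2)[OF i] by linarith
          also have "K \<le> inverse t" using le_imp_inverse_le[of t "inverse K"] t by simp
          finally show "\<bar>z ! i\<bar> \<le> inverse t" .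
        qed
        hence "\<bar>\<theta> t\<bar> * \<bar>w z\<bar> \<le> \<bar>\<theta> t\<bar> * A t" by (intro mult_left_mono) auto
        also have "\<dots> \<le> t" by (rule \<theta>(2)) (use t in auto)
        finally have "\<bar>\<theta> t * w z\<bar> < e" using t(2) by (simp add: abs_mult)
        thus ?thesis using True unfolding ext0_def t_def by simp
      qed
    qed
  qed
qed

text \<open>Mean value inequality on the segment from \<open>y0\<close>, after its last point outside \<open>G\<close>.\<close>

lemma hdv_at_zero:
  assumes W: "W \<in> S m" "open_in_Rn m W" and F: "dfun m F" "\<And>y. y \<in> W ==> ctd m F y"
    and G: "G \<in> S m" "open_in_Rn m G" "G \<subseteq> W" and dG: "\<And>y. y \<in> G ==> hdv m F (\<lambda>i. D i y) y"
    and F0: "\<And>y. y \<in> W ==> y \<notin> G ==> F y = 0" and D: "\<And>i. i < m ==> ctd m (D i) y0" "\<And>i. i < m ==> D i y0 = 0"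
    and y0: "y0 \<in> W" "y0 \<notin> G"
  shows "hdv m F (\<lambda>i. D i y0) y0"
proof -
  have l0: "length y0 = m" using open_len W(2) y0(1) by blast
  have "hdv m F (\<lambda>i. 0) y0" unfolding hdv_def lo_def
  proof (intro allI impI)
    fix e :: 'r assume e: "e > 0"
    have "eventually (\<lambda>y. \<forall>i<m. \<bar>D i y - D i y0\<bar> < e) (nb m y0)" by (rule ev_all_less) (rule ctdD[OF D(1) e])
    with open_ev[OF W(2) y0(1)] have "eventually (\<lambda>y. y \<in> W \<and> (\<forall>i<m. \<bar>D i y\<bar> \<le> e)) (nb m y0)"
      by eventually_elim (use D(2) in \<open>auto intro: less_imp_le\<close>)
    then obtain r where r: "r > 0" "\<forall>y\<in>Rn m. near m r y0 y --> y \<in> W \<and> (\<forall>i<m. \<bar>D i y\<bar> \<le> e)" unfolding eventually_nb by blast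
    show "eventually (\<lambda>y. \<bar>F y - F y0 - (\<Sum>i<m. 0 * (y ! i - y0 ! i))\<bar> \<le> e * n1 m y0 y) (nb m y0)" unfolding eventually_nb
    proof (intro exI[of _ r] conjI r(1) ballI impI)
      fix y :: "'r list" assume y: "y \<in> Rn m" "near m r y0 y"
      define \<gamma> where "\<gamma> s = map (\<lambda>i. y0 ! i + s * (y ! i - y0 ! i)) [0..<m]" for s
      have \<gamma>0: "\<gamma> 0 = y0" using l0 unfolding \<gamma>_def by (intro nth_equalityI) auto
      have \<gamma>1: "\<gamma> 1 = y" using y(1) unfolding \<gamma>_def by (intro nth_equalityI) auto
      have near\<gamma>: "\<gamma> s \<in> Rn m" "near m r y0 (\<gamma> s)" if "0 \<le> s" "s \<le> 1" for s
      proof -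
        show "\<gamma> s \<in> Rn m" unfolding \<gamma>_def by simp
        show "near m r y0 (\<gamma> s)" unfolding near_def
        proof (intro allI impI)
          fix i assume i: "i < m"
          have "\<bar>s * (y ! i - y0 ! i)\<bar> \<le> 1 * \<bar>y ! i - y0 ! i\<bar>" unfolding abs_mult using that by (intro mult_right_mono) auto
          also have "\<dots> < r" using y(2) i unfolding near_def by simp
          finally show "\<bar>\<gamma> s ! i - y0 ! i\<bar> < r" unfolding \<gamma>_def using i by simp
        qed
      qed
      have \<gamma>W: "\<gamma> s \<in> W" and \<gamma>D: "\<And>i. i < m ==> \<bar>D i (\<gamma> s)\<bar> \<le> e" if "0 \<le> s" "s \<le> 1" for s using r(2) near\<gamma>[OF that] by auto
      have DV\<gamma>: "DV m (\<lambda>e. \<gamma> (f e))" if "DF f" for f unfolding \<gamma>_def by (intro DV_map DF_add DF_mult DF_const that)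
      have c\<gamma>: "ctd1 (\<lambda>s. f (\<gamma> s)) s" if "ctd m f (\<gamma> s)" for f s
      proof -
        have "ctd 1 (\<lambda>x. f (map (\<lambda>i. y0 ! i + x ! 0 * (y ! i - y0 ! i)) [0..<m])) [s]"
          using ctd_comp[of m f "\<lambda>i x. y0 ! i + x ! 0 * (y ! i - y0 ! i)" "[s]" 1] that[unfolded \<gamma>_def]
            ctd_add[OF ctd_const ctd_mult[OF ctd_nth[of 0 1] ctd_const]] by simp
        thus ?thesis unfolding ctd1_ctd \<gamma>_def .
      qed
      have "\<bar>F y\<bar> \<le> e * n1 m y0 y"
      proof (cases "y \<in> G")
        case False
        have "y \<in> W" using \<gamma>W[of 1] \<gamma>1 by simp
        thus ?thesis using F0 False e n1_nonneg[of m y0 y] by simp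
      next
        case True
        \<comment> \<open>The supremum \<open>s0\<close> of these parameters is the last one at
          which the segment is outside \<open>G\<close>. It is attained because \<open>G\<close> is
          open, so \<open>F\<close> vanishes there.\<close>
        define Z where "Z s \<longleftrightarrow> 0 \<le> s \<and> s \<le> 1 \<and> \<gamma> s \<notin> G" for s
        have dZ: "Dp (\<lambda>e. Z (e 0))" unfolding Z_def by (intro Dp_conj Dp_not Dp_le DF_const DF_var Dp_mem[OF G(1)] DV\<gamma>)
        have Z0: "Z 0" unfolding Z_def using y0(2) \<gamma>0 by simp
        obtain s0 where s0: "\<And>s. Z s ==> s \<le> s0" "\<And>v. (\<And>s. Z s ==> s \<le> v) ==> s0 \<le> v"
          by (rule definable_sup[OF dZ Z0, of 1]) (auto simp: Z_def)
        have s01: "0 \<le> s0" "s0 \<le> 1" using s0(1)[OF Z0] s0(2)[of 1] unfolding Z_def by auto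
        have ZG: "\<gamma> s0 \<notin> G"
        proof
          assume g: "\<gamma> s0 \<in> G"
          have "eventually (\<lambda>x. map (\<lambda>i. y0 ! i + x ! 0 * (y ! i - y0 ! i)) [0..<m] \<in> G) (nb 1 [s0])"
            using ev_comp[of "\<lambda>z. z \<in> G" m "\<lambda>i x. y0 ! i + x ! 0 * (y ! i - y0 ! i)" "[s0]" 1] open_ev[OF G(2) g, unfolded \<gamma>_def]
            ctd_add[OF ctd_const ctd_mult[OF ctd_nth[of 0 1] ctd_const]] by simp
          then obtain d where d: "d > 0" "\<forall>x\<in>Rn 1. near 1 d [s0] x --> map (\<lambda>i. y0 ! i + x ! 0 * (y ! i - y0 ! i)) [0..<m] \<in> G" unfolding eventually_nb by blast
          have "\<gamma> s \<in> G" if "\<bar>s - s0\<bar> < d" for s using d(2)[rule_format, of "[s]"] that unfolding \<gamma>_def near_def by simp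
          hence "\<not> \<bar>s - s0\<bar> < d" if "Z s" for s using that unfolding Z_def by blast
          hence "s \<le> s0 - d" if "Z s" for s using s0(1)[OF that] that by force
          hence "s0 \<le> s0 - d" by (rule s0(2))
          thus False using d(1) by simp
        qed
        have "\<gamma> 1 \<in> G" using True \<gamma>1 by simp
        hence "s0 \<noteq> 1" using ZG by auto
        hence s1: "s0 < 1" using s01 by simp
        have after: "\<gamma> s \<in> G" if "s0 < s" "s \<le> 1" for s using s0(1)[of s] that s01 unfolding Z_def by auto
        have dF: "DF (\<lambda>e. F (\<gamma> (e 0)))" by (intro DF_app[OF F(1)] DV\<gamma> DF_var)
        have "\<bar>F (\<gamma> 1) - F (\<gamma> s0) - 0 * (1 - s0)\<bar> \<le> (e * n1 m y0 y) * (1 - s0)"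
        proof (rule mvt_abs[OF dF s1])
          show "ctd1 (\<lambda>s. F (\<gamma> s)) s" if "s0 \<le> s" "s \<le> 1" for s by (rule c\<gamma>[OF F(2)[OF \<gamma>W]]) (use that s01 in auto)
          show "\<exists>D. dv1 (\<lambda>s. F (\<gamma> s)) s D \<and> \<bar>D - 0\<bar> \<le> e * n1 m y0 y" if s: "s0 < s" "s < 1" for s
          proof (intro exI conjI)
            have "hdv m F (\<lambda>i. D i (\<gamma> s)) (\<gamma> s)" by (rule dG[OF after]) (use s in auto)
            from hdv_line[OF this[unfolded \<gamma>_def]] show "dv1 (\<lambda>s. F (\<gamma> s)) s (\<Sum>i<m. D i (\<gamma> s) * (y ! i - y0 ! i))" unfolding \<gamma>_def .
            have "\<bar>\<Sum>i<m. D i (\<gamma> s) * (y ! i - y0 ! i)\<bar> \<le> (\<Sum>i<m. \<bar>D i (\<gamma> s) * (y ! i - y0 ! i)\<bar>)" by (rule sum_abs)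
            also have "\<dots> \<le> (\<Sum>i<m. e * \<bar>y ! i - y0 ! i\<bar>)" unfolding abs_mult
              by (intro sum_mono mult_right_mono) (use \<gamma>D[of s] s s01 in auto)
            finally show "\<bar>(\<Sum>i<m. D i (\<gamma> s) * (y ! i - y0 ! i)) - 0\<bar> \<le> e * n1 m y0 y" unfolding n1_def by (simp add: sum_distrib_left)
          qed
        qed
        also have "\<dots> \<le> (e * n1 m y0 y) * 1" using e n1_nonneg[of m y0 y] s01 by (intro mult_left_mono) auto
        finally have "\<bar>F y - F (\<gamma> s0)\<bar> \<le> e * n1 m y0 y" using \<gamma>1 by simp
        moreover have "F (\<gamma> s0) = 0" by (rule F0[OF \<gamma>W ZG]) (use s01 in auto)
        ultimately show ?thesis by simp
      qed
      thus "\<bar>F y - F y0 - (\<Sum>i<m. 0 * (y ! i - y0 ! i))\<bar> \<le> e * n1 m y0 y" using F0[OF y0] by simp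
    qed
  qed
  thus ?thesis by (rule hdv_weaken) (simp add: D(2))
qed

text \<open>Of the last function \<open>\<theta> p\<close> only continuity is asked. Hence the
  condition for \<open>p + 1\<close> implies that for \<open>p\<close>, both for the sequence and
  for its shift by one; the induction on the order of regularity uses both.\<close>

definition dominated :: "nat \<Rightarrow> (nat \<Rightarrow> 'r \<Rightarrow> 'r) \<Rightarrow> ('r \<Rightarrow> 'r) \<Rightarrow> bool" where
  "dominated p \<theta> A \<longleftrightarrow> (\<forall>k. DF (\<lambda>e. \<theta> k (e 0))) \<and> (\<forall>k<p. \<forall>t. 0 < t \<and> t < 2 --> dv1 (\<theta> k) t (\<theta> (Suc k) t)) \<and>
     (\<forall>t. 0 < t \<and> t < 2 --> ctd1 (\<theta> p) t) \<and> (\<forall>k\<le>p. \<forall>t. 0 < t \<and> t \<le> 1 --> \<bar>\<theta> k t\<bar> * A t \<le> t)"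

lemma dominated_mono: assumes "dominated p \<theta> A" "\<And>t. 0 < t ==> B t \<le> A t" shows "dominated p \<theta> B"
proof -
  have "\<bar>\<theta> k t\<bar> * B t \<le> t" if "k \<le> p" "0 < t \<and> t \<le> 1" for k t
  proof -
    have "\<bar>\<theta> k t\<bar> * B t \<le> \<bar>\<theta> k t\<bar> * A t" using assms(2)[of t] that by (intro mult_left_mono) auto
    also have "\<dots> \<le> t" using assms(1) that unfolding dominated_def by blast
    finally show ?thesis .
  qed
  thus ?thesis using assms(1) unfolding dominated_def by blast
qed

text \<open>The partial derivatives of \<open>ext0 W u (\<theta> 0) w\<close> are again sums of such extensions, with \<open>\<theta> 0\<close> or \<open>\<theta> 1\<close>.\<close>

lemma ext0_reg:
  assumes W: "W \<in> S m" "open_in_Rn m W" and u: "dfun m u" "\<And>y. y \<in> W ==> ctd m u y" "\<And>y. y \<in> W ==> 0 \<le> u y \<and> u y \<le> 1"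
    "\<And>y. y \<in> W ==> 0 < u y ==> reg p m u y"
  shows "dfun m w ==> (\<And>y. y \<in> W ==> 0 < u y ==> reg p m w y) ==>
    \<exists>A. majorant A \<and> (\<forall>\<theta>. dominated p \<theta> A --> (\<forall>y\<in>W. reg p m (ext0 W u (\<theta> 0) w) y))"
  using u(4)
proof (induction p arbitrary: w)
  case 0
  have cw: "ctd m w y" if "y \<in> W" "0 < u y" for y using reg_ctd[OF "0.prems"(2)[OF that]] open_len[OF W(2) that(1)] by blast
  from local_majorant[OF W u(1,2) "0.prems"(1) cw] obtain A where A: "majorant A"
    "\<forall>t>0. \<forall>y\<in>W. t \<le> u y --> (\<forall>z\<in>Rn m. near m t y z --> z \<in> W) --> (\<forall>i<m. \<bar>y ! i\<bar> \<le> inverse t) --> \<bar>w y\<bar> \<le> A t" by auto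
  have "reg 0 m (ext0 W u (\<theta> 0) w) y" if \<theta>: "dominated 0 \<theta> A" and y: "y \<in> W" for \<theta> y
  proof -
    have "ctd m (ext0 W u (\<theta> 0) w) z" if z: "z \<in> W" for z
      by (rule ext0_ctd[OF W(2) u(2,3) cw _ _ A(2) z]) (use \<theta> in \<open>auto simp: dominated_def\<close>)
    thus ?thesis unfolding reg.simps using open_ev[OF W(2) y] by (auto elim!: eventually_mono)
  qed
  thus ?case using A(1) by blast
next
  case (Suc p)
  have ur: "reg p m u y" if "y \<in> W" "0 < u y" for y by (rule reg_dec[OF Suc.prems(3)[OF that]])
  have wr: "reg p m w y" if "y \<in> W" "0 < u y" for y by (rule reg_dec[OF Suc.prems(2)[OF that]])
  have cw: "ctd m w y" if "y \<in> W" "0 < u y" for y using reg_ctd[OF Suc.prems(2)[OF that]] open_len[OF W(2) that(1)] by blast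
  have pu: "eventually (\<lambda>z. hdv m u (\<lambda>i. pd m i u z) z) (nb m y)" "\<And>i. i < m ==> reg p m (pd m i u) y" if "y \<in> W" "0 < u y" for y
    using Suc.prems(3)[OF that] reg_Suc_pd[OF open_len[OF W(2) that(1)], of p u] by auto
  have pw: "eventually (\<lambda>z. hdv m w (\<lambda>i. pd m i w z) z) (nb m y)" "\<And>i. i < m ==> reg p m (pd m i w) y" if "y \<in> W" "0 < u y" for y
    using Suc.prems(2)[OF that] reg_Suc_pd[OF open_len[OF W(2) that(1)], of p w] by auto
  from local_majorant[OF W u(1,2) Suc.prems(1) cw] obtain A0 where A0: "majorant A0"
    "\<forall>t>0. \<forall>y\<in>W. t \<le> u y --> (\<forall>z\<in>Rn m. near m t y z --> z \<in> W) --> (\<forall>i<m. \<bar>y ! i\<bar> \<le> inverse t) --> \<bar>w y\<bar> \<le> A0 t" by auto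
  have "\<exists>A. majorant A \<and> (\<forall>\<theta>. dominated p \<theta> A --> (\<forall>y\<in>W. reg p m (ext0 W u (\<theta> 0) (\<lambda>y. pd m i u y * w y)) y))" if i: "i < m" for i
  proof (rule Suc.IH)
    show "dfun m (\<lambda>y. pd m i u y * w y)" using dfun_pd[OF u(1) i] Suc.prems(1) unfolding dfun_def by (intro DF_mult)
    show "reg p m (\<lambda>y. pd m i u y * w y) y" if "y \<in> W" "0 < u y" for y by (intro reg_mult pu(2)[OF that i] wr[OF that])
  qed (rule ur)
  hence "\<forall>i. \<exists>A. i < m --> majorant A \<and> (\<forall>\<theta>. dominated p \<theta> A --> (\<forall>y\<in>W. reg p m (ext0 W u (\<theta> 0) (\<lambda>y. pd m i u y * w y)) y))" by blast
  from choice[OF this] obtain A1 where A1: "\<And>i. i < m ==> majorant (A1 i)"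
    "\<And>i \<theta> y. i < m ==> dominated p \<theta> (A1 i) ==> y \<in> W ==> reg p m (ext0 W u (\<theta> 0) (\<lambda>y. pd m i u y * w y)) y" by auto
  have "\<exists>A. majorant A \<and> (\<forall>\<theta>. dominated p \<theta> A --> (\<forall>y\<in>W. reg p m (ext0 W u (\<theta> 0) (pd m i w)) y))" if i: "i < m" for i
    by (rule Suc.IH[OF dfun_pd[OF Suc.prems(1) i]]) (use pw(2) i ur in auto)
  hence "\<forall>i. \<exists>A. i < m --> majorant A \<and> (\<forall>\<theta>. dominated p \<theta> A --> (\<forall>y\<in>W. reg p m (ext0 W u (\<theta> 0) (pd m i w)) y))" by blast
  from choice[OF this] obtain A2 where A2: "\<And>i. i < m ==> majorant (A2 i)"
    "\<And>i \<theta> y. i < m ==> dominated p \<theta> (A2 i) ==> y \<in> W ==> reg p m (ext0 W u (\<theta> 0) (pd m i w)) y" by auto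
  \<comment> \<open>Controls \<open>w\<close> itself and, for every \<open>i\<close>, the two
    coefficient functions occurring in the \<open>i\<close>-th partial derivative.\<close>
  define A where "A t = A0 t + (\<Sum>i<m. A1 i t + A2 i t)" for t
  have mA: "majorant A" unfolding A_def by (intro majorant_add majorant_sum A0 A1 A2)
  have le: "A0 t \<le> A t" "\<And>i. i < m ==> A1 i t \<le> A t" "\<And>i. i < m ==> A2 i t \<le> A t" if t: "0 < t" for t :: 'r
  proof -
    have nn: "0 \<le> A0 t" "\<And>i. i < m ==> 0 \<le> A1 i t" "\<And>i. i < m ==> 0 \<le> A2 i t" using majorant_nonneg A0 A1(1) A2(1) t by auto
    have s0: "0 \<le> (\<Sum>i<m. A1 i t + A2 i t)" using nn by (intro sum_nonneg) auto
    thus "A0 t \<le> A t" unfolding A_def by simp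
    have si: "A1 i t + A2 i t \<le> A t" if "i < m" for i
    proof -
      have "A1 i t + A2 i t \<le> (\<Sum>i<m. A1 i t + A2 i t)" by (rule member_le_sum[where f = "\<lambda>i. A1 i t + A2 i t"]) (use that nn in auto)
      thus ?thesis unfolding A_def using nn(1) by simp
    qed
    show "A1 i t \<le> A t" "A2 i t \<le> A t" if "i < m" for i using si[OF that] nn(2,3)[OF that] by auto
  qed
  define G where "G = {y \<in> Rn m. y \<in> W \<and> 0 < u y}"
  have GS: "G \<in> S m" unfolding G_def by (rule S_Collect) (intro Dp_conj Dp_mem[OF W(1)] Dp_less DF_const DF_app[OF u(1)] DV_vars)
  have Go: "open_in_Rn m G" unfolding open_in_Rn_iff
  proof (intro conjI ballI)
    fix y assume "y \<in> G"
    hence y: "y \<in> W" "0 < u y" unfolding G_def by auto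
    from open_ev[OF W(2) y(1)] ctd_pos[OF u(2)[OF y(1)] y(2)] ev_length[of m y] show "eventually (\<lambda>z. z \<in> G) (nb m y)"
      unfolding G_def by eventually_elim simp
  qed (auto simp: G_def)
  have Gmem: "y \<in> G \<longleftrightarrow> y \<in> W \<and> 0 < u y" for y unfolding G_def using open_len[OF W(2)] by auto
  have "reg (Suc p) m (ext0 W u (\<theta> 0) w) y" if \<theta>: "dominated (Suc p) \<theta> A" and y: "y \<in> W" for \<theta> y
  proof -
    have \<theta>dv: "dv1 (\<theta> k) t (\<theta> (Suc k) t)" if "k < Suc p" "0 < t" "t < 2" for k t using \<theta> that unfolding dominated_def by blast
    have dom0: "dominated p \<theta> A"
      using \<theta> dv1_ctd1[OF \<theta>dv[of p]] unfolding dominated_def by (auto simp: le_SucI)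
    have dom1: "dominated p (\<lambda>k. \<theta> (Suc k)) A" using \<theta> unfolding dominated_def by auto
    let ?F = "ext0 W u (\<theta> 0) w"
    \<comment> \<open>The gradient given by product and chain rule, extended by zero. The first
      summand involves the shifted sequence, which is why the majorants must serve all dominated
      sequences.\<close>
    define D where "D i y = ext0 W u (\<theta> 1) (\<lambda>y. pd m i u y * w y) y + ext0 W u (\<theta> 0) (pd m i w) y" for i y
    have Dreg: "reg p m (D i) z" if i: "i < m" and z: "z \<in> W" for i z unfolding D_def
    proof (rule reg_add)
      show "reg p m (ext0 W u (\<theta> 1) (\<lambda>y. pd m i u y * w y)) z"
        using A1(2)[OF i dominated_mono[OF dom1] z] le(2)[OF _ i] by simp
      show "reg p m (ext0 W u (\<theta> 0) (pd m i w)) z" using A2(2)[OF i dominated_mono[OF dom0] z] le(3)[OF _ i] by simp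
    qed
    have d0: "DF (\<lambda>e. \<theta> 0 (e 0))" using \<theta> unfolding dominated_def by blast
    have Fct: "ctd m ?F z" if z: "z \<in> W" for z
    proof (rule ext0_ctd[OF W(2) u(2,3) cw _ _ A0(2) z])
      show "ctd1 (\<theta> 0) t" if "0 < t" "t < 2" for t by (rule dv1_ctd1[OF \<theta>dv]) (use that in auto)
      show "\<bar>\<theta> 0 t\<bar> * A0 t \<le> t" if "0 < t" "t \<le> 1" for t
      proof -
        have "\<bar>\<theta> 0 t\<bar> * A0 t \<le> \<bar>\<theta> 0 t\<bar> * A t" using le(1)[OF that(1)] by (intro mult_left_mono) auto
        also have "\<dots> \<le> t" using \<theta> that unfolding dominated_def by blast
        finally show ?thesis .
      qed
    qed
    have hG: "hdv m ?F (\<lambda>i. D i z) z" if z: "z \<in> G" for z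
    proof -
      have zW: "z \<in> W" "0 < u z" using z Gmem by auto
      have lz: "length z = m" using open_len[OF W(2) zW(1)] .
      have u2: "u z < 2" using u(3)[OF zW(1)] by (auto intro: le_less_trans)
      have hu: "hdv m u (\<lambda>i. pd m i u z) z" by (rule ev_self[OF pu(1)[OF zW] lz])
      have hw: "hdv m w (\<lambda>i. pd m i w z) z" by (rule ev_self[OF pw(1)[OF zW] lz])
      have "dv1 (\<theta> 0) (u z) (\<theta> 1 (u z))" using \<theta>dv[of 0 "u z"] zW u2 by simp
      from hdv_mult[OF hdv_theta[OF hu this] hw]
      have "hdv m (\<lambda>y. \<theta> 0 (u y) * w y) (\<lambda>i. \<theta> 0 (u z) * pd m i w z + \<theta> 1 (u z) * pd m i u z * w z) z" .
      hence "hdv m ?F (\<lambda>i. \<theta> 0 (u z) * pd m i w z + \<theta> 1 (u z) * pd m i u z * w z) z"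
        by (rule hdv_cong[OF _ ext0_ev[OF W(2) zW u(2)[OF zW(1)]] lz])
      thus ?thesis by (rule hdv_weaken) (use zW in \<open>simp add: D_def ext0_def algebra_simps\<close>)
    qed
    \<comment> \<open>At points of \<open>W\<close> outside \<open>G\<close> the function and the
      candidate gradient vanish, and \<open>hdv_at_zero\<close> obtains differentiability from the
      continuity of that gradient.\<close>
    have hW: "hdv m ?F (\<lambda>i. D i z) z" if z: "z \<in> W" for z
    proof (cases "z \<in> G")
      case False
      show ?thesis
      proof (rule hdv_at_zero[OF W dfun_ext0[OF W(1) u(1) d0 Suc.prems(1)] Fct GS Go _ hG _ _ _ z False])
        show "G \<subseteq> W" using Gmem by blast
        show "?F x = 0" if "x \<in> W" "x \<notin> G" for x using that Gmem unfolding ext0_def by auto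
        show "ctd m (D i) z" if "i < m" for i by (rule reg_ctd[OF Dreg[OF that z] open_len[OF W(2) z]])
        show "D i z = 0" for i using False z Gmem unfolding D_def ext0_def by auto
      qed
    qed (rule hG)
    show ?thesis unfolding reg.simps
    proof (intro exI[of _ D] conjI allI impI)
      show "eventually (\<lambda>y. hdv m ?F (\<lambda>i. D i y) y) (nb m y)" using open_ev[OF W(2) y] by (rule eventually_mono) (rule hW)
    qed (rule Dreg[OF _ y])
  qed
  thus ?case using mA by blast
qed

subsection \<open>Definable maps of class \<open>C^p\<close>\<close>

lemma sup_norm_nonneg: "0 \<le> sup_norm xs"
  unfolding sup_norm_def by (induction xs) (auto simp: le_max_iff_disj)

lemma sup_norm_less: "0 < d ==> sup_norm xs < d \<longleftrightarrow> (\<forall>i<length xs. \<bar>xs ! i\<bar> < d)"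
  unfolding sup_norm_def by (induction xs) (auto simp: less_Suc_eq_0_disj)

lemma sup_norm_le: "0 \<le> d ==> sup_norm xs \<le> d \<longleftrightarrow> (\<forall>i<length xs. \<bar>xs ! i\<bar> \<le> d)"
  unfolding sup_norm_def by (induction xs) (auto simp: less_Suc_eq_0_disj)

lemma length_vsub [simp]: "length (vsub xs ys) = min (length xs) (length ys)"
  unfolding vsub_def by simp

lemma nth_vsub [simp]: "i < length xs ==> i < length ys ==> vsub xs ys ! i = xs ! i - ys ! i"
  unfolding vsub_def by simp

lemma sup_norm_vsub_less: "length x = n ==> length y = n ==> 0 < d ==> sup_norm (vsub y x) < d \<longleftrightarrow> near n d x y"
  unfolding near_def by (simp add: sup_norm_less)

lemma sup_norm_le_n1: assumes "length x = n" "length y = n" shows "sup_norm (vsub y x) \<le> n1 n x y"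
  using assms n1_coord[of _ n y x] n1_nonneg[of n x y] by (simp add: sup_norm_le)

lemma n1_le_sup_norm: assumes "length x = n" "length y = n" shows "n1 n x y \<le> of_nat n * sup_norm (vsub y x)"
proof -
  have "\<bar>y ! i - x ! i\<bar> \<le> sup_norm (vsub y x)" if "i < n" for i
    using sup_norm_le[OF sup_norm_nonneg[of "vsub y x"], of "vsub y x"] that assms by simp
  hence "n1 n x y \<le> of_nat (card {..<n}) * sup_norm (vsub y x)" unfolding n1_def by (intro sum_bounded_above) auto
  thus ?thesis by simp
qed

text \<open>Sup norm and \<open>n1\<close> bound each other up to a factor depending on
  \<open>n\<close>, so they define the same derivatives. Matrices are stored by rows, whence the
  index \<open>j * n + i\<close>.\<close>

lemma has_deriv_iff:
  assumes x: "length x = n" and f: "eventually (\<lambda>y. length (f y) = m) (nb n x)"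
  shows "has_deriv n m f D x \<longleftrightarrow> length D = m * n \<and> (\<forall>j<m. hdv n (\<lambda>y. f y ! j) (\<lambda>i. D ! (j * n + i)) x)"
proof -
  let ?r = "\<lambda>y. vsub (vsub (f y) (f x)) (mat_apply m n D (vsub y x))"
  let ?q = "\<lambda>j y. f y ! j - f x ! j - (\<Sum>i<n. D ! (j * n + i) * (y ! i - x ! i))"
  have fx: "length (f x) = m" by (rule ev_self[OF f x])
  have q: "sup_norm (?r y) \<le> c \<longleftrightarrow> (\<forall>j<m. \<bar>?q j y\<bar> \<le> c)" if "length y = n" "length (f y) = m" "0 \<le> c" for y c
  proof -
    have l: "length (mat_apply m n D (vsub y x)) = m" unfolding mat_apply_def by simp
    have "?r y ! j = ?q j y" if "j < m" for j
      using that \<open>length y = n\<close> \<open>length (f y) = m\<close> fx x l by (simp add: mat_apply_def)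
    thus ?thesis using sup_norm_le[OF that(3), of "?r y"] that l fx by simp
  qed
  have ball: "(\<exists>d>0. \<forall>y\<in>Rn n. sup_norm (vsub y x) < d --> P y) \<longleftrightarrow> eventually P (nb n x)" for P
    unfolding eventually_nb by (rule ex_cong1) (use sup_norm_vsub_less[OF x] in auto)
  have h: "has_deriv n m f D x \<longleftrightarrow> length D = m * n \<and> (\<forall>e>0. eventually (\<lambda>y. sup_norm (?r y) \<le> e * sup_norm (vsub y x)) (nb n x))"
    unfolding has_deriv_def ball by simp
  have "(\<forall>e>0. eventually (\<lambda>y. sup_norm (?r y) \<le> e * sup_norm (vsub y x)) (nb n x)) \<longleftrightarrow>
      (\<forall>j<m. \<forall>e>0. eventually (\<lambda>y. \<bar>?q j y\<bar> \<le> e * n1 n x y) (nb n x))" (is "?L \<longleftrightarrow> ?R")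
  proof
    assume L: ?L
    show ?R
    proof (intro allI impI)
      fix j :: nat and e :: 'r assume j: "j < m" and e: "0 < e"
      from L[rule_format, OF e] f ev_length[of n x] show "eventually (\<lambda>y. \<bar>?q j y\<bar> \<le> e * n1 n x y) (nb n x)"
      proof eventually_elim
        case (elim y)
        have "0 \<le> e * sup_norm (vsub y x)" using e by (simp add: sup_norm_nonneg)
        hence "\<bar>?q j y\<bar> \<le> e * sup_norm (vsub y x)" using q[of y] elim j by blast
        also have "\<dots> \<le> e * n1 n x y" using e by (intro mult_left_mono sup_norm_le_n1 x elim) auto
        finally show ?case .
      qed
    qed
  next
    assume R: ?R
    show ?L
    proof (intro allI impI)
      fix e :: 'r assume e: "0 < e"
      define N :: 'r where "N = of_nat n + 1"
      have N: "N > 0" "of_nat n \<le> N" unfolding N_def by (auto simp: add_nonneg_pos)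
      have "0 < e / N" using e N by simp
      hence "eventually (\<lambda>y. \<forall>j<m. \<bar>?q j y\<bar> \<le> e / N * n1 n x y) (nb n x)" using R by (intro ev_all_less) blast
      with f ev_length[of n x] show "eventually (\<lambda>y. sup_norm (?r y) \<le> e * sup_norm (vsub y x)) (nb n x)"
      proof eventually_elim
        case (elim y)
        have "n1 n x y \<le> of_nat n * sup_norm (vsub y x)" by (rule n1_le_sup_norm) (use x elim in auto)
        also have "\<dots> \<le> N * sup_norm (vsub y x)" using N sup_norm_nonneg by (intro mult_right_mono) auto
        finally have "e / N * n1 n x y \<le> e / N * (N * sup_norm (vsub y x))" using e N by (intro mult_left_mono) auto
        also have "\<dots> = e * sup_norm (vsub y x)" using N by simp
        finally have "\<forall>j<m. \<bar>?q j y\<bar> \<le> e * sup_norm (vsub y x)" using elim(3) by (meson order_trans)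
        moreover have "0 \<le> e * sup_norm (vsub y x)" using e by (simp add: sup_norm_nonneg)
        ultimately show ?case using q[of y] elim by blast
      qed
    qed
  qed
  thus ?thesis unfolding h hdv_def lo_def by simp
qed

lemma continuous_on_Rn_iff:
  assumes U: "open_in_Rn n U" and f: "\<And>x. x \<in> U ==> length (f x) = m"
  shows "continuous_on_Rn n f U \<longleftrightarrow> (\<forall>x\<in>U. \<forall>j<m. ctd n (\<lambda>y. f y ! j) x)"
proof -
  have "(\<forall>e>0. \<exists>d>0. \<forall>y\<in>U. sup_norm (vsub y x) < d --> sup_norm (vsub (f y) (f x)) < e) \<longleftrightarrow> (\<forall>j<m. ctd n (\<lambda>y. f y ! j) x)"
    (is "?L \<longleftrightarrow> ?R") if x: "x \<in> U" for x
  proof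
    have lx: "length x = n" using open_len[OF U x] .
    { assume L: ?L
      show ?R unfolding ctd_def
      proof (intro allI impI)
        fix j :: nat and e :: 'r assume j: "j < m" and e: "0 < e"
        obtain d where d: "d > 0" "\<forall>y\<in>U. sup_norm (vsub y x) < d --> sup_norm (vsub (f y) (f x)) < e" using L e by blast
        from open_ev[OF U x] ev_near[OF d(1), of n x] show "eventually (\<lambda>y. \<bar>f y ! j - f x ! j\<bar> < e) (nb n x)"
        proof eventually_elim
          case (elim y)
          have "sup_norm (vsub (f y) (f x)) < e" using d elim sup_norm_vsub_less[OF lx open_len[OF U elim(1)] d(1)] by blast
          thus ?case using sup_norm_vsub_less[OF f[OF x] f[OF elim(1)] e] j unfolding near_def by blast
        qed
      qed }
    assume R: ?R
    show ?L
    proof (intro allI impI)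
      fix e :: 'r assume e: "0 < e"
      have "eventually (\<lambda>y. \<forall>j<m. \<bar>f y ! j - f x ! j\<bar> < e) (nb n x)" by (rule ev_all_less) (use R e ctdD in blast)
      then obtain d where d: "d > 0" "\<forall>y\<in>Rn n. near n d x y --> near m e (f x) (f y)" unfolding eventually_nb near_def by blast
      have "sup_norm (vsub (f y) (f x)) < e" if "y \<in> U" "sup_norm (vsub y x) < d" for y
        using that d(2) sup_norm_vsub_less[OF lx open_len[OF U that(1)] d(1)] open_len[OF U that(1)]
          sup_norm_vsub_less[OF f[OF x] f[OF that(1)] e] by simp
      thus "\<exists>d>0. \<forall>y\<in>U. sup_norm (vsub y x) < d --> sup_norm (vsub (f y) (f x)) < e" using d(1) by blast
    qed
  qed
  thus ?thesis unfolding continuous_on_Rn_def by blast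
qed

text \<open>Translates the recursive condition on a set into a local one at each point. In one
  direction the matrix \<open>D\<close> supplies gradients; in the other it is assembled from
  \<open>pd\<close>, since the gradients granted by \<open>reg\<close> may vary with the point at
  which it is applied.\<close>

lemma Ck_iff:
  assumes U: "open_in_Rn n U"
  shows "Ck k n m f U \<longleftrightarrow> (\<forall>x\<in>U. length (f x) = m \<and> (\<forall>j<m. reg k n (\<lambda>y. f y ! j) x))"
proof (induction k arbitrary: m f)
  case 0
  have "(\<forall>x\<in>U. \<forall>j<m. ctd n (\<lambda>y. f y ! j) x) \<longleftrightarrow> (\<forall>x\<in>U. \<forall>j<m. reg 0 n (\<lambda>y. f y ! j) x)"
  proof
    assume c: "\<forall>x\<in>U. \<forall>j<m. ctd n (\<lambda>y. f y ! j) x"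
    show "\<forall>x\<in>U. \<forall>j<m. reg 0 n (\<lambda>y. f y ! j) x"
    proof (intro ballI allI impI)
      fix x j assume "x \<in> U" "j < m"
      thus "reg 0 n (\<lambda>y. f y ! j) x" unfolding reg.simps using c by (intro eventually_mono[OF open_ev[OF U]]) auto
    qed
  qed (use reg_ctd open_len[OF U] in blast)
  thus ?case using continuous_on_Rn_iff[OF U, of f m] by auto
next
  case (Suc k)
  have ev: "eventually (\<lambda>y. length (f y) = m) (nb n x)" if "x \<in> U" "\<forall>x\<in>U. length (f x) = m" for x
    using open_ev[OF U that(1)] that(2) by (auto elim: eventually_mono)
  show ?case
  proof
    assume "Ck (Suc k) n m f U"
    then obtain D where f: "\<forall>x\<in>U. length (f x) = m" and D: "\<forall>x\<in>U. has_deriv n m f (D x) x" "Ck k n (m * n) D U" by auto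
    have h: "hdv n (\<lambda>y. f y ! j) (\<lambda>i. D x ! (j * n + i)) x" if "x \<in> U" "j < m" for x j
      using D(1) that has_deriv_iff[OF open_len[OF U that(1)] ev[OF that(1) f], of "D x"] by blast
    have r: "reg k n (\<lambda>y. D y ! l) x" if "x \<in> U" "l < m * n" for x l using Suc.IH[of "m * n" D] D(2) that by blast
    show "\<forall>x\<in>U. length (f x) = m \<and> (\<forall>j<m. reg (Suc k) n (\<lambda>y. f y ! j) x)"
    proof (intro ballI conjI allI impI)
      fix x j assume x: "x \<in> U" and j: "j < m"
      show "reg (Suc k) n (\<lambda>y. f y ! j) x" unfolding reg.simps
      proof (rule exI[of _ "\<lambda>i y. D y ! (j * n + i)"], intro conjI allI impI)
        show "eventually (\<lambda>y. hdv n (\<lambda>y. f y ! j) (\<lambda>i. D y ! (j * n + i)) y) (nb n x)"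
          using open_ev[OF U x] by (rule eventually_mono) (rule h[OF _ j])
        fix i assume i: "i < n"
        have "j * n + i < Suc j * n" using i by simp
        also have "\<dots> \<le> m * n" by (rule mult_le_mono1) (use j in simp)
        finally show "reg k n (\<lambda>y. D y ! (j * n + i)) x" by (rule r[OF x])
      qed
    qed (use f in blast)
  next
    assume R: "\<forall>x\<in>U. length (f x) = m \<and> (\<forall>j<m. reg (Suc k) n (\<lambda>y. f y ! j) x)"
    \<comment> \<open>Entry \<open>l\<close> of the row-major matrix sits in row
      \<open>l div n\<close> and column \<open>l mod n\<close>.\<close>
    define D where "D x = map (\<lambda>l. pd n (l mod n) (\<lambda>y. f y ! (l div n)) x) [0..<m * n]" for x
    have Dn: "D x ! (j * n + i) = pd n i (\<lambda>y. f y ! j) x" if "j < m" "i < n" for x j i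
    proof -
      have "j * n + i < Suc j * n" using that by simp
      also have "\<dots> \<le> m * n" by (rule mult_le_mono1) (use that in simp)
      finally show ?thesis unfolding D_def using that by simp
    qed
    have "has_deriv n m f (D x) x" if x: "x \<in> U" for x
    proof -
      have "hdv n (\<lambda>y. f y ! j) (\<lambda>i. D x ! (j * n + i)) x" if j: "j < m" for j
      proof (rule hdv_weaken)
        show "hdv n (\<lambda>y. f y ! j) (\<lambda>i. pd n i (\<lambda>y. f y ! j) x) x"
          using R x j reg_Suc_pd[OF open_len[OF U x], of k "\<lambda>y. f y ! j"] ev_self[OF _ open_len[OF U x]] by blast
      qed (simp add: Dn[OF j])
      thus ?thesis using has_deriv_iff[OF open_len[OF U x] ev[OF x], of "D x"] R by (auto simp: D_def)
    qed
    moreover have "Ck k n (m * n) D U" unfolding Suc.IH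
    proof (intro ballI conjI allI impI)
      fix x l assume x: "x \<in> U" and l: "l < m * n"
      hence "n > 0" by (cases n) auto
      hence l2: "l div n < m" "l mod n < n" using l by (auto simp: less_mult_imp_div_less)
      have "reg k n (pd n (l mod n) (\<lambda>y. f y ! (l div n))) x"
        using R x l2 reg_Suc_pd[OF open_len[OF U x], of k "\<lambda>y. f y ! (l div n)"] by blast
      thus "reg k n (\<lambda>y. D y ! l) x" unfolding D_def using l by simp
    qed (simp add: D_def)
    ultimately show "Ck (Suc k) n m f U" using R by auto
  qed
qed

lemma definable_mapI:
  assumes A: "A \<in> S n" and f: "\<And>x. x \<in> A ==> length (f x) = m" and F: "\<And>j. j < m ==> dfun n (F j)"
    "\<And>j x. j < m ==> x \<in> A ==> F j x = f x ! j"
  shows "definable_map S n m f A"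
proof -
  define Q where "Q z \<longleftrightarrow> take n z \<in> A \<and> (\<forall>j<m. z ! (n + j) = F j (take n z))" for z
  have t: "DV n (\<lambda>e. take n (map e [0..<n + m]))" by (rule DV_take[OF DV_vars]) simp
  have "{z \<in> Rn (n + m). Q z} \<in> S (n + m)" unfolding Q_def
    by (rule S_Collect) (intro Dp_conj Dp_mem[OF A t] Dp_all_less Dp_eq DF_nth[OF DV_vars] DF_app[OF F(1) t], auto)
  moreover have "{x @ f x | x. x \<in> A} = {z \<in> Rn (n + m). Q z}"
  proof (intro set_eqI iffI)
    fix z assume "z \<in> {x @ f x | x. x \<in> A}"
    then obtain x where "x \<in> A" "z = x @ f x" by blast
    thus "z \<in> {z \<in> Rn (n + m). Q z}" using f F(2) S_len[OF A] unfolding Q_def by (simp add: nth_append)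
  next
    fix z assume "z \<in> {z \<in> Rn (n + m). Q z}"
    hence z: "length z = n + m" "take n z \<in> A" "\<forall>j<m. z ! (n + j) = F j (take n z)" unfolding Q_def by auto
    have "z = take n z @ f (take n z)"
    proof (rule nth_equalityI)
      fix i assume "i < length z"
      thus "z ! i = (take n z @ f (take n z)) ! i"
        using z(1) f[OF z(2)] F(2)[OF _ z(2), of "i - n"] z(3)[rule_format, of "i - n"] by (cases "i < n") (auto simp: nth_append)
    qed (use z f[OF z(2)] in simp)
    thus "z \<in> {x @ f x | x. x \<in> A}" using z(2) by blast
  qed
  ultimately show ?thesis unfolding definable_map_def using S_sub[OF A] f by auto
qed

text \<open>Components are continued by 0 outside \<open>A\<close> because \<open>dfun\<close>
  concerns total functions. Lengths determine how a point of the graph splits into argument and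
  value.\<close>

lemma definable_mapD:
  assumes A: "A \<in> S n" and f: "definable_map S n m f A" and j: "j < m"
  shows "dfun n (\<lambda>x. if x \<in> A then f x ! j else 0)" unfolding dfun_def
proof (rule DF_graph)
  define G where "G = {x @ f x | x. x \<in> A}"
  have G: "G \<in> S (n + m)" and fl: "\<And>x. x \<in> A ==> length (f x) = m" using f unfolding definable_map_def G_def by auto
  have mem: "x @ w \<in> G \<longleftrightarrow> x \<in> A \<and> w = f x" if x: "length x = n" for x w
  proof
    assume "x @ w \<in> G"
    then obtain y where y: "y \<in> A" "x @ w = y @ f y" unfolding G_def by blast
    have "length x = length y" using S_len[OF A y(1)] x by simp
    thus "x \<in> A \<and> w = f x" using y by simp
  qed (auto simp: G_def)
  show "y = (if map e [0..<n] \<in> A then f (map e [0..<n]) ! j else 0) \<longleftrightarrow>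
      (map e [0..<n] \<in> A --> (\<exists>w\<in>Rn m. map e [0..<n] @ w \<in> G \<and> y = w ! j)) \<and> (\<not> map e [0..<n] \<in> A --> y = 0)" for e y
  proof -
    have l: "length (map e [0..<n]) = n" by simp
    show ?thesis unfolding mem[OF l] using fl[of "map e [0..<n]"] by (simp add: Bex_def)
  qed
  show "Dp (\<lambda>e. (map (\<lambda>i. e (Suc i)) [0..<n] \<in> A --> (\<exists>w\<in>Rn m. map (\<lambda>i. e (Suc i)) [0..<n] @ w \<in> G \<and> e 0 = w ! j)) \<and>
      (\<not> map (\<lambda>i. e (Suc i)) [0..<n] \<in> A --> e 0 = 0))"
    by (intro Dp_conj Dp_imp Dp_not Dp_exv Dp_mem[OF A] Dp_mem[OF G] Dp_eq DF_nth[OF DV_vars j] DV_append DV_vars DV_map DF_var DF_const)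
qed

text \<open>The working form of \<open>dCp\<close>: one scalar condition per component, to which the
  calculus of \<open>dfun\<close> and \<open>reg\<close> applies directly.\<close>

lemma dCp_iff:
  "dCp S p n m f U \<longleftrightarrow> U \<in> S n \<and> open_in_Rn n U \<and> (\<forall>x\<in>U. length (f x) = m) \<and>
     (\<forall>j<m. dfun n (\<lambda>x. if x \<in> U then f x ! j else 0)) \<and> (\<forall>x\<in>U. \<forall>j<m. reg p n (\<lambda>y. f y ! j) x)"
proof
  assume d: "dCp S p n m f U"
  hence U: "U \<in> S n" "open_in_Rn n U" and m: "definable_map S n m f U" and c: "Ck p n m f U" unfolding dCp_def by auto
  show "U \<in> S n \<and> open_in_Rn n U \<and> (\<forall>x\<in>U. length (f x) = m) \<and>
     (\<forall>j<m. dfun n (\<lambda>x. if x \<in> U then f x ! j else 0)) \<and> (\<forall>x\<in>U. \<forall>j<m. reg p n (\<lambda>y. f y ! j) x)"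
    using U definable_mapD[OF U(1) m] c[unfolded Ck_iff[OF U(2)]] by blast
next
  assume R: "U \<in> S n \<and> open_in_Rn n U \<and> (\<forall>x\<in>U. length (f x) = m) \<and>
     (\<forall>j<m. dfun n (\<lambda>x. if x \<in> U then f x ! j else 0)) \<and> (\<forall>x\<in>U. \<forall>j<m. reg p n (\<lambda>y. f y ! j) x)"
  hence U: "U \<in> S n" "open_in_Rn n U" by auto
  have "definable_map S n m f U" by (rule definable_mapI[OF U(1), where F = "\<lambda>j x. if x \<in> U then f x ! j else 0"]) (use R in auto)
  thus "dCp S p n m f U" unfolding dCp_def using U R by (simp add: Ck_iff[OF U(2)])
qed

lemma dCpD: assumes "dCp S p n m f U"
  shows "U \<in> S n" "open_in_Rn n U" "\<And>x. x \<in> U ==> length (f x) = m" "\<And>x. x \<in> U ==> length x = n"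
    "\<And>j. j < m ==> dfun n (\<lambda>x. if x \<in> U then f x ! j else 0)" "\<And>x j. x \<in> U ==> j < m ==> reg p n (\<lambda>y. f y ! j) x"
  using assms open_len[of n U] unfolding dCp_iff by auto

lemma map_nth': "length y = n ==> map (\<lambda>i. y ! i) [0..<n] = y"
  using map_nth[of y] by simp

lemma dCp_ev: assumes "dCp S p n k f U" "x \<in> U" "eventually P (nb k (f x))" shows "eventually (\<lambda>y. P (f y)) (nb n x)"
proof -
  note f = dCpD[OF assms(1)]
  have "eventually (\<lambda>y. P (map (\<lambda>j. f y ! j) [0..<k])) (nb n x)"
    using ev_comp[of P k "\<lambda>j y. f y ! j" x n] assms(3) map_nth'[OF f(3)[OF assms(2)]] reg_ctd[OF f(6) f(4)] assms(2) by simp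
  with open_ev[OF f(2) assms(2)] show ?thesis by eventually_elim (simp add: map_nth'[OF f(3)])
qed

lemma dCp_reg_comp: assumes "dCp S p n k f U" "x \<in> U" "reg p k F (f x)" shows "reg p n (\<lambda>y. F (f y)) x"
proof -
  note f = dCpD[OF assms(1)]
  have "reg p n (\<lambda>y. F (map (\<lambda>j. f y ! j) [0..<k])) x"
    using reg_comp[of p k F "\<lambda>j y. f y ! j" x n] assms(3) map_nth'[OF f(3)[OF assms(2)]] f(6)[OF assms(2)] f(4)[OF assms(2)] by simp
  moreover have "eventually (\<lambda>y. F (map (\<lambda>j. f y ! j) [0..<k]) = F (f y)) (nb n x)"
    using open_ev[OF f(2) assms(2)] by (rule eventually_mono) (simp add: map_nth'[OF f(3)])
  ultimately show ?thesis by (rule reg_cong)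
qed

lemma dCp_preimage: assumes "dCp S p n k f U" "V \<in> S k" "open_in_Rn k V" shows "{x \<in> U. f x \<in> V} \<in> S n" "open_in_Rn n {x \<in> U. f x \<in> V}"
proof -
  note f = dCpD[OF assms(1)]
  define t where "t x = map (\<lambda>j. if x \<in> U then f x ! j else 0) [0..<k]" for x
  have t: "f x = t x" if "x \<in> U" for x unfolding t_def using map_nth'[OF f(3)[OF that]] that by simp
  have "{x \<in> Rn n. x \<in> U \<and> t x \<in> V} \<in> S n"
    by (rule S_Collect, unfold t_def) (intro Dp_conj Dp_mem[OF f(1)] Dp_mem[OF assms(2)] DV_vars DV_map f(5)[unfolded dfun_def])
  moreover have "{x \<in> Rn n. x \<in> U \<and> t x \<in> V} = {x \<in> U. f x \<in> V}"
  proof (rule set_eqI)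
    show "x \<in> {x \<in> Rn n. x \<in> U \<and> t x \<in> V} \<longleftrightarrow> x \<in> {x \<in> U. f x \<in> V}" for x using t[of x] f(4)[of x] by auto
  qed
  ultimately show "{x \<in> U. f x \<in> V} \<in> S n" by simp
  show "open_in_Rn n {x \<in> U. f x \<in> V}" unfolding open_in_Rn_iff
  proof (intro conjI ballI)
    fix x assume x: "x \<in> {x \<in> U. f x \<in> V}"
    hence x': "x \<in> U" "f x \<in> V" by auto
    show "eventually (\<lambda>y. y \<in> {x \<in> U. f x \<in> V}) (nb n x)"
      using eventually_conj[OF open_ev[OF f(2) x'(1)] dCp_ev[OF assms(1) x'(1) open_ev[OF assms(3) x'(2)]]] by simp
  qed (use S_sub[OF f(1)] in blast)
qed

lemma dCp_subset: assumes "dCp S p n k f U" "U' \<in> S n" "open_in_Rn n U'" "U' \<subseteq> U" shows "dCp S p n k f U'"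
proof -
  note f = dCpD[OF assms(1)]
  have "dfun n (\<lambda>x. if x \<in> U' then f x ! j else 0)" if "j < k" for j
  proof -
    have "dfun n (\<lambda>x. if x \<in> U' then (if x \<in> U then f x ! j else 0) else 0)" unfolding dfun_def
      by (intro DF_if Dp_mem[OF assms(2)] DV_vars DF_const f(5)[OF that, unfolded dfun_def])
    moreover have "(\<lambda>x. if x \<in> U' then (if x \<in> U then f x ! j else 0) else 0) = (\<lambda>x. if x \<in> U' then f x ! j else 0)" using assms(4) by (intro ext) auto
    ultimately show ?thesis by simp
  qed
  moreover have "reg p n (\<lambda>y. f y ! j) x" if "x \<in> U'" "j < k" for x j
    using f(6)[of x j] that assms(4) by blast
  ultimately show ?thesis unfolding dCp_iff using assms(2-4) f(3) by blast
qed

lemma dCp_cong: assumes "dCp S p n k f U" "\<And>x. x \<in> U ==> f x = g x" shows "dCp S p n k g U"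
proof -
  note f = dCpD[OF assms(1)]
  have "dfun n (\<lambda>x. if x \<in> U then g x ! j else 0)" if "j < k" for j using f(5)[OF that] assms(2) by (simp cong: if_cong)
  moreover have "reg p n (\<lambda>y. g y ! j) x" if "x \<in> U" "j < k" for x j
    by (rule reg_cong[OF f(6)[OF that]]) (use open_ev[OF f(2) that(1)] assms(2) in \<open>auto elim!: eventually_mono\<close>)
  ultimately show ?thesis unfolding dCp_iff using f assms(2) by auto
qed

lemma dCp_comp: assumes "dCp S p n k f U" "dCp S p k l g V" "\<And>x. x \<in> U ==> f x \<in> V" shows "dCp S p n l (\<lambda>x. g (f x)) U"
proof -
  note f = dCpD[OF assms(1)] and g = dCpD[OF assms(2)]
  have "dfun n (\<lambda>x. if x \<in> U then g (f x) ! j else 0)" if j: "j < l" for j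
  proof -
    define t where "t x = map (\<lambda>j. if x \<in> U then f x ! j else 0) [0..<k]" for x
    have t: "t x = f x" if "x \<in> U" for x unfolding t_def using map_nth'[OF f(3)[OF that]] that by simp
    have "DV k (\<lambda>e. t (map e [0..<n]))" unfolding t_def by (intro DV_map f(5)[unfolded dfun_def])
    hence "dfun n (\<lambda>x. if x \<in> U then (if t x \<in> V then g (t x) ! j else 0) else 0)" unfolding dfun_def
      by (intro DF_if Dp_mem[OF f(1)] DV_vars DF_const DF_app[OF g(5)[OF j]])
    moreover have "(\<lambda>x. if x \<in> U then (if t x \<in> V then g (t x) ! j else 0) else 0) = (\<lambda>x. if x \<in> U then g (f x) ! j else 0)"
      using t[of x for x] assms(3)[of x for x] by (simp add: fun_eq_iff)
    ultimately show ?thesis by simp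
  qed
  moreover have "reg p n (\<lambda>y. g (f y) ! j) x" if "x \<in> U" "j < l" for x j
    using dCp_reg_comp[OF assms(1) that(1) g(6)[OF assms(3)[OF that(1)] that(2)]] .
  ultimately show ?thesis unfolding dCp_iff using f g(3) assms(3) by auto
qed

lemma dCp_append: assumes "dCp S p n k f U" "dCp S p n l g U" shows "dCp S p n (k + l) (\<lambda>x. f x @ g x) U"
proof -
  note f = dCpD[OF assms(1)] and g = dCpD[OF assms(2)]
  have nth: "(f x @ g x) ! j = (if j < k then f x ! j else g x ! (j - k))" if "x \<in> U" for x j using f(3)[OF that] by (simp add: nth_append)
  have "dfun n (\<lambda>x. if x \<in> U then (f x @ g x) ! j else 0)" if j: "j < k + l" for j
  proof -
    have "(\<lambda>x. if x \<in> U then (f x @ g x) ! j else 0) = (if j < k then (\<lambda>x. if x \<in> U then f x ! j else 0) else (\<lambda>x. if x \<in> U then g x ! (j - k) else 0))"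
      using nth by auto
    thus ?thesis using f(5)[of j] g(5)[of "j - k"] j by simp
  qed
  moreover have "reg p n (\<lambda>y. (f y @ g y) ! j) x" if x: "x \<in> U" and j: "j < k + l" for x j
  proof (rule reg_cong)
    show "reg p n (\<lambda>y. if j < k then f y ! j else g y ! (j - k)) x" using f(6)[OF x, of j] g(6)[OF x, of "j - k"] j by (cases "j < k") auto
    show "eventually (\<lambda>y. (if j < k then f y ! j else g y ! (j - k)) = (f y @ g y) ! j) (nb n x)"
      using open_ev[OF f(2) x] by (rule eventually_mono) (simp add: nth)
  qed
  ultimately show ?thesis unfolding dCp_iff using f g(3) by auto
qed

lemma dCp_empty: "dCp S p n k f {}"
proof -
  have "dfun n (\<lambda>x. if x \<in> {} then f x ! j else 0)" for j unfolding dfun_def by (simp add: DF_const)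
  thus ?thesis unfolding dCp_iff open_in_Rn_def by (simp add: S_empty)
qed

lemma dCp_Un: assumes "dCp S p n k f U" "dCp S p n k f V" shows "dCp S p n k f (U \<union> V)"
proof -
  note f = dCpD[OF assms(1)] and g = dCpD[OF assms(2)]
  have "dfun n (\<lambda>x. if x \<in> U \<union> V then f x ! j else 0)" if j: "j < k" for j
  proof -
    have "dfun n (\<lambda>x. if x \<in> U then (if x \<in> U then f x ! j else 0) else (if x \<in> V then f x ! j else 0))" unfolding dfun_def
      by (rule DF_if[OF Dp_mem[OF f(1) DV_vars] f(5)[OF j, unfolded dfun_def] g(5)[OF j, unfolded dfun_def]])
    moreover have "(\<lambda>x. if x \<in> U then (if x \<in> U then f x ! j else 0) else (if x \<in> V then f x ! j else 0)) = (\<lambda>x. if x \<in> U \<union> V then f x ! j else 0)" by (intro ext) auto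
    ultimately show ?thesis by simp
  qed
  moreover have "open_in_Rn n (U \<union> V)" using f(2) g(2) unfolding open_in_Rn_iff by (auto elim!: eventually_mono)
  ultimately show ?thesis unfolding dCp_iff using f g by (auto intro: S_Un)
qed

lemma dCp_UN: "finite I ==> (\<And>i. i \<in> I ==> dCp S p n k f (U i)) ==> dCp S p n k f (\<Union>i\<in>I. U i)"
  by (induction I rule: finite_induct) (auto simp: dCp_empty intro: dCp_Un)

text \<open>Differentiating \<open>L (f y) = y\<close> shows that the Jacobian of \<open>L\<close>
  times that of \<open>f\<close> is the identity, so the latter is injective.\<close>

lemma left_inverse_immersion:
  assumes p: "1 \<le> p" and f: "dCp S p n k f U" and L: "dCp S p k n L V" and x: "x \<in> U" "f x \<in> V"
    and inv: "eventually (\<lambda>y. L (f y) = y) (nb n x)"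
  shows "\<exists>D. has_deriv n k f D x \<and> (\<forall>v\<in>Rn n. mat_apply k n D v = replicate k 0 --> v = replicate n 0)"
proof -
  note f' = dCpD[OF f] and L' = dCpD[OF L]
  obtain p' where p': "p = Suc p'" using p by (cases p) auto
  have lx: "length x = n" using f'(4)[OF x(1)] .
  have "Ck (Suc p') n k f U" using f unfolding dCp_def p' by blast
  then obtain D where D: "has_deriv n k f D x" using x(1) by auto
  have ev: "eventually (\<lambda>y. length (f y) = k) (nb n x)" using open_ev[OF f'(2) x(1)] by (rule eventually_mono) (rule f'(3))
  have h: "hdv n (\<lambda>y. f y ! j) (\<lambda>i. D ! (j * n + i)) x" if "j < k" for j using D has_deriv_iff[OF lx ev] that by blast
  have v: "v ! i = 0" if v: "length v = n" "mat_apply k n D v = replicate k 0" and i: "i < n" for v i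
  proof -
    have "reg (Suc p') k (\<lambda>z. L z ! i) (f x)" using L'(6)[OF x(2) i] unfolding p' .
    then obtain E where "hdv k (\<lambda>z. L z ! i) E (f x)"
      using reg_Suc_pd[OF f'(3)[OF x(1)], of p' "\<lambda>z. L z ! i"] ev_self[OF _ f'(3)[OF x(1)]] by blast
    hence "hdv k (\<lambda>z. L z ! i) E (map (\<lambda>j. f x ! j) [0..<k])" using map_nth'[OF f'(3)[OF x(1)]] by simp
    from hdv_comp[of k "\<lambda>z. L z ! i" E "\<lambda>j y. f y ! j" x n "\<lambda>j i. D ! (j * n + i)", OF this h]
    have c: "hdv n (\<lambda>y. L (map (\<lambda>j. f y ! j) [0..<k]) ! i) (\<lambda>i'. \<Sum>j<k. E j * D ! (j * n + i')) x" .
    have "eventually (\<lambda>y. L (map (\<lambda>j. f y ! j) [0..<k]) ! i = y ! i) (nb n x)"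
      using ev inv by eventually_elim (simp add: map_nth')
    from hdv_cong[OF c this lx] have c': "hdv n (\<lambda>y. y ! i) (\<lambda>i'. \<Sum>j<k. E j * D ! (j * n + i')) x" .
    \<comment> \<open>Uniqueness of gradients: the chain rule and the coordinate function describe
      the same derivative.\<close>
    have delta: "(\<Sum>j<k. E j * D ! (j * n + i')) = (if i' = i then 1 else 0)" if "i' < n" for i'
      using hdv_pd[OF c' lx that] hdv_pd[OF hdv_nth[OF i] lx that] by simp
    have z: "(\<Sum>i'<n. D ! (j * n + i') * v ! i') = 0" if "j < k" for j
      using v(2) that nth_replicate[of j k "0::'r"] unfolding mat_apply_def by (metis (no_types, lifting) add_0 diff_zero length_upt nth_map nth_upt)
    have "v ! i = (\<Sum>i'<n. (if i' = i then 1 else 0) * v ! i')" using i by (simp add: if_distrib[of "\<lambda>a. a * _"] sum.delta cong: if_cong)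
    also have "\<dots> = (\<Sum>i'<n. (\<Sum>j<k. E j * D ! (j * n + i')) * v ! i')" by (intro sum.cong) (auto simp: delta)
    also have "\<dots> = (\<Sum>i'<n. \<Sum>j<k. E j * (D ! (j * n + i') * v ! i'))" by (simp add: sum_distrib_right mult.assoc)
    also have "\<dots> = (\<Sum>j<k. \<Sum>i'<n. E j * (D ! (j * n + i') * v ! i'))" by (rule sum.swap)
    also have "\<dots> = (\<Sum>j<k. E j * (\<Sum>i'<n. D ! (j * n + i') * v ! i'))" by (simp add: sum_distrib_left)
    also have "\<dots> = 0" using z by (intro sum.neutral) auto
    finally show ?thesis .
  qed
  show ?thesis
  proof (intro exI[of _ D] conjI D ballI impI)
    fix w :: "'r list" assume w: "w \<in> Rn n" "mat_apply k n D w = replicate k 0"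
    show "w = replicate n 0" by (rule nth_equalityI) (use w v in auto)
  qed
qed

subsection \<open>The embedding\<close>

lemma atlasD:
  assumes "is_atlas S p m M A" "(U, \<phi>) \<in> set A"
  shows "inj_on \<phi> U" "\<phi> ` U \<in> S m" "open_in_Rn m (\<phi> ` U)" "U \<subseteq> M"
  using assms unfolding is_atlas_def by (auto dest!: bspec[where x = "(U, \<phi>)"])

lemma atlas_transition:
  assumes "is_atlas S p m M A" "(U, \<phi>) \<in> set A" "(V, \<psi>) \<in> set A"
  shows "dCp S p m m (\<lambda>y. \<psi> (the_inv_into U \<phi> y)) (\<phi> ` (U \<inter> V))"
proof -
  have "\<forall>(U, \<phi>)\<in>set A. \<forall>(V, \<psi>)\<in>set A. \<phi> ` (U \<inter> V) \<in> S m \<and> open_in_Rn m (\<phi> ` (U \<inter> V)) \<and>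
        dCp_diffeo S p m (\<psi> \<circ> the_inv_into U \<phi>) (\<phi> ` (U \<inter> V)) (\<psi> ` (U \<inter> V))" using assms(1) unfolding is_atlas_def by (elim conjE)
  from bspec[OF this assms(2)] have "\<forall>(V, \<psi>)\<in>set A. \<phi> ` (U \<inter> V) \<in> S m \<and> open_in_Rn m (\<phi> ` (U \<inter> V)) \<and>
        dCp_diffeo S p m (\<psi> \<circ> the_inv_into U \<phi>) (\<phi> ` (U \<inter> V)) (\<psi> ` (U \<inter> V))" by simp
  from bspec[OF this assms(3)] show ?thesis unfolding dCp_diffeo_def comp_def by simp
qed

text \<open>Hausdorffness enters in the continuity of \<open>u\<close>: if \<open>u\<close> did not tend to \<open>0\<close> at a point of \<open>V - U\<close>, a cluster
  point of the images in the chart \<open>\<phi>\<close> would be a point of \<open>U\<close> that cannot be separated from it.\<close>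

lemma pullback:
  assumes M: "ad_manifold S p m M A" and c: "(U, \<phi>) \<in> set A" "(V, \<psi>) \<in> set A" and h: "nice p m h" "supp m h \<subseteq> \<phi> ` U"
  defines "u \<equiv> \<lambda>y. if y \<in> \<psi> ` (V \<inter> U) then h (\<phi> (the_inv_into V \<psi> y)) else 0"
  shows "dfun m u" "\<And>y. y \<in> \<psi> ` V ==> ctd m u y" "\<And>y. 0 \<le> u y \<and> u y \<le> 1" "\<And>y. 0 < u y ==> reg p m u y"
proof -
  have A: "is_atlas S p m M A" using M unfolding ad_manifold_def by blast
  note U = atlasD[OF A c(1)] and V = atlasD[OF A c(2)]
  let ?O = "\<psi> ` (V \<inter> U)"
  let ?\<tau> = "\<lambda>y. \<phi> (the_inv_into V \<psi> y)"
  have T: "dCp S p m m ?\<tau> ?O" by (rule atlas_transition[OF A c(2,1)])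
  note \<tau> = dCpD[OF T]
  have hd: "dfun m h" "\<And>x. length x = m ==> 0 \<le> h x \<and> h x \<le> 1" "\<And>x. length x = m ==> ctd m h x"
    "\<And>e. e > 0 ==> \<exists>B. \<forall>x\<in>Rn m. e \<le> h x --> (\<forall>i<m. \<bar>x ! i\<bar> \<le> B)" "\<And>x. length x = m ==> 0 < h x ==> reg p m h x"
    using h(1) unfolding nice_def by auto
  define t where "t j y = (if y \<in> ?O then ?\<tau> y ! j else 0)" for j y
  have dt: "dfun m (t j)" if "j < m" for j unfolding t_def using \<tau>(5)[OF that] .
  have t: "map (\<lambda>j. t j y) [0..<m] = ?\<tau> y" if "y \<in> ?O" for y unfolding t_def using map_nth'[OF \<tau>(3)[OF that]] that by simp
  have ut: "u = (\<lambda>y. if y \<in> ?O then h (map (\<lambda>j. t j y) [0..<m]) else 0)"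
  proof
    show "u y = (if y \<in> ?O then h (map (\<lambda>j. t j y) [0..<m]) else 0)" for y unfolding u_def using t[of y] by simp
  qed
  show "dfun m u" unfolding ut dfun_def
    by (intro DF_if Dp_mem[OF \<tau>(1)] DV_vars DF_const DF_app[OF hd(1)] DV_map dt[unfolded dfun_def])
  show u01: "0 \<le> u y \<and> u y \<le> 1" for y unfolding u_def using hd(2)[OF \<tau>(3)[of y]] by simp
  have evu: "eventually (\<lambda>z. h (?\<tau> z) = u z) (nb m y)" if "y \<in> ?O" for y
    using open_ev[OF \<tau>(2) that] by (rule eventually_mono) (simp add: u_def)
  show "reg p m u y" if "0 < u y" for y
  proof -
    have y: "y \<in> ?O" "0 < h (?\<tau> y)" using that unfolding u_def by (auto split: if_splits)
    show ?thesis by (rule reg_cong[OF dCp_reg_comp[OF T y(1) hd(5)[OF \<tau>(3)[OF y(1)] y(2)]] evu[OF y(1)]])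
  qed
  show "ctd m u y0" if y0: "y0 \<in> \<psi> ` V" for y0
  proof (cases "y0 \<in> ?O")
    case True
    have l: "length y0 = m" using \<tau>(4)[OF True] .
    have "ctd m (\<lambda>y. h (?\<tau> y)) y0" unfolding ctd_def
      by (intro allI impI) (rule dCp_ev[OF T True], rule ctdD[OF hd(3)[OF \<tau>(3)[OF True]]])
    thus ?thesis by (rule ctd_cong[OF _ evu[OF True] l])
  next
    case False
    hence u0: "u y0 = 0" unfolding u_def by simp
    show ?thesis
    proof (rule ccontr)
      assume "\<not> ctd m u y0"
      then obtain \<epsilon> where \<epsilon>: "\<epsilon> > 0" and ne: "\<not> eventually (\<lambda>y. \<bar>u y - u y0\<bar> < \<epsilon>) (nb m y0)" unfolding ctd_def by blast
      have far: "\<exists>y\<in>Rn m. near m d y0 y \<and> y \<in> ?O \<and> \<epsilon> \<le> h (?\<tau> y)" if d: "d > 0" for d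
      proof -
        obtain y where y: "y \<in> Rn m" "near m d y0 y" "\<not> \<bar>u y - u y0\<bar> < \<epsilon>" using ne d unfolding eventually_nb by blast
        have "\<epsilon> \<le> u y" using y(3) u0 u01[of y] by simp
        moreover from this have "y \<in> ?O" using \<epsilon> unfolding u_def by (auto split: if_splits)
        ultimately show ?thesis using y(1,2) unfolding u_def by auto
      qed
      obtain B where B: "\<forall>x\<in>Rn m. \<epsilon> \<le> h x --> (\<forall>i<m. \<bar>x ! i\<bar> \<le> B)" using hd(4)[OF \<epsilon>] by blast
      \<comment> \<open>Points \<open>z\<close> in the chart \<open>\<phi>\<close> with
        \<open>h z \<ge> \<epsilon>\<close> that come from points of the overlap closer than
        \<open>d\<close> to \<open>y0\<close>. Boundedness of the superlevel sets of
        \<open>h\<close> gives them a cluster point.\<close>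
      define P where "P d z \<longleftrightarrow> \<epsilon> \<le> h z \<and> (\<exists>y\<in>Rn m. (\<forall>i<m. \<bar>y ! i - y0 ! i\<bar> < d) \<and> y \<in> ?O \<and> (\<forall>j<m. z ! j = t j y))" for d z
      have "\<exists>c\<in>Rn m. \<forall>d>0. \<forall>r>0. \<exists>z\<in>Rn m. near m r c z \<and> P d z"
      proof (rule cluster_point[where B = B])
        show "Dp (\<lambda>e. P (f e) (v e))" if "DF f" "DV m v" for f v unfolding P_def
          by (intro Dp_conj Dp_exv Dp_all_less Dp_le Dp_less Dp_eq Dp_mem[OF \<tau>(1)] DF_const DF_abs DF_diff DF_app[OF hd(1)] that DV_vars
            DF_nth[OF DV_vars] DF_ren[OF that(1)] DF_nth[OF DV_ren[OF that(2)]] DF_app[OF dt])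
        show "P d' z" if "0 < d" "d \<le> d'" "P d z" for d d' z using that unfolding P_def by (meson less_le_trans)
        fix d :: 'r assume "0 < d"
        then obtain y where y: "y \<in> Rn m" "near m d y0 y" "y \<in> ?O" "\<epsilon> \<le> h (?\<tau> y)" using far by blast
        have "P d (?\<tau> y)" unfolding P_def using y unfolding t_def near_def by auto
        thus "\<exists>z\<in>Rn m. (\<forall>i<m. \<bar>z ! i\<bar> \<le> B) \<and> P d z" using B y(4) \<tau>(3)[OF y(3)] by (intro bexI[of _ "?\<tau> y"]) auto
      qed
      then obtain z0 where lz: "length z0 = m" and z0: "\<forall>d>0. \<forall>r>0. \<exists>z\<in>Rn m. near m r z0 z \<and> P d z" by auto
      have "\<epsilon> \<le> h z0"
      proof (rule ccontr)
        assume "\<not> \<epsilon> \<le> h z0"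
        hence "\<epsilon> - h z0 > 0" by simp
        from ctdD[OF hd(3)[OF lz] this] obtain r where r: "r > 0" "\<forall>z\<in>Rn m. near m r z0 z --> \<bar>h z - h z0\<bar> < \<epsilon> - h z0" unfolding eventually_nb by blast
        obtain z where z: "z \<in> Rn m" "near m r z0 z" "P \<epsilon> z" using z0 r(1) \<epsilon> by blast
        have "\<bar>h z - h z0\<bar> < \<epsilon> - h z0" using r(2) z by blast
        thus False using z(3) unfolding P_def by (auto simp: abs_less_iff)
      qed
      \<comment> \<open>Since \<open>h z0\<close> is still at least \<open>\<epsilon>\<close>, the
        cluster point represents a point \<open>x1\<close> of \<open>U\<close>. It differs from
        \<open>x0\<close>, which is outside \<open>U\<close>, yet any neighbourhoods of the two
        points meet.\<close>
      hence "z0 \<in> supp m h" unfolding supp_def using \<epsilon> lz by auto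
      then obtain x1 where x1: "x1 \<in> U" "z0 = \<phi> x1" using h(2) by blast
      obtain x0 where x0: "x0 \<in> V" "y0 = \<psi> x0" using y0 by blast
      have "x0 \<notin> U" using False x0 by blast
      hence "x0 \<noteq> x1" using x1 by blast
      then obtain W1 W2 where W: "atlas_open m M A W1" "atlas_open m M A W2" "x0 \<in> W1" "x1 \<in> W2" "W1 \<inter> W2 = {}"
        using M x0(1) x1(1) U(4) V(4) unfolding ad_manifold_def by (metis subsetD)
      have o1: "open_in_Rn m (\<psi> ` (W1 \<inter> V))" using W(1) c(2) unfolding atlas_open_def by auto
      have o2: "open_in_Rn m (\<phi> ` (W2 \<inter> U))" using W(2) c(1) unfolding atlas_open_def by auto
      have "y0 \<in> \<psi> ` (W1 \<inter> V)" "z0 \<in> \<phi> ` (W2 \<inter> U)" using x0 x1 W by auto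
      from open_ev[OF o1 this(1)] open_ev[OF o2 this(2)] obtain d r where d: "d > 0" "\<forall>y\<in>Rn m. near m d y0 y --> y \<in> \<psi> ` (W1 \<inter> V)"
        and r: "r > 0" "\<forall>y\<in>Rn m. near m r z0 y --> y \<in> \<phi> ` (W2 \<inter> U)" unfolding eventually_nb by blast
      obtain z where z: "z \<in> Rn m" "near m r z0 z" "P d z" using z0 d(1) r(1) by blast
      obtain y where y: "y \<in> Rn m" "near m d y0 y" "y \<in> ?O" "\<forall>j<m. z ! j = t j y" using z(3) unfolding P_def near_def by blast
      have zy: "z = ?\<tau> y" unfolding t[OF y(3), symmetric] by (rule nth_equalityI) (use z(1) y(4) in auto)
      have "y \<in> \<psi> ` (W1 \<inter> V)" using d(2) y(1,2) by blast
      then obtain x where x: "x \<in> W1" "x \<in> V" "y = \<psi> x" by blast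
      obtain x' where x': "x' \<in> V" "x' \<in> U" "y = \<psi> x'" using y(3) by blast
      have "x' = x" using inj_onD[OF V(1), of x' x] x x' by simp
      hence xU: "x \<in> U" using x' by simp
      have "z = \<phi> x" unfolding zy x(3) the_inv_into_f_f[OF V(1) x(2)] ..
      moreover have "z \<in> \<phi> ` (W2 \<inter> U)" using r(2) z(1,2) by blast
      ultimately obtain w where w: "w \<in> W2" "w \<in> U" "\<phi> x = \<phi> w" by blast
      have "x = w" using inj_onD[OF U(1) w(3) xU w(2)] .
      thus False using x(1) w(1) W(5) by blast
    qed
  qed
qed

section \<open>Coordinate pieces of the embedding\<close>

text \<open>Being dominated with respect to a larger function is a stronger condition, so the sum of
  the individual majorants serves all finitely many conditions.\<close>

lemma common_majorant:
  assumes "finite I" "\<And>i. i \<in> I ==> \<exists>A. majorant A \<and> (\<forall>\<theta>. dominated p \<theta> A --> R i \<theta>)"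
  shows "\<exists>A. majorant A \<and> (\<forall>\<theta>. dominated p \<theta> A --> (\<forall>i\<in>I. R i \<theta>))"
  using assms
proof (induction I rule: finite_induct)
  case empty show ?case using majorant_zero by auto
next
  case (insert i I)
  obtain A where A: "majorant A" "\<forall>\<theta>. dominated p \<theta> A --> R i \<theta>" using insert.prems[of i] by blast
  obtain B where B: "majorant B" "\<forall>\<theta>. dominated p \<theta> B --> (\<forall>i\<in>I. R i \<theta>)" using insert by blast
  have "R i \<theta> \<and> (\<forall>i\<in>I. R i \<theta>)" if d: "dominated p \<theta> (\<lambda>t. A t + B t)" for \<theta>
  proof -
    have "dominated p \<theta> A" "dominated p \<theta> B"
      by (rule dominated_mono[OF d], use majorant_nonneg[OF A(1)] majorant_nonneg[OF B(1)] in simp)+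
    thus ?thesis using A(2) B(2) by blast
  qed
  thus ?case using majorant_add[OF A(1) B(1)] by (intro exI[of _ "\<lambda>t. A t + B t"]) auto
qed

text \<open>Coordinate 0 of \<open>e\<close> is the bump, the others are the bump times the chart
  coordinates. Regularity is required in every chart of the atlas and not only in
  \<open>\<phi>\<close>, because the extension by zero leaves \<open>U\<close>.\<close>

definition piece :: "nat \<Rightarrow> nat \<Rightarrow> 'm set \<Rightarrow> ('m set \<times> ('m \<Rightarrow> 'r list)) list \<Rightarrow> 'm set \<Rightarrow> ('m \<Rightarrow> 'r list) \<Rightarrow> ('m \<Rightarrow> 'r list) \<Rightarrow> bool" where
  "piece p m M A U \<phi> e \<longleftrightarrow> (U, \<phi>) \<in> set A \<and> (\<forall>(V, \<psi>)\<in>set A. dCp S p m (Suc m) (\<lambda>y. e (the_inv_into V \<psi> y)) (\<psi> ` V)) \<and>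
     (\<forall>x\<in>M. length (e x) = Suc m \<and> (0 < e x ! 0 --> x \<in> U \<and> (\<forall>l<m. e x ! Suc l = e x ! 0 * \<phi> x ! l)))"

text \<open>As \<open>e\<close> is a single function on \<open>M\<close>, one \<theta> has to work
  in all charts at once. The majorants for all charts and all coordinates are therefore merged
  before \<theta> is constructed.\<close>

lemma piece_exists:
  assumes M: "ad_manifold S p m M A" and c: "(U, \<phi>) \<in> set A" and h: "nice p m h" "supp m h \<subseteq> \<phi> ` U"
  shows "\<exists>e. piece p m M A U \<phi> e \<and> (\<forall>x\<in>U. 0 < h (\<phi> x) --> 0 < e x ! 0)"
proof -
  have A: "is_atlas S p m M A" using M unfolding ad_manifold_def by blast
  note U = atlasD[OF A c]
  have h01: "0 \<le> h x \<and> h x \<le> 1" if "length x = m" for x using h(1) that unfolding nice_def by simp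
  define u where "u V \<psi> y = (if y \<in> \<psi> ` (V \<inter> U) then h (\<phi> (the_inv_into V \<psi> y)) else 0)" for V and \<psi> :: "'a \<Rightarrow> 'r list" and y
  \<comment> \<open>\<open>l = 0\<close> stands for the bump itself, and \<open>l > 0\<close> for
    chart coordinate \<open>l - 1\<close>.\<close>
  define w where "w V \<psi> l y = (if l = 0 then 1 else if y \<in> \<psi> ` (V \<inter> U) then \<phi> (the_inv_into V \<psi> y) ! (l - 1) else 0)" for V and \<psi> :: "'a \<Rightarrow> 'r list" and l y
  have pb: "dfun m (u V \<psi>)" "\<And>y. y \<in> \<psi> ` V ==> ctd m (u V \<psi>) y" "\<And>y. 0 \<le> u V \<psi> y \<and> u V \<psi> y \<le> 1" "\<And>y. 0 < u V \<psi> y ==> reg p m (u V \<psi>) y"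
    if V: "(V, \<psi>) \<in> set A" for V \<psi>
    using pullback[OF M c V h] unfolding u_def by auto
  have dw: "dfun m (w V \<psi> l)" if V: "(V, \<psi>) \<in> set A" and l: "l < Suc m" for V \<psi> l
  proof (cases l)
    case 0 thus ?thesis unfolding w_def dfun_def by (simp add: DF_const)
  next
    case (Suc k)
    have "dfun m (\<lambda>y. if y \<in> \<psi> ` (V \<inter> U) then \<phi> (the_inv_into V \<psi> y) ! k else 0)"
      by (rule dCpD(5)[OF atlas_transition[OF A V c]]) (use l Suc in simp)
    moreover have "w V \<psi> l = (\<lambda>y. if y \<in> \<psi> ` (V \<inter> U) then \<phi> (the_inv_into V \<psi> y) ! k else 0)" unfolding w_def Suc by (intro ext) simp
    ultimately show ?thesis by simp
  qed
  have maj: "\<exists>B. majorant B \<and> (\<forall>\<theta>. dominated p \<theta> B --> (\<forall>y\<in>\<psi> ` V. reg p m (ext0 (\<psi> ` V) (u V \<psi>) (\<theta> 0) (w V \<psi> l)) y))"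
    if V: "(V, \<psi>) \<in> set A" and l: "l < Suc m" for V \<psi> l
  proof (rule ext0_reg[OF atlasD(2,3)[OF A V] pb(1,2)[OF V] _ _ dw[OF V l]])
    show "0 \<le> u V \<psi> y \<and> u V \<psi> y \<le> 1" for y by (rule pb(3)[OF V])
    show "reg p m (u V \<psi>) y" if "0 < u V \<psi> y" for y by (rule pb(4)[OF V that])
    show "reg p m (w V \<psi> l) y" if "0 < u V \<psi> y" for y
    proof (cases l)
      case 0
      hence "w V \<psi> l = (\<lambda>y. 1)" unfolding w_def by auto
      thus ?thesis by (simp add: reg_const)
    next
      case (Suc k)
      have y: "y \<in> \<psi> ` (V \<inter> U)" using that unfolding u_def by (auto split: if_splits)
      note \<tau> = dCpD[OF atlas_transition[OF A V c]]
      show ?thesis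
      proof (rule reg_cong)
        show "reg p m (\<lambda>y. \<phi> (the_inv_into V \<psi> y) ! k) y" by (rule \<tau>(6)[OF y]) (use l Suc in simp)
        show "eventually (\<lambda>y. \<phi> (the_inv_into V \<psi> y) ! k = w V \<psi> l y) (nb m y)"
          using open_ev[OF \<tau>(2) y] by (rule eventually_mono) (simp add: w_def Suc)
      qed
    qed
  qed
  have "\<exists>B. majorant B \<and> (\<forall>\<theta>. dominated p \<theta> B --> (\<forall>i\<in>set A \<times> {..<Suc m}. \<forall>y\<in>snd (fst i) ` fst (fst i).
      reg p m (ext0 (snd (fst i) ` fst (fst i)) (u (fst (fst i)) (snd (fst i))) (\<theta> 0) (w (fst (fst i)) (snd (fst i)) (snd i))) y))"
  proof (rule common_majorant)
    fix i assume "i \<in> set A \<times> {..<Suc m}"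
    thus "\<exists>B. majorant B \<and> (\<forall>\<theta>. dominated p \<theta> B --> (\<forall>y\<in>snd (fst i) ` fst (fst i).
      reg p m (ext0 (snd (fst i) ` fst (fst i)) (u (fst (fst i)) (snd (fst i))) (\<theta> 0) (w (fst (fst i)) (snd (fst i)) (snd i))) y))"
      using maj[of "fst (fst i)" "snd (fst i)" "snd i"] by auto
  qed simp
  then obtain B where B: "majorant B" "\<forall>\<theta>. dominated p \<theta> B --> (\<forall>i\<in>set A \<times> {..<Suc m}. \<forall>y\<in>snd (fst i) ` fst (fst i).
      reg p m (ext0 (snd (fst i) ` fst (fst i)) (u (fst (fst i)) (snd (fst i))) (\<theta> 0) (w (fst (fst i)) (snd (fst i)) (snd i))) y)" by (elim exE conjE)
  obtain \<theta> where \<theta>: "\<forall>k. DF (\<lambda>e. \<theta> k (e 0))" "\<forall>k\<le>p. \<forall>t. 0 < t \<and> t < 2 --> dv1 (\<theta> k) t (\<theta> (Suc k) t)"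
    "\<forall>t. 0 < t \<and> t < 2 --> 0 < \<theta> 0 t" "\<forall>k\<le>p. \<forall>t. 0 < t \<and> t \<le> 1 --> \<bar>\<theta> k t\<bar> * B t \<le> t"
    using theta_exists[OF B(1), of p] by (elim exE conjE)
  have dom: "dominated p \<theta> B" unfolding dominated_def using \<theta> dv1_ctd1 by (metis less_imp_le order_refl)
  have rg: "reg p m (ext0 (\<psi> ` V) (u V \<psi>) (\<theta> 0) (w V \<psi> l)) y" if "(V, \<psi>) \<in> set A" "l < Suc m" "y \<in> \<psi> ` V" for V \<psi> l y
    using B(2)[rule_format, OF dom, of "((V, \<psi>), l)" y] that by simp
  define e where "e x = (if x \<in> U \<and> 0 < h (\<phi> x) then map (\<lambda>l. \<theta> 0 (h (\<phi> x)) * (if l = 0 then 1 else \<phi> x ! (l - 1))) [0..<Suc m] else replicate (Suc m) 0)" for x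
  have le: "length (e x) = Suc m" for x unfolding e_def by simp
  have e0: "0 < e x ! 0 \<longleftrightarrow> x \<in> U \<and> 0 < h (\<phi> x)" if "x \<in> M" for x
  proof (cases "x \<in> U \<and> 0 < h (\<phi> x)")
    case True
    have "h (\<phi> x) \<le> 1" using h01[OF open_len[OF U(3)]] True by blast
    hence "0 < \<theta> 0 (h (\<phi> x))" using \<theta>(3) True by (auto intro: le_less_trans)
    thus ?thesis using True unfolding e_def by (simp del: upt_Suc)
  next
    case False thus ?thesis unfolding e_def by auto
  qed
  have el: "e x ! Suc l = e x ! 0 * \<phi> x ! l" if "x \<in> U \<and> 0 < h (\<phi> x)" "l < m" for x l
    using that unfolding e_def by (simp del: upt_Suc)
  have dC: "dCp S p m (Suc m) (\<lambda>y. e (the_inv_into V \<psi> y)) (\<psi> ` V)" if V: "(V, \<psi>) \<in> set A" for V \<psi>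
  proof -
    note V' = atlasD[OF A V]
    have ex: "e (the_inv_into V \<psi> y) ! l = ext0 (\<psi> ` V) (u V \<psi>) (\<theta> 0) (w V \<psi> l) y" if y: "y \<in> \<psi> ` V" and l: "l < Suc m" for y l
    proof -
      obtain x where x: "x \<in> V" "y = \<psi> x" using y by blast
      have i: "the_inv_into V \<psi> y = x" unfolding x(2) by (rule the_inv_into_f_f[OF V'(1) x(1)])
      have o: "y \<in> \<psi> ` (V \<inter> U) \<longleftrightarrow> x \<in> U" unfolding x(2) using inj_onD[OF V'(1)] x(1) by blast
      show ?thesis unfolding e_def ext0_def u_def w_def i o using y l by (auto simp del: upt_Suc)
    qed
    show ?thesis unfolding dCp_iff
    proof (intro conjI ballI allI impI V'(2,3) le)
      fix l assume l: "l < Suc m"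
      have "dfun m (ext0 (\<psi> ` V) (u V \<psi>) (\<theta> 0) (w V \<psi> l))" by (rule dfun_ext0[OF V'(2) pb(1)[OF V] _ dw[OF V l]]) (use \<theta>(1) in blast)
      moreover have "(\<lambda>y. if y \<in> \<psi> ` V then e (the_inv_into V \<psi> y) ! l else 0) = ext0 (\<psi> ` V) (u V \<psi>) (\<theta> 0) (w V \<psi> l)"
      proof
        show "(if y \<in> \<psi> ` V then e (the_inv_into V \<psi> y) ! l else 0) = ext0 (\<psi> ` V) (u V \<psi>) (\<theta> 0) (w V \<psi> l) y" for y
          using ex[of y l] l unfolding ext0_def by simp
      qed
      ultimately show "dfun m (\<lambda>y. if y \<in> \<psi> ` V then e (the_inv_into V \<psi> y) ! l else 0)" by simp
      fix y assume y: "y \<in> \<psi> ` V"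
      show "reg p m (\<lambda>y. e (the_inv_into V \<psi> y) ! l) y"
      proof (rule reg_cong[OF rg[OF V l y]])
        show "eventually (\<lambda>y. ext0 (\<psi> ` V) (u V \<psi>) (\<theta> 0) (w V \<psi> l) y = e (the_inv_into V \<psi> y) ! l) (nb m y)"
          using open_ev[OF V'(3) y] by (rule eventually_mono) (simp add: ex[OF _ l])
      qed
    qed
  qed
  have "piece p m M A U \<phi> e" unfolding piece_def using c dC le e0 el by auto
  thus ?thesis using e0 U(4) by (intro exI[of _ e]) auto
qed

lemma pieces_exist:
  assumes M: "ad_manifold S p m M A"
  shows "\<exists>es. (\<forall>(U, \<phi>, e)\<in>set es. piece p m M A U \<phi> e) \<and> (\<forall>x\<in>M. \<exists>(U, \<phi>, e)\<in>set es. 0 < e x ! 0)"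
proof -
  have A: "is_atlas S p m M A" using M unfolding ad_manifold_def by blast
  have chart: "\<exists>E. finite E \<and> (\<forall>e\<in>E. piece p m M A U \<phi> e) \<and> (\<forall>x\<in>U. \<exists>e\<in>E. 0 < e x ! 0)" if c: "(U, \<phi>) \<in> set A" for U \<phi>
  proof -
    obtain H where H: "finite H" "\<forall>h\<in>H. nice p m h \<and> supp m h \<subseteq> \<phi> ` U" "\<phi> ` U \<subseteq> (\<Union>h\<in>H. supp m h)"
      using nice_cover[OF atlasD(2,3)[OF A c], of p] unfolding covered_def by (elim exE conjE)
    have "\<forall>h\<in>H. \<exists>e. piece p m M A U \<phi> e \<and> (\<forall>x\<in>U. 0 < h (\<phi> x) --> 0 < e x ! 0)"
      using piece_exists[OF M c] H(2) by blast
    from bchoice[OF this] obtain E where E: "\<forall>h\<in>H. piece p m M A U \<phi> (E h) \<and> (\<forall>x\<in>U. 0 < h (\<phi> x) --> 0 < E h x ! 0)" by (elim exE)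
    have "\<exists>e\<in>E ` H. 0 < e x ! 0" if x: "x \<in> U" for x
    proof -
      obtain h where h: "h \<in> H" "\<phi> x \<in> supp m h" using H(3) x by blast
      hence "0 < E h x ! 0" using E x unfolding supp_def by blast
      thus ?thesis using h(1) by blast
    qed
    thus ?thesis using H(1) E by (intro exI[of _ "E ` H"]) auto
  qed
  hence "\<forall>c\<in>set A. \<exists>E. finite E \<and> (\<forall>e\<in>E. piece p m M A (fst c) (snd c) e) \<and> (\<forall>x\<in>fst c. \<exists>e\<in>E. 0 < e x ! 0)" by auto
  from bchoice[OF this] obtain E where E: "\<forall>c\<in>set A. finite (E c) \<and> (\<forall>e\<in>E c. piece p m M A (fst c) (snd c) e) \<and> (\<forall>x\<in>fst c. \<exists>e\<in>E c. 0 < e x ! 0)" by (elim exE)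
  define T where "T = (\<Union>c\<in>set A. (\<lambda>e. (fst c, snd c, e)) ` E c)"
  have "finite T" unfolding T_def using E by auto
  then obtain es where es: "set es = T" using finite_list by blast
  have MU: "M = (\<Union>(U, \<phi>)\<in>set A. U)" using A unfolding is_atlas_def by (elim conjE)
  have "\<exists>(U, \<phi>, e)\<in>T. 0 < e x ! 0" if x: "x \<in> M" for x
  proof -
    obtain c where c: "c \<in> set A" "x \<in> fst c" using x unfolding MU by auto
    obtain e where "e \<in> E c" "0 < e x ! 0" using E c by blast
    thus ?thesis unfolding T_def using c(1) by (intro bexI[of _ "(fst c, snd c, e)"]) auto
  qed
  thus ?thesis using E by (intro exI[of _ es]) (auto simp: es T_def)
qed

section \<open>Compatible charts and gluing of the pieces\<close>

lemma dCp_const: assumes "U \<in> S n" "open_in_Rn n U" shows "dCp S p n (length c) (\<lambda>x. c) U"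
proof -
  have "dfun n (\<lambda>x. if x \<in> U then c ! j else 0)" for j
    unfolding dfun_def by (intro DF_if Dp_mem[OF assms(1)] DV_vars DF_const)
  thus ?thesis unfolding dCp_iff using assms reg_const by blast
qed

text \<open>The charts of \<open>A\<close> cut the domain of the new chart into finitely many
  overlaps, on each of which a transition map reduces the claim to a chart of
  \<open>A\<close>.\<close>

lemma dCp_compat_chart:
  assumes A: "is_atlas S p m M A" and f: "\<And>V \<psi>. (V, \<psi>) \<in> set A ==> dCp S p m k (\<lambda>y. f (the_inv_into V \<psi> y)) (\<psi> ` V)"
    and c: "compat_chart S p m M A (U, \<phi>)"
  shows "dCp S p m k (\<lambda>y. f (the_inv_into U \<phi> y)) (\<phi> ` U)"
proof -
  have A': "is_atlas S p m M (A @ [(U, \<phi>)])" using c unfolding compat_chart_def .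
  have U: "(U, \<phi>) \<in> set (A @ [(U, \<phi>)])" by simp
  note U' = atlasD[OF A' U]
  have "M = (\<Union>(V, \<psi>)\<in>set A. V)" using A unfolding is_atlas_def by (elim conjE)
  hence "M = (\<Union>c\<in>set A. fst c)" by (simp add: case_prod_beta)
  hence "U = (\<Union>c\<in>set A. U \<inter> fst c)" using U'(4) by blast
  hence UU: "\<phi> ` U = (\<Union>c\<in>set A. \<phi> ` (U \<inter> fst c))" by blast
  show ?thesis unfolding UU
  proof (rule dCp_UN)
    fix c assume c: "c \<in> set A"
    define V where "V = fst c"
    define \<psi> where "\<psi> = snd c"
    have V: "(V, \<psi>) \<in> set A" using c unfolding V_def \<psi>_def by simp
    hence V2: "(V, \<psi>) \<in> set (A @ [(U, \<phi>)])" by simp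
    have i: "the_inv_into U \<phi> y \<in> U \<inter> V" if y: "y \<in> \<phi> ` (U \<inter> V)" for y
    proof -
      obtain x where x: "x \<in> U" "x \<in> V" "y = \<phi> x" using y by blast
      show ?thesis unfolding x(3) the_inv_into_f_f[OF U'(1) x(1)] using x by simp
    qed
    have "dCp S p m k (\<lambda>y. f (the_inv_into V \<psi> (\<psi> (the_inv_into U \<phi> y)))) (\<phi> ` (U \<inter> V))"
      by (rule dCp_comp[OF atlas_transition[OF A' U V2] f[OF V]]) (use i in blast)
    hence "dCp S p m k (\<lambda>y. f (the_inv_into U \<phi> y)) (\<phi> ` (U \<inter> V))"
      by (rule dCp_cong) (use i the_inv_into_f_f[OF atlasD(1)[OF A V]] in simp)
    thus "dCp S p m k (\<lambda>y. f (the_inv_into U \<phi> y)) (\<phi> ` (U \<inter> fst c))" unfolding V_def .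
  qed simp
qed

text \<open>The transition maps between the identity chart and the new one are \<open>\<psi>\<close>
  and its inverse.\<close>

lemma compat_chart_Rn:
  assumes "compat_chart S p n (Rn n) (Rn_atlas n) (V, \<psi>)"
  shows "V \<in> S n" "open_in_Rn n V" "inj_on \<psi> V" "dCp S p n n \<psi> V" "dCp S p n n (the_inv_into V \<psi>) (\<psi> ` V)"
proof -
  let ?A = "Rn_atlas n @ [(V, \<psi>)]"
  have A: "is_atlas S p n (Rn n) ?A" using assms unfolding compat_chart_def .
  have I: "(Rn n, id) \<in> set ?A" and V: "(V, \<psi>) \<in> set ?A" unfolding Rn_atlas_def by auto
  have sub: "V \<subseteq> Rn n" by (rule atlasD(4)[OF A V])
  hence eq: "id ` (Rn n \<inter> V) = V" "V \<inter> Rn n = V" by auto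
  have i: "the_inv_into (Rn n) id y = y" if "y \<in> Rn n" for y :: "'r list" using the_inv_into_f_f[of id "Rn n" y] that by simp
  show d: "dCp S p n n \<psi> V" by (rule dCp_cong[OF atlas_transition[OF A I V, unfolded eq]]) (use i subsetD[OF sub] in simp)
  show "V \<in> S n" "open_in_Rn n V" using dCpD(1,2)[OF d] .
  show "inj_on \<psi> V" by (rule atlasD(1)[OF A V])
  show "dCp S p n n (the_inv_into V \<psi>) (\<psi> ` V)" using atlas_transition[OF A V I, unfolded eq] by simp
qed

text \<open>The final 0 keeps the target dimension positive even when the list of pieces is
  empty.\<close>

definition glue :: "('u \<times> 'v \<times> ('m \<Rightarrow> 'r list)) list \<Rightarrow> 'm \<Rightarrow> 'r list" where
  "glue es x = concat (map (\<lambda>(U, \<phi>, e). e x) es) @ [0]"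

lemma glue_nth:
  assumes "\<And>U \<phi> e. (U, \<phi>, e) \<in> set es ==> length (e x) = d"
  shows "length (glue es x) = length es * d + 1"
    "k < length es ==> l < d ==> glue es x ! (k * d + l) = (snd (snd (es ! k)) x) ! l"
  using assms
proof (induction es arbitrary: k)
  case Nil
  { case 1 show ?case by (simp add: glue_def) next case 2 thus ?case by simp }
next
  case (Cons a es)
  obtain U \<phi> e where a: "a = (U, \<phi>, e)" by (cases a) auto
  have g: "glue (a # es) x = e x @ glue es x" unfolding glue_def a by simp
  { case 1
    have "length (glue es x) = length es * d + 1" by (rule Cons.IH(1)) (use 1 in auto)
    moreover have "length (e x) = d" using 1 a by auto
    ultimately show ?case unfolding g by simp
  next
    case 2
    have l: "length (e x) = d" using 2(3) a by auto
    show ?case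
    proof (cases k)
      case 0 thus ?thesis using 2(2) l unfolding g by (simp add: nth_append a)
    next
      case (Suc k')
      have "glue es x ! (k' * d + l) = snd (snd (es ! k')) x ! l" by (rule Cons.IH(2)) (use 2 Suc in auto)
      thus ?thesis using l unfolding g Suc by (simp add: nth_append)
    qed }
qed

lemma dCp_glue:
  assumes U: "U \<in> S n" "open_in_Rn n U" and "\<And>V \<phi> e. (V, \<phi>, e) \<in> set es ==> dCp S p n d (\<lambda>y. e (i y)) U"
  shows "dCp S p n (length es * d + 1) (\<lambda>y. glue es (i y)) U"
  using assms(3)
proof (induction es)
  case Nil show ?case using dCp_const[OF U, of p "[0]"] unfolding glue_def by simp
next
  case (Cons a es)
  obtain V \<phi> e where a: "a = (V, \<phi>, e)" by (cases a) auto
  have "dCp S p n (d + (length es * d + 1)) (\<lambda>y. e (i y) @ glue es (i y)) U"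
  proof (rule dCp_append)
    show "dCp S p n d (\<lambda>y. e (i y)) U" by (rule Cons.prems[of V \<phi>]) (simp add: a)
    show "dCp S p n (length es * d + 1) (\<lambda>y. glue es (i y)) U"
    proof (rule Cons.IH)
      show "dCp S p n d (\<lambda>y. e (i y)) U" if "(V, \<phi>, e) \<in> set es" for V \<phi> e using Cons.prems[of V \<phi> e] that by simp
    qed
  qed
  thus ?case unfolding glue_def a by (simp add: add.assoc)
qed

text \<open>With \<open>b\<close> the position of a bump in the glued vector, these quotients are
  the coordinates of its chart, on the part of the image where the bump is positive.\<close>

lemma dCp_quotients:
  assumes "b < n" "b + m < n"
  shows "dCp S p n m (\<lambda>q. map (\<lambda>l. q ! (b + Suc l) / q ! b) [0..<m]) {q \<in> Rn n. 0 < q ! b}"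
proof -
  let ?U = "{q \<in> Rn n. 0 < q ! b} :: 'r list set"
  have U: "?U \<in> S n" by (rule S_Collect) (intro Dp_less DF_const DF_nth[OF DV_vars] assms)
  have o: "open_in_Rn n ?U" unfolding open_in_Rn_iff
  proof (intro conjI ballI)
    fix q assume "q \<in> ?U"
    thus "eventually (\<lambda>y. y \<in> ?U) (nb n q)" using eventually_conj[OF ev_length ev_coord_gt[OF assms(1), of 0 q]] by simp
  qed auto
  have "dfun n (\<lambda>q. if q \<in> ?U then map (\<lambda>l. q ! (b + Suc l) / q ! b) [0..<m] ! j else 0)" if "j < m" for j
  proof -
    have "dfun n (\<lambda>q. if q \<in> ?U then q ! (b + Suc j) / q ! b else 0)" unfolding dfun_def
      by (intro DF_if Dp_mem[OF U] DV_vars DF_const DF_divide DF_nth[OF DV_vars]) (use assms that in auto)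
    moreover have "map (\<lambda>l. q ! (b + Suc l) / q ! b) [0..<m] ! j = q ! (b + Suc j) / q ! b" for q :: "'r list" using that by simp
    ultimately show ?thesis by presburger
  qed
  moreover have "reg p n (\<lambda>q. map (\<lambda>l. q ! (b + Suc l) / q ! b) [0..<m] ! j) q" if "q \<in> ?U" "j < m" for q j
  proof -
    have "reg p n (\<lambda>q. q ! (b + Suc j) / q ! b) q"
      by (intro reg_divide reg_nth) (use assms that in auto)
    thus ?thesis using that by simp
  qed
  ultimately show ?thesis unfolding dCp_iff using U o by simp
qed

theorem embedding_exists:
  assumes p: "1 \<le> p" and M: "ad_manifold S p m M A"
  shows "\<exists>n>0. \<exists>g. ad_Cp_embedding_Rn S p m M A n g"
proof -
  have A: "is_atlas S p m M A" using M unfolding ad_manifold_def by blast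
  obtain es where es: "\<forall>(U, \<phi>, e)\<in>set es. piece p m M A U \<phi> e" "\<forall>x\<in>M. \<exists>(U, \<phi>, e)\<in>set es. 0 < e x ! 0"
    using pieces_exist[OF M] by (elim exE conjE)
  define K where "K = length es"
  define n where "n = K * Suc m + 1"
  define g where "g = glue es"
  define U where "U k = fst (es ! k)" for k
  define \<phi> where "\<phi> k = fst (snd (es ! k))" for k
  define e where "e k = snd (snd (es ! k))" for k
  have pc: "piece p m M A (U k) (\<phi> k) (e k)" if "k < K" for k
    using es(1) nth_mem[of k es] that unfolding K_def U_def \<phi>_def e_def by (auto simp: case_prod_beta)
  have len: "length (e' x) = Suc m" if "x \<in> M" "(V, \<psi>, e') \<in> set es" for x V \<psi> e' using es(1) that unfolding piece_def by auto
  have gl: "length (g x) = n" if "x \<in> M" for x using glue_nth(1)[OF len[OF that]] unfolding g_def n_def K_def by simp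
  have gn: "g x ! (k * Suc m + l) = e k x ! l" if "x \<in> M" "k < K" "l < Suc m" for x k l
    using glue_nth(2)[OF len[OF that(1)]] that unfolding g_def K_def e_def by simp
  have pos: "\<exists>k<K. 0 < e k x ! 0" if "x \<in> M" for x
    using es(2) that unfolding K_def e_def by (fastforce simp: in_set_conv_nth)
  have eU: "x \<in> U k" "\<And>l. l < m ==> e k x ! Suc l = e k x ! 0 * \<phi> k x ! l" if "x \<in> M" "k < K" "0 < e k x ! 0" for x k
    using pc[OF that(2)] that unfolding piece_def by auto
  have cA: "(U k, \<phi> k) \<in> set A" if "k < K" for k using pc[OF that] unfolding piece_def by blast
  have kn: "k * Suc m + m < n" if "k < K" for k
  proof -
    have "Suc k * Suc m \<le> K * Suc m" by (rule mult_le_mono1) (use that in simp)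
    thus ?thesis unfolding n_def by simp
  qed
  \<comment> \<open>\<open>k * Suc m\<close> is the position of the \<open>k\<close>-th bump;
    dividing the following \<open>m\<close> entries by it recovers \<open>\<phi> k\<close>. The
    formula makes sense on the open set \<open>P k\<close> of the ambient space and not merely on
    the image of \<open>g\<close>.\<close>
  define r where "r k q = map (\<lambda>l. q ! (k * Suc m + Suc l) / q ! (k * Suc m)) [0..<m]" for k and q :: "'r list"
  define P where "P k = {q \<in> Rn n. (0::'r) < q ! (k * Suc m)}" for k :: nat
  have dr: "dCp S p n m (r k) (P k)" if "k < K" for k
    unfolding r_def P_def by (rule dCp_quotients) (use kn[OF that] in auto)
  have gP: "g x \<in> P k \<longleftrightarrow> 0 < e k x ! 0" if "x \<in> M" "k < K" for x k
    unfolding P_def using gl[OF that(1)] gn[OF that, of 0] by simp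
  have rg: "r k (g x) = \<phi> k x" if x: "x \<in> M" and k: "k < K" "0 < e k x ! 0" for x k
  proof (rule nth_equalityI)
    have l: "length (\<phi> k x) = m" by (rule open_len[OF atlasD(3)[OF A cA[OF k(1)]]]) (use eU(1)[OF x k] in blast)
    thus "length (r k (g x)) = length (\<phi> k x)" unfolding r_def by simp
    fix i assume "i < length (r k (g x))"
    hence i: "i < m" unfolding r_def by simp
    show "r k (g x) ! i = \<phi> k x ! i"
      using i k(2) gn[OF x k(1), of 0] gn[OF x k(1), of "Suc i"] eU(2)[OF x k i] unfolding r_def by simp
  qed
  have dg: "dCp S p m n (\<lambda>y. g (the_inv_into V \<psi> y)) (\<psi> ` V)" if "compat_chart S p m M A (V, \<psi>)" for V \<psi>
  proof (rule dCp_compat_chart[OF A _ that])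
    fix V \<psi> assume V: "(V, \<psi>) \<in> set A"
    have "dCp S p m (length es * Suc m + 1) (\<lambda>y. glue es (the_inv_into V \<psi> y)) (\<psi> ` V)"
    proof (rule dCp_glue[OF atlasD(2,3)[OF A V]])
      fix U \<phi> e assume "(U, \<phi>, e) \<in> set es"
      hence "piece p m M A U \<phi> e" using es(1) by blast
      thus "dCp S p m (Suc m) (\<lambda>y. e (the_inv_into V \<psi> y)) (\<psi> ` V)" using V unfolding piece_def by blast
    qed
    thus "dCp S p m n (\<lambda>y. g (the_inv_into V \<psi> y)) (\<psi> ` V)" unfolding g_def n_def K_def .
  qed
  have rep: "dCp S p m n (\<psi> \<circ> g \<circ> the_inv_into U \<phi>) (\<phi> ` (U \<inter> g -` V))"
    if c: "compat_chart S p m M A (U, \<phi>)" "compat_chart S p n (Rn n) (Rn_atlas n) (V, \<psi>)" for U \<phi> V \<psi>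
  proof -
    note V = compat_chart_Rn[OF c(2)]
    have inj: "inj_on \<phi> U" using atlasD(1)[of p m M "A @ [(U, \<phi>)]" U \<phi>] c(1) unfolding compat_chart_def by simp
    let ?f = "\<lambda>y. g (the_inv_into U \<phi> y)"
    have eq: "\<phi> ` (U \<inter> g -` V) = {y \<in> \<phi> ` U. ?f y \<in> V}" using the_inv_into_f_f[OF inj] by auto
    note pre = dCp_preimage[OF dg[OF c(1)] V(1,2)]
    have "dCp S p m n (\<lambda>y. \<psi> (?f y)) {y \<in> \<phi> ` U. ?f y \<in> V}"
      by (rule dCp_comp[OF dCp_subset[OF dg[OF c(1)] pre] V(4)]) auto
    thus ?thesis unfolding eq comp_def .
  qed
  have map: "ad_Cp_map S p m M A n (Rn n) (Rn_atlas n) g" unfolding ad_Cp_map_def using gl rep by auto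
  have imm: "\<exists>D. has_deriv m n (\<psi> \<circ> g \<circ> the_inv_into U' \<phi>') D (\<phi>' x) \<and> (\<forall>v\<in>Rn m. mat_apply n m D v = replicate n 0 --> v = replicate m 0)"
    if c: "compat_chart S p m M A (U', \<phi>')" "compat_chart S p n (Rn n) (Rn_atlas n) (V, \<psi>)" and x: "x \<in> U' \<inter> g -` V" for U' \<phi>' V \<psi> x
  proof -
    note V = compat_chart_Rn[OF c(2)]
    have A': "is_atlas S p m M (A @ [(U', \<phi>')])" using c(1) unfolding compat_chart_def .
    have c': "(U', \<phi>') \<in> set (A @ [(U', \<phi>')])" by simp
    note U' = atlasD[OF A' c']
    have xM: "x \<in> M" using x U'(4) by blast
    obtain k where k: "k < K" "0 < e k x ! 0" using pos[OF xM] by blast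
    have ck: "(U k, \<phi> k) \<in> set (A @ [(U', \<phi>')])" using cA[OF k(1)] by simp
    note Uk = atlasD[OF A' ck]
    \<comment> \<open>In arbitrary compatible charts on both sides a local left inverse arises by
      undoing \<open>\<psi>\<close>, recovering \<open>\<phi> k\<close> as a quotient, and changing
      from \<open>\<phi> k\<close> to \<open>\<phi>'\<close>.\<close>
    let ?T = "\<lambda>z. \<phi>' (the_inv_into (U k) (\<phi> k) z)"
    have T: "dCp S p m m ?T (\<phi> k ` (U k \<inter> U'))" by (rule atlas_transition[OF A' ck c'])
    define D1 where "D1 = {z \<in> \<psi> ` V. the_inv_into V \<psi> z \<in> P k}"
    have PS: "P k \<in> S n" "open_in_Rn n (P k)" using dCpD(1,2)[OF dr[OF k(1)]] .
    have L1: "dCp S p n m (\<lambda>z. r k (the_inv_into V \<psi> z)) D1"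
      by (rule dCp_comp[OF dCp_subset[OF V(5)] dr[OF k(1)]]) (use dCp_preimage[OF V(5) PS] in \<open>auto simp: D1_def\<close>)
    define D2 where "D2 = {z \<in> D1. r k (the_inv_into V \<psi> z) \<in> \<phi> k ` (U k \<inter> U')}"
    have L: "dCp S p n m (\<lambda>z. ?T (r k (the_inv_into V \<psi> z))) D2"
      by (rule dCp_comp[OF dCp_subset[OF L1] T]) (use dCp_preimage[OF L1 dCpD(1,2)[OF T]] in \<open>auto simp: D2_def\<close>)
    have key: "\<psi> (g x') \<in> D2" "?T (r k (the_inv_into V \<psi> (\<psi> (g x')))) = \<phi>' x'"
      if x': "x' \<in> U'" "g x' \<in> V" "g x' \<in> P k" for x'
    proof -
      have m: "x' \<in> M" using x'(1) U'(4) by blast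
      have e': "0 < e k x' ! 0" using x'(3) gP[OF m k(1)] by blast
      have i: "the_inv_into V \<psi> (\<psi> (g x')) = g x'" by (rule the_inv_into_f_f[OF V(3) x'(2)])
      note u = eU(1)[OF m k(1) e'] and r = rg[OF m k(1) e']
      show "\<psi> (g x') \<in> D2" unfolding D2_def D1_def using x' i r u by auto
      show "?T (r k (the_inv_into V \<psi> (\<psi> (g x')))) = \<phi>' x'" unfolding i r the_inv_into_f_f[OF Uk(1) u] ..
    qed
    have gx: "g x \<in> P k" using gP[OF xM k(1)] k(2) by blast
    have ix: "the_inv_into U' \<phi>' (\<phi>' x) = x" by (rule the_inv_into_f_f[OF U'(1)]) (use x in blast)
    show ?thesis
    proof (rule left_inverse_immersion[OF p rep[OF c] L])
      show "\<phi>' x \<in> \<phi>' ` (U' \<inter> g -` V)" using x by blast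
      show "(\<psi> \<circ> g \<circ> the_inv_into U' \<phi>') (\<phi>' x) \<in> D2" unfolding comp_def ix by (rule key(1)) (use x gx in auto)
      let ?f = "\<lambda>y. g (the_inv_into U' \<phi>' y)"
      have "open_in_Rn m {y \<in> \<phi>' ` U'. ?f y \<in> V \<inter> P k}"
        by (rule dCp_preimage(2)[OF dg[OF c(1)] S_Int[OF V(1) PS(1)]])
          (use V(2) PS(2) in \<open>auto simp: open_in_Rn_iff intro: eventually_conj\<close>)
      moreover have "\<phi>' x \<in> {y \<in> \<phi>' ` U'. ?f y \<in> V \<inter> P k}" using x gx ix by auto
      ultimately have "eventually (\<lambda>y. y \<in> {y \<in> \<phi>' ` U'. ?f y \<in> V \<inter> P k}) (nb m (\<phi>' x))" by (rule open_ev)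
      thus "eventually (\<lambda>y. ?T (r k (the_inv_into V \<psi> ((\<psi> \<circ> g \<circ> the_inv_into U' \<phi>') y))) = y) (nb m (\<phi>' x))"
      proof (rule eventually_mono)
        fix y assume y: "y \<in> {y \<in> \<phi>' ` U'. ?f y \<in> V \<inter> P k}"
        then obtain x' where x': "x' \<in> U'" "y = \<phi>' x'" by blast
        have i: "the_inv_into U' \<phi>' y = x'" unfolding x'(2) by (rule the_inv_into_f_f[OF U'(1) x'(1)])
        have "g x' \<in> V" "g x' \<in> P k" using y i by auto
        from key(2)[OF x'(1) this] show "?T (r k (the_inv_into V \<psi> ((\<psi> \<circ> g \<circ> the_inv_into U' \<phi>') y))) = y" unfolding comp_def i x'(2)[symmetric] .
      qed
    qed
  qed
  have "ad_Cp_immersion S p m M A n (Rn n) (Rn_atlas n) g" unfolding ad_Cp_immersion_def using map imm by blast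
  moreover have "inj_on g M"
  proof (rule inj_onI)
    fix x y assume xy: "x \<in> M" "y \<in> M" "g x = g y"
    obtain k where k: "k < K" "0 < e k x ! 0" using pos[OF xy(1)] by blast
    have k': "0 < e k y ! 0" using gP[OF xy(1) k(1)] gP[OF xy(2) k(1)] k(2) xy(3) by simp
    have "\<phi> k x = \<phi> k y" using rg[OF xy(1) k] rg[OF xy(2) k(1) k'] xy(3) by simp
    thus "x = y" using inj_onD[OF atlasD(1)[OF A cA[OF k(1)]]] eU(1)[OF xy(1) k] eU(1)[OF xy(2) k(1) k'] by blast
  qed
  moreover have "\<exists>Q. open_in_Rn n Q \<and> g ` W = g ` M \<inter> Q" if W: "atlas_open m M A W" for W
  proof -
    have WM: "W \<subseteq> M" using W unfolding atlas_open_def by blast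
    have oW: "open_in_Rn m (\<phi> k ` (W \<inter> U k))" if "k < K" for k using W cA[OF that] unfolding atlas_open_def by blast
    \<comment> \<open>Open in the ambient space by continuity of \<open>r k\<close>. For a point in
      the image of \<open>g\<close>, membership says that its preimage has the same coordinates in
      \<open>\<phi> k\<close> as some point of \<open>W\<close>, hence equals it.\<close>
    define Q where "Q = {q \<in> Rn n. \<exists>k<K. q \<in> P k \<and> r k q \<in> \<phi> k ` (W \<inter> U k)}"
    have "open_in_Rn n Q" unfolding open_in_Rn_iff
    proof (intro conjI ballI)
      fix q assume "q \<in> Q"
      then obtain k where k: "k < K" "q \<in> P k" "r k q \<in> \<phi> k ` (W \<inter> U k)" unfolding Q_def by blast
      from open_ev[OF dCpD(2)[OF dr[OF k(1)]] k(2)] dCp_ev[OF dr[OF k(1)] k(2) open_ev[OF oW[OF k(1)] k(3)]] ev_length[of n q]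
      show "eventually (\<lambda>y. y \<in> Q) (nb n q)"
      proof eventually_elim
        case (elim y) thus ?case unfolding Q_def using k(1) by auto
      qed
    qed (auto simp: Q_def)
    moreover have "g ` W = g ` M \<inter> Q"
    proof (intro set_eqI iffI)
      fix q assume "q \<in> g ` W"
      then obtain x where x: "x \<in> W" "q = g x" by blast
      have xM: "x \<in> M" using x WM by blast
      obtain k where k: "k < K" "0 < e k x ! 0" using pos[OF xM] by blast
      have "g x \<in> P k" "r k (g x) \<in> \<phi> k ` (W \<inter> U k)" using gP[OF xM k(1)] k rg[OF xM k] eU(1)[OF xM k] x(1) by auto
      thus "q \<in> g ` M \<inter> Q" unfolding Q_def x(2) using k(1) xM gl[OF xM] by auto
    next
      fix q assume "q \<in> g ` M \<inter> Q"
      then obtain x k where x: "x \<in> M" "q = g x" and k: "k < K" "g x \<in> P k" "r k (g x) \<in> \<phi> k ` (W \<inter> U k)" unfolding Q_def by blast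
      have e': "0 < e k x ! 0" using gP[OF x(1) k(1)] k(2) by blast
      obtain w where w: "w \<in> W" "w \<in> U k" "r k (g x) = \<phi> k w" using k(3) by blast
      have "\<phi> k x = \<phi> k w" using rg[OF x(1) k(1) e'] w(3) by simp
      hence "x = w" using inj_onD[OF atlasD(1)[OF A cA[OF k(1)]]] eU(1)[OF x(1) k(1) e'] w(2) by blast
      thus "q \<in> g ` W" using w(1) x(2) by blast
    qed
    ultimately show ?thesis by blast
  qed
  ultimately have "ad_Cp_embedding_Rn S p m M A n g" unfolding ad_Cp_embedding_Rn_def by blast
  moreover have "n > 0" unfolding n_def by simp
  ultimately show ?thesis by blast
qed

end

theorem theorem3p1:
  fixes S :: "nat \<Rightarrow> 'r::linordered_field list set set"
    and p m :: nat
    and M :: "'m set"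
    and A :: "('m set \<times> ('m \<Rightarrow> 'r list)) list"
  assumes "real_closed_field TYPE('r)"
    and "o_minimal_structure S"
    and "1 \<le> p"
    and "ad_manifold S p m M A"
  shows "\<exists>n>0. \<exists>g. ad_Cp_embedding_Rn S p m M A n g"
proof -
  interpret omin S by standard (rule assms(2))
  show ?thesis by (rule embedding_exists[OF assms(3,4)])
qed

end
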